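(* Let $k$ be an algebraically closed field, $M\cong\mathbb Z^n$ a lattice, $\sigma\subseteq M_{\mathbb R}$ a lattice polytope with $\dim\sigma=n$, $r\ge0$ an integer, and $V=V(\sigma)\times\mathbb G_m^r$ with its sheaf $\mathcal{LS}_V$ of log smooth structures of the standard ghost type. Choose a primitive generator $d_\omega$ for each edge $\omega$ of $\sigma$ and a sign vector $\epsilon_\tau$ for each two-dimensional face $\tau$ of $\sigma$. Then $\mathcal{LS}_V$ is isomorphic to the subsheaf of $\bigoplus_{\dim\omega=1}\mathcal O_{V_\omega}^\times$ (sum over the edges $\omega$ of $\sigma$) whose sections over an open set $U\subseteq V$ are those $(f_\omega)\in\Gamma\big(U,\bigoplus_{\dim\omega=1}\mathcal O_{V_\omega}^\times\big)$ such that for every two-dimensional face $\tau$ of $\sigma$ $$\prod_{\dim\omega=1}d_\omega\otimes f_\omega^{\epsilon_\tau(\omega)}\big|_{V_\tau}=1\quad\text{in } M\otimes_{\mathbb Z}\Gamma(U,\mathcal O_{V_\tau}^\times),$$ where $M$ is written additively and $\Gamma(U,\mathcal O_{V_\tau}^\times)$ multiplicatively.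
   Context: $N=\operatorname{Hom}(M,\mathbb Z)$, $M_{\mathbb R}=M\otimes\mathbb R$, $N_{\mathbb R}=N\otimes\mathbb R$. **The scheme $V$.** $C(\sigma)=\{(rm,r)\mid r\ge0,\ m\in\sigma\}\subseteq M_{\mathbb R}\oplus\mathbb R$, $P=C(\sigma)^\vee\cap(N\oplus\mathbb Z)$, $\rho=(0,1)\in P$. $\partial P=(\partial C(\sigma)^\vee\cap(N\oplus\mathbb Z))\cup\{\infty\}$ with $p+q$ the usual sum if $p,q,p+q$ lie in $\partial C(\sigma)^\vee$ and $\infty$ otherwise; $k[\partial P]$ is the monoid ring with $z^\infty=0$, and $V(\sigma)=\operatorname{Spec}k[\partial P]=\operatorname{Spec}k[P]/(z^\rho)$. So $V=\operatorname{Spec}k[\partial P\oplus\mathbb Z^r]$. For a face $\tau$ of $\sigma$ let $\check\tau\subseteq N_{\mathbb R}$ be the cone of the normal fan of $\sigma$ consisting of functionals that are constant on $\tau$ and attain their minimum over $\sigma$ there; $V_\tau=\operatorname{Spec}k[(\check\tau\cap N)\oplus\mathbb Z^r]$ is a closed irreducible stratum of $V$ ($\partial P\setminus\{\infty\}$ being identified with $N$ by projection). The components of $V$ are the $V_v$, $v$ a vertex. **The sheaf $\mathcal{LS}_V$.** $V$ carries the log structure with chart $P\to k[\partial P\oplus\mathbb Z^r]$, $p\mapsto z^p$ ($0$ if $p\notin\partial P$), with the section $\rho$ defining a morphism to the standard log point $\operatorname{Spec}k^\dagger$ (log structure $k^\times\oplus\mathbb N$, $(a,0)\mapsto a$, $(a,m)\mapsto0$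 for $m>0$). Let $\overline{\mathcal M}_V$ be its ghost sheaf and $\bar\rho$ the image of $\rho$. $\mathcal{LS}_V\subseteq\mathcal Ext^1(\overline{\mathcal M}_V^{\mathrm{gp}}/\bar\rho,\mathcal O_V^\times)$ is the subsheaf of extension classes of the same type as this log structure; its sections over $U$ are in bijection with isomorphism classes of log smooth structures on $U$ over $\operatorname{Spec}k^\dagger$ with ghost sheaf $(\overline{\mathcal M}_V,\bar\rho)$ and of this type. Concretely: for $p\in P$ let $V(p)$ be the closure of $V\setminus\operatorname{supp}(p)$, i.e. the closure of $\{z^p\ne0\}$. Let $\mathcal F$ be the sheaf of families $(h_p)_{p\in P}$ with $h_p$ an invertible function on $U\cap V(p)$ and $h_ph_q=h_{p+q}$ on $U\cap V(p+q)$ (the family $(h_p)$ corresponds to the log structure with chart $p\mapsto h_pz^p$). Then $\mathcal{LS}_V=\mathcal F/\mathcal Hom(P^{\mathrm{gp}}/\rho,\mathcal O_V^\times)=\mathcal F/\mathcal Hom(N,\mathcal O_V^\times)$. Sheaves may be taken in the Zariski or étale topology. **Choices.** For each edge $\omega$ of $\sigma$, $d_\omega$ is a primitive generator of the intersection of $M$ with the tangent line of $\omega$; it orients $\omega$. For each two-face $\tau$, the sign vector $\epsilon_\tau$ assigns $0$ to edges not contained in $\tau$ and $\pm1$ to edges $\omega\subseteq\tau$, the signs being such that $\sum_{\omega\subseteq\tau}\epsilon_\tau(\omega)\,\omega$ is the oriented boundary of $\tau$ with respect to some orientation of $\tau$ and the given orientations of the edges (well-defined up to an overall sign). *)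

theory Defs
  imports
    "HOL-Analysis.Analysis"
    "HOL-Algebra.Free_Abelian_Groups"
    "HOL-Algebra.Ideal"
    "HOL-Computational_Algebra.Polynomial"
begin

section \<open>Presheaves of abelian groups\<close>

record ('p, 's) presheaf =
  sect :: "'p set \<Rightarrow> 's monoid"
  restr :: "'p set \<Rightarrow> 'p set \<Rightarrow> 's \<Rightarrow> 's"  \<comment> \<open>\<open>restr F U W\<close> restricts from \<open>U\<close> to \<open>W \<subseteq> U\<close>\<close>

definition sheaf_isomorphic :: "'p topology \<Rightarrow> ('p, 's) presheaf \<Rightarrow> ('p, 't) presheaf \<Rightarrow> bool" where
  "sheaf_isomorphic X F G \<longleftrightarrow>
    (\<exists>\<phi>. (\<forall>U. openin X U \<longrightarrow> \<phi> U \<in> iso (sect F U) (sect G U)) \<and>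
         (\<forall>U W. openin X U \<and> openin X W \<and> W \<subseteq> U \<longrightarrow>
            (\<forall>s\<in>carrier (sect F U). \<phi> W (restr F U W s) = restr G U W (\<phi> U s))))"

definition germ :: "'p topology \<Rightarrow> ('p, 's) presheaf \<Rightarrow> 'p \<Rightarrow> 'p set \<Rightarrow> 's \<Rightarrow> ('p set \<times> 's) set" where
  "germ X F x U s = {(W, t). openin X W \<and> x \<in> W \<and> t \<in> carrier (sect F W) \<and>
     (\<exists>W'. openin X W' \<and> x \<in> W' \<and> W' \<subseteq> U \<inter> W \<and> restr F U W' s = restr F W W' t)}"

definition germ_mult ::
  "'p topology \<Rightarrow> ('p, 's) presheaf \<Rightarrow> 'p \<Rightarrow> ('p set \<times> 's) set \<Rightarrow> ('p set \<times> 's) set \<Rightarrow> ('p set \<times> 's) set" where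
  "germ_mult X F x a b = (\<Union>(U, s)\<in>a. \<Union>(W, t)\<in>b.
     germ X F x (U \<inter> W) (restr F U (U \<inter> W) s \<otimes>\<^bsub>sect F (U \<inter> W)\<^esub> restr F W (U \<inter> W) t))"

definition sheafify :: "'p topology \<Rightarrow> ('p, 's) presheaf \<Rightarrow> ('p, 'p \<Rightarrow> ('p set \<times> 's) set) presheaf" where
  "sheafify X F = \<lparr>
     sect = (\<lambda>U. \<lparr>
       carrier = {g \<in> extensional U. \<forall>x\<in>U. \<exists>W s. openin X W \<and> x \<in> W \<and> W \<subseteq> U \<and>
                    s \<in> carrier (sect F W) \<and> (\<forall>y\<in>W. g y = germ X F y W s)},
       mult = (\<lambda>g h. \<lambda>x\<in>U. germ_mult X F x (g x) (h x)),
       one = (\<lambda>x\<in>U. germ X F x U \<one>\<^bsub>sect F U\<^esub>)\<rparr>),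
     restr = (\<lambda>U W g. restrict g W)\<rparr>"

definition quotient_presheaf :: "('p, 's) presheaf \<Rightarrow> ('p set \<Rightarrow> 's set) \<Rightarrow> ('p, 's set) presheaf" where
  "quotient_presheaf F H = \<lparr>
     sect = (\<lambda>U. sect F U Mod H U),
     restr = (\<lambda>U W C. \<Union>s\<in>C. H W #>\<^bsub>sect F W\<^esub> restr F U W s)\<rparr>"

definition quotient_sheaf ::
  "'p topology \<Rightarrow> ('p, 's) presheaf \<Rightarrow> ('p set \<Rightarrow> 's set) \<Rightarrow> ('p, 'p \<Rightarrow> ('p set \<times> 's set) set) presheaf" where
  "quotient_sheaf X F H = sheafify X (quotient_presheaf F H)"


section \<open>Tensor product of abelian groups\<close>

definition tensor_relations :: "('a, 'x) monoid_scheme \<Rightarrow> ('b, 'y) monoid_scheme \<Rightarrow> ('a \<times> 'b \<Rightarrow>\<^sub>0 int) set" where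
  "tensor_relations A G =
     {frag_of (a \<otimes>\<^bsub>A\<^esub> a', g) - frag_of (a, g) - frag_of (a', g) | a a' g.
        a \<in> carrier A \<and> a' \<in> carrier A \<and> g \<in> carrier G} \<union>
     {frag_of (a, g \<otimes>\<^bsub>G\<^esub> g') - frag_of (a, g) - frag_of (a, g') | a g g'.
        a \<in> carrier A \<and> g \<in> carrier G \<and> g' \<in> carrier G}"

definition tensor_kernel :: "('a, 'x) monoid_scheme \<Rightarrow> ('b, 'y) monoid_scheme \<Rightarrow> ('a \<times> 'b \<Rightarrow>\<^sub>0 int) set" where
  "tensor_kernel A G = generate (free_Abelian_group (carrier A \<times> carrier G)) (tensor_relations A G)"

definition tensor_group :: "('a, 'x) monoid_scheme \<Rightarrow> ('b, 'y) monoid_scheme \<Rightarrow> ('a \<times> 'b \<Rightarrow>\<^sub>0 int) set monoid" where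
  "tensor_group A G = free_Abelian_group (carrier A \<times> carrier G) Mod tensor_kernel A G"

definition pure_tensor ::
  "('a, 'x) monoid_scheme \<Rightarrow> ('b, 'y) monoid_scheme \<Rightarrow> 'a \<Rightarrow> 'b \<Rightarrow> ('a \<times> 'b \<Rightarrow>\<^sub>0 int) set" where
  "pure_tensor A G a g = tensor_kernel A G #>\<^bsub>free_Abelian_group (carrier A \<times> carrier G)\<^esub> frag_of (a, g)"

definition additive_group :: "'a::{plus, zero} set \<Rightarrow> 'a monoid" where
  "additive_group S = \<lparr>carrier = S, mult = (+), one = 0\<rparr>"


section \<open>Affine schemes and their closed subschemes\<close>

definition Spec :: "('f, 'm) ring_scheme \<Rightarrow> 'f set set" where
  "Spec R = {p. primeideal p R}"

definition zero_locus :: "('f, 'm) ring_scheme \<Rightarrow> 'f set \<Rightarrow> 'f set set" where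
  "zero_locus R I = {p \<in> Spec R. I \<subseteq> p}"

definition vanishing_ideal :: "('f, 'm) ring_scheme \<Rightarrow> 'f set set \<Rightarrow> 'f set" where
  "vanishing_ideal R Z = {f \<in> carrier R. \<forall>p\<in>Z. f \<in> p}"

definition zariski :: "('f, 'm) ring_scheme \<Rightarrow> 'f set topology" where
  "zariski R = topology (\<lambda>U. \<exists>S \<subseteq> carrier R. U = Spec R - zero_locus R S)"

lemma istopology_zariski: "istopology (\<lambda>U. \<exists>S \<subseteq> carrier R. U = Spec R - zero_locus R S)"
proof -
  have inter: "\<exists>S\<subseteq>carrier R. (Spec R - zero_locus R A) \<inter> (Spec R - zero_locus R B) = Spec R - zero_locus R S"
    if "A \<subseteq> carrier R" "B \<subseteq> carrier R" for A B
  proof (intro exI conjI)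
    let ?S = "{a \<otimes>\<^bsub>R\<^esub> b | a b. a \<in> A \<and> b \<in> B} \<inter> carrier R"
    show "?S \<subseteq> carrier R" by blast
    have "?S \<subseteq> p \<longleftrightarrow> A \<subseteq> p \<or> B \<subseteq> p" if "p \<in> Spec R" for p
    proof -
      interpret primeideal p R using that by (simp add: Spec_def)
      have *: "?S = {a \<otimes>\<^bsub>R\<^esub> b | a b. a \<in> A \<and> b \<in> B}"
        using \<open>A \<subseteq> carrier R\<close> \<open>B \<subseteq> carrier R\<close> by blast
      have "A \<subseteq> p \<or> B \<subseteq> p" if S: "?S \<subseteq> p"
      proof (rule ccontr)
        assume "\<not> (A \<subseteq> p \<or> B \<subseteq> p)"
        then obtain a b where ab: "a \<in> A" "b \<in> B" "a \<notin> p" "b \<notin> p" by blast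
        then have "a \<otimes>\<^bsub>R\<^esub> b \<in> p" using S unfolding * by blast
        then show False using I_prime[of a b] ab \<open>A \<subseteq> carrier R\<close> \<open>B \<subseteq> carrier R\<close> by blast
      qed
      moreover have "?S \<subseteq> p" if "A \<subseteq> p \<or> B \<subseteq> p"
        unfolding * using that \<open>A \<subseteq> carrier R\<close> \<open>B \<subseteq> carrier R\<close> by (blast intro: I_l_closed I_r_closed)
      ultimately show ?thesis by blast
    qed
    then show "(Spec R - zero_locus R A) \<inter> (Spec R - zero_locus R B) = Spec R - zero_locus R ?S"
      unfolding zero_locus_def by blast
  qed
  have union: "\<exists>S\<subseteq>carrier R. \<Union>K = Spec R - zero_locus R S"
    if K: "\<forall>U\<in>K. \<exists>S \<subseteq> carrier R. U = Spec R - zero_locus R S" for K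
  proof -
    obtain s where s: "\<forall>U\<in>K. s U \<subseteq> carrier R \<and> U = Spec R - zero_locus R (s U)"
      using bchoice[OF K] by blast
    have "\<Union>K = (\<Union>U\<in>K. Spec R - zero_locus R (s U))" using s by blast
    also have "\<dots> = Spec R - zero_locus R (\<Union>U\<in>K. s U)"
      unfolding zero_locus_def by blast
    finally show ?thesis using s by (intro exI[of _ "\<Union>U\<in>K. s U"]) blast
  qed
  show ?thesis
    unfolding istopology_def
  proof (intro conjI allI impI)
    fix U W
    assume "\<exists>S \<subseteq> carrier R. U = Spec R - zero_locus R S" "\<exists>S \<subseteq> carrier R. W = Spec R - zero_locus R S"
    then show "\<exists>S \<subseteq> carrier R. U \<inter> W = Spec R - zero_locus R S" using inter by metis
  qed (rule union)
qed

text \<open>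
  The structure sheaf of the closed subscheme \<open>Spec (R/I)\<close> is regarded as a sheaf on \<open>Spec R\<close>.
  \<open>fraction R I p a f\<close> is the fraction \<open>a/f\<close> in the local ring of \<open>Spec (R/I)\<close> at \<open>p\<close>, realised as the
  set of all pairs of representatives in \<open>R\<close> of that fraction.
\<close>

definition fraction :: "('f, 'm) ring_scheme \<Rightarrow> 'f set \<Rightarrow> 'f set \<Rightarrow> 'f \<Rightarrow> 'f \<Rightarrow> ('f \<times> 'f) set" where
  "fraction R I p a f = {(b, g). b \<in> carrier R \<and> g \<in> carrier R - p \<and>
     (\<exists>u\<in>carrier R - p. u \<otimes>\<^bsub>R\<^esub> (a \<otimes>\<^bsub>R\<^esub> g \<ominus>\<^bsub>R\<^esub> b \<otimes>\<^bsub>R\<^esub> f) \<in> I)}"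

definition fraction_mult ::
  "('f, 'm) ring_scheme \<Rightarrow> 'f set \<Rightarrow> 'f set \<Rightarrow> ('f \<times> 'f) set \<Rightarrow> ('f \<times> 'f) set \<Rightarrow> ('f \<times> 'f) set" where
  "fraction_mult R I p x y = (\<Union>(a, f)\<in>x. \<Union>(b, g)\<in>y. fraction R I p (a \<otimes>\<^bsub>R\<^esub> b) (f \<otimes>\<^bsub>R\<^esub> g))"

text \<open>The multiplicative monoid of the ring of sections over \<open>U\<close> of the structure sheaf of \<open>Spec (R/I)\<close>.\<close>

definition regular_functions ::
  "('f, 'm) ring_scheme \<Rightarrow> 'f set \<Rightarrow> 'f set set \<Rightarrow> ('f set \<Rightarrow> ('f \<times> 'f) set) monoid" where
  "regular_functions R I U = \<lparr>
     carrier = {s \<in> extensional (U \<inter> zero_locus R I).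
       \<forall>p \<in> U \<inter> zero_locus R I. \<exists>W. openin (zariski R) W \<and> p \<in> W \<and> W \<subseteq> U \<and>
         (\<exists>a\<in>carrier R. \<exists>f\<in>carrier R. \<forall>q \<in> W \<inter> zero_locus R I. f \<notin> q \<and> s q = fraction R I q a f)},
     mult = (\<lambda>s t. \<lambda>p \<in> U \<inter> zero_locus R I. fraction_mult R I p (s p) (t p)),
     one = (\<lambda>p \<in> U \<inter> zero_locus R I. fraction R I p \<one>\<^bsub>R\<^esub> \<one>\<^bsub>R\<^esub>)\<rparr>"

abbreviation invertible_functions ::
  "('f, 'm) ring_scheme \<Rightarrow> 'f set \<Rightarrow> 'f set set \<Rightarrow> ('f set \<Rightarrow> ('f \<times> 'f) set) monoid" where
  "invertible_functions R I U \<equiv> units_of (regular_functions R I U)"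

text \<open>
  Restriction to \<open>W \<inter> Spec (R/J)\<close> of a function on \<open>U \<inter> Spec (R/I)\<close>, where \<open>W \<subseteq> U\<close> and \<open>I \<subseteq> J\<close>;
  \<open>I\<close> and \<open>U\<close> need not be mentioned because every germ is a set of representatives in \<open>R\<close>.
\<close>

definition restrict_function ::
  "('f, 'm) ring_scheme \<Rightarrow> 'f set \<Rightarrow> 'f set set \<Rightarrow> ('f set \<Rightarrow> ('f \<times> 'f) set) \<Rightarrow> 'f set \<Rightarrow> ('f \<times> 'f) set" where
  "restrict_function R J W s = (\<lambda>p \<in> W \<inter> zero_locus R J. \<Union>(a, f) \<in> s p. fraction R J p a f)"


section \<open>Lattices and lattice polytopes\<close>

text \<open>
  A lattice of rank \<open>n\<close> is realised as the \<open>\<int>\<close>-span of \<open>n\<close> linearly independent vectors of some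
  Euclidean space of dimension at least \<open>n\<close> (so that \<open>n = 0\<close> is allowed); then \<open>M\<^sub>\<real> = span M\<close>.
\<close>

definition lattice_of_rank :: "nat \<Rightarrow> 'a::euclidean_space set \<Rightarrow> bool" where
  "lattice_of_rank n M \<longleftrightarrow>
     (\<exists>B. independent B \<and> card B = n \<and> M = {\<Sum>b\<in>B. of_int (c b) *\<^sub>R b | c :: 'a \<Rightarrow> int. True})"

definition lattice_polytope :: "'a::euclidean_space set \<Rightarrow> 'a set \<Rightarrow> bool" where
  "lattice_polytope M \<sigma> \<longleftrightarrow> (\<exists>S. finite S \<and> S \<subseteq> M \<and> \<sigma> = convex hull S)"

text \<open>
  A functional on \<open>M\<^sub>\<real>\<close> is represented by the unique \<open>w \<in> span M\<close> with which it is the inner product.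
  In this way \<open>N\<^sub>\<real>\<close> is \<open>span M\<close>, and \<open>N = Hom(M, \<int>)\<close> is the following subset (see
  \<open>dual_lattice_represents_Hom\<close>).
\<close>

definition dual_lattice :: "'a::euclidean_space set \<Rightarrow> 'a set" where
  "dual_lattice M = {w \<in> span M. \<forall>m\<in>M. w \<bullet> m \<in> \<int>}"

lemma dual_lattice_represents_Hom:
  assumes "lattice_of_rank n M" and "h \<in> hom (additive_group M) integer_group"
  shows "\<exists>!w. w \<in> dual_lattice M \<and> (\<forall>m\<in>M. w \<bullet> m = of_int (h m))"
proof -
  obtain B where B: "independent B" "M = {\<Sum>b\<in>B. of_int (c b) *\<^sub>R b | c :: 'a \<Rightarrow> int. True}"
    using assms(1) by (auto simp: lattice_of_rank_def)
  have fin: "finite B" using B(1) by (rule independent_imp_finite)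
  have part: "(\<Sum>b\<in>A. of_int (c b) *\<^sub>R b) \<in> M" if "A \<subseteq> B" for A and c :: "'a \<Rightarrow> int"
  proof -
    have "(\<Sum>b\<in>B. of_int (if b \<in> A then c b else 0) *\<^sub>R b) = (\<Sum>b\<in>A. of_int (c b) *\<^sub>R b)"
      using that fin by (intro sum.mono_neutral_cong_right) auto
    then show ?thesis
      unfolding B(2) by (intro CollectI exI[of _ "\<lambda>b. if b \<in> A then c b else 0"]) simp
  qed
  have one: "of_int c *\<^sub>R b \<in> M" if "b \<in> B" for b c
    using part[of "{b}" "\<lambda>_. c"] that by simp
  have add: "h (x + y) = h x + h y" if "x \<in> M" "y \<in> M" for x y
    using assms(2) that by (auto simp: hom_def additive_group_def)
  have zeroM: "0 \<in> M" using part[of "{}"] by simp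
  have h0: "h 0 = 0" using add[OF zeroM zeroM] by simp
  have nat: "h (of_int (int k) *\<^sub>R b) = int k * h b" if "b \<in> B" for k b
  proof (induction k)
    case (Suc k)
    have "h (of_int (int (Suc k)) *\<^sub>R b) = h (b + of_int (int k) *\<^sub>R b)"
      by (simp add: algebra_simps)
    also have "\<dots> = h b + h (of_int (int k) *\<^sub>R b)"
      using add one[OF that, of 1] one[OF that, of "int k"] by simp
    finally show ?case using Suc by (simp add: algebra_simps)
  qed (use h0 in simp)
  have int: "h (of_int c *\<^sub>R b) = c * h b" if "b \<in> B" for c b
  proof (cases "c \<ge> 0")
    case True then show ?thesis using nat[OF that, of "nat c"] by simp
  next
    case False
    have "h (of_int c *\<^sub>R b + of_int (- c) *\<^sub>R b) = h (of_int c *\<^sub>R b) + h (of_int (- c) *\<^sub>R b)"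
      using add one[OF that] by blast
    then have "0 = h (of_int c *\<^sub>R b) + h (of_int (- c) *\<^sub>R b)" using h0 by simp
    then show ?thesis using nat[OF that, of "nat (- c)"] False by simp
  qed
  have comb: "h (\<Sum>b\<in>A. of_int (c b) *\<^sub>R b) = (\<Sum>b\<in>A. c b * h b)" if "A \<subseteq> B" for A c
    using finite_subset[OF that fin] that
  proof (induction A rule: finite_induct)
    case empty then show ?case using h0 by simp
  next
    case (insert a A)
    then show ?case using add[OF one part, of a A "c a" c] int by simp
  qed
  obtain g where g: "linear g" "\<forall>b\<in>B. g b = real_of_int (h b)"
    using linear_independent_extend[OF B(1), of "\<lambda>b. real_of_int (h b)"] by blast
  have gM: "g m = of_int (h m)" if m: "m \<in> M" for m
  proof -
    obtain c :: "'a \<Rightarrow> int" where m_eq: "m = (\<Sum>b\<in>B. of_int (c b) *\<^sub>R b)"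
      using m unfolding B(2) by blast
    have "g m = (\<Sum>b\<in>B. of_int (c b) * g b)"
      unfolding m_eq using g(1) by (simp add: linear_sum linear_scale)
    then show ?thesis unfolding m_eq using comb[of B c] g(2) by simp
  qed
  obtain w z where wz: "w \<in> span M" "\<And>x. x \<in> span M \<Longrightarrow> orthogonal z x" "adjoint g 1 = w + z"
    using orthogonal_subspace_decomp_exists[of M "adjoint g 1"] by blast
  have wM: "w \<bullet> m = of_int (h m)" if "m \<in> M" for m
  proof -
    have "g m = (w + z) \<bullet> m" using adjoint_works[OF g(1), of m 1] wz(3) by (simp add: inner_commute)
    moreover have "z \<bullet> m = 0" using wz(2) that by (auto simp: orthogonal_def span_base)
    ultimately show ?thesis using gM[OF that] by (simp add: inner_add_left)
  qed
  show ?thesis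
  proof (rule ex1I[of _ w])
    show "w \<in> dual_lattice M \<and> (\<forall>m\<in>M. w \<bullet> m = of_int (h m))"
      using wz(1) wM by (auto simp: dual_lattice_def)
    fix v assume v: "v \<in> dual_lattice M \<and> (\<forall>m\<in>M. v \<bullet> m = of_int (h m))"
    then have "v - w \<in> span M" using wz(1) by (auto simp: dual_lattice_def intro: span_diff)
    moreover have "orthogonal (v - w) m" if "m \<in> M" for m
      using v wM that by (simp add: orthogonal_def inner_diff_left)
    ultimately have "orthogonal (v - w) (v - w)" by (meson orthogonal_to_span)
    then show "v = w" by (simp add: orthogonal_def)
  qed
qed

definition cone_over :: "'a::euclidean_space set \<Rightarrow> ('a \<times> real) set" where
  "cone_over \<sigma> = {(t *\<^sub>R m, t) | t m. t \<ge> 0 \<and> m \<in> \<sigma>}"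

definition dual_cone :: "'a::euclidean_space set \<Rightarrow> 'a set \<Rightarrow> ('a \<times> real) set" where
  "dual_cone M \<sigma> = {y \<in> span M \<times> UNIV. \<forall>x \<in> cone_over \<sigma>. y \<bullet> x \<ge> 0}"

definition P_monoid :: "'a::euclidean_space set \<Rightarrow> 'a set \<Rightarrow> ('a \<times> real) set" where
  "P_monoid M \<sigma> = dual_cone M \<sigma> \<inter> (dual_lattice M \<times> \<int>)"

text \<open>
  The elements of \<open>\<partial>P\<close> other than \<open>\<infinity>\<close>. The dual cone spans \<open>N\<^sub>\<real> \<oplus> \<real>\<close>, which need not be the whole type,
  so its boundary is the relative frontier.
\<close>

definition boundary_P :: "'a::euclidean_space set \<Rightarrow> 'a set \<Rightarrow> ('a \<times> real) set" where
  "boundary_P M \<sigma> = rel_frontier (dual_cone M \<sigma>) \<inter> (dual_lattice M \<times> \<int>)"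

definition normal_cone :: "'a::euclidean_space set \<Rightarrow> 'a set \<Rightarrow> 'a set \<Rightarrow> 'a set" where
  "normal_cone M \<sigma> \<tau> = {w \<in> span M. (\<forall>x\<in>\<tau>. \<forall>y\<in>\<tau>. w \<bullet> x = w \<bullet> y) \<and> (\<forall>x\<in>\<tau>. \<forall>y\<in>\<sigma>. w \<bullet> x \<le> w \<bullet> y)}"


section \<open>The scheme \<open>V = V(\<sigma>) \<times> G\<^sub>m\<^sup>r\<close>\<close>

type_synonym 'a exponent = "('a \<times> real) \<times> (nat \<Rightarrow>\<^sub>0 int)"
type_synonym ('a, 'k) fun_ring = "('a exponent \<Rightarrow>\<^sub>0 'k) ring"
type_synonym ('a, 'k) point = "('a exponent \<Rightarrow>\<^sub>0 'k) set"
type_synonym ('a, 'k) local_fun = "('a, 'k) point \<Rightarrow> (('a exponent \<Rightarrow>\<^sub>0 'k) \<times> ('a exponent \<Rightarrow>\<^sub>0 'k)) set"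

text \<open>
  \<open>contracted_monoid_ring E\<close> is the ring with \<open>k\<close>-basis \<open>z\<^sup>e\<close> \<open>(e \<in> E)\<close> and \<open>z\<^sup>e z\<^sup>e' = z\<^bsup>e+e'\<^esup>\<close> if \<open>e + e' \<in> E\<close>,
  \<open>z\<^sup>e z\<^sup>e' = 0\<close> otherwise, i.e. the monoid ring of \<open>E \<union> {\<infinity>}\<close> with \<open>z\<^sup>\<infinity> = 0\<close>.
\<close>

definition contracted_monoid_ring :: "'e::monoid_add set \<Rightarrow> ('e \<Rightarrow>\<^sub>0 'k::comm_ring_1) ring" where
  "contracted_monoid_ring E = \<lparr>
     carrier = {f. Poly_Mapping.keys f \<subseteq> E},
     mult = (\<lambda>f g. \<Sum>x\<in>Poly_Mapping.keys f. \<Sum>y\<in>Poly_Mapping.keys g.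
       if x + y \<in> E
       then Poly_Mapping.single (x + y) (Poly_Mapping.lookup f x * Poly_Mapping.lookup g y) else 0),
     one = Poly_Mapping.single 0 1,
     zero = 0,
     add = (+)\<rparr>"

definition boundary_exponents :: "'a::euclidean_space set \<Rightarrow> 'a set \<Rightarrow> nat \<Rightarrow> 'a exponent set" where
  "boundary_exponents M \<sigma> r = boundary_P M \<sigma> \<times> {c. Poly_Mapping.keys c \<subseteq> {..<r}}"

definition coord_ring :: "'a::euclidean_space set \<Rightarrow> 'a set \<Rightarrow> nat \<Rightarrow> ('a, 'k::field) fun_ring" where
  "coord_ring M \<sigma> r = contracted_monoid_ring (boundary_exponents M \<sigma> r)"

definition V_space :: "'a::euclidean_space set \<Rightarrow> 'a set \<Rightarrow> nat \<Rightarrow> ('a, 'k::field) point topology" where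
  "V_space M \<sigma> r = zariski (coord_ring M \<sigma> r)"

text \<open>
  Projecting \<open>\<partial>P - {\<infinity>}\<close> to \<open>N\<close>, the monoid \<open>(\<tau>\<^sup>\<or> \<inter> N) \<oplus> \<int>\<^sup>r\<close> becomes a subset of the exponents of
  \<open>k[\<partial>P \<oplus> \<int>\<^sup>r]\<close>, and \<open>V\<^sub>\<tau>\<close> is the closed subscheme given by the surjection which fixes the monomials with
  exponents in this subset and kills the others.
\<close>

definition stratum_exponents :: "'a::euclidean_space set \<Rightarrow> 'a set \<Rightarrow> nat \<Rightarrow> 'a set \<Rightarrow> 'a exponent set" where
  "stratum_exponents M \<sigma> r \<tau> = {e \<in> boundary_exponents M \<sigma> r. fst (fst e) \<in> normal_cone M \<sigma> \<tau>}"

definition project_keys :: "'e set \<Rightarrow> ('e \<Rightarrow>\<^sub>0 'k::comm_monoid_add) \<Rightarrow> 'e \<Rightarrow>\<^sub>0 'k" where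
  "project_keys E f = (\<Sum>x\<in>Poly_Mapping.keys f \<inter> E. Poly_Mapping.single x (Poly_Mapping.lookup f x))"

lemma lookup_project_keys:
  "Poly_Mapping.lookup (project_keys E f) x = (if x \<in> E then Poly_Mapping.lookup f x else 0)"
  unfolding project_keys_def
  by (auto simp: lookup_sum lookup_single when_def sum.delta' sum.delta Poly_Mapping.in_keys_iff
      intro: sum.neutral)

lemma project_keys_add: "project_keys E (f + g) = project_keys E f + project_keys E g"
  by (rule poly_mapping_eqI) (simp add: lookup_project_keys lookup_add)

lemma project_keys_eq_0: "Poly_Mapping.keys f \<inter> E = {} \<Longrightarrow> project_keys E f = 0"
  by (simp add: project_keys_def)

lemma project_keys_id: "Poly_Mapping.keys f \<subseteq> E \<Longrightarrow> project_keys E f = f"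
  by (rule poly_mapping_eqI) (auto simp: lookup_project_keys Poly_Mapping.in_keys_iff)

lemma keys_project_keys: "Poly_Mapping.keys (project_keys E f) \<subseteq> E"
  by (auto simp: Poly_Mapping.in_keys_iff lookup_project_keys split: if_splits)

lemma project_keys_sum: "project_keys E (sum f A) = (\<Sum>a\<in>A. project_keys E (f a))"
proof (induction A rule: infinite_finite_induct)
qed (simp_all add: project_keys_add project_keys_eq_0)

lemma contracted_mult:
  fixes f g :: "'e::monoid_add \<Rightarrow>\<^sub>0 'k::comm_ring_1"
  shows "f \<otimes>\<^bsub>contracted_monoid_ring E\<^esub> g = project_keys E (f * g)"
proof -
  have "f * g = (\<Sum>x\<in>Poly_Mapping.keys f. Poly_Mapping.single x (Poly_Mapping.lookup f x)) *
      (\<Sum>y\<in>Poly_Mapping.keys g. Poly_Mapping.single y (Poly_Mapping.lookup g y))"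
    using project_keys_id[of f UNIV] project_keys_id[of g UNIV] by (simp add: project_keys_def)
  also have "\<dots> = (\<Sum>x\<in>Poly_Mapping.keys f. \<Sum>y\<in>Poly_Mapping.keys g.
      Poly_Mapping.single (x + y) (Poly_Mapping.lookup f x * Poly_Mapping.lookup g y))"
    by (simp add: sum_product mult_single)
  finally have fg: "f * g = \<dots>" .
  have single: "project_keys E (Poly_Mapping.single e c) = (if e \<in> E then Poly_Mapping.single e c else 0)"
    for e and c :: 'k
    by (rule poly_mapping_eqI) (auto simp: lookup_project_keys lookup_single when_def)
  show ?thesis
    unfolding fg project_keys_sum single by (simp add: contracted_monoid_ring_def)
qed

lemma cring_contracted_monoid_ring:
  fixes E :: "'e::comm_monoid_add set"
  assumes E0: "0 \<in> E"
    and E: "\<And>x y z. \<lbrakk>x \<in> E; y \<in> E; z \<in> E; x + y + z \<in> E\<rbrakk> \<Longrightarrow> x + y \<in> E"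
  shows "cring (contracted_monoid_ring E :: ('e \<Rightarrow>\<^sub>0 'k::comm_ring_1) ring)" (is "cring ?R")
proof -
  have assoc: "project_keys E (project_keys E (f * g) * h) = project_keys E (f * g * h)"
    if "Poly_Mapping.keys f \<subseteq> E" "Poly_Mapping.keys g \<subseteq> E" "Poly_Mapping.keys h \<subseteq> E"
    for f g h :: "'e \<Rightarrow>\<^sub>0 'k"
  proof -
    define D where "D = f * g - project_keys E (f * g)"
    have D: "Poly_Mapping.keys D \<subseteq> Poly_Mapping.keys (f * g) - E"
      unfolding D_def by (auto simp: Poly_Mapping.in_keys_iff lookup_minus lookup_project_keys split: if_splits)
    have "e \<notin> E" if e: "e \<in> Poly_Mapping.keys (D * h)" for e
    proof -
      obtain s z where s: "s \<in> Poly_Mapping.keys D" "z \<in> Poly_Mapping.keys h" "e = s + z"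
        using subsetD[OF keys_mult e] by auto
      then obtain x y where "x \<in> Poly_Mapping.keys f" "y \<in> Poly_Mapping.keys g" "s = x + y" "s \<notin> E"
        using D keys_mult[of f g] by fastforce
      then show ?thesis using s E[of x y z] \<open>Poly_Mapping.keys f \<subseteq> E\<close> \<open>Poly_Mapping.keys g \<subseteq> E\<close>
          \<open>Poly_Mapping.keys h \<subseteq> E\<close> by blast
    qed
    then have "project_keys E (D * h) = 0" by (intro project_keys_eq_0) blast
    moreover have "f * g * h = project_keys E (f * g) * h + D * h"
      by (simp add: D_def algebra_simps)
    ultimately show ?thesis by (simp add: project_keys_add)
  qed
  have carr: "carrier ?R = {f. Poly_Mapping.keys f \<subseteq> E}" "\<one>\<^bsub>?R\<^esub> = 1" "\<zero>\<^bsub>?R\<^esub> = 0"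
    "\<And>f g. f \<oplus>\<^bsub>?R\<^esub> g = f + g"
    by (simp_all add: contracted_monoid_ring_def)
  have one: "Poly_Mapping.keys (1 :: 'e \<Rightarrow>\<^sub>0 'k) \<subseteq> E" using E0 by simp
  show ?thesis
  proof (rule cringI)
    show "abelian_group ?R"
    proof (rule abelian_groupI; unfold carr)
      fix x y :: "'e \<Rightarrow>\<^sub>0 'k"
      assume x: "x \<in> {f. Poly_Mapping.keys f \<subseteq> E}"
      then show "\<exists>y\<in>{f. Poly_Mapping.keys f \<subseteq> E}. y + x = 0"
        by (intro bexI[of _ "- x"]) (auto simp: Poly_Mapping.in_keys_iff)
      assume "y \<in> {f. Poly_Mapping.keys f \<subseteq> E}"
      then show "x + y \<in> {f. Poly_Mapping.keys f \<subseteq> E}"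
        using x Poly_Mapping.keys_add[of x y] by blast
    qed (simp_all add: ac_simps)
    show "comm_monoid ?R"
    proof (rule comm_monoidI; unfold contracted_mult carr)
      fix x y z :: "'e \<Rightarrow>\<^sub>0 'k"
      assume "x \<in> {f. Poly_Mapping.keys f \<subseteq> E}" "y \<in> {f. Poly_Mapping.keys f \<subseteq> E}"
        "z \<in> {f. Poly_Mapping.keys f \<subseteq> E}"
      then show "project_keys E (project_keys E (x * y) * z) = project_keys E (x * project_keys E (y * z))"
        using assoc[of x y z] assoc[of y z x] by (simp add: mult_ac)
    qed (use one keys_project_keys in \<open>simp_all add: project_keys_id mult.commute\<close>)
  qed (unfold contracted_mult carr, simp add: project_keys_add distrib_right)
qed

lemma dual_cone_props:
  shows convex_dual_cone: "convex (dual_cone M \<sigma>)"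
    and closed_dual_cone: "closed (dual_cone M \<sigma>)"
    and zero_dual_cone: "0 \<in> dual_cone M \<sigma>"
    and add_dual_cone: "\<lbrakk>x \<in> dual_cone M \<sigma>; y \<in> dual_cone M \<sigma>\<rbrakk> \<Longrightarrow> x + y \<in> dual_cone M \<sigma>"
    and scale_dual_cone: "\<lbrakk>x \<in> dual_cone M \<sigma>; c \<ge> 0\<rbrakk> \<Longrightarrow> c *\<^sub>R x \<in> dual_cone M \<sigma>"
proof -
  have eq: "dual_cone M \<sigma> = (span M \<times> UNIV) \<inter> (\<Inter>x\<in>cone_over \<sigma>. {y. x \<bullet> y \<ge> 0})"
    by (auto simp: dual_cone_def inner_commute simp del: inner_Pair)
  show "convex (dual_cone M \<sigma>)" unfolding eq
    by (intro convex_Int convex_Times convex_INT convex_halfspace_ge subspace_imp_convex subspace_span convex_UNIV)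
  show "closed (dual_cone M \<sigma>)" unfolding eq
    by (intro closed_Int closed_Times closed_INT ballI closed_halfspace_ge closed_span closed_UNIV)
  show "0 \<in> dual_cone M \<sigma>"
    by (auto simp: dual_cone_def zero_prod_def span_zero)
  show "x + y \<in> dual_cone M \<sigma>" if "x \<in> dual_cone M \<sigma>" "y \<in> dual_cone M \<sigma>"
    using that by (auto simp: eq mem_Times_iff span_add inner_add_right)
  show "c *\<^sub>R x \<in> dual_cone M \<sigma>" if "x \<in> dual_cone M \<sigma>" "c \<ge> 0"
    using that by (auto simp: eq mem_Times_iff span_scale)
qed

lemma add_rel_interior_dual_cone:
  assumes "x \<in> rel_interior (dual_cone M \<sigma>)" "y \<in> dual_cone M \<sigma>"
  shows "x + y \<in> rel_interior (dual_cone M \<sigma>)"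
proof -
  let ?C = "dual_cone M \<sigma>"
  have x: "x \<in> ?C" using assms(1) rel_interior_subset by blast
  have *: "\<exists>e>1. (1 - e) *\<^sub>R z + e *\<^sub>R (x + y) \<in> ?C" if z: "z \<in> ?C" for z
  proof -
    obtain e where e: "e > 1" "(1 - e) *\<^sub>R z + e *\<^sub>R x \<in> ?C"
      using assms(1) z convex_rel_interior_iff[OF convex_dual_cone] x by blast
    have "((1 - e) *\<^sub>R z + e *\<^sub>R x) + e *\<^sub>R y \<in> ?C"
      using add_dual_cone[OF e(2) scale_dual_cone[OF assms(2), of e]] e(1) by simp
    then show ?thesis using e(1) by (auto simp: algebra_simps)
  qed
  then show ?thesis
    using convex_rel_interior_iff[OF convex_dual_cone] x by blast
qed

lemma cring_coord_ring:
  assumes "\<sigma> \<noteq> {}"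
  shows "cring (coord_ring M \<sigma> r :: ('a::euclidean_space, 'k::field) fun_ring)"
  unfolding coord_ring_def
proof (rule cring_contracted_monoid_ring)
  let ?C = "dual_cone M \<sigma>"
  have rf: "rel_frontier ?C = ?C - rel_interior ?C"
    by (simp add: rel_frontier_def closed_dual_cone)
  have "0 \<notin> rel_interior ?C"
  proof
    assume "0 \<in> rel_interior ?C"
    moreover have one: "(0, 1) \<in> ?C"
      by (auto simp: dual_cone_def cone_over_def span_zero)
    ultimately obtain e :: real where e: "e > 1" "(1 - e) *\<^sub>R (0, 1) + e *\<^sub>R 0 \<in> ?C"
      using convex_rel_interior_iff[OF convex_dual_cone] by blast
    obtain m where "m \<in> \<sigma>" using assms by blast
    then have "(m, 1) \<in> cone_over \<sigma>" unfolding cone_over_def by force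
    then show False using e by (auto simp: dual_cone_def)
  qed
  then show "0 \<in> boundary_exponents M \<sigma> r"
    using zero_dual_cone[of M \<sigma>]
    by (auto simp: boundary_exponents_def boundary_P_def rf zero_prod_def dual_lattice_def span_zero)
  show "x + y \<in> boundary_exponents M \<sigma> r"
    if "x \<in> boundary_exponents M \<sigma> r" "y \<in> boundary_exponents M \<sigma> r" "z \<in> boundary_exponents M \<sigma> r"
      "x + y + z \<in> boundary_exponents M \<sigma> r" for x y z
  proof -
    have b: "fst x \<in> ?C" "fst y \<in> ?C" "fst z \<in> ?C" "fst x + fst y + fst z \<notin> rel_interior ?C"
      using that by (auto simp: boundary_exponents_def boundary_P_def rf mem_Times_iff)
    have "fst x + fst y \<in> ?C" by (rule add_dual_cone[OF b(1,2)])
    moreover have "fst x + fst y \<notin> rel_interior ?C"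
      using add_rel_interior_dual_cone[OF _ b(3)] b(4) by blast
    moreover have "fst x + fst y \<in> dual_lattice M \<times> \<int>" using that
      by (auto simp: boundary_exponents_def boundary_P_def mem_Times_iff dual_lattice_def
          inner_add_left span_add)
    moreover have "Poly_Mapping.keys (snd x + snd y) \<subseteq> {..<r}"
      using that Poly_Mapping.keys_add[of "snd x" "snd y"]
      by (auto simp: boundary_exponents_def mem_Times_iff)
    ultimately show ?thesis
      by (auto simp: boundary_exponents_def boundary_P_def rf mem_Times_iff)
  qed
qed

definition stratum_ideal :: "'a::euclidean_space set \<Rightarrow> 'a set \<Rightarrow> nat \<Rightarrow> 'a set \<Rightarrow> ('a exponent \<Rightarrow>\<^sub>0 'k::field) set" where
  "stratum_ideal M \<sigma> r \<tau> =
     a_kernel (coord_ring M \<sigma> r) (contracted_monoid_ring (stratum_exponents M \<sigma> r \<tau>))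
       (project_keys (stratum_exponents M \<sigma> r \<tau>))"


section \<open>The sheaf of log smooth structures\<close>

definition chart :: "'a::euclidean_space set \<Rightarrow> 'a set \<Rightarrow> 'a \<times> real \<Rightarrow> 'a exponent \<Rightarrow>\<^sub>0 'k::field" where
  "chart M \<sigma> p = (if p \<in> boundary_P M \<sigma> then Poly_Mapping.single (p, 0) 1 else 0)"

definition V_p :: "'a::euclidean_space set \<Rightarrow> 'a set \<Rightarrow> nat \<Rightarrow> 'a \<times> real \<Rightarrow> ('a, 'k::field) point set" where
  "V_p M \<sigma> r p = V_space M \<sigma> r closure_of {x \<in> Spec (coord_ring M \<sigma> r). chart M \<sigma> p \<notin> x}"

text \<open>\<open>V(p)\<close> carries the reduced scheme structure.\<close>

definition ideal_p :: "'a::euclidean_space set \<Rightarrow> 'a set \<Rightarrow> nat \<Rightarrow> 'a \<times> real \<Rightarrow> ('a exponent \<Rightarrow>\<^sub>0 'k::field) set" where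
  "ideal_p M \<sigma> r p = vanishing_ideal (coord_ring M \<sigma> r) (V_p M \<sigma> r p)"

definition log_families ::
  "'a::euclidean_space set \<Rightarrow> 'a set \<Rightarrow> nat \<Rightarrow> (('a, 'k::field) point, 'a \<times> real \<Rightarrow> ('a, 'k) local_fun) presheaf" where
  "log_families M \<sigma> r = (let R = coord_ring M \<sigma> r; P = P_monoid M \<sigma>; I = ideal_p M \<sigma> r in \<lparr>
     sect = (\<lambda>U. \<lparr>
       carrier = {h \<in> (\<Pi>\<^sub>E p\<in>P. carrier (invertible_functions R (I p) U)).
         \<forall>p\<in>P. \<forall>q\<in>P.
           restrict_function R (I (p + q)) U (h p) \<otimes>\<^bsub>invertible_functions R (I (p + q)) U\<^esub>
           restrict_function R (I (p + q)) U (h q) = h (p + q)},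
       mult = (\<lambda>h h'. \<lambda>p\<in>P. h p \<otimes>\<^bsub>invertible_functions R (I p) U\<^esub> h' p),
       one = (\<lambda>p\<in>P. \<one>\<^bsub>invertible_functions R (I p) U\<^esub>)\<rparr>),
     restr = (\<lambda>U W h. \<lambda>p\<in>P. restrict_function R (I p) W (h p))\<rparr>)"

text \<open>
  The image of \<open>Hom(P\<^sup>g\<^sup>p/\<rho>, \<O>\<^sub>V\<^sup>\<times>) = Hom(N, \<O>\<^sub>V\<^sup>\<times>)\<close> in the sheaf of families: the quotient map \<open>P \<rightarrow> P\<^sup>g\<^sup>p/\<rho> = N\<close>
  is the projection \<open>fst\<close>. The structure sheaf of \<open>V\<close> itself belongs to the zero ideal.
\<close>

definition hom_families ::
  "'a::euclidean_space set \<Rightarrow> 'a set \<Rightarrow> nat \<Rightarrow> ('a, 'k::field) point set \<Rightarrow> ('a \<times> real \<Rightarrow> ('a, 'k) local_fun) set" where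
  "hom_families M \<sigma> r U = (let R = coord_ring M \<sigma> r in
     (\<lambda>\<phi>. \<lambda>p\<in>P_monoid M \<sigma>. restrict_function R (ideal_p M \<sigma> r p) U (\<phi> (fst p))) `
       hom (additive_group (dual_lattice M)) (invertible_functions R {\<zero>\<^bsub>R\<^esub>} U))"

definition LS_sheaf ::
  "'a::euclidean_space set \<Rightarrow> 'a set \<Rightarrow> nat \<Rightarrow>
    (('a, 'k::field) point,
     ('a, 'k) point \<Rightarrow> (('a, 'k) point set \<times> ('a \<times> real \<Rightarrow> ('a, 'k) local_fun) set) set) presheaf" where
  "LS_sheaf M \<sigma> r = quotient_sheaf (V_space M \<sigma> r) (log_families M \<sigma> r) (hom_families M \<sigma> r)"


section \<open>The subsheaf of \<open>\<Oplus>\<^sub>\<omega> \<O>\<^bsub>V\<^sub>\<omega>\<^esub>\<^sup>\<times>\<close>\<close>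

definition tangent_space :: "'a::euclidean_space set \<Rightarrow> 'a set" where
  "tangent_space \<tau> = span {x - y | x y. x \<in> \<tau> \<and> y \<in> \<tau>}"

definition primitive_generator :: "'a::euclidean_space set \<Rightarrow> 'a set \<Rightarrow> 'a \<Rightarrow> bool" where
  "primitive_generator M \<omega> v \<longleftrightarrow> M \<inter> tangent_space \<omega> = {of_int c *\<^sub>R v | c. True}"

definition two_face_of :: "'a::euclidean_space set \<Rightarrow> 'a set \<Rightarrow> bool" where
  "two_face_of \<tau> \<sigma> \<longleftrightarrow> \<tau> face_of \<sigma> \<and> aff_dim \<tau> = 2"

text \<open>An orientation of a polygon, given as an area form on its tangent plane.\<close>

definition area_form :: "'a::euclidean_space set \<Rightarrow> ('a \<Rightarrow> 'a \<Rightarrow> real) \<Rightarrow> bool" where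
  "area_form \<tau> \<alpha> \<longleftrightarrow> bilinear \<alpha> \<and> (\<forall>u. \<alpha> u u = 0) \<and>
     (\<exists>u\<in>tangent_space \<tau>. \<exists>v\<in>tangent_space \<tau>. \<alpha> u v \<noteq> 0)"

text \<open>
  In the oriented boundary the edges carry the orientation for which an outward pointing vector followed by
  the direction of the edge is a positively oriented basis. For a point \<open>x\<close> of an edge \<open>\<omega>\<close> and a point \<open>y\<close> of
  the polygon outside \<open>\<omega>\<close> the vector \<open>x - y\<close> points outwards along \<open>\<omega>\<close>.
\<close>

definition sign_vector ::
  "'a::euclidean_space set \<Rightarrow> ('a set \<Rightarrow> 'a) \<Rightarrow> 'a set \<Rightarrow> ('a set \<Rightarrow> int) \<Rightarrow> bool" where
  "sign_vector \<sigma> d \<tau> \<epsilon> \<longleftrightarrow>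
     (\<forall>\<omega>. \<omega> edge_of \<sigma> \<and> \<not> \<omega> \<subseteq> \<tau> \<longrightarrow> \<epsilon> \<omega> = 0) \<and>
     (\<exists>\<alpha>. area_form \<tau> \<alpha> \<and>
        (\<forall>\<omega>. \<omega> edge_of \<sigma> \<and> \<omega> \<subseteq> \<tau> \<longrightarrow> \<epsilon> \<omega> \<in> {1, -1} \<and>
           (\<forall>x\<in>\<omega>. \<forall>y\<in>\<tau> - \<omega>. of_int (\<epsilon> \<omega>) = sgn (\<alpha> (x - y) (d \<omega>)))))"

text \<open>
  If \<open>\<omega>\<close> is not contained in \<open>\<tau>\<close> then \<open>V\<^sub>\<tau>\<close> is not contained in \<open>V\<^sub>\<omega>\<close> and \<open>f\<^sub>\<omega>\<close> has no restriction to \<open>V\<^sub>\<tau>\<close>;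
  the zeroth power of that restriction stands for \<open>1\<close>.
\<close>

definition cycle_condition ::
  "'a::euclidean_space set \<Rightarrow> 'a set \<Rightarrow> nat \<Rightarrow> ('a set \<Rightarrow> 'a) \<Rightarrow> ('a set \<Rightarrow> int) \<Rightarrow> 'a set \<Rightarrow>
    ('a, 'k::field) point set \<Rightarrow> ('a set \<Rightarrow> ('a, 'k) local_fun) \<Rightarrow> bool" where
  "cycle_condition M \<sigma> r d \<epsilon> \<tau> U f \<longleftrightarrow>
     (let R = coord_ring M \<sigma> r; J = stratum_ideal M \<sigma> r \<tau>; G = invertible_functions R J U;
          T = tensor_group (additive_group M) G in
      finprod T
        (\<lambda>\<omega>. pure_tensor (additive_group M) G (d \<omega>)
               ((if \<omega> \<subseteq> \<tau> then restrict_function R J U (f \<omega>) else \<one>\<^bsub>G\<^esub>) [^]\<^bsub>G\<^esub> \<epsilon> \<omega>))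
        {\<omega>. \<omega> edge_of \<sigma>} = \<one>\<^bsub>T\<^esub>)"

definition edge_sheaf ::
  "'a::euclidean_space set \<Rightarrow> 'a set \<Rightarrow> nat \<Rightarrow> ('a set \<Rightarrow> 'a) \<Rightarrow> ('a set \<Rightarrow> 'a set \<Rightarrow> int) \<Rightarrow>
    (('a, 'k::field) point, 'a set \<Rightarrow> ('a, 'k) local_fun) presheaf" where
  "edge_sheaf M \<sigma> r d \<epsilon> =
     (let R = coord_ring M \<sigma> r; I = stratum_ideal M \<sigma> r; E = {\<omega>. \<omega> edge_of \<sigma>} in \<lparr>
     sect = (\<lambda>U. \<lparr>
       carrier = {f \<in> (\<Pi>\<^sub>E \<omega>\<in>E. carrier (invertible_functions R (I \<omega>) U)).
         \<forall>\<tau>. two_face_of \<tau> \<sigma> \<longrightarrow> cycle_condition M \<sigma> r d (\<epsilon> \<tau>) \<tau> U f},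
       mult = (\<lambda>f g. \<lambda>\<omega>\<in>E. f \<omega> \<otimes>\<^bsub>invertible_functions R (I \<omega>) U\<^esub> g \<omega>),
       one = (\<lambda>\<omega>\<in>E. \<one>\<^bsub>invertible_functions R (I \<omega>) U\<^esub>)\<rparr>),
     restr = (\<lambda>U W f. \<lambda>\<omega>\<in>E. restrict_function R (I \<omega>) W (f \<omega>))\<rparr>)"

end

theory Submission
 imports Defs
begin

text \<open>
Near a point a log structure of the given type is a family of units \<open>h p\<close>, indexed by the monoid \<open>P\<close>, with
\<open>h p\<close> defined on \<open>V(p)\<close>. Only boundary points \<open>p = (w, hgt w)\<close> matter, one for each \<open>w\<close> in the dual lattice, and the
multiplication rule says that \<open>w \<mapsto> h (w, hgt w)\<close> is a multiplicative piecewise linear function on the normal fan of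
the polytope: on the stratum of a face it is linear on the cones of the vertices of that face. Families that come
from homomorphisms are the linear functions. Dividing by them leaves the bends of the function: for an edge, the
quotient of the linear extensions at its two vertices depends on a functional only through its value on the primitive
direction of the edge, so it is a power of one unit on the stratum of the edge, the kink.

The isomorphism sends a family to its kinks (\<open>kinks\<close>). Going around a two-dimensional face the linear extensions
return to the first one, which is the cycle condition (\<open>kinks_closed\<close>). If all kinks are trivial, the
extensions at the vertices of any face agree on its stratum because the graph of the face is connected
(\<open>polytope_graph_connected\<close>), and they glue to a homomorphism into functions on \<open>V\<close> (\<open>kinks_kernel\<close>).
Conversely, functions on the edge strata are locally kinks (\<open>kinks_locally_surjective\<close>): at a point the
linear extensions at the vertices are a cochain with prescribed differences along the edges, and the obstruction to its
existence on one stratum is measured by loops in the edge graph of a face. These are generated by the boundaries of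
two-dimensional faces (\<open>polytope_simply_connected\<close>), where the cycle condition makes them trivial. Since the
restrictions of germs to the strata are commuting retractions, the solutions on the different strata are combined into one
(\<open>lift_cochain\<close>), and functions on strata that agree on intersections glue (\<open>section_from_strata\<close>).
A locally surjective map from a presheaf to a sheaf with this kernel presents the sheaf as the sheafified quotient
(\<open>quotient_sheaf_isomorphic\<close>).
\<close>

abbreviation "seg \<equiv> closed_segment"

section \<open>Polytopes and their graphs\<close>

lemma generic_functional:
 fixes A :: "'a::euclidean_space set"
 assumes "finite A" "0~:A"
 obtains l where "!!a. a:A ==> l\<bullet>a~=0"
proof -
 have "negligible (\<Union>a\<in>A. {x. a\<bullet>x=0})"
  using assms by (intro negligible_Union) (auto intro!: negligible_hyperplane)
 hence "(\<Union>a\<in>A. {x. a\<bullet>x=0})~=UNIV" by (metis non_negligible_UNIV)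
 then obtain l where "l~:(\<Union>a\<in>A. {x. a\<bullet>x=0})" by blast
 thus thesis using that[of l] by (auto simp: inner_commute)
qed

lemma polytope_eq_hull_extreme_points:
 fixes rh :: "'a::euclidean_space set"
 assumes "polytope rh"
 shows "rh=convex hull {v. v extreme_point_of rh}" "finite {v. v extreme_point_of rh}"
 using Krein_Milman_Minkowski assms polytope_imp_compact polytope_imp_convex apply blast
 using finite_polyhedron_extreme_points assms polytope_imp_polyhedron by blast

lemma extreme_point_inner_le:
 fixes rh :: "'a::euclidean_space set"
 assumes "polytope rh" "y:rh"
 obtains v where "v extreme_point_of rh" "l\<bullet>v\<le>l\<bullet>y"
proof (rule ccontr)
 assume "\<not> thesis"
 hence "{v. v extreme_point_of rh}\<subseteq>{x. l\<bullet>x > l\<bullet>y}" using that by force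
 hence "convex hull {v. v extreme_point_of rh}\<subseteq>{x. l\<bullet>x > l\<bullet>y}"
  by (intro hull_minimal) (auto intro: convex_halfspace_gt)
 thus False using polytope_eq_hull_extreme_points(1)[OF assms(1)] assms(2) by blast
qed

lemma face_in_rel_interior:
 fixes rh :: "'a::euclidean_space set"
 assumes "polytope rh" "q:rh"
 obtains F where "F face_of rh" "q:rel_interior F"
proof -
 let ?\<F> = "{F. F face_of rh & q:F}"
 define F where "F=\<Inter>?\<F>"
 have rh: "rh:?\<F>" using assms face_of_refl polytope_imp_convex by auto
 have F: "F face_of rh" unfolding F_def using rh by (intro face_of_Inter) auto
 have qF: "q:F" unfolding F_def by blast
 have "polytope F" using F assms(1) face_of_polytope_polytope by blast
 hence rf: "rel_frontier F=\<Union>{F'. F' facet_of F}"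
  by (intro rel_frontier_of_polyhedron polytope_imp_polyhedron)
 have "q~:rel_frontier F"
 proof
  assume "q:rel_frontier F"
  then obtain F' where F': "F' facet_of F" "q:F'" using rf by blast
  hence "F' face_of rh" using F facet_of_imp_face_of face_of_trans by blast
  hence "F\<subseteq>F'" unfolding F_def using F'(2) by blast
  thus False using F' facet_of_imp_subset[OF F'(1)] facet_of_irrefl by (metis subset_antisym)
 qed
 hence "q:rel_interior F" using qF closure_subset by (auto simp: rel_frontier_def)
 thus thesis using that F by blast
qed

lemma edge_of_polytope_segment:
 fixes rh :: "'a::euclidean_space set"
 assumes "polytope rh" "ed edge_of rh"
 obtains u v where "u~=v" "ed=seg u v" "u extreme_point_of rh" "v extreme_point_of rh"
proof -
 have f: "ed face_of rh" "aff_dim ed=1" using assms(2) by (auto simp: edge_of_def)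
 hence "polytope ed" using assms(1) face_of_polytope_polytope by blast
 moreover have "ed~={}" using f(2) by auto
 ultimately obtain u v where uv: "ed=seg u v"
  using compact_convex_collinear_segment[of ed] f(2) collinear_aff_dim[of ed]
  by (auto simp: polytope_imp_compact polytope_imp_convex)
 have "u~=v" using f(2) uv by (auto simp: aff_dim_sing)
 moreover have "u extreme_point_of ed" "v extreme_point_of ed" unfolding uv
  by (auto simp: extreme_point_of_segment)
 ultimately show thesis using that uv extreme_point_of_face[OF f(1)] by blast
qed

lemma edge_of_extreme_points:
 fixes rh :: "'a::euclidean_space set"
 assumes "seg u v edge_of rh"
 shows "u~=v" "u extreme_point_of rh" "v extreme_point_of rh"
proof -
 have f: "seg u v face_of rh" "aff_dim (seg u v)=1"
  using assms by (auto simp: edge_of_def)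
 thus "u~=v" by (auto simp: aff_dim_sing)
 show "u extreme_point_of rh" "v extreme_point_of rh"
  using extreme_point_of_face[OF f(1)] extreme_point_of_segment by blast+
qed

lemma edge_of_at_vertex:
 fixes rh :: "'a::euclidean_space set"
 assumes "polytope rh" "ed edge_of rh" "v:ed" "v extreme_point_of rh"
 obtains u where "ed=seg v u"
proof -
 obtain a b where ab: "ed=seg a b" using edge_of_polytope_segment[OF assms(1,2)] by metis
 have "v extreme_point_of ed"
  using extreme_point_of_face[of ed rh v] assms by (auto simp: edge_of_def)
 hence "v=a\<or>v=b" unfolding ab by (simp add: extreme_point_of_segment)
 thus thesis using that ab closed_segment_commute by metis
qed

lemma exposing_functional:
 fixes rh :: "'a::euclidean_space set"
 assumes "polytope rh" "F face_of rh" "F~={}"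
 obtains \<psi> c where "!!x. x:F ==> \<psi>\<bullet>x=c" "!!x. x:rh ==> x~:F ==> \<psi>\<bullet>x > c"
proof -
 have "F exposed_face_of rh"
  using assms exposed_face_of_polyhedron polytope_imp_polyhedron by blast
 then obtain a b where ab: "rh\<subseteq>{x. a\<bullet>x\<le>b}" "F=rh\<inter>{x. a\<bullet>x=b}"
  unfolding exposed_face_of_def by blast
 thus thesis by (intro that[of "-a" "-b"]) force+
qed

lemma aff_dim_Int_hyperplane_rel_interior:
 fixes F :: "'a::euclidean_space set"
 assumes "convex F" "q:rel_interior F" "a\<bullet>q=b" "v:F" "a\<bullet>v~=b"
 shows "aff_dim (F\<inter>{x. a\<bullet>x=b})=aff_dim F - 1"
proof -
 let ?H = "{x. a\<bullet>x=b}"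
 let ?S = "affine hull F\<inter>?H"
 have aff: "affine ?S" by (intro affine_Int affine_affine_hull affine_hyperplane)
 have "affine hull (?S\<inter>(rel_interior F\<inter>?H))=affine hull ?S"
 proof (rule affine_hull_convex_Int_openin)
  show "convex ?S" using aff affine_imp_convex by blast
  have "openin (top_of_set (affine hull F)) (rel_interior F)" by (rule openin_rel_interior)
  then obtain T where T: "open T" "rel_interior F=affine hull F\<inter>T" by (auto simp: openin_open)
  hence "?S\<inter>rel_interior F=?S\<inter>T" by blast
  hence "openin (top_of_set ?S) (?S\<inter>rel_interior F)" using T(1) by (auto simp: openin_open)
  moreover have "?S\<inter>rel_interior F=rel_interior F\<inter>?H"
   using rel_interior_subset[of F] hull_subset[of F affine] by blast
  ultimately show "openin (top_of_set (affine hull ?S)) (rel_interior F\<inter>?H)"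
   using aff by (simp add: affine_hull_eq[THEN iffD2])
  show "?S\<inter>(rel_interior F\<inter>?H)~={}"
   using assms(2,3) rel_interior_subset[of F] hull_subset[of F affine] by fast
 qed
 moreover have "affine hull (?S\<inter>(rel_interior F\<inter>?H))\<subseteq>affine hull (F\<inter>?H)"
  using rel_interior_subset by (intro hull_mono) blast
 moreover have "affine hull (F\<inter>?H)\<subseteq>?S"
  using aff hull_subset[of F affine] by (intro hull_minimal) auto
 ultimately have "affine hull (F\<inter>?H)=?S" using aff by (simp add: affine_hull_eq[THEN iffD2])
 hence "aff_dim (F\<inter>?H)=aff_dim ?S" by (metis aff_dim_affine_hull)
 also have "...=aff_dim (affine hull F) - 1"
 proof -
  have "?S~={}" using assms(2,3) rel_interior_subset[of F] hull_subset[of F affine] by fast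
  moreover have "\<not> affine hull F\<subseteq>?H" using assms(4,5) hull_subset[of F affine] by blast
  ultimately show ?thesis by (subst aff_dim_affine_Int_hyperplane) (auto simp: affine_affine_hull)
 qed
 finally show ?thesis by (simp add: aff_dim_affine_hull)
qed

text \<open>The hyperplane \<open>{x. \<psi> \<bullet> x = c}\<close> meets the polytope in the vertex figure of \<open>v\<close>, a polytope whose faces of dimension \<open>k\<close> are the traces of the faces of dimension \<open>k + 1\<close> through \<open>v\<close>.\<close>
definition cuts_off :: "'a::euclidean_space set=>'a=>'a=>real=>bool" where
 "cuts_off rh v \<psi> c \<longleftrightarrow> \<psi>\<bullet>v < c & (ALL u. u extreme_point_of rh --> u~=v --> c < \<psi>\<bullet>u)"

lemma cuts_off_exists:
 fixes rh :: "'a::euclidean_space set"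
 assumes "polytope rh" "v extreme_point_of rh"
 obtains \<psi> c where "cuts_off rh v \<psi> c"
proof -
 have "{v} face_of rh" using assms(2) by (simp add: face_of_singleton)
 then obtain \<psi> b where \<psi>: "\<psi>\<bullet>v=b" "!!x. x:rh ==> x~=v ==> \<psi>\<bullet>x > b"
  using exposing_functional[OF assms(1), of "{v}"] by auto
 let ?A = "insert (b + 1) ((%u. \<psi>\<bullet>u) ` ({u. u extreme_point_of rh} - {v}))"
 have fin: "finite ?A" using polytope_eq_hull_extreme_points(2)[OF assms(1)] by auto
 have gt: "b < m" if "m:?A" for m using that \<psi>(2) by (auto simp: extreme_point_of_def)
 have "b < Min ?A" using gt Min_in[OF fin] by blast
 moreover have "Min ?A\<le>\<psi>\<bullet>u" if "u extreme_point_of rh" "u~=v" for u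
  using that fin by (intro Min_le) auto
 ultimately show thesis using \<psi>(1)
  by (intro that[of \<psi> "(b + Min ?A) / 2"]) (force simp: cuts_off_def field_simps)
qed

lemma polytope_cut:
 fixes rh :: "'a::euclidean_space set"
 shows "polytope rh ==> polytope (rh\<inter>{x. \<psi>\<bullet>x=c})"
 by (simp add: polytope_Int_polyhedron polyhedron_hyperplane)

text \<open>The face of the polytope whose relative interior contains a relatively interior point of \<open>e\<close> cuts out \<open>e\<close>. It contains \<open>v\<close>, since otherwise all its vertices would lie strictly beyond the hyperplane.\<close>
lemma vertex_figure_face:
 fixes rh :: "'a::euclidean_space set"
 assumes rh: "polytope rh" and cut: "cuts_off rh v \<psi> c" and v: "v extreme_point_of rh"
  and e: "e face_of (rh\<inter>{x. \<psi>\<bullet>x=c})" "e~={}"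
 obtains F where "F face_of rh" "v:F" "F\<inter>{x. \<psi>\<bullet>x=c}=e" "aff_dim F=aff_dim e + 1"
proof -
 let ?H = "{x. \<psi>\<bullet>x=c}"
 have "convex e" using e face_of_imp_convex by blast
 then obtain q where q: "q:rel_interior e" using e(2) rel_interior_eq_empty by blast
 have qe: "q:e" using q rel_interior_subset by blast
 hence qrh: "q:rh" "\<psi>\<bullet>q=c" using face_of_imp_subset[OF e(1)] by auto
 obtain F where F: "F face_of rh" "q:rel_interior F" using face_in_rel_interior[OF rh qrh(1)] by blast
 have pF: "polytope F" using F(1) rh face_of_polytope_polytope by blast
 have qF: "q:F" using F(2) rel_interior_subset by blast
 obtain u where u: "u extreme_point_of F" "\<psi>\<bullet>u\<le>\<psi>\<bullet>q" using extreme_point_inner_le[OF pF qF] by blast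
 hence "u extreme_point_of rh" "u:F" using extreme_point_of_face[OF F(1)] by auto
 hence vF: "v:F" using cut u(2) qrh(2) by (force simp: cuts_off_def)
 have "e\<subseteq>F" using e(1) F(1) q qF face_of_imp_subset by (intro subset_of_face_of[OF F(1)]) blast+
 have ri: "rel_interior (F\<inter>?H)=rel_interior F\<inter>?H"
  using F(2) qrh(2) pF by (intro convex_affine_rel_interior_Int) (auto simp: polytope_imp_convex affine_hyperplane)
 have "F\<inter>?H\<subseteq>e"
 proof (rule subset_of_face_of[OF e(1)])
  show "F\<inter>?H\<subseteq>rh\<inter>?H" using face_of_imp_subset[OF F(1)] by blast
  show "e\<inter>rel_interior (F\<inter>?H)~={}" using ri F(2) qrh(2) qe by blast
 qed
 hence eq: "F\<inter>?H=e" using \<open>e \<subseteq> F\<close> face_of_imp_subset[OF e(1)] by blast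
 have "aff_dim (F\<inter>?H)=aff_dim F - 1"
  using aff_dim_Int_hyperplane_rel_interior[of F q \<psi> c v] pF F(2) qrh(2) vF cut
  by (auto simp: polytope_imp_convex cuts_off_def)
 thus thesis using that[of F] F(1) vF eq by auto
qed

lemma vertex_figure_vertex:
 fixes rh :: "'a::euclidean_space set"
 assumes rh: "polytope rh" and cut: "cuts_off rh v \<psi> c" and v: "v extreme_point_of rh"
  and q: "q extreme_point_of (rh\<inter>{x. \<psi>\<bullet>x=c})"
 obtains u where "seg v u edge_of rh" "q:open_segment v u"
  "seg v u\<inter>{x. \<psi>\<bullet>x=c}={q}"
proof -
 have "{q} face_of (rh\<inter>{x. \<psi>\<bullet>x=c})" using q by (simp add: face_of_singleton)
 then obtain F where F: "F face_of rh" "v:F" "F\<inter>{x. \<psi>\<bullet>x=c}={q}" "aff_dim F=aff_dim {q} + 1"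
  using vertex_figure_face[OF rh cut v, of "{q}"] by blast
 hence "F edge_of rh" by (simp add: edge_of_def aff_dim_sing)
 then obtain u where u: "F=seg v u" using edge_of_at_vertex[OF rh _ F(2) v] by blast
 hence "u extreme_point_of rh" "u~=v" using edge_of_extreme_points[of v u rh] \<open>F edge_of rh\<close> by auto
 hence "\<psi>\<bullet>u~=c" "\<psi>\<bullet>v~=c" using cut by (auto simp: cuts_off_def)
 moreover have "q:seg v u" "\<psi>\<bullet>q=c" using F(3) u by auto
 ultimately have "q:open_segment v u" by (auto simp: open_segment_def)
 thus thesis using that[of u] u F(3) \<open>F edge_of rh\<close> by auto
qed

lemma edge_meets_vertex_figure:
 fixes rh :: "'a::euclidean_space set"
 assumes cut: "cuts_off rh v \<psi> c" and uv: "v extreme_point_of rh" "u extreme_point_of rh" "u~=v" and rh: "polytope rh"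
 obtains q where "q:open_segment v u" "seg v u\<inter>{x. \<psi>\<bullet>x=c}={q}"
  "seg v u edge_of rh --> q extreme_point_of (rh\<inter>{x. \<psi>\<bullet>x=c})"
  "q:rh" "\<psi>\<bullet>q=c"
proof -
 have lt: "\<psi>\<bullet>v < c" "c < \<psi>\<bullet>u" using cut uv by (auto simp: cuts_off_def)
 define t where "t=(c - \<psi>\<bullet>v) / (\<psi>\<bullet>u - \<psi>\<bullet>v)"
 define q where "q=(1 - t) *\<^sub>R v + t *\<^sub>R u"
 have t: "0 < t" "t < 1" using lt by (auto simp: t_def field_simps)
 have inn: "\<psi>\<bullet>((1 - s) *\<^sub>R v + s *\<^sub>R u)=c \<longleftrightarrow> s=t" for s
 proof -
  have "\<psi>\<bullet>((1 - s) *\<^sub>R v + s *\<^sub>R u)=\<psi>\<bullet>v + s * (\<psi>\<bullet>u - \<psi>\<bullet>v)"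
   by (simp add: inner_add_right algebra_simps)
  thus ?thesis using lt by (simp add: t_def field_simps) (auto simp: algebra_simps)
 qed
 have q1: "q:open_segment v u" unfolding q_def in_segment using t uv by auto
 have q2: "seg v u\<inter>{x. \<psi>\<bullet>x=c}={q}"
 proof (intro subset_antisym subsetI)
  fix x assume "x:seg v u\<inter>{x. \<psi>\<bullet>x=c}"
  then obtain s where "x=(1 - s) *\<^sub>R v + s *\<^sub>R u" "\<psi>\<bullet>x=c" by (auto simp: in_segment)
  thus "x:{q}" using inn q_def by auto
 next
  fix x assume "x:{q}"
  thus "x:seg v u\<inter>{x. \<psi>\<bullet>x=c}"
   using q1 inn[of t] q_def by (auto simp: open_segment_def)
 qed
 have conv: "convex rh" using rh polytope_imp_convex by blast
 have "seg v u\<subseteq>rh" using uv conv by (auto simp: extreme_point_of_def closed_segment_subset)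
 hence qrh: "q:rh" "\<psi>\<bullet>q=c" using q2 by auto
 have "q extreme_point_of (rh\<inter>{x. \<psi>\<bullet>x=c})" if "seg v u edge_of rh"
 proof -
  have "seg v u\<inter>{x. \<psi>\<bullet>x=c} face_of rh\<inter>{x. \<psi>\<bullet>x=c}"
   using that by (intro face_of_slice) (auto simp: edge_of_def convex_hyperplane)
  thus ?thesis by (simp add: q2 face_of_singleton)
 qed
 thus thesis using that q1 q2 qrh by blast
qed

lemma open_segment_inner_less_iff:
 fixes l :: "'a::euclidean_space"
 assumes "q:open_segment v u"
 shows "l\<bullet>q < l\<bullet>v \<longleftrightarrow> l\<bullet>u < l\<bullet>v"
proof -
 obtain s where s: "0 < s" "q=(1 - s) *\<^sub>R v + s *\<^sub>R u" using assms by (auto simp: in_segment)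
 have "l\<bullet>q=l\<bullet>v + s * (l\<bullet>u - l\<bullet>v)" by (simp add: s inner_add_right algebra_simps)
 thus ?thesis using s(1) by (simp add: mult_less_0_iff)
qed

text \<open>A step of the simplex algorithm: the ray from \<open>v\<close> to \<open>y\<close> crosses the vertex figure, and the linear functional takes at some vertex of the vertex figure a value that is at most its value at that crossing. This vertex lies on an edge through \<open>v\<close>, along which \<open>l\<close> decreases.\<close>
lemma descending_edge:
 fixes rh :: "'a::euclidean_space set"
 assumes rh: "polytope rh" and v: "v extreme_point_of rh" and y: "y:rh" "l\<bullet>y < l\<bullet>v"
 obtains u where "seg v u edge_of rh" "l\<bullet>u < l\<bullet>v"
proof -
 obtain u where u: "u extreme_point_of rh" "l\<bullet>u\<le>l\<bullet>y" using extreme_point_inner_le[OF rh y(1)] by blast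
 hence "u~=v" using y by auto
 obtain \<psi> c where cut: "cuts_off rh v \<psi> c" using cuts_off_exists[OF rh v] by blast
 obtain z where z: "z:open_segment v u" "z:rh" "\<psi>\<bullet>z=c"
  using edge_meets_vertex_figure[OF cut v u(1) \<open>u \<noteq> v\<close> rh] by blast
 hence "l\<bullet>z < l\<bullet>v" using u(2) y(2) open_segment_inner_less_iff[OF z(1), of l] by auto
 moreover obtain q where q: "q extreme_point_of (rh\<inter>{x. \<psi>\<bullet>x=c})" "l\<bullet>q\<le>l\<bullet>z"
  using extreme_point_inner_le[OF polytope_cut[OF rh], of z \<psi> c l] z by blast
 moreover obtain u' where "seg v u' edge_of rh" "q:open_segment v u'"
  using vertex_figure_vertex[OF rh cut v q(1)] by blast
 ultimately show thesis using that[of u'] open_segment_inner_less_iff[of q v u' l] by auto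
qed

definition adjacent :: "'a::euclidean_space set=>('a\<times>'a) set" where
 "adjacent rh={(u, v). seg u v edge_of rh}"

text \<open>Descending along edges with respect to a functional that has its minimum only at \<open>v'\<close> ends at \<open>v'\<close>.\<close>
lemma polytope_graph_connected:
 fixes rh :: "'a::euclidean_space set"
 assumes rh: "polytope rh" and v: "v extreme_point_of rh" and v': "v' extreme_point_of rh"
 shows "(v, v'):(adjacent rh)\<^sup>*"
proof -
 obtain l c where l: "l\<bullet>v'=c" "!!x. x:rh ==> x~=v' ==> l\<bullet>x > c"
  using exposing_functional[OF rh, of "{v'}"] v' by (auto simp: face_of_singleton)
 have "(u, v'):(adjacent rh)\<^sup>*" if "u extreme_point_of rh" for u
  using that
 proof (induction "card {w. w extreme_point_of rh & l\<bullet>w < l\<bullet>u}" arbitrary: u rule: less_induct)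
  case less
  show ?case
  proof (cases "u=v'")
   case False
   hence "l\<bullet>v' < l\<bullet>u" using l less.prems by (auto simp: extreme_point_of_def)
   then obtain w where w: "seg u w edge_of rh" "l\<bullet>w < l\<bullet>u"
    using descending_edge[OF rh less.prems, of v' l] v' by (auto simp: extreme_point_of_def)
   have we: "w extreme_point_of rh" using edge_of_extreme_points[OF w(1)] by blast
   have "{x. x extreme_point_of rh & l\<bullet>x < l\<bullet>w} \<subset> {x. x extreme_point_of rh & l\<bullet>x < l\<bullet>u}"
    using w(2) we by force
   hence "(w, v'):(adjacent rh)\<^sup>*"
    using less.hyps[OF _ we] polytope_eq_hull_extreme_points(2)[OF rh]
    by (simp add: psubset_card_mono)
   moreover have "(u, w):adjacent rh" using w(1) by (simp add: adjacent_def)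
   ultimately show ?thesis by (rule converse_rtrancl_into_rtrancl[rotated])
  qed simp
 qed
 thus ?thesis using v by blast
qed

section \<open>Simple connectedness of the boundary complex\<close>

lemma face_of_open_segment:
 assumes "F face_of rh" "q:open_segment v u" "q:F" "v:rh" "u:rh"
 shows "v:F" "u:F"
 using face_ofD[OF assms(1,2,4,5,3)] by auto

lemma edges_share_interior_point:
 fixes rh :: "'a::euclidean_space set"
 assumes "seg v u edge_of rh" "seg v u' edge_of rh"
  "q:open_segment v u" "q:open_segment v u'"
 shows "u=u'"
proof -
 have "seg v u=seg v u'"
 proof (rule face_of_eq[of _ rh])
  show "rel_interior (seg v u)\<inter>rel_interior (seg v u')~={}"
   using assms by (auto simp: rel_interior_closed_segment)
 qed (use assms in \<open>auto simp: edge_of_def\<close>)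
 thus ?thesis by (auto simp: closed_segment_eq doubleton_eq_iff)
qed

text \<open>The vertex figure of a polygon is a segment, and its two ends are the edges at \<open>v\<close>.\<close>
lemma polygon_two_edges:
 fixes ph :: "'a::euclidean_space set"
 assumes ph: "polytope ph" "aff_dim ph=2" and v: "v extreme_point_of ph"
 obtains u1 u2 where "u1~=u2" "{u. seg v u edge_of ph}={u1, u2}"
proof -
 obtain \<psi> c where cut: "cuts_off ph v \<psi> c" using cuts_off_exists[OF ph(1) v] by blast
 let ?Q = "ph\<inter>{x. \<psi>\<bullet>x=c}"
 have Q: "polytope ?Q" using polytope_cut[OF ph(1)] .
 have ex: "EX q:?Q. q:open_segment v u" if u: "u extreme_point_of ph" "u~=v" for u
  using edge_meets_vertex_figure[OF cut v u ph(1)] by blast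
 have "EX u. u extreme_point_of ph & u~=v"
 proof (rule ccontr)
  assume "\<not> ?thesis"
  hence "{u. u extreme_point_of ph}\<subseteq>{v}" by blast
  hence "ph\<subseteq>{v}" using polytope_eq_hull_extreme_points(1)[OF ph(1)] hull_mono[of _ "{v}" convex]
   by (metis convex_hull_singleton)
  thus False using ph(2) aff_dim_subset[of ph "{v}"] by (simp add: aff_dim_sing)
 qed
 hence ne: "?Q~={}" using ex by blast
 have "?Q face_of ?Q" using Q face_of_refl polytope_imp_convex by blast
 then obtain F where F: "F face_of ph" "v:F" "F\<inter>{x. \<psi>\<bullet>x=c}=?Q" "aff_dim F=aff_dim ?Q + 1"
  using vertex_figure_face[OF ph(1) cut v _ ne] by blast
 have "u:F" if u: "u extreme_point_of ph" for u
 proof (cases "u=v")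
  case False
  then obtain q where "q:?Q" "q:open_segment v u" using ex[OF u False] by blast
  thus ?thesis using face_of_open_segment[OF F(1), of q v u] F(3) u v
   by (auto simp: extreme_point_of_def)
 qed (use F in simp)
 hence "ph\<subseteq>F" using polytope_eq_hull_extreme_points(1)[OF ph(1)] hull_minimal[of "{u. u extreme_point_of ph}" F convex]
   F(1) face_of_imp_convex by blast
 hence "F=ph" using face_of_imp_subset[OF F(1)] by blast
 hence "?Q edge_of ?Q" using F(4) ph(2) \<open>?Q face_of ?Q\<close> by (simp add: edge_of_def)
 then obtain q1 q2 where q: "q1~=q2" "?Q=seg q1 q2" "q1 extreme_point_of ?Q" "q2 extreme_point_of ?Q"
  using edge_of_polytope_segment[OF Q] by metis
 obtain u1 where u1: "seg v u1 edge_of ph" "q1:open_segment v u1" "seg v u1\<inter>{x. \<psi>\<bullet>x=c}={q1}"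
  using vertex_figure_vertex[OF ph(1) cut v q(3)] by blast
 obtain u2 where u2: "seg v u2 edge_of ph" "q2:open_segment v u2" "seg v u2\<inter>{x. \<psi>\<bullet>x=c}={q2}"
  using vertex_figure_vertex[OF ph(1) cut v q(4)] by blast
 show thesis
 proof (rule that)
  show "u1~=u2" using u1(3) u2(3) q(1) by auto
  show "{u. seg v u edge_of ph}={u1, u2}"
  proof (intro subset_antisym subsetI)
   fix u assume "u:{u. seg v u edge_of ph}"
   hence u: "seg v u edge_of ph" by blast
   hence "u extreme_point_of ph" "u~=v" using edge_of_extreme_points[OF u] by auto
   then obtain q0 where q0: "q0:open_segment v u" "q0 extreme_point_of ?Q"
    using edge_meets_vertex_figure[OF cut v _ _ ph(1)] u by metis
   hence "q0=q1\<or>q0=q2" unfolding q(2) by (simp add: extreme_point_of_segment)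
   thus "u:{u1, u2}" using edges_share_interior_point[OF u] q0(1) u1 u2 by blast
  qed (use u1 u2 in auto)
 qed
qed

definition descending_links :: "'a::euclidean_space set=>'a=>'a=>('a\<times>'a) set" where
 "descending_links rh v l={(a, b). seg v a edge_of rh & seg v b edge_of rh &
   l\<bullet>a < l\<bullet>v & l\<bullet>b < l\<bullet>v & (EX ph. ph face_of rh & aff_dim ph=2 & v:ph & a:ph & b:ph)}"

text \<open>The descending edges at \<open>v\<close> correspond to the vertices of the vertex figure on one side of a level set of \<open>l\<close>. Any two of them are joined in the graph of the vertex figure by going down to the lowest vertex, and an edge of the vertex figure is the trace of a two-dimensional face.\<close>
lemma descending_edges_linked:
 fixes rh :: "'a::euclidean_space set"
 assumes rh: "polytope rh" and v: "v extreme_point_of rh" and cut: "cuts_off rh v \<psi> c"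
  and inj: "inj_on ((\<bullet>) l) {q. q extreme_point_of (rh\<inter>{x. \<psi>\<bullet>x=c})}"
  and a: "seg v a edge_of rh" "l\<bullet>a < l\<bullet>v"
  and b: "seg v b edge_of rh" "l\<bullet>b < l\<bullet>v"
 shows "(a, b):(descending_links rh v l)\<^sup>*"
proof -
 let ?Q = "rh\<inter>{x. \<psi>\<bullet>x=c}"
 let ?X = "{q. q extreme_point_of ?Q}"
 have Q: "polytope ?Q" using polytope_cut[OF rh] .
 have fin: "finite ?X" using polytope_eq_hull_extreme_points(2)[OF Q] .
 have meet: "EX q. q extreme_point_of ?Q & q:open_segment v u" if u: "seg v u edge_of rh" for u
  using edge_meets_vertex_figure[OF cut v edge_of_extreme_points(3)[OF u] edge_of_extreme_points(1)[OF u, symmetric] rh] u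
  by metis
 have "?X~={}" using meet[OF a(1)] by blast
 then obtain q0 where q0: "q0:?X" "!!q. q:?X ==> l\<bullet>q0\<le>l\<bullet>q"
  using fin by (metis (no_types, lifting) arg_min_if_finite(1) arg_min_least)
 obtain a0 where a0: "seg v a0 edge_of rh" "q0:open_segment v a0"
  using vertex_figure_vertex[OF rh cut v, of q0] q0(1) by blast
 have to_min: "(u, a0):(descending_links rh v l)\<^sup>*"
  if "q extreme_point_of ?Q" "seg v u edge_of rh" "q:open_segment v u" "l\<bullet>u < l\<bullet>v" for q u
  using that
 proof (induction "card {x:?X. l\<bullet>x < l\<bullet>q}" arbitrary: q u rule: less_induct)
  case less
  show ?case
  proof (cases "q=q0")
   case True
   thus ?thesis using edges_share_interior_point[OF less.prems(2) a0(1) less.prems(3)] a0(2) by simp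
  next
   case False
   hence "l\<bullet>q0 < l\<bullet>q" using q0 less.prems(1) inj by (force simp: inj_on_def)
   moreover have "q0:?Q" using q0(1) by (auto simp: extreme_point_of_def)
   ultimately obtain q' where q': "seg q q' edge_of ?Q" "l\<bullet>q' < l\<bullet>q"
    using descending_edge[OF Q less.prems(1)] by metis
   have q'e: "q' extreme_point_of ?Q" using edge_of_extreme_points[OF q'(1)] by blast
   obtain u' where u': "seg v u' edge_of rh" "q':open_segment v u'"
    using vertex_figure_vertex[OF rh cut v q'e] by blast
   have lu': "l\<bullet>u' < l\<bullet>v" using open_segment_inner_less_iff[OF u'(2), of l]
     open_segment_inner_less_iff[OF less.prems(3), of l] less.prems(4) q'(2) by linarith
   have "{x:?X. l\<bullet>x < l\<bullet>q'} \<subset> {x:?X. l\<bullet>x < l\<bullet>q}" using q'(2) q'e by force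
   hence "card {x:?X. l\<bullet>x < l\<bullet>q'} < card {x:?X. l\<bullet>x < l\<bullet>q}"
    using fin by (intro psubset_card_mono) auto
   hence IH: "(u', a0):(descending_links rh v l)\<^sup>*"
    using less.hyps[OF _ q'e u' lu'] by blast
   have "seg q q' face_of ?Q" "seg q q'~={}" "aff_dim (seg q q')=1"
    using q'(1) by (auto simp: edge_of_def)
   then obtain ph where ph: "ph face_of rh" "v:ph" "ph\<inter>{x. \<psi>\<bullet>x=c}=seg q q'" "aff_dim ph=2"
    using vertex_figure_face[OF rh cut v] by (metis one_add_one)
   have "q:ph" "q':ph" using ph(3) by (metis Int_iff ends_in_segment)+
   hence "u:ph" "u':ph"
    using face_of_open_segment(2)[OF ph(1)] less.prems(3) u'(2) v edge_of_extreme_points(3)[OF u'(1)]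
     edge_of_extreme_points(3)[OF less.prems(2)] by (auto simp: extreme_point_of_def)
   hence "(u, u'):descending_links rh v l"
    unfolding descending_links_def using ph less.prems(2,4) u' lu' by blast
   thus ?thesis using IH by (rule converse_rtrancl_into_rtrancl)
  qed
 qed
 have "sym (descending_links rh v l)" by (auto simp: sym_def descending_links_def)
 moreover have "(a, a0):(descending_links rh v l)\<^sup>*" using to_min meet[OF a(1)] a by blast
 moreover have "(b, a0):(descending_links rh v l)\<^sup>*" using to_min meet[OF b(1)] b by blast
 ultimately show ?thesis by (meson rtrancl_trans sym_rtrancl symD)
qed

lemma edge_of_face:
 assumes "ph face_of rh"
 shows "ed edge_of ph \<longleftrightarrow> ed edge_of rh & ed\<subseteq>ph"
 using assms face_of_face[OF assms, of ed] by (auto simp: edge_of_def)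

lemma generic_functional_inj:
 fixes \<X> :: "'a::euclidean_space set set"
 assumes "finite \<X>" "!!X. X:\<X> ==> finite X"
 obtains l where "!!X. X:\<X> ==> inj_on ((\<bullet>) l) X"
proof -
 let ?A = "(\<Union>X\<in>\<X>. (%(x, y). x - y) ` (X\<times>X)) - {0}"
 obtain l where l: "!!a. a:?A ==> l\<bullet>a~=0" using generic_functional[of ?A] assms by auto
 have "inj_on ((\<bullet>) l) X" if "X:\<X>" for X
 proof (rule inj_onI)
  fix x y assume xy: "x:X" "y:X" "l\<bullet>x=l\<bullet>y"
  hence "x - y:(\<Union>X\<in>\<X>. (%(x, y). x - y) ` (X\<times>X))" using that by force
  moreover have "l\<bullet>(x - y)=0" using xy(3) by (simp add: inner_diff_right)
  ultimately have "x - y=0" using l[of "x - y"] by blast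
  thus "x=y" by simp
 qed
 thus thesis using that by blast
qed

text \<open>This is the statement that the two-skeleton of a polytope is simply connected, in the form in which it is used: a system of transports along the edges that closes up around every two-dimensional face has a global section. The section is built by sweeping through the vertices in the order given by a generic functional. A new vertex is reached along its descending edges; two of them in a common two-dimensional face give the same value because all other edges of that face have been treated before, and any two of them are linked by such faces.\<close>
lemma polytope_simply_connected:
 fixes rh :: "'a::euclidean_space set" and T :: "'a=>'a=>'g=>'g"
 assumes rh: "polytope rh" "rh~={}"
  and closed: "!!u v g. [|seg u v edge_of rh; g:C|] ==> T u v g:C"
  and inv: "!!u v g. [|seg u v edge_of rh; g:C|] ==> T v u (T u v g)=g"
  and closing: "!!ph F v u. [|ph face_of rh; aff_dim ph=2; seg v u edge_of ph;
    !!x. x extreme_point_of ph ==> F x:C;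
    !!a b. [|seg a b edge_of ph; {a, b}~={v, u}|] ==> F b=T a b (F a)|] ==> F u=T v u (F v)"
  and g0: "g0:C"
 obtains F v0 where "v0 extreme_point_of rh" "F v0=g0" "!!v. v extreme_point_of rh ==> F v:C"
  "!!a b. seg a b edge_of rh ==> F b=T a b (F a)"
proof -
 let ?X = "{v. v extreme_point_of rh}"
 have fin: "finite ?X" using polytope_eq_hull_extreme_points(2)[OF rh(1)] .
 have "EX p. cuts_off rh v (fst p) (snd p)" if "v:?X" for v
  using cuts_off_exists[OF rh(1), of v] that by (metis mem_Collect_eq fst_conv snd_conv)
 hence "ALL v:?X. EX p. cuts_off rh v (fst p) (snd p)" by blast
 then obtain p where p: "ALL v:?X. cuts_off rh v (fst (p v)) (snd (p v))" by (rule bchoice[THEN exE])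
 define H where "H=(%v. {x. fst (p v)\<bullet>x=snd (p v)})"
 have H: "EX \<psi> c. H v={x. \<psi>\<bullet>x=c} & cuts_off rh v \<psi> c" if "v:?X" for v
  using p that unfolding H_def by blast
 let ?\<X> = "insert ?X ((%v. {q. q extreme_point_of (rh\<inter>H v)}) ` ?X)"
 have finX: "finite Y" if "Y:?\<X>" for Y
 proof -
  have "finite {q. q extreme_point_of (rh\<inter>H v)}" if "v:?X" for v
   unfolding H_def by (rule polytope_eq_hull_extreme_points(2)[OF polytope_cut[OF rh(1)]])
  thus ?thesis using that fin by auto
 qed
 obtain l where l: "!!Y. Y:?\<X> ==> inj_on ((\<bullet>) l) Y"
  using generic_functional_inj[of ?\<X>] fin finX by (metis (no_types, lifting) finite.insertI finite_imageI)
 have linj: "x=y" if "x:?X" "y:?X" "l\<bullet>x=l\<bullet>y" for x y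
  using l[of ?X] that by (auto simp: inj_on_def)
 have "?X~={}" using rh polytope_eq_hull_extreme_points(1)[OF rh(1)] by auto
 then obtain v0 where v0: "v0:?X" "!!q. q:?X ==> l\<bullet>v0\<le>l\<bullet>q"
  using fin by (metis (no_types, lifting) arg_min_if_finite(1) arg_min_least)
 have "EX F. (v0:D --> F v0=g0) & (ALL v:D. F v:C) &
   (ALL a:D. ALL b:D. seg a b edge_of rh --> F b=T a b (F a))"
  if "D\<subseteq>?X" "!!u v. [|v:D; u:?X; l\<bullet>u < l\<bullet>v|] ==> u:D" for D
  using that
 proof (induction "card D" arbitrary: D rule: less_induct)
  case less
  have finD: "finite D" using less.prems(1) fin finite_subset by blast
  show ?case
  proof (cases "D={}")
   case False
   obtain v where v: "v:D" "!!u. u:D ==> l\<bullet>u\<le>l\<bullet>v"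
   proof -
    have "Max ((\<bullet>) l ` D):(\<bullet>) l ` D" using finD False by (intro Max_in) auto
    then obtain v where "v:D" "l\<bullet>v=Max ((\<bullet>) l ` D)" by (metis imageE)
    moreover have "l\<bullet>u\<le>Max ((\<bullet>) l ` D)" if "u:D" for u using that finD by (intro Max_ge) auto
    ultimately show thesis using that by metis
   qed
   have vX: "v:?X" using v(1) less.prems(1) by blast
   let ?D' = "D - {v}"
   have D': "?D'\<subseteq>?X" "!!u w. [|w:?D'; u:?X; l\<bullet>u < l\<bullet>w|] ==> u:?D'"
    using less.prems v(2) by (blast, force)
   have "card ?D' < card D" using finD v(1) by (meson card_Diff1_less)
   hence "EX F. (v0:?D' --> F v0=g0) & (ALL v:?D'. F v:C) &
     (ALL a:?D'. ALL b:?D'. seg a b edge_of rh --> F b=T a b (F a))"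
    by (rule less.hyps[OF _ D'(1)]) (rule D'(2))
   then obtain F' where F': "v0:?D' --> F' v0=g0" "ALL v:?D'. F' v:C"
    "ALL a:?D'. ALL b:?D'. seg a b edge_of rh --> F' b=T a b (F' a)"
    by blast
   show ?thesis
   proof (cases "v=v0")
    case True
    have "D\<subseteq>{v0}"
     using v v0 linj less.prems(1) True by (metis (mono_tags, lifting) antisym insertI1 subset_iff)
    hence "\<not> seg a b edge_of rh" if "a:D" "b:D" for a b
     using that edge_of_extreme_points(1)[of a b rh] by blast
    thus ?thesis using g0 by (intro exI[of _ "%_. g0"]) blast
   next
    case False
    have lt: "l\<bullet>u < l\<bullet>v" if "u:?D'" for u
     using v(2) linj[of u v] that D'(1) vX by force
    have "l\<bullet>v0 < l\<bullet>v" using v0 False vX linj by force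
    then obtain u1 where u1: "seg v u1 edge_of rh" "l\<bullet>u1 < l\<bullet>v"
     using descending_edge[OF rh(1), of v v0 l] vX v0(1) by (auto simp: extreme_point_of_def)
    have below: "u:?D'" if "u extreme_point_of rh" "l\<bullet>u < l\<bullet>v" for u
     using less.prems(2)[OF v(1), of u] that by auto
    have u1D: "u1:?D'" using below u1 edge_of_extreme_points[OF u1(1)] by blast
    define F where "F=F'(v := T u1 v (F' u1))"
    have FD': "F x=F' x" if "x:?D'" for x using that by (auto simp: F_def)
    have FC: "F x:C" if "x:D" for x
     using that F'(2) u1D closed[of u1 v] u1(1) by (auto simp: F_def closed_segment_commute)
    have vF: "F v=T a v (F a)" if "(u1, a):(descending_links rh v l)\<^sup>*" for a
     using that
    proof (induction rule: rtrancl_induct)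
     case base
     thus ?case using u1D by (auto simp: F_def)
    next
     case (step a b)
     obtain ph where ab: "seg v a edge_of rh" "seg v b edge_of rh"
      "l\<bullet>a < l\<bullet>v" "l\<bullet>b < l\<bullet>v" and ph: "ph face_of rh" "aff_dim ph=2" "v:ph" "a:ph" "b:ph"
      using step.hyps(2) unfolding descending_links_def by blast
     show ?case
     proof (cases "a=b")
      case False
      have pph: "polytope ph" using ph(1) rh(1) face_of_polytope_polytope by blast
      have conv: "convex ph" using pph polytope_imp_convex by blast
      have ab': "seg v a edge_of ph" "seg v b edge_of ph"
       using ab ph edge_of_face[OF ph(1)] conv by (auto simp: closed_segment_subset)
      have vph: "v extreme_point_of ph" using edge_of_extreme_points[OF ab'(1)] by blast
      have two: "u=a\<or>u=b" if "seg v u edge_of ph" for u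
      proof -
       obtain w1 w2 where "{u. seg v u edge_of ph}={w1, w2}"
        using polygon_two_edges[OF pph ph(2) vph] by blast
       hence "a:{w1, w2}" "b:{w1, w2}" "u:{w1, w2}" using that ab' by blast+
       thus ?thesis using False by blast
      qed
      have max: "l\<bullet>y\<le>l\<bullet>v" if y: "y:ph" for y
      proof (rule ccontr)
       assume "\<not> ?thesis"
       then obtain u where "seg v u edge_of ph" "- l\<bullet>u < - l\<bullet>v"
        using descending_edge[OF pph vph y, of "- l"] by auto
       thus False using two[of u] ab(3,4) by auto
      qed
      have phX: "x extreme_point_of rh" "x:ph" if "x extreme_point_of ph" for x
       using that extreme_point_of_face[OF ph(1)] by auto
      have in_D': "x:?D'" if "x extreme_point_of ph" "x~=v" for x
       using max[OF phX(2)[OF that(1)]] linj[of x v] phX(1)[OF that(1)] vX that(2) below by force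
      have aD: "a:?D'" using in_D' edge_of_extreme_points[OF ab'(1)] by auto
      have bD: "b:?D'" using in_D' edge_of_extreme_points[OF ab'(2)] by auto
      have "F b=T v b (F v)"
      proof (rule closing[OF ph(1,2) ab'(2)])
       show "F x:C" if "x extreme_point_of ph" for x using in_D'[OF that] FC v(1) by blast
       fix x y assume xy: "seg x y edge_of ph" "{x, y}~={v, b}"
       have xyX: "x extreme_point_of ph" "y extreme_point_of ph" using edge_of_extreme_points[OF xy(1)] by auto
       consider "x=v" | "y=v" | "x~=v" "y~=v" by blast
       thus "F y=T x y (F x)"
       proof cases
        case 1
        hence "y=a" using two[of y] xy by auto
        thus ?thesis using step.IH inv[of a v "F a"] ab(1) FC aD 1 by (simp add: closed_segment_commute)
       next
        case 2
        hence "x=a" using two[of x] xy by (auto simp: closed_segment_commute)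
        thus ?thesis using step.IH 2 by simp
       next
        case 3
        hence "x:?D'" "y:?D'" using in_D' xyX by auto
        thus ?thesis using F'(3) FD' xy(1) edge_of_face[OF ph(1)] by metis
       qed
      qed
      thus ?thesis using inv[of v b "F v"] ab(2) FC v(1) by simp
     qed (use step.IH in simp)
    qed
    have desc: "F v=T a v (F a)" if "a:D" "seg v a edge_of rh" for a
    proof -
     have "a:?D'" using that edge_of_extreme_points(1)[OF that(2)] by auto
     hence la: "l\<bullet>a < l\<bullet>v" using lt by blast
     obtain \<psi> c where \<psi>: "H v={x. \<psi>\<bullet>x=c}" "cuts_off rh v \<psi> c" using H[OF vX] by blast
     have "inj_on ((\<bullet>) l) {q. q extreme_point_of (rh\<inter>H v)}"
      by (rule l) (use vX in blast)
     hence "inj_on ((\<bullet>) l) {q. q extreme_point_of (rh\<inter>{x. \<psi>\<bullet>x=c})}" unfolding \<psi>(1) .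
     thus ?thesis using vF descending_edges_linked[OF rh(1) _ \<psi>(2) _ u1 that(2) la] vX by blast
    qed
    have "F b=T a b (F a)" if ab: "a:D" "b:D" "seg a b edge_of rh" for a b
    proof -
     have ne: "a~=b" using edge_of_extreme_points(1)[OF ab(3)] .
     consider "a=v" | "b=v" | "a:?D'" "b:?D'" using ab ne by blast
     thus ?thesis
     proof cases
      case 1
      have "F v=T b v (F b)" using desc[OF ab(2)] ab(3) 1 by simp
      thus ?thesis using inv[of b v "F b"] 1 ab FC by (simp add: closed_segment_commute)
     next
      case 2
      thus ?thesis using desc[OF ab(1)] ab(3) by (simp add: closed_segment_commute)
     next
      case 3
      thus ?thesis using F'(3) FD' ab(3) by metis
     qed
    qed
    moreover have "v0:D --> F v0=g0" using F'(1) False by (auto simp: F_def)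
    ultimately show ?thesis using FC by blast
   qed
  qed auto
 qed
 from this[of ?X] obtain F where "F v0=g0" "ALL v:?X. F v:C"
  "ALL a:?X. ALL b:?X. seg a b edge_of rh --> F b=T a b (F a)" using v0(1) by blast
 thus thesis using that[of v0 F] v0(1) edge_of_extreme_points by blast
qed

section \<open>Lattice polytopes and the normal fan\<close>

locale full_lattice_polytope =
 fixes M \<sigma> :: "'a::euclidean_space set" and n :: nat
 assumes lattice: "lattice_of_rank n M" and latpoly: "lattice_polytope M \<sigma>" and full: "aff_dim \<sigma>=int n"
begin

abbreviation "N \<equiv> dual_lattice M"
abbreviation "vertices \<equiv> {v. v extreme_point_of \<sigma>}"

lemma M_closed:
 shows zero_M: "0:M" and add_M: "[|x:M; y:M|] ==> x + y:M"
  and scale_M: "x:M ==> of_int i *\<^sub>R x:M" and minus_M: "[|x:M; y:M|] ==> x - y:M"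
proof -
 obtain B where M: "M={\<Sum>b\<in>B. of_int (c b) *\<^sub>R b | c :: 'a=>int. True}"
  using lattice by (auto simp: lattice_of_rank_def)
 show z: "0:M" unfolding M by (intro CollectI exI[of _ "%_. 0"]) simp
 show sc: "of_int i *\<^sub>R x:M" if x: "x:M" for x i
 proof -
  obtain c :: "'a=>int" where "x=(\<Sum>b\<in>B. of_int (c b) *\<^sub>R b)" using x unfolding M by blast
  thus ?thesis unfolding M
   by (intro CollectI exI[of _ "%b. i * c b"]) (simp add: scaleR_sum_right)
 qed
 show ad: "x + y:M" if xy: "x:M" "y:M" for x y
 proof -
  obtain c c' :: "'a=>int" where "x=(\<Sum>b\<in>B. of_int (c b) *\<^sub>R b)" "y=(\<Sum>b\<in>B. of_int (c' b) *\<^sub>R b)"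
   using xy unfolding M by blast
  thus ?thesis unfolding M
   by (intro CollectI exI[of _ "%b. c b + c' b"]) (simp add: scaleR_add_left sum.distrib)
 qed
 show "x - y:M" if "x:M" "y:M" for x y
  using ad[OF that(1) sc[OF that(2), of "-1"]] by simp
qed

definition dual_bases :: "'a set=>('a=>'a)=>bool" where
 "dual_bases B D \<longleftrightarrow> finite B & B\<subseteq>M & D ` B\<subseteq>N &
   (ALL b:B. ALL b':B. D b\<bullet>b'=(if b=b' then 1 else 0)) &
   (ALL m:span M. m=(\<Sum>b\<in>B. (D b\<bullet>m) *\<^sub>R b)) & (ALL w:span M. w=(\<Sum>b\<in>B. (w\<bullet>b) *\<^sub>R D b)) &
   M={\<Sum>b\<in>B. of_int (c b) *\<^sub>R b | c :: 'a=>int. True}"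

lemma dual_bases_exist: "EX B D. dual_bases B D"
proof -
 obtain B where B: "independent B" "M={\<Sum>b\<in>B. of_int (c b) *\<^sub>R b | c :: 'a=>int. True}"
  using lattice by (auto simp: lattice_of_rank_def)
 have fin: "finite B" using B(1) by (rule independent_imp_finite)
 have BM: "B\<subseteq>M"
 proof
  fix b assume b: "b:B"
  have "(\<Sum>b'\<in>B. of_int (if b'=b then 1 else 0) *\<^sub>R b')=b" using fin b
   by (simp add: if_distrib[of of_int] if_distrib[of "%r. r *\<^sub>R _"] sum.delta cong: if_cong)
  thus "b:M" unfolding B(2) by (intro CollectI exI[of _ "%b'. if b'=b then 1 else 0"]) simp
 qed
 have spanB: "span M=span B"
 proof (intro antisym span_minimal subspace_span)
  have "(\<Sum>b\<in>B. of_int (c b) *\<^sub>R b):span B" for c :: "'a=>int"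
   by (intro span_sum span_scale span_base)
  thus "M\<subseteq>span B" unfolding B(2) by blast
  show "B\<subseteq>span M" using BM span_superset by blast
 qed
 have "EX w. w:span M & (ALL b':B. w\<bullet>b'=(if b'=b then 1 else 0))" for b
 proof -
  obtain g where g: "linear g" "ALL b':B. g b'=(if b'=b then 1 else 0 :: real)"
   using linear_independent_extend[OF B(1), of "%b'. if b'=b then 1 else 0 :: real"] by blast
  obtain w z where wz: "w:span M" "!!x. x:span M ==> orthogonal z x" "adjoint g 1=w + z"
   using orthogonal_subspace_decomp_exists[of M "adjoint g 1"] by blast
  have "w\<bullet>b'=(if b'=b then 1 else 0)" if "b':B" for b'
  proof -
   have "g b'=(w + z)\<bullet>b'" using adjoint_works[OF g(1), of b' 1] wz(3) by (simp add: inner_commute)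
   moreover have "z\<bullet>b'=0" using wz(2)[of b'] that BM by (auto simp: orthogonal_def span_base)
   ultimately show ?thesis using g(2) that by (simp add: inner_add_left)
  qed
  thus ?thesis using wz(1) by blast
 qed
 then obtain D where D: "!!b. D b:span M" "!!b b'. b':B ==> D b\<bullet>b'=(if b'=b then 1 else 0)" by metis
 have expand: "m=(\<Sum>b\<in>B. (D b\<bullet>m) *\<^sub>R b)" if m: "m:span M" for m
 proof -
  obtain u where u: "m=(\<Sum>b\<in>B. u b *\<^sub>R b)" using m unfolding spanB span_finite[OF fin] by auto
  have "D b\<bullet>m=u b" if "b:B" for b
   unfolding u using fin that
   by (simp add: inner_sum_right D(2) if_distrib[of "%r. _ * r"] sum.delta cong: if_cong)
  thus ?thesis using u by simp
 qed
 have DN: "D b:N" if "b:B" for b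
 proof -
  have "D b\<bullet>m:\<int>" if m: "m:M" for m
  proof -
   obtain c :: "'a=>int" where c: "m=(\<Sum>b\<in>B. of_int (c b) *\<^sub>R b)" using m unfolding B(2) by blast
   show ?thesis unfolding c using D(2) by (auto simp: inner_sum_right intro!: Ints_sum)
  qed
  thus ?thesis using D(1) by (simp add: dual_lattice_def)
 qed
 have expand': "w=(\<Sum>b\<in>B. (w\<bullet>b) *\<^sub>R D b)" if w: "w:span M" for w
 proof -
  let ?w = "\<Sum>b\<in>B. (w\<bullet>b) *\<^sub>R D b"
  have "(w - ?w)\<bullet>b'=0" if "b':B" for b'
   using fin that by (simp add: inner_diff_left inner_sum_left D(2) if_distrib[of "%r. _ * r"] sum.delta cong: if_cong)
  hence "orthogonal (w - ?w) m" if "m:span B" for m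
   using orthogonal_to_span[OF that] by (simp add: orthogonal_def)
  moreover have "w - ?w:span B" unfolding spanB[symmetric] using w D(1)
   by (intro span_diff span_sum span_scale) auto
  ultimately have "orthogonal (w - ?w) (w - ?w)" by blast
  thus ?thesis by (simp add: orthogonal_def)
 qed
 have "D ` B\<subseteq>N" using DN by blast
 moreover have "ALL b:B. ALL b':B. D b\<bullet>b'=(if b=b' then 1 else 0)" using D(2) by auto
 moreover have "ALL m:span M. m=(\<Sum>b\<in>B. (D b\<bullet>m) *\<^sub>R b)" using expand by (intro ballI)
 moreover have "ALL w:span M. w=(\<Sum>b\<in>B. (w\<bullet>b) *\<^sub>R D b)" using expand' by (intro ballI)
 ultimately have "dual_bases B D" unfolding dual_bases_def using fin BM B(2) by (intro conjI)
 thus ?thesis by (intro exI)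
qed

lemma N_closed:
 shows zero_N: "0:N" and add_N: "[|x:N; y:N|] ==> x + y:N" and minus_N: "[|x:N; y:N|] ==> x - y:N"
  and uminus_N: "x:N ==> - x:N" and scale_N: "x:N ==> of_int i *\<^sub>R x:N"
  and sum_N: "(!!b. b:A ==> f b:N) ==> sum f A:N"
  and N_M_int: "[|x:N; m:M|] ==> x\<bullet>m:\<int>" and N_span: "x:N ==> x:span M"
 by (auto simp: dual_lattice_def span_zero span_add span_diff span_neg span_scale inner_add_left
   inner_diff_left inner_sum_left intro!: span_sum)

lemma polytope_\<sigma>: "polytope \<sigma>"
 using latpoly by (auto simp: lattice_polytope_def polytope_def)

lemma vertices_M: "v extreme_point_of \<sigma> ==> v:M"
 using latpoly extreme_point_of_convex_hull by (auto simp: lattice_polytope_def)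

lemma \<sigma>_nonempty: "\<sigma>~={}" using full by auto

lemma finite_vertices: "finite vertices" and \<sigma>_hull: "\<sigma>=convex hull vertices"
 using polytope_eq_hull_extreme_points[OF polytope_\<sigma>] by auto

text \<open>The face on which \<open>w\<close> is minimal; \<open>v \<in> minface w\<close> says that \<open>w\<close> lies in the maximal cone of the normal fan that belongs to \<open>v\<close>.\<close>
definition minface :: "'a=>'a set" where
 "minface w={x:\<sigma>. ALL y:\<sigma>. w\<bullet>x\<le>w\<bullet>y}"

text \<open>The piecewise linear function whose graph is the boundary of the dual cone.\<close>
definition hgt :: "'a=>real" where
 "hgt w=- Inf ((\<bullet>) w ` \<sigma>)"

lemma minface_subset: "minface w\<subseteq>\<sigma>" by (auto simp: minface_def)

lemma minface_nonempty: "minface w~={}"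
proof -
 have "compact \<sigma>" using polytope_\<sigma> polytope_imp_compact by blast
 moreover have "continuous_on \<sigma> ((\<bullet>) w)" by (intro continuous_intros)
 ultimately obtain x where "x:\<sigma>" "ALL y:\<sigma>. w\<bullet>x\<le>w\<bullet>y"
  using continuous_attains_inf[OF _ \<sigma>_nonempty] by blast
 thus ?thesis by (auto simp: minface_def)
qed

lemma hgt_eq: "x:minface w ==> hgt w=- (w\<bullet>x)"
 unfolding hgt_def minface_def by (subst cInf_eq_minimum[of "w\<bullet>x"]) auto

lemma minface_hgt: "minface w={x:\<sigma>. w\<bullet>x=- hgt w}" and hgt_ge: "x:\<sigma> ==> - hgt w\<le>w\<bullet>x"
proof -
 obtain z where z: "z:minface w" using minface_nonempty by blast
 have h: "hgt w=- (w\<bullet>z)" using hgt_eq[OF z] .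
 show "minface w={x:\<sigma>. w\<bullet>x=- hgt w}" unfolding h using z by (auto simp: minface_def intro: antisym)
 show "- hgt w\<le>w\<bullet>x" if "x:\<sigma>" unfolding h using z that by (auto simp: minface_def)
qed

lemma minface_face: "minface w face_of \<sigma>"
proof -
 have "minface w=\<sigma>\<inter>{x. w\<bullet>x=- hgt w}" using minface_hgt by auto
 moreover have "\<sigma>\<inter>{x. w\<bullet>x=- hgt w} face_of \<sigma>"
  using polytope_\<sigma> polytope_imp_convex hgt_ge by (intro face_of_Int_supporting_hyperplane_ge) auto
 ultimately show ?thesis by simp
qed

lemma face_extreme_point:
 assumes "fc face_of \<sigma>" "fc~={}"
 shows "EX v. v extreme_point_of \<sigma> & v:fc"
proof -
 obtain y where "y:fc" using assms by blast
 then obtain v where "v extreme_point_of fc"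
  using extreme_point_inner_le[of fc y 0] face_of_polytope_polytope[OF polytope_\<sigma> assms(1)] by blast
 thus ?thesis using extreme_point_of_face[OF assms(1)] by blast
qed

lemma normal_cone_iff:
 assumes "fc\<subseteq>\<sigma>"
 shows "w:normal_cone M \<sigma> fc \<longleftrightarrow> w:span M & fc\<subseteq>minface w"
proof -
 have "w\<bullet>x=w\<bullet>y" if "x:fc" "y:fc" "ALL x:fc. ALL y:\<sigma>. w\<bullet>x\<le>w\<bullet>y" for x y
  using that assms by (intro antisym) auto
 thus ?thesis using assms unfolding normal_cone_def minface_def by blast
qed

lemma minface_vertexI:
 assumes "v extreme_point_of \<sigma>" "!!u. u extreme_point_of \<sigma> ==> w\<bullet>v\<le>w\<bullet>u"
 shows "v:minface w"
proof -
 have "w\<bullet>v\<le>w\<bullet>y" if y: "y:\<sigma>" for y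
 proof -
  obtain u where "u extreme_point_of \<sigma>" "w\<bullet>u\<le>w\<bullet>y"
   using extreme_point_inner_le[OF polytope_\<sigma> y, of w] by metis
  thus ?thesis using assms(2)[of u] by linarith
 qed
 thus ?thesis using assms(1) by (auto simp: minface_def extreme_point_of_def)
qed

lemma minface_scale: "c > 0 ==> minface (c *\<^sub>R w)=minface w"
 by (auto simp: minface_def)

lemma hgt_add_le: "hgt (w + w')\<le>hgt w + hgt w'"
proof -
 obtain z where z: "z:minface (w + w')" using minface_nonempty by blast
 hence "z:\<sigma>" using minface_subset by blast
 thus ?thesis using hgt_eq[OF z] hgt_ge[of z w] hgt_ge[of z w'] by (simp add: inner_add_left)
qed

lemma hgt_add_iff: "hgt (w + w')=hgt w + hgt w' \<longleftrightarrow> minface w\<inter>minface w'~={}"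
proof
 assume e: "hgt (w + w')=hgt w + hgt w'"
 obtain z where z: "z:minface (w + w')" using minface_nonempty by blast
 hence "z:\<sigma>" using minface_subset by blast
 hence "z:minface w\<inter>minface w'"
  using hgt_eq[OF z] hgt_ge[of z w] hgt_ge[of z w'] e by (auto simp: minface_hgt inner_add_left)
 thus "minface w\<inter>minface w'~={}" by blast
next
 assume "minface w\<inter>minface w'~={}"
 then obtain z where z: "z:minface w" "z:minface w'" by blast
 hence "z:minface (w + w')" by (force simp: minface_def inner_add_left intro: add_mono)
 thus "hgt (w + w')=hgt w + hgt w'" using z hgt_eq by (simp add: inner_add_left)
qed

lemma minface_add:
 assumes "minface w\<inter>minface w'~={}"
 shows "minface (w + w')=minface w\<inter>minface w'"
proof -
 have h: "hgt (w + w')=hgt w + hgt w'" using hgt_add_iff assms by blast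
 have "w\<bullet>x + w'\<bullet>x=- hgt w - hgt w' \<longleftrightarrow> w\<bullet>x=- hgt w & w'\<bullet>x=- hgt w'" if "x:\<sigma>" for x
  using hgt_ge[OF that, of w] hgt_ge[OF that, of w'] by auto
 thus ?thesis unfolding minface_hgt h by (auto simp: inner_add_left)
qed

lemma hgt_int: "w:N ==> hgt w:\<int>"
 using face_extreme_point[OF minface_face minface_nonempty, of w] hgt_eq N_M_int vertices_M by fastforce

lemma hgt_zero: "hgt 0=0"
 using minface_nonempty[of 0] hgt_eq[of _ 0] by force

lemma dual_cone_iff: "(w, s):dual_cone M \<sigma> \<longleftrightarrow> w:span M & hgt w\<le>s"
proof -
 obtain z where z: "z:minface w" using minface_nonempty by blast
 have "(ALL x:cone_over \<sigma>. (w, s)\<bullet>x\<ge>0) \<longleftrightarrow> (ALL x:\<sigma>. w\<bullet>x + s\<ge>0)"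
 proof
  assume A: "ALL x:cone_over \<sigma>. (w, s)\<bullet>x\<ge>0"
  show "ALL x:\<sigma>. w\<bullet>x + s\<ge>0"
  proof
   fix x assume "x:\<sigma>"
   hence "(1 *\<^sub>R x, 1):cone_over \<sigma>" unfolding cone_over_def by fastforce
   hence "0\<le>(w, s)\<bullet>(1 *\<^sub>R x, 1)" using A by blast
   thus "w\<bullet>x + s\<ge>0" by simp
  qed
 next
  assume A: "ALL x:\<sigma>. w\<bullet>x + s\<ge>0"
  show "ALL x:cone_over \<sigma>. (w, s)\<bullet>x\<ge>0"
  proof
   fix x assume "x:cone_over \<sigma>"
   then obtain t m where x: "x=(t *\<^sub>R m, t)" "t\<ge>0" "m:\<sigma>" by (auto simp: cone_over_def)
   have "(w, s)\<bullet>x=t * (w\<bullet>m + s)" using x(1) by (simp add: algebra_simps)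
   thus "(w, s)\<bullet>x\<ge>0" using A x by simp
  qed
 qed
 also have "... \<longleftrightarrow> hgt w\<le>s"
  using z hgt_eq[OF z] hgt_ge[of _ w] minface_subset[of w] by force
 finally show ?thesis by (simp add: dual_cone_def del: inner_Pair)
qed

lemma rel_frontier_dual_cone: "rel_frontier (dual_cone M \<sigma>)={(w, hgt w) | w. w:span M}"
proof -
 let ?C = "dual_cone M \<sigma>"
 let ?V = "span M\<times>(UNIV :: real set)"
 have "?V\<inter>(\<Inter>v\<in>vertices. {y. (v, 1)\<bullet>y > 0})={(w, s). w:span M & hgt w < s}"
 proof -
  have "(ALL v:vertices. w\<bullet>v + s > 0) \<longleftrightarrow> hgt w < s" for w s
  proof
   assume A: "ALL v:vertices. w\<bullet>v + s > 0"
   obtain v where "v extreme_point_of \<sigma>" "v:minface w"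
    using face_extreme_point[OF minface_face minface_nonempty] by blast
   thus "hgt w < s" using A hgt_eq by force
  next
   assume "hgt w < s"
   thus "ALL v:vertices. w\<bullet>v + s > 0" using hgt_ge[of _ w] by (force simp: extreme_point_of_def)
  qed
  hence key: "(ALL v:vertices. v\<bullet>w + s > 0) \<longleftrightarrow> hgt w < s" for w s by (simp add: inner_commute[of _ w])
  have "y:?V\<inter>(\<Inter>v\<in>vertices. {y. (v, 1)\<bullet>y > 0}) \<longleftrightarrow> y:{(w, s). w:span M & hgt w < s}" for y
   using key[of "fst y" "snd y"] by (cases y) auto
  thus ?thesis by blast
 qed
 moreover define T where "T=(\<Inter>v\<in>vertices. {y :: 'a\<times>real. (v, 1)\<bullet>y > 0})"
 moreover have T1: "open T" unfolding T_def
  using finite_vertices by (intro open_INT ballI open_halfspace_gt) auto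
 moreover define O' where "O'={(w, s). w:span M & hgt w < s}"
 ultimately have T: "open T" "O'=?V\<inter>T" by simp_all
 have OC: "O'\<subseteq>?C" by (auto simp: O'_def dual_cone_iff)
 have "affine hull ?C\<subseteq>?V"
  by (intro hull_minimal subspace_imp_affine subspace_Times) (auto simp: dual_cone_iff)
 hence "O'=affine hull ?C\<inter>T" using T(2) OC hull_subset[of ?C affine] by blast
 hence 1: "O'\<subseteq>rel_interior ?C" using T(1) OC by (intro rel_interior_maximal) (auto simp: openin_open)
 have "hgt w < s" if ws: "(w, s):rel_interior ?C" for w s
 proof -
  have one: "(0, 1):?C" by (auto simp: dual_cone_iff span_zero hgt_zero)
  hence "EX e>1. (1 - e) *\<^sub>R (0, 1) + e *\<^sub>R (w, s):?C"
   using ws convex_rel_interior_iff[OF convex_dual_cone] by blast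
  then obtain e where e: "e > 1" "(1 - e) *\<^sub>R (0, 1) + e *\<^sub>R (w, s):?C" by blast
  hence le: "hgt (e *\<^sub>R w)\<le>1 - e + e * s" by (auto simp: dual_cone_iff)
  obtain z where z: "z:minface w" using minface_nonempty by blast
  hence "z:minface (e *\<^sub>R w)" using minface_scale e(1) by simp
  hence "hgt (e *\<^sub>R w)=e * hgt w" using hgt_eq z by simp
  hence "e * hgt w < e * s" using le e(1) by linarith
  thus ?thesis using e(1) by simp
 qed
 hence 2: "rel_interior ?C\<subseteq>O'" using rel_interior_subset[of ?C] by (auto simp: O'_def dual_cone_iff)
 have "rel_frontier ?C=?C - O'" using 1 2 by (auto simp: rel_frontier_def closed_dual_cone)
 also have "...={(w, hgt w) | w. w:span M}" by (auto simp: O'_def dual_cone_iff)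
 finally show ?thesis .
qed

lemma boundary_P_eq: "boundary_P M \<sigma>={(w, hgt w) | w. w:N}"
 unfolding boundary_P_def rel_frontier_dual_cone using hgt_int by (auto simp: N_span)

lemma P_monoid_eq: "P_monoid M \<sigma>={(w, s). w:N & s:\<int> & hgt w\<le>s}"
 unfolding P_monoid_def using N_span by (auto simp: dual_cone_iff)

text \<open>Coordinates with respect to a basis of the dual lattice are rounded to integers; the bound depends on \<open>m\<close> only, not on the functional that is approximated.\<close>
lemma approximate_by_N:
 obtains C where "!!\<xi> K. EX c:N. ALL m:span M. \<bar>c\<bullet>m - K * (\<xi>\<bullet>m)\<bar>\<le>C m"
proof -
 obtain B D where "dual_bases B D" using dual_bases_exist by blast
 hence BD: "finite B" "B\<subseteq>M" "!!b. b:B ==> D b:N"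
  "!!m. m:span M ==> m=(\<Sum>b\<in>B. (D b\<bullet>m) *\<^sub>R b)" unfolding dual_bases_def by blast+
 show thesis
 proof (rule that[of "%m. \<Sum>b\<in>B. \<bar>D b\<bullet>m\<bar>"])
  fix \<xi> :: 'a and K :: real
  define c where "c=(\<Sum>b\<in>B. of_int \<lfloor>K * (\<xi>\<bullet>b)\<rfloor> *\<^sub>R D b)"
  have "c:N" unfolding c_def using BD(3) by (intro sum_N scale_N)
  moreover have "\<bar>c\<bullet>m - K * (\<xi>\<bullet>m)\<bar>\<le>(\<Sum>b\<in>B. \<bar>D b\<bullet>m\<bar>)" if "m:span M" for m
  proof -
   have "\<xi>\<bullet>m=(\<Sum>b\<in>B. (D b\<bullet>m) * (\<xi>\<bullet>b))"
    by (subst BD(4)[OF that]) (simp add: inner_sum_right)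
   hence "c\<bullet>m - K * (\<xi>\<bullet>m)=(\<Sum>b\<in>B. (of_int \<lfloor>K * (\<xi>\<bullet>b)\<rfloor> - K * (\<xi>\<bullet>b)) * (D b\<bullet>m))"
    by (simp add: c_def inner_sum_left sum_distrib_left sum_subtractf algebra_simps)
   also have "\<bar>...\<bar>\<le>(\<Sum>b\<in>B. \<bar>(of_int \<lfloor>K * (\<xi>\<bullet>b)\<rfloor> - K * (\<xi>\<bullet>b)) * (D b\<bullet>m)\<bar>)" by (rule sum_abs)
   also have "...\<le>(\<Sum>b\<in>B. 1 * \<bar>D b\<bullet>m\<bar>)"
   proof (rule sum_mono)
    fix b
    have "\<bar>of_int \<lfloor>K * (\<xi>\<bullet>b)\<rfloor> - K * (\<xi>\<bullet>b)\<bar>\<le>1" by linarith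
    thus "\<bar>(of_int \<lfloor>K * (\<xi>\<bullet>b)\<rfloor> - K * (\<xi>\<bullet>b)) * (D b\<bullet>m)\<bar>\<le>1 * \<bar>D b\<bullet>m\<bar>"
     unfolding abs_mult by (intro mult_right_mono) auto
   qed
   finally show ?thesis by simp
  qed
  ultimately show "EX c:N. ALL m:span M. \<bar>c\<bullet>m - K * (\<xi>\<bullet>m)\<bar>\<le>(\<Sum>b\<in>B. \<bar>D b\<bullet>m\<bar>)" by blast
 qed
qed

text \<open>A real functional exposing the face is multiplied by a large factor, rounded to the dual lattice and corrected by a multiple of \<open>w1\<close> so that it is constant on the face again. The values at the finitely many other vertices stay larger because rounding changes them by a bounded amount. The case \<open>d = 0\<close> is that of a vertex.\<close>
lemma exposing_lattice_functional:
 assumes fc: "fc face_of \<sigma>" and v: "v extreme_point_of \<sigma>" "v:fc" and d: "d:M" "w1:N"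
  "!!x. x:fc ==> EX t. x - v=t *\<^sub>R d" "d=0\<or>(d\<bullet>w1=1 & (EX t. t~=0 & v + t *\<^sub>R d:fc))"
 obtains c where "c:N" "minface c=fc"
proof -
 obtain \<xi> e where \<xi>: "!!x. x:fc ==> \<xi>\<bullet>x=e" "!!x. x:\<sigma> ==> x~:fc ==> \<xi>\<bullet>x > e"
  using exposing_functional[OF polytope_\<sigma> fc] v by blast
 obtain C where C: "!!\<xi> K. EX c:N. ALL m:span M. \<bar>c\<bullet>m - K * (\<xi>\<bullet>m)\<bar>\<le>C m"
  using approximate_by_N by blast
 have dspan: "d:span M" using d(1) span_base by blast
 have \<xi>d: "\<xi>\<bullet>d=0"
 proof (cases "d=0")
  case False
  then obtain t where t: "t~=0" "v + t *\<^sub>R d:fc" using d(4) by blast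
  hence "\<xi>\<bullet>(v + t *\<^sub>R d)=\<xi>\<bullet>v" using \<xi>(1) v(2) by simp
  thus ?thesis using t(1) by (simp add: inner_add_right)
 qed simp
 let ?U = "vertices - fc"
 define K where "K=(\<Sum>u\<in>?U. (\<bar>C (u - v)\<bar> + \<bar>C d\<bar> * \<bar>w1\<bullet>(u - v)\<bar> + 1) / (\<xi>\<bullet>(u - v)))"
 have pos: "\<xi>\<bullet>(u - v) > 0" if "u:?U" for u
  using that \<xi>(1)[OF v(2)] \<xi>(2)[of u] by (auto simp: inner_diff_right extreme_point_of_def)
 have Kge: "K * (\<xi>\<bullet>(u - v))\<ge>\<bar>C (u - v)\<bar> + \<bar>C d\<bar> * \<bar>w1\<bullet>(u - v)\<bar> + 1" if u: "u:?U" for u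
 proof -
  have "(\<bar>C (u - v)\<bar> + \<bar>C d\<bar> * \<bar>w1\<bullet>(u - v)\<bar> + 1) / (\<xi>\<bullet>(u - v))\<le>K" unfolding K_def
   using finite_vertices pos by (intro member_le_sum[OF u]) (auto intro!: divide_nonneg_pos add_nonneg_nonneg)
  thus ?thesis using pos[OF u] by (simp add: field_simps)
 qed
 obtain c where c: "c:N" "!!m. m:span M ==> \<bar>c\<bullet>m - K * (\<xi>\<bullet>m)\<bar>\<le>C m" using C[of K \<xi>] by blast
 define c' where "c'=c - (c\<bullet>d) *\<^sub>R w1"
 obtain i where i: "c\<bullet>d = of_int i" using N_M_int[OF c(1) d(1)] by (auto elim: Ints_cases)
 have c'N: "c':N" unfolding c'_def i using c(1) d(2) by (intro minus_N scale_N)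
 have c'd: "c'\<bullet>d=0" using d(4) by (auto simp: c'_def inner_diff_left inner_commute[of w1 d])
 have cd: "\<bar>c\<bullet>d\<bar>\<le>C d" using c(2)[OF dspan] \<xi>d by simp
 have on: "c'\<bullet>x=c'\<bullet>v" if x: "x:fc" for x
 proof -
  obtain t where "x - v=t *\<^sub>R d" using d(3)[OF x] by blast
  hence "c'\<bullet>(x - v)=0" using c'd by simp
  thus ?thesis by (simp add: inner_diff_right)
 qed
 have off: "c'\<bullet>v < c'\<bullet>u" if u: "u:?U" for u
 proof -
  have "u:M" "v:M" using u v vertices_M by auto
  hence sp: "u - v:span M" using minus_M span_base by blast
  have "\<bar>(c\<bullet>d) * (w1\<bullet>(u - v))\<bar>\<le>\<bar>C d\<bar> * \<bar>w1\<bullet>(u - v)\<bar>"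
   unfolding abs_mult using cd by (intro mult_right_mono) auto
  moreover have "c'\<bullet>(u - v)=c\<bullet>(u - v) - (c\<bullet>d) * (w1\<bullet>(u - v))"
   by (simp add: c'_def inner_diff_left)
  ultimately have "c'\<bullet>(u - v) > 0" using c(2)[OF sp] Kge[OF u] by linarith
  thus ?thesis by (simp add: inner_diff_right)
 qed
 have vm: "v:minface c'" using on off by (intro minface_vertexI v) (metis DiffI mem_Collect_eq order_less_imp_le order_refl)
 have "minface c'=fc"
 proof
  have hv: "hgt c'=- (c'\<bullet>v)" using hgt_eq[OF vm] .
  show "fc\<subseteq>minface c'" using on face_of_imp_subset[OF fc] by (auto simp: minface_hgt hv)
  have F: "minface c' face_of \<sigma>" by (rule minface_face)
  have pF: "polytope (minface c')" using F polytope_\<sigma> face_of_polytope_polytope by blast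
  have "{u. u extreme_point_of minface c'}\<subseteq>fc"
  proof
   fix u assume "u:{u. u extreme_point_of minface c'}"
   hence u: "u:vertices" "u:minface c'" using extreme_point_of_face[OF F] by auto
   thus "u:fc" using off[of u] hv by (force simp: minface_hgt)
  qed
  hence "convex hull {u. u extreme_point_of minface c'}\<subseteq>fc"
   using face_of_imp_convex[OF fc] by (intro hull_minimal)
  thus "minface c'\<subseteq>fc" using polytope_eq_hull_extreme_points(1)[OF pF] by simp
 qed
 thus thesis using that c'N by blast
qed

lemma minface_shift:
 assumes c: "minface c=fc" and v: "v extreme_point_of \<sigma>" "v:fc" "!!u. u:fc ==> w\<bullet>v\<le>w\<bullet>u"
 obtains k where "!!m. m\<ge>k ==> v:minface (of_nat m *\<^sub>R c + w)"
proof -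
 let ?U = "vertices - fc"
 have pos: "c\<bullet>(u - v) > 0" if "u:?U" for u
  using that v c hgt_ge[of u c] by (force simp: inner_diff_right minface_hgt extreme_point_of_def)
 obtain k :: nat where k: "(\<Sum>u\<in>?U. \<bar>w\<bullet>(u - v)\<bar> / (c\<bullet>(u - v)))\<le>real k" using real_arch_simple by blast
 show thesis
 proof (rule that[of k], rule minface_vertexI[OF v(1)])
  fix m u assume m: "k\<le>m" and u: "u extreme_point_of \<sigma>"
  show "(of_nat m *\<^sub>R c + w)\<bullet>v\<le>(of_nat m *\<^sub>R c + w)\<bullet>u"
  proof (cases "u:fc")
   case True
   hence "c\<bullet>u=c\<bullet>v" using v(2) c by (auto simp: minface_hgt)
   thus ?thesis using v(3)[OF True] by (simp add: inner_add_left)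
  next
   case False
   hence uU: "u:?U" using u by blast
   have "\<bar>w\<bullet>(u - v)\<bar> / (c\<bullet>(u - v))\<le>(\<Sum>u\<in>?U. \<bar>w\<bullet>(u - v)\<bar> / (c\<bullet>(u - v)))"
    using finite_vertices pos by (intro member_le_sum[OF uU]) (auto intro!: divide_nonneg_pos)
   hence "\<bar>w\<bullet>(u - v)\<bar> / (c\<bullet>(u - v))\<le>real m" using k m by linarith
   hence "\<bar>w\<bullet>(u - v)\<bar>\<le>real m * (c\<bullet>(u - v))" using pos[OF uU] by (simp add: field_simps)
   thus ?thesis by (simp add: inner_add_left inner_diff_right algebra_simps)
  qed
 qed
qed

text \<open>A primitive generator can be completed to pair to \<open>1\<close> with some element of the dual lattice: otherwise all its coordinates in a basis of \<open>M\<close> would have a common divisor, and the quotient would lie in \<open>M\<close> too.\<close>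
lemma edge_data:
 assumes ed: "ed edge_of \<sigma>" and d: "primitive_generator M ed d"
 obtains v v' t w where "ed=seg v v'" "v extreme_point_of \<sigma>" "v' extreme_point_of \<sigma>"
  "t > 0" "v' - v=t *\<^sub>R d" "w:N" "w\<bullet>d=1" "d:M" "d~=0"
proof -
 obtain u u' where u: "u~=u'" "ed=seg u u'" "u extreme_point_of \<sigma>" "u' extreme_point_of \<sigma>"
  using edge_of_polytope_segment[OF polytope_\<sigma> ed] by metis
 have d': "M\<inter>tangent_space ed={of_int c *\<^sub>R d | c. True}" using d by (simp add: primitive_generator_def)
 have tang: "tangent_space ed=span {u' - u}"
 proof (intro antisym)
  have "x - y:span {u' - u}" if xy: "x:ed" "y:ed" for x y
  proof -
   obtain s s' where xys: "x=(1 - s) *\<^sub>R u + s *\<^sub>R u'" "y=(1 - s') *\<^sub>R u + s' *\<^sub>R u'"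
    using xy unfolding u(2) in_segment by blast
   have "x - y=(s - s') *\<^sub>R (u' - u)" unfolding xys by (simp add: algebra_simps)
   thus ?thesis by (simp add: span_base span_scale)
  qed
  thus "tangent_space ed\<subseteq>span {u' - u}" unfolding tangent_space_def
   by (intro span_minimal subspace_span) blast
  have "u' - u:tangent_space ed" unfolding tangent_space_def using u(2) by (intro span_base) auto
  thus "span {u' - u}\<subseteq>tangent_space ed" unfolding tangent_space_def
   by (intro span_minimal subspace_span) auto
 qed
 have "u' - u:M" using u vertices_M minus_M by blast
 hence "u' - u:M\<inter>tangent_space ed" using tang span_base by blast
 then obtain j where j: "u' - u = of_int j *\<^sub>R d" unfolding d' by blast
 have j0: "j~=0" "d~=0" using j u(1) by auto
 have "1 *\<^sub>R d:M\<inter>tangent_space ed" unfolding d' by (intro CollectI exI[of _ 1]) simp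
 hence dM: "d:M" "d:tangent_space ed" by auto
 obtain B D where BD: "dual_bases B D" using dual_bases_exist by blast
 have int: "w\<bullet>d:\<int>" if "w:N" for w using N_M_int that dM(1) by blast
 have "EX w:N. w\<bullet>d=1"
 proof -
  have exp: "d=(\<Sum>b\<in>B. (D b\<bullet>d) *\<^sub>R b)" using BD span_base[OF dM(1)] unfolding dual_bases_def by blast
  have DN: "D b:N" if "b:B" for b using BD that by (auto simp: dual_bases_def)
  define A where "A={k::nat. k > 0 & (EX w:N. w\<bullet>d = of_nat k)}"
  have "EX b:B. D b\<bullet>d~=0"
  proof (rule ccontr)
   assume "\<not> ?thesis"
   hence "(\<Sum>b\<in>B. (D b\<bullet>d) *\<^sub>R b)=0" by (intro sum.neutral) auto
   thus False using exp j0(2) by simp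
  qed
  then obtain b where b: "b:B" "D b\<bullet>d~=0" by blast
  obtain i where i: "D b\<bullet>d = of_int i" using int[OF DN[OF b(1)]] by (auto elim: Ints_cases)
  have "of_int (sgn i) *\<^sub>R D b:N" using DN[OF b(1)] by (rule scale_N)
  moreover have "of_int (sgn i) *\<^sub>R D b\<bullet>d = of_nat (nat \<bar>i\<bar>)" using i by (simp add: sgn_if)
  ultimately have "nat \<bar>i\<bar>:A" unfolding A_def using b i
   by (intro CollectI conjI bexI[of _ "of_int (sgn i) *\<^sub>R D b"]) auto
  define g where "g=(LEAST k. k:A)"
  have gA: "g:A" unfolding g_def using \<open>nat \<bar>i\<bar> \<in> A\<close> by (rule LeastI)
  have gmin: "g\<le>k" if "k:A" for k unfolding g_def using that by (rule Least_le)
  obtain w0 where w0: "w0:N" "w0\<bullet>d = of_nat g" "g > 0" using gA unfolding A_def by blast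
  have mult: "EX q. w\<bullet>d = of_int q * of_nat g" if wN: "w:N" for w
  proof -
   obtain i where i: "w\<bullet>d = of_int i" using int[OF wN] by (auto elim: Ints_cases)
   let ?r = "i mod int g"
   have r: "(w - of_int (i div int g) *\<^sub>R w0)\<bullet>d = of_int ?r"
   proof -
    have "real_of_int i=real g * of_int (i div int g) + of_int ?r"
     by (metis mult_div_mod_eq of_int_add of_int_mult of_int_of_nat_eq)
    thus ?thesis using w0(2) i by (simp add: inner_diff_left mult.commute)
   qed
   have rN: "w - of_int (i div int g) *\<^sub>R w0:N" using wN w0(1) by (intro minus_N scale_N)
   have "?r=0"
   proof (rule ccontr)
    assume "?r~=0"
    moreover have "?r\<ge>0" using w0(3) by simp
    ultimately have pos: "?r > 0" by linarith
    hence "nat ?r:A" unfolding A_def using r rN by (intro CollectI conjI bexI[of _ "w - of_int (i div int g) *\<^sub>R w0"]) auto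
    hence "g\<le>nat ?r" by (rule gmin)
    thus False using w0(3) pos pos_mod_bound[of "int g" i] by linarith
   qed
   hence "i=(i div int g) * int g" by (metis add.right_neutral div_mult_mod_eq)
   hence "(of_int i :: real) = of_int (i div int g) * of_nat g" by (metis of_int_mult of_int_of_nat_eq)
   thus ?thesis using i by metis
  qed
  obtain q where q: "D b\<bullet>d = of_int (q b) * of_nat g" if "b:B" for b
   using mult[OF DN] by metis
  define d1 where "d1=(\<Sum>b\<in>B. of_int (q b) *\<^sub>R b)"
  have "d1:M" using BD unfolding dual_bases_def d1_def by blast
  have "of_nat g *\<^sub>R d1=(\<Sum>b\<in>B. (D b\<bullet>d) *\<^sub>R b)"
   unfolding d1_def scaleR_sum_right using q by (intro sum.cong) (auto simp: mult.commute)
  hence gd1: "of_nat g *\<^sub>R d1=d" using exp by simp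
  have "d1=inverse (of_nat g) *\<^sub>R (of_nat g *\<^sub>R d1)" using w0(3) by simp
  hence "d1=inverse (of_nat g) *\<^sub>R d" unfolding gd1 .
  hence "d1:tangent_space ed" using dM(2) unfolding tangent_space_def by (simp add: span_scale)
  then obtain k where "d1 = of_int k *\<^sub>R d" using \<open>d1 \<in> M\<close> d' by blast
  hence "(of_nat g * of_int k) *\<^sub>R d=1 *\<^sub>R d" using gd1 by simp
  hence "(of_nat g * of_int k :: real)=1" using j0(2) by (metis scaleR_right_imp_eq)
  hence "int g * k=1" by (metis of_int_1 of_int_eq_iff of_int_mult of_int_of_nat_eq)
  hence "g=1" using w0(3) by (metis zmult_eq_1_iff of_nat_1_eq_iff of_nat_less_0_iff zero_less_one less_minus_one_simps(1))
  thus ?thesis using w0 by auto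
 qed
 then obtain w where w: "w:N" "w\<bullet>d=1" by blast
 show thesis
 proof (cases "j > 0")
  case True
  show ?thesis using that[of u u' "of_int j" w] u j True w dM j0 by auto
 next
  case False
  have "u - u' = of_int (- j) *\<^sub>R d" using j by (metis minus_diff_eq of_int_minus scaleR_minus_left)
  moreover have "of_int (- j) > (0::real)" using False j0 by simp
  ultimately show ?thesis using that[of u' u "of_int (- j)" w] u w dM j0 closed_segment_commute by metis
 qed
qed

lemma vertex_exposed:
 assumes "v extreme_point_of \<sigma>"
 obtains c where "c:N" "minface c={v}"
proof (rule exposing_lattice_functional[of "{v}" v 0 0])
 show "{v} face_of \<sigma>" using assms by (simp add: face_of_singleton)
qed (use assms zero_M zero_N in auto)

lemma edge_exposed:
 assumes ed: "ed edge_of \<sigma>" and d: "primitive_generator M ed d"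
 obtains c where "c:N" "minface c=ed"
proof -
 obtain v v' t w where e: "ed=seg v v'" "v extreme_point_of \<sigma>" "v' extreme_point_of \<sigma>"
  "t > 0" "v' - v=t *\<^sub>R d" "w:N" "w\<bullet>d=1" "d:M" "d~=0" using edge_data[OF ed d] by blast
 have f: "ed face_of \<sigma>" using ed by (simp add: edge_of_def)
 have v: "v:ed" using e(1) by simp
 have x: "EX s. x - v=s *\<^sub>R d" if x: "x:ed" for x
 proof -
  obtain s where "x=(1 - s) *\<^sub>R v + s *\<^sub>R v'" using x unfolding e(1) in_segment by blast
  hence "x - v=s *\<^sub>R (v' - v)" by (simp add: algebra_simps)
  thus ?thesis using e(5) by auto
 qed
 have "v + t *\<^sub>R d:ed" using e(1,5) by (metis add.commute diff_add_cancel ends_in_segment(2))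
 hence y: "d=0\<or>(d\<bullet>w=1 & (EX t. t~=0 & v + t *\<^sub>R d:ed))"
  using e(4,7) by (metis inner_commute order_less_irrefl)
 show thesis using exposing_lattice_functional[OF f e(2) v e(8,6) x y] that by blast
qed

lemma vertex_shift:
 assumes v: "v extreme_point_of \<sigma>" and w: "w:N"
 obtains c where "c:N" "v:minface c" "v:minface (w + c)"
proof -
 obtain c where c: "c:N" "minface c={v}" using vertex_exposed[OF v] by blast
 obtain k where k: "!!m. m\<ge>k ==> v:minface (of_nat m *\<^sub>R c + w)"
  using minface_shift[OF c(2) v, of w] by auto
 let ?m = "Suc k"
 have "of_int (int ?m) *\<^sub>R c:N" using c(1) by (rule scale_N)
 hence "of_nat ?m *\<^sub>R c:N" by simp
 moreover have "minface (of_nat ?m *\<^sub>R c)={v}" using minface_scale[of "of_nat ?m" c] c(2) by simp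
 moreover have "v:minface (w + of_nat ?m *\<^sub>R c)" using k[of ?m] by (simp add: add.commute)
 ultimately show thesis using that by blast
qed

lemma edge_shift:
 assumes ed: "ed edge_of \<sigma>" "primitive_generator M ed d" "ed=seg v v'" and w: "w:N" "w\<bullet>v\<le>w\<bullet>v'"
 obtains c where "c:N" "ed\<subseteq>minface c" "v:minface (c + w)" "v':minface (c - w)"
proof -
 have vv: "v extreme_point_of \<sigma>" "v' extreme_point_of \<sigma>" "v:ed" "v':ed"
  using edge_of_extreme_points[of v v' \<sigma>] ed by auto
 obtain c where c: "c:N" "minface c=ed" using edge_exposed[OF ed(1,2)] by blast
 have mono: "w\<bullet>v\<le>w\<bullet>u" "w\<bullet>u\<le>w\<bullet>v'" if u: "u:ed" for u
 proof -
  obtain s where s: "u=(1 - s) *\<^sub>R v + s *\<^sub>R v'" "0\<le>s" "s\<le>1" using u unfolding ed(3) in_segment by blast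
  have "w\<bullet>u=w\<bullet>v + s * (w\<bullet>v' - w\<bullet>v)" "w\<bullet>u=w\<bullet>v' - (1 - s) * (w\<bullet>v' - w\<bullet>v)"
   by (simp_all add: s(1) inner_add_right algebra_simps)
  moreover have "s * (w\<bullet>v' - w\<bullet>v)\<ge>0" "(1 - s) * (w\<bullet>v' - w\<bullet>v)\<ge>0" using s w(2) by simp_all
  ultimately show "w\<bullet>v\<le>w\<bullet>u" "w\<bullet>u\<le>w\<bullet>v'" by linarith+
 qed
 obtain k where k: "!!m. m\<ge>k ==> v:minface (of_nat m *\<^sub>R c + w)"
  using minface_shift[OF c(2) vv(1,3), of w] mono by blast
 obtain k' where k': "!!m. m\<ge>k' ==> v':minface (of_nat m *\<^sub>R c + - w)"
  using minface_shift[OF c(2) vv(2,4), of "- w"] mono by (metis inner_minus_left neg_le_iff_le)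
 let ?m = "Suc (max k k')"
 have "of_int (int ?m) *\<^sub>R c:N" using c(1) by (rule scale_N)
 hence "of_nat ?m *\<^sub>R c:N" by simp
 moreover have "minface (of_nat ?m *\<^sub>R c)=ed" using minface_scale[of "of_nat ?m" c] c(2) by simp
 moreover have "v:minface (of_nat ?m *\<^sub>R c + w)" by (rule k) simp
 moreover have "v':minface (of_nat ?m *\<^sub>R c - w)" using k'[of ?m] by simp
 ultimately show thesis using that by blast
qed

end

section \<open>Germs of invertible functions\<close>

text \<open>The unit group of the stalk at \<open>p\<close> of the structure sheaf of \<open>Spec (R/I)\<close>.\<close>
definition unit_germs :: "('f, 'm) ring_scheme=>'f set=>'f set=>('f\<times>'f) set monoid" where
 "unit_germs R I p=\<lparr>
   carrier={fraction R I p a f | a f. a:carrier R - p & f:carrier R - p},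
   mult=fraction_mult R I p,
   one=fraction R I p \<one>\<^bsub>R\<^esub>\<one>\<^bsub>R\<^esub>\<rparr>"

locale local_fractions = cring R + I: ideal I R + p: primeideal p R for R (structure) and I p
begin

lemma cross_trans:
 assumes "a:carrier R" "b:carrier R" "c:carrier R" "f:carrier R" "g:carrier R - p" "h:carrier R"
  "u:carrier R - p" "v:carrier R - p"
  "u\<otimes>(a\<otimes>g\<ominus>b\<otimes>f):I" "v\<otimes>(b\<otimes>h\<ominus>c\<otimes>g):I"
 shows "EX w:carrier R - p. w\<otimes>(a\<otimes>h\<ominus>c\<otimes>f):I"
proof
 have c: "u:carrier R" "v:carrier R" "g:carrier R" using assms by auto
 show "u\<otimes>v\<otimes>g:carrier R - p" using assms p.I_prime by (metis Diff_iff m_closed)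
 have "u\<otimes>v\<otimes>g\<otimes>(a\<otimes>h\<ominus>c\<otimes>f)
   = (v\<otimes>h)\<otimes>(u\<otimes>(a\<otimes>g\<ominus>b\<otimes>f))\<oplus>(u\<otimes>f)\<otimes>(v\<otimes>(b\<otimes>h\<ominus>c\<otimes>g))"
  using assms(1-4,6) c by algebra
 also have "...:I" by (rule I.a_closed[OF I.I_l_closed[OF assms(9)] I.I_l_closed[OF assms(10)]]) (use assms c in auto)
 finally show "u\<otimes>v\<otimes>g\<otimes>(a\<otimes>h\<ominus>c\<otimes>f):I" .
qed

lemma cross_sym:
 assumes "a:carrier R" "b:carrier R" "f:carrier R" "g:carrier R" "u:carrier R"
  "u\<otimes>(a\<otimes>g\<ominus>b\<otimes>f):I"
 shows "u\<otimes>(b\<otimes>f\<ominus>a\<otimes>g):I"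
proof -
 have "u\<otimes>(b\<otimes>f\<ominus>a\<otimes>g) =\<ominus>(u\<otimes>(a\<otimes>g\<ominus>b\<otimes>f))"
  using assms(1-5) by algebra
 thus ?thesis using assms(6) by (metis I.a_inv_closed)
qed

lemma fraction_eq_iff:
 assumes "a:carrier R" "f:carrier R - p" "b:carrier R" "g:carrier R - p"
 shows "fraction R I p a f=fraction R I p b g \<longleftrightarrow> (EX u:carrier R - p. u\<otimes>(a\<otimes>g\<ominus>b\<otimes>f):I)"
proof
 have one: "\<one>:carrier R - p" using p.I_notcarr p.one_imp_carrier by blast
 have "\<one>\<otimes>(b\<otimes>g\<ominus>b\<otimes>g)=\<zero>" using assms by (auto simp: minus_eq r_neg)
 hence "(b, g):fraction R I p b g" unfolding fraction_def using assms one
  by (auto intro!: bexI[of _ \<one>])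
 moreover assume "fraction R I p a f=fraction R I p b g"
 ultimately have "(b, g):fraction R I p a f" by simp
 thus "EX u:carrier R - p. u\<otimes>(a\<otimes>g\<ominus>b\<otimes>f):I" unfolding fraction_def by blast
next
 assume "EX u:carrier R - p. u\<otimes>(a\<otimes>g\<ominus>b\<otimes>f):I"
 then obtain u where u: "u:carrier R - p" "u\<otimes>(a\<otimes>g\<ominus>b\<otimes>f):I" by blast
 hence u': "u\<otimes>(b\<otimes>f\<ominus>a\<otimes>g):I" using cross_sym[of a b f g u] assms by blast
 have "(c, h):fraction R I p a f \<longleftrightarrow> (c, h):fraction R I p b g" for c h
 proof
  assume "(c, h):fraction R I p a f"
  then obtain v where v: "c:carrier R" "h:carrier R - p" "v:carrier R - p" "v\<otimes>(a\<otimes>h\<ominus>c\<otimes>f):I"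
   unfolding fraction_def by blast
  hence "EX w:carrier R - p. w\<otimes>(b\<otimes>h\<ominus>c\<otimes>g):I"
   using cross_trans[of b a c g f h u v] u u' assms by blast
  thus "(c, h):fraction R I p b g" unfolding fraction_def using v by blast
 next
  assume "(c, h):fraction R I p b g"
  then obtain v where v: "c:carrier R" "h:carrier R - p" "v:carrier R - p" "v\<otimes>(b\<otimes>h\<ominus>c\<otimes>g):I"
   unfolding fraction_def by blast
  hence "EX w:carrier R - p. w\<otimes>(a\<otimes>h\<ominus>c\<otimes>f):I"
   using cross_trans[of a b c f g h u v] u assms by blast
  thus "(c, h):fraction R I p a f" unfolding fraction_def using v by blast
 qed
 thus "fraction R I p a f=fraction R I p b g" by auto
qed

lemma mem_fraction_iff:
 assumes "a:carrier R" "f:carrier R - p"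
 shows "(b, g):fraction R I p a f \<longleftrightarrow>
  b:carrier R & g:carrier R - p & fraction R I p b g=fraction R I p a f"
proof -
 have "(b, g):fraction R I p a f \<longleftrightarrow>
   b:carrier R & g:carrier R - p & (EX u:carrier R - p. u\<otimes>(a\<otimes>g\<ominus>b\<otimes>f):I)"
  by (simp add: fraction_def)
 thus ?thesis using fraction_eq_iff[OF assms, of b g] by metis
qed

lemma fraction_self: "[|a:carrier R; f:carrier R - p|] ==> (a, f):fraction R I p a f"
 by (simp add: mem_fraction_iff)

lemma mult_notin: "[|f:carrier R - p; g:carrier R - p|] ==> f\<otimes>g:carrier R - p"
 using p.I_prime by blast

lemma one_notin: "\<one>:carrier R - p"
 using p.I_notcarr p.one_imp_carrier by blast

lemma fraction_mult_cong:
 assumes "a:carrier R" "f:carrier R - p" "b:carrier R" "g:carrier R - p"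
  "a':carrier R" "f':carrier R - p" "b':carrier R" "g':carrier R - p"
  "fraction R I p a f=fraction R I p a' f'" "fraction R I p b g=fraction R I p b' g'"
 shows "fraction R I p (a\<otimes>b) (f\<otimes>g)=fraction R I p (a'\<otimes>b') (f'\<otimes>g')"
proof -
 obtain u v where u: "u:carrier R - p" "u\<otimes>(a\<otimes>f'\<ominus>a'\<otimes>f):I"
  and v: "v:carrier R - p" "v\<otimes>(b\<otimes>g'\<ominus>b'\<otimes>g):I"
  using assms fraction_eq_iff by metis
 have c: "u:carrier R" "v:carrier R" "f:carrier R" "g:carrier R" "f':carrier R" "g':carrier R"
  using u v assms by auto
 have "(u\<otimes>v)\<otimes>((a\<otimes>b)\<otimes>(f'\<otimes>g')\<ominus>(a'\<otimes>b')\<otimes>(f\<otimes>g))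
   = (v\<otimes>b\<otimes>g')\<otimes>(u\<otimes>(a\<otimes>f'\<ominus>a'\<otimes>f))\<oplus>(u\<otimes>a'\<otimes>f)\<otimes>(v\<otimes>(b\<otimes>g'\<ominus>b'\<otimes>g))"
  using assms(1,3,5,7) c by algebra
 also have "...:I" by (rule I.a_closed[OF I.I_l_closed[OF u(2)] I.I_l_closed[OF v(2)]]) (use assms c in auto)
 finally show ?thesis
  using mult_notin[OF u(1) v(1)] assms mult_notin by (subst fraction_eq_iff) auto
qed

lemma fraction_mult_fraction:
 assumes "a:carrier R" "f:carrier R - p" "b:carrier R" "g:carrier R - p"
 shows "fraction_mult R I p (fraction R I p a f) (fraction R I p b g)=fraction R I p (a\<otimes>b) (f\<otimes>g)"
proof -
 have "fraction R I p (a'\<otimes>b') (f'\<otimes>g')=fraction R I p (a\<otimes>b) (f\<otimes>g)"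
  if "(a', f'):fraction R I p a f" "(b', g'):fraction R I p b g" for a' f' b' g'
  using that assms mem_fraction_iff by (intro fraction_mult_cong) auto
 moreover have "(a, f):fraction R I p a f" "(b, g):fraction R I p b g"
  using assms fraction_self by auto
 ultimately show ?thesis unfolding fraction_mult_def by blast
qed

lemma unit_germs_simps:
 "carrier (unit_germs R I p)={fraction R I p a f | a f. a:carrier R - p & f:carrier R - p}"
 "x\<otimes>\<^bsub>unit_germs R I p\<^esub>y=fraction_mult R I p x y"
 "\<one>\<^bsub>unit_germs R I p\<^esub>= fraction R I p \<one> \<one>"
 by (simp_all add: unit_germs_def)

lemma fraction_cancel:
 assumes "a:carrier R - p" "f:carrier R - p"
 shows "fraction R I p (a\<otimes>f) (f\<otimes>a)=fraction R I p \<one> \<one>"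
proof -
 have "\<one>\<otimes>((a\<otimes>f)\<otimes>\<one>\<ominus>\<one>\<otimes>(f\<otimes>a))=\<zero>" using assms by (auto simp: minus_eq r_neg m_comm[of f a])
 thus ?thesis using assms mult_notin one_notin
  by (subst fraction_eq_iff) (auto intro!: bexI[of _ \<one>])
qed

lemma comm_group_unit_germs: "comm_group (unit_germs R I p)"
proof (rule comm_groupI)
 fix x y z
 assume "x:carrier (unit_germs R I p)"
 then obtain a f where x: "x=fraction R I p a f" and af: "a:carrier R - p" "f:carrier R - p"
  by (auto simp: unit_germs_simps)
 show "\<one>\<^bsub>unit_germs R I p\<^esub>\<otimes>\<^bsub>unit_germs R I p\<^esub>x=x" using af one_notin
  by (simp add: unit_germs_simps x fraction_mult_fraction)
 have "fraction R I p f a\<otimes>\<^bsub>unit_germs R I p\<^esub>x=\<one>\<^bsub>unit_germs R I p\<^esub>"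
  using af fraction_cancel by (simp add: unit_germs_simps x fraction_mult_fraction)
 thus "EX y:carrier (unit_germs R I p). y\<otimes>\<^bsub>unit_germs R I p\<^esub>x=\<one>\<^bsub>unit_germs R I p\<^esub>"
  using af by (force simp: unit_germs_simps)
 assume "y:carrier (unit_germs R I p)"
 then obtain b g where y: "y=fraction R I p b g" and bg: "b:carrier R - p" "g:carrier R - p"
  by (auto simp: unit_germs_simps)
 show "x\<otimes>\<^bsub>unit_germs R I p\<^esub>y:carrier (unit_germs R I p)"
  using af bg mult_notin[of a b] mult_notin[of f g] by (auto simp: unit_germs_simps x y fraction_mult_fraction)
 show "x\<otimes>\<^bsub>unit_germs R I p\<^esub>y=y\<otimes>\<^bsub>unit_germs R I p\<^esub>x"
  using af bg by (simp add: unit_germs_simps x y fraction_mult_fraction m_comm)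
 assume "z:carrier (unit_germs R I p)"
 then obtain c h where z: "z=fraction R I p c h" and ch: "c:carrier R - p" "h:carrier R - p"
  by (auto simp: unit_germs_simps)
 show "x\<otimes>\<^bsub>unit_germs R I p\<^esub>y\<otimes>\<^bsub>unit_germs R I p\<^esub>z=x\<otimes>\<^bsub>unit_germs R I p\<^esub>(y\<otimes>\<^bsub>unit_germs R I p\<^esub>z)"
  using af bg ch mult_notin[of a b] mult_notin[of f g] mult_notin[of b c] mult_notin[of g h]
  by (simp add: unit_germs_simps x y z fraction_mult_fraction m_assoc)
next
 show "\<one>\<^bsub>unit_germs R I p\<^esub>:carrier (unit_germs R I p)" using one_notin by (auto simp: unit_germs_simps)
qed

end

locale prime_point = cring R + p: primeideal p R for R (structure) and p
begin

lemma local_fractions: "ideal I R ==> local_fractions R I p"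
 by (simp add: local_fractions_def is_cring p.primeideal_axioms)

lemma restrict_fraction:
 assumes "ideal I R" "ideal J R" "I\<subseteq>J" "a:carrier R" "f:carrier R - p"
 shows "(\<Union>(b, g)\<in>fraction R I p a f. fraction R J p b g)=fraction R J p a f"
proof -
 interpret I: local_fractions R I p using local_fractions assms(1) .
 interpret J: local_fractions R J p using local_fractions assms(2) .
 have "fraction R J p b g=fraction R J p a f" if "(b, g):fraction R I p a f" for b g
 proof -
  have bg: "b:carrier R" "g:carrier R - p" "EX u:carrier R - p. u\<otimes>(a\<otimes>g\<ominus>b\<otimes>f):I"
   using that by (auto simp: fraction_def)
  hence "EX u:carrier R - p. u\<otimes>(a\<otimes>g\<ominus>b\<otimes>f):J" using assms(3) by blast
  thus ?thesis using J.fraction_eq_iff[OF assms(4,5) bg(1,2)] by simp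
 qed
 thus ?thesis using I.fraction_self[OF assms(4,5)] by blast
qed

end

section \<open>Invertible functions as families of germs\<close>

lemma openin_zariski: "openin (zariski R) U \<longleftrightarrow> (\<exists>S\<subseteq>carrier R. U=Spec R - zero_locus R S)"
 unfolding zariski_def topology_inverse'[OF istopology_zariski] by (rule refl)

lemma openin_zariski_Spec: "openin (zariski R) U ==> U\<subseteq>Spec R"
 unfolding openin_zariski by blast

lemma openin_basic: "f:carrier R ==> openin (zariski R) {q:Spec R. f~:q}"
 unfolding openin_zariski by (intro exI[of _ "{f}"]) (auto simp: zero_locus_def)

context cring begin

lemma prime_pointI: "p:Spec R ==> prime_point R p"
 by (simp add: prime_point_def is_cring Spec_def)

lemma local_fractionsI: "[|p:Spec R; ideal I R|] ==> local_fractions R I p"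
 by (rule prime_point.local_fractions[OF prime_pointI])

lemma regular_functions_simps:
 "s:carrier (regular_functions R I U) \<longleftrightarrow> s:extensional (U\<inter>zero_locus R I) &
   (ALL p:U\<inter>zero_locus R I. EX W. openin (zariski R) W & p:W & W\<subseteq>U &
     (EX a:carrier R. EX f:carrier R. ALL q:W\<inter>zero_locus R I. f~:q & s q=fraction R I q a f))"
 "s\<otimes>\<^bsub>regular_functions R I U\<^esub>t=(\<lambda>p\<in>U\<inter>zero_locus R I. fraction_mult R I p (s p) (t p))"
 "\<one>\<^bsub>regular_functions R I U\<^esub>= (\<lambda>p\<in>U\<inter>zero_locus R I. fraction R I p \<one> \<one>)"
 by (simp_all add: regular_functions_def)

definition locally_fraction :: "'a set=>'a set set=>('a set=>('a\<times>'a) set)=>bool" where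
 "locally_fraction I U s \<longleftrightarrow> (ALL p:U\<inter>zero_locus R I. EX W. openin (zariski R) W & p:W & W\<subseteq>U &
   (EX a:carrier R. EX f:carrier R. ALL q:W\<inter>zero_locus R I. a~:q & f~:q & s q=fraction R I q a f))"

lemma regular_functionsE:
 assumes "s:carrier (regular_functions R I U)" "p:U\<inter>zero_locus R I"
 obtains W a f where "openin (zariski R) W" "p:W" "W\<subseteq>U" "a:carrier R" "f:carrier R"
  "ALL q:W\<inter>zero_locus R I. f~:q & s q=fraction R I q a f"
proof -
 have "ALL p:U\<inter>zero_locus R I. EX W. openin (zariski R) W & p:W & W\<subseteq>U &
   (EX a:carrier R. EX f:carrier R. ALL q:W\<inter>zero_locus R I. f~:q & s q=fraction R I q a f)"
  by (rule conjunct2[OF assms(1)[unfolded regular_functions_simps(1)]])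
 from bspec[OF this assms(2)] show thesis by (elim exE conjE bexE) (rule that)
qed

lemma locally_fractionE:
 assumes "locally_fraction I U s" "p:U\<inter>zero_locus R I"
 obtains W a f where "openin (zariski R) W" "p:W" "W\<subseteq>U" "a:carrier R" "f:carrier R"
  "ALL q:W\<inter>zero_locus R I. a~:q & f~:q & s q=fraction R I q a f"
 using bspec[OF assms(1)[unfolded locally_fraction_def] assms(2)] by (elim exE conjE bexE) (rule that)

lemma locally_fractionI:
 assumes "!!p. p:U\<inter>zero_locus R I ==> EX W a f. openin (zariski R) W & p:W & W\<subseteq>U &
   a:carrier R & f:carrier R & (ALL q:W\<inter>zero_locus R I. a~:q & f~:q & s q=fraction R I q a f)"
 shows "locally_fraction I U s"
 unfolding locally_fraction_def
proof
 fix p assume "p:U\<inter>zero_locus R I"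
 from assms[OF this] show "EX W. openin (zariski R) W & p:W & W\<subseteq>U &
   (EX a:carrier R. EX f:carrier R. ALL q:W\<inter>zero_locus R I. a~:q & f~:q & s q=fraction R I q a f)"
  by (elim exE conjE) (intro exI conjI bexI, assumption+)
qed

lemma monoid_regular_functions:
 assumes "ideal I R" "openin (zariski R) U"
 shows "comm_monoid (regular_functions R I U)"
proof -
 let ?G = "regular_functions R I U" and ?Z = "U\<inter>zero_locus R I"
 have lf: "local_fractions R I q" if "q:?Z" for q
 proof -
  have "q:Spec R" using openin_zariski_Spec[OF assms(2)] that by blast
  thus ?thesis by (rule local_fractionsI[OF _ assms(1)])
 qed
 have germ: "EX a:carrier R. EX f:carrier R - q. s q=fraction R I q a f" if sq: "s:carrier ?G" "q:?Z" for s q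
 proof -
  obtain W a f where "q:W" "a:carrier R" "f:carrier R"
   "ALL q:W\<inter>zero_locus R I. f~:q & s q=fraction R I q a f" by (rule regular_functionsE[OF sq])
  thus ?thesis using sq(2) by blast
 qed
 show ?thesis
 proof (rule comm_monoidI)
  fix s t assume s: "s:carrier ?G" and t: "t:carrier ?G"
  show "s\<otimes>\<^bsub>?G\<^esub>t:carrier ?G"
   unfolding regular_functions_simps(1)
  proof (intro conjI ballI)
   fix q assume q: "q:?Z"
   obtain W a f where W: "openin (zariski R) W" "q:W" "W\<subseteq>U" "a:carrier R" "f:carrier R"
    "ALL x:W\<inter>zero_locus R I. f~:x & s x=fraction R I x a f" by (rule regular_functionsE[OF s q])
   obtain W' a' f' where W': "openin (zariski R) W'" "q:W'" "W'\<subseteq>U" "a':carrier R" "f':carrier R"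
    "ALL x:W'\<inter>zero_locus R I. f'~:x & t x=fraction R I x a' f'" by (rule regular_functionsE[OF t q])
   have all: "f\<otimes>f'~:x & (s\<otimes>\<^bsub>?G\<^esub>t) x=fraction R I x (a\<otimes>a') (f\<otimes>f')" if x: "x:W\<inter>W'\<inter>zero_locus R I" for x
   proof -
    have xZ: "x:?Z" using x W by blast
    interpret l: local_fractions R I x using lf xZ .
    show ?thesis using x xZ W W' l.mult_notin[of f f'] l.fraction_mult_fraction[of a f a' f']
     by (simp add: regular_functions_simps)
   qed
   have "openin (zariski R) (W\<inter>W')" using W(1) W'(1) by (rule openin_Int)
   moreover have "ALL x:W\<inter>W'\<inter>zero_locus R I. f\<otimes>f'~:x & (s\<otimes>\<^bsub>?G\<^esub>t) x=fraction R I x (a\<otimes>a') (f\<otimes>f')"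
    using all by (intro ballI)
   hence "EX a:carrier R. EX f:carrier R. ALL x:W\<inter>W'\<inter>zero_locus R I.
     f~:x & (s\<otimes>\<^bsub>?G\<^esub>t) x=fraction R I x a f"
    using m_closed[OF W(4) W'(4)] m_closed[OF W(5) W'(5)] by (intro bexI)
   moreover have "q:W\<inter>W'" "W\<inter>W'\<subseteq>U" using W(2,3) W'(2) by auto
   ultimately show "EX W. openin (zariski R) W & q:W & W\<subseteq>U &
     (EX a:carrier R. EX f:carrier R. ALL x:W\<inter>zero_locus R I. f~:x & (s\<otimes>\<^bsub>?G\<^esub>t) x=fraction R I x a f)"
    by (intro exI conjI)
  qed (simp add: regular_functions_simps)
  show "s\<otimes>\<^bsub>?G\<^esub>t=t\<otimes>\<^bsub>?G\<^esub>s" unfolding regular_functions_simps(2)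
  proof (rule restrict_ext)
   fix q assume q: "q:?Z"
   interpret l: local_fractions R I q using lf[OF q] .
   obtain a f b g where "a:carrier R" "f:carrier R - q" "s q=fraction R I q a f"
    "b:carrier R" "g:carrier R - q" "t q=fraction R I q b g" using germ[OF s q] germ[OF t q] by blast
   thus "fraction_mult R I q (s q) (t q)=fraction_mult R I q (t q) (s q)"
    by (simp add: l.fraction_mult_fraction m_comm)
  qed
  fix r assume r: "r:carrier ?G"
  show "s\<otimes>\<^bsub>?G\<^esub>t\<otimes>\<^bsub>?G\<^esub>r=s\<otimes>\<^bsub>?G\<^esub>(t\<otimes>\<^bsub>?G\<^esub>r)" unfolding regular_functions_simps(2)
  proof (rule restrict_ext)
   fix q assume q: "q:?Z"
   interpret l: local_fractions R I q using lf[OF q] .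
   obtain a f b g c h where x: "a:carrier R" "f:carrier R - q" "s q=fraction R I q a f"
    "b:carrier R" "g:carrier R - q" "t q=fraction R I q b g"
    "c:carrier R" "h:carrier R - q" "r q=fraction R I q c h" using germ[OF s q] germ[OF t q] germ[OF r q] by blast
   thus "fraction_mult R I q (restrict (%q. fraction_mult R I q (s q) (t q)) ?Z q) (r q) =
     fraction_mult R I q (s q) (restrict (%q. fraction_mult R I q (t q) (r q)) ?Z q)"
    using q l.mult_notin[of f g] l.mult_notin[of g h] by (simp add: l.fraction_mult_fraction m_assoc)
  qed
 next
  fix s assume s: "s:carrier ?G"
  show "\<one>\<^bsub>?G\<^esub>\<otimes>\<^bsub>?G\<^esub>s=s"
  proof
   fix q show "(\<one>\<^bsub>?G\<^esub>\<otimes>\<^bsub>?G\<^esub>s) q=s q"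
   proof (cases "q:?Z")
    case True
    interpret l: local_fractions R I q using lf[OF True] .
    obtain a f where "a:carrier R" "f:carrier R - q" "s q=fraction R I q a f" using germ[OF s True] by blast
    thus ?thesis using True l.one_notin by (simp add: regular_functions_simps l.fraction_mult_fraction)
   next
    case False
    thus ?thesis using s by (auto simp: regular_functions_simps extensional_def)
   qed
  qed
 next
  have "\<one>~:x" if "x:?Z" for x using lf[OF that] local_fractions.one_notin[of R I x] by blast
  thus "\<one>\<^bsub>?G\<^esub>:carrier ?G" unfolding regular_functions_simps using assms
   by (auto intro!: exI[of _ U] bexI[of _ \<one>])
 qed
qed

lemma invertible_functions_simps:
 "s\<otimes>\<^bsub>invertible_functions R I U\<^esub>t=(\<lambda>p\<in>U\<inter>zero_locus R I. s p\<otimes>\<^bsub>unit_germs R I p\<^esub>t p)"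
 "\<one>\<^bsub>invertible_functions R I U\<^esub>= (\<lambda>p\<in>U\<inter>zero_locus R I. \<one>\<^bsub>unit_germs R I p\<^esub>)"
 by (simp_all add: units_of_def regular_functions_def unit_germs_def)

lemma comm_group_invertible_functions:
 assumes "ideal I R" "openin (zariski R) U"
 shows "comm_group (invertible_functions R I U)"
 using monoid_regular_functions[OF assms] by (rule comm_monoid.units_comm_group)

text \<open>Locally both the section and its inverse are fractions; clearing denominators makes the numerator a unit on a smaller neighbourhood, and conversely the inverse fractions fit together because they are determined pointwise.\<close>
lemma carrier_invertible_functions:
 assumes "ideal I R" "openin (zariski R) U"
 shows "s:carrier (invertible_functions R I U) \<longleftrightarrow> s:extensional (U\<inter>zero_locus R I) & locally_fraction I U s"
proof -
 let ?G = "regular_functions R I U" and ?Z = "U\<inter>zero_locus R I"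
 have lf: "local_fractions R I q" if "q:?Z" for q
 proof -
  have "q:Spec R" using openin_zariski_Spec[OF assms(2)] that by blast
  thus ?thesis by (rule local_fractionsI[OF _ assms(1)])
 qed
 interpret G: comm_monoid ?G by (rule monoid_regular_functions[OF assms])
 show ?thesis
 proof
  assume "s:carrier (invertible_functions R I U)"
  hence "s:Units ?G" by (simp add: units_of_def)
  then obtain t where s: "s:carrier ?G" and t: "t:carrier ?G" "s\<otimes>\<^bsub>?G\<^esub>t=\<one>\<^bsub>?G\<^esub>"
   unfolding Units_def by auto
  have "locally_fraction I U s"
  proof (rule locally_fractionI)
   fix q assume q: "q:?Z"
   obtain W a f where W: "openin (zariski R) W" "q:W" "W\<subseteq>U" "a:carrier R" "f:carrier R"
    "ALL x:W\<inter>zero_locus R I. f~:x & s x=fraction R I x a f" by (rule regular_functionsE[OF s q])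
   have anx: "a~:x" if x: "x:W\<inter>zero_locus R I" for x
   proof
    assume ax: "a:x"
    have xZ: "x:?Z" using x W by blast
    interpret l: local_fractions R I x using lf[OF xZ] .
    obtain W' b g where "x:W'" "b:carrier R" "g:carrier R"
     "ALL q:W'\<inter>zero_locus R I. g~:q & t q=fraction R I q b g"
     by (rule regular_functionsE[OF t(1) xZ])
    hence bg: "b:carrier R" "g:carrier R - x" "t x=fraction R I x b g" using xZ by auto
    have f: "f:carrier R - x" "s x=fraction R I x a f" using W x by auto
    have "(s\<otimes>\<^bsub>?G\<^esub>t) x=fraction R I x (a\<otimes>b) (f\<otimes>g)"
     using xZ bg f W(4) by (simp add: regular_functions_simps l.fraction_mult_fraction)
    hence "fraction R I x (a\<otimes>b) (f\<otimes>g)=fraction R I x \<one> \<one>"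
     using fun_cong[OF t(2), of x] xZ by (simp add: regular_functions_simps)
    then obtain u where u: "u:carrier R - x" "u\<otimes>((a\<otimes>b)\<otimes>\<one>\<ominus>\<one>\<otimes>(f\<otimes>g)):I"
     using l.fraction_eq_iff[of "a\<otimes>b" "f\<otimes>g" \<one> \<one>] bg f W(4) l.mult_notin l.one_notin by auto
    have "I\<subseteq>x" using x by (simp add: zero_locus_def)
    hence "u\<otimes>((a\<otimes>b)\<otimes>\<one>\<ominus>\<one>\<otimes>(f\<otimes>g)):x" using u by blast
    moreover have "u\<otimes>b\<otimes>a:x" using ax u(1) bg(1) by (intro l.p.I_l_closed) auto
    moreover have "u\<otimes>(f\<otimes>g)=u\<otimes>b\<otimes>a\<oplus>\<ominus>(u\<otimes>((a\<otimes>b)\<otimes>\<one>\<ominus>\<one>\<otimes>(f\<otimes>g)))"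
    proof -
     have "u:carrier R" "g:carrier R" using u(1) bg by auto
     thus ?thesis using bg(1) W(4,5) by algebra
    qed
    ultimately have "u\<otimes>(f\<otimes>g):x" by (metis l.p.a_closed l.p.a_inv_closed)
    thus False using l.mult_notin[OF u(1) l.mult_notin[OF f(1) bg(2)]] by blast
   qed
   have "ALL x:W\<inter>zero_locus R I. a~:x & f~:x & s x=fraction R I x a f"
   proof
    fix x assume x: "x:W\<inter>zero_locus R I"
    show "a~:x & f~:x & s x=fraction R I x a f" using anx[OF x] bspec[OF W(6) x] by (rule conjI)
   qed
   thus "EX W a f. openin (zariski R) W & q:W & W\<subseteq>U & a:carrier R & f:carrier R &
     (ALL x:W\<inter>zero_locus R I. a~:x & f~:x & s x=fraction R I x a f)"
    using W(1-5) by (intro exI conjI)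
  qed
  thus "s:extensional ?Z & locally_fraction I U s" using s by (simp add: regular_functions_simps)
 next
  assume s: "s:extensional ?Z & locally_fraction I U s"
  have reg: "u:carrier ?G" if u: "u:extensional ?Z & locally_fraction I U u" for u
  proof -
   have "EX W. openin (zariski R) W & p:W & W\<subseteq>U &
     (EX a:carrier R. EX f:carrier R. ALL q:W\<inter>zero_locus R I. f~:q & u q=fraction R I q a f)"
    if p: "p:?Z" for p
   proof -
    obtain W a f where W: "openin (zariski R) W" "p:W" "W\<subseteq>U" "a:carrier R" "f:carrier R"
     "ALL q:W\<inter>zero_locus R I. a~:q & f~:q & u q=fraction R I q a f"
     by (rule locally_fractionE[OF conjunct2[OF u] p])
    have "ALL q:W\<inter>zero_locus R I. f~:q & u q=fraction R I q a f"
    proof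
     fix q assume "q:W\<inter>zero_locus R I"
     from bspec[OF W(6) this] show "f~:q & u q=fraction R I q a f" by (rule conjunct2)
    qed
    hence "EX a:carrier R. EX f:carrier R. ALL q:W\<inter>zero_locus R I. f~:q & u q=fraction R I q a f"
     using W(4,5) by (intro bexI)
    thus ?thesis using W(1-3) by (intro exI conjI)
   qed
   thus ?thesis unfolding regular_functions_simps(1) using u by (intro conjI ballI conjunct1[OF u])
  qed
  have "EX c. ALL a:carrier R - x. ALL f:carrier R - x. s x=fraction R I x a f --> c=fraction R I x f a" if "x:?Z" for x
  proof -
   interpret l: local_fractions R I x using lf[OF that] .
   have "fraction R I x f a=fraction R I x f' a'"
    if A: "a:carrier R - x" "f:carrier R - x" "a':carrier R - x" "f':carrier R - x"
     "fraction R I x a f=fraction R I x a' f'" for a f a' f'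
   proof -
    obtain u where u: "u:carrier R - x" "u\<otimes>(a\<otimes>f'\<ominus>a'\<otimes>f):I"
     using l.fraction_eq_iff[of a f a' f'] A by auto
    have "a:carrier R" "f:carrier R" "a':carrier R" "f':carrier R" "u:carrier R" using A u(1) by auto
    hence "u\<otimes>(f\<otimes>a'\<ominus>f'\<otimes>a) =\<ominus>(u\<otimes>(a\<otimes>f'\<ominus>a'\<otimes>f))" by algebra
    hence "u\<otimes>(f\<otimes>a'\<ominus>f'\<otimes>a):I" using u(2) l.I.a_inv_closed by metis
    thus ?thesis using l.fraction_eq_iff[of f a f' a'] A u(1) by auto
   qed
   thus ?thesis by metis
  qed
  hence "ALL x. EX c. x:?Z --> (ALL a:carrier R - x. ALL f:carrier R - x. s x=fraction R I x a f --> c=fraction R I x f a)"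
   by meson
  then obtain t' where t': "!!x a f. [|x:?Z; a:carrier R - x; f:carrier R - x; s x=fraction R I x a f|] ==> t' x=fraction R I x f a"
   by (metis choice)
  define t where "t=restrict t' ?Z"
  have "locally_fraction I U t"
  proof (rule locally_fractionI)
   fix q assume q: "q:?Z"
   obtain W a f where W: "openin (zariski R) W" "q:W" "W\<subseteq>U" "a:carrier R" "f:carrier R"
    "ALL x:W\<inter>zero_locus R I. a~:x & f~:x & s x=fraction R I x a f" by (rule locally_fractionE[OF conjunct2[OF s] q])
   have "ALL x:W\<inter>zero_locus R I. f~:x & a~:x & t x=fraction R I x f a"
   proof
    fix x assume x: "x:W\<inter>zero_locus R I"
    have xZ: "x:?Z" using x W(3) by blast
    have "a~:x" "f~:x" "s x=fraction R I x a f" using bspec[OF W(6) x] by simp_all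
    thus "f~:x & a~:x & t x=fraction R I x f a"
     using t'[OF xZ, of a f] W(4,5) xZ by (simp add: t_def)
   qed
   thus "EX W a f. openin (zariski R) W & q:W & W\<subseteq>U & a:carrier R & f:carrier R &
     (ALL x:W\<inter>zero_locus R I. a~:x & f~:x & t x=fraction R I x a f)"
    using W(1-5) by (intro exI conjI)
  qed
  hence tG: "t:carrier ?G" using reg by (simp add: t_def)
  have sG: "s:carrier ?G" using reg s by blast
  have "s\<otimes>\<^bsub>?G\<^esub>t=\<one>\<^bsub>?G\<^esub>" unfolding regular_functions_simps
  proof (rule restrict_ext)
   fix x assume x: "x:?Z"
   interpret l: local_fractions R I x using lf[OF x] .
   obtain a f where af: "a:carrier R - x" "f:carrier R - x" "s x=fraction R I x a f"
   proof (rule locally_fractionE[OF conjunct2[OF s] x])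
    fix W a f assume W: "x:W" "a:carrier R" "f:carrier R"
     "ALL q:W\<inter>zero_locus R I. a~:q & f~:q & s q=fraction R I q a f"
    have "x:W\<inter>zero_locus R I" using W(1) x by blast
    from bspec[OF W(4) this] show thesis using that[of a f] W(2,3) by simp
   qed
   thus "fraction_mult R I x (s x) (t x)=fraction R I x \<one> \<one>"
    using t'[OF x af] x l.fraction_cancel by (simp add: t_def l.fraction_mult_fraction)
  qed
  moreover from this have "t\<otimes>\<^bsub>?G\<^esub>s=\<one>\<^bsub>?G\<^esub>" using G.m_comm[OF tG sG] by simp
  ultimately have "s:Units ?G" unfolding Units_def using sG tG by blast
  thus "s:carrier (invertible_functions R I U)" by (simp add: units_of_def)
 qed
qed

lemma germ_hom:
 assumes "ideal I R" "openin (zariski R) U" "x:U\<inter>zero_locus R I"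
 shows "(%s. s x):hom (invertible_functions R I U) (unit_germs R I x)"
proof (rule homI)
 fix s assume "s:carrier (invertible_functions R I U)"
 hence "locally_fraction I U s" using assms by (simp add: carrier_invertible_functions)
 then obtain W a f where "x:W" "a:carrier R" "f:carrier R"
  "ALL q:W\<inter>zero_locus R I. a~:q & f~:q & s q=fraction R I q a f"
  by (rule locally_fractionE[OF _ assms(3)])
 thus "s x:carrier (unit_germs R I x)" using assms(3) by (auto simp: unit_germs_def)
qed (use assms in \<open>simp add: invertible_functions_simps\<close>)

lemma invertible_functions_eqI:
 assumes "ideal I R" "openin (zariski R) U" "s:carrier (invertible_functions R I U)"
  "t:carrier (invertible_functions R I U)" "!!x. x:U\<inter>zero_locus R I ==> s x=t x"
 shows "s=t"
 using assms by (auto simp: carrier_invertible_functions intro: extensionalityI)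

end

section \<open>The coordinate ring\<close>

lemma project_keys_subset: "E\<subseteq>B ==> project_keys E (project_keys B f)=project_keys E f"
 by (rule poly_mapping_eqI) (auto simp: lookup_project_keys)

lemma project_keys_project_keys: "project_keys E (project_keys E' f)=project_keys (E\<inter>E') f"
 by (rule poly_mapping_eqI) (auto simp: lookup_project_keys)

lemma project_keys_diff:
 fixes f g :: "'e \<Rightarrow>\<^sub>0 'k::ab_group_add"
 shows "project_keys E (f - g)=project_keys E f - project_keys E g"
 by (rule poly_mapping_eqI) (simp add: lookup_project_keys lookup_minus)

lemma project_keys_0_iff: "project_keys E f=0 \<longleftrightarrow> Poly_Mapping.keys f\<inter>E={}"
proof
 assume "project_keys E f=0"
 hence "Poly_Mapping.lookup f x=0" if "x:E" for x
  using lookup_project_keys[of E f x] that by simp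
 thus "Poly_Mapping.keys f\<inter>E={}" by (auto simp: Poly_Mapping.in_keys_iff)
qed (rule project_keys_eq_0)

lemma project_keys_mult:
 fixes f g :: "'e::comm_monoid_add \<Rightarrow>\<^sub>0 'k::comm_ring_1"
 assumes face: "!!e e'. [|e:B; e':B; e + e':E|] ==> e:E & e':E"
  and closed: "!!e e'. [|e:E; e':E|] ==> e + e':E"
  and f: "Poly_Mapping.keys f\<subseteq>B" and g: "Poly_Mapping.keys g\<subseteq>B"
 shows "project_keys E (f * g)=project_keys E f * project_keys E g"
proof -
 let ?pf = "project_keys E f" and ?pg = "project_keys E g"
 have zero: "project_keys E (u * v)=0"
  if "Poly_Mapping.keys u\<subseteq>B" "Poly_Mapping.keys v\<subseteq>B" "Poly_Mapping.keys u\<inter>E={}\<or>Poly_Mapping.keys v\<inter>E={}"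
  for u v :: "'e \<Rightarrow>\<^sub>0 'k"
 proof (rule project_keys_eq_0, rule ccontr)
  assume "Poly_Mapping.keys (u * v)\<inter>E~={}"
  then obtain k where k: "k:Poly_Mapping.keys (u * v)" "k:E" by blast
  then obtain a b where "a:Poly_Mapping.keys u" "b:Poly_Mapping.keys v" "k=a + b"
   using keys_mult[of u v] by blast
  thus False using face[of a b] k(2) that by blast
 qed
 have kf: "Poly_Mapping.keys (f - ?pf)\<subseteq>B" "Poly_Mapping.keys (f - ?pf)\<inter>E={}"
  using f by (auto simp: Poly_Mapping.in_keys_iff lookup_minus lookup_project_keys split: if_splits)
 have kg: "Poly_Mapping.keys (g - ?pg)\<subseteq>B" "Poly_Mapping.keys (g - ?pg)\<inter>E={}"
  using g by (auto simp: Poly_Mapping.in_keys_iff lookup_minus lookup_project_keys split: if_splits)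
 have kpf: "Poly_Mapping.keys ?pf\<subseteq>E" "Poly_Mapping.keys ?pf\<subseteq>B"
  using f by (auto simp: Poly_Mapping.in_keys_iff lookup_project_keys split: if_splits)
 have kpg: "Poly_Mapping.keys ?pg\<subseteq>E"
  by (auto simp: Poly_Mapping.in_keys_iff lookup_project_keys split: if_splits)
 have "f * g=?pf * ?pg + (?pf * (g - ?pg) + (f - ?pf) * g)" by (simp add: algebra_simps)
 hence "project_keys E (f * g)=project_keys E (?pf * ?pg) + (project_keys E (?pf * (g - ?pg)) + project_keys E ((f - ?pf) * g))"
  by (metis project_keys_add)
 also have "...=project_keys E (?pf * ?pg)" using zero kf kg kpf g by simp
 also have "...=?pf * ?pg"
 proof (rule project_keys_id)
  show "Poly_Mapping.keys (?pf * ?pg)\<subseteq>E" using keys_mult[of ?pf ?pg] kpf(1) kpg closed by blast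
 qed
 finally show ?thesis .
qed

text \<open>The exponents form a totally orderable group, for which the product of the largest terms cannot cancel.\<close>
lemma exponent_ring_no_zero_divisors:
 fixes f g :: "'a::euclidean_space exponent \<Rightarrow>\<^sub>0 'k::field"
 assumes "f~=0" "g~=0"
 shows "f * g~=0"
proof -
 let ?X = "fst ` (Poly_Mapping.keys f\<union>Poly_Mapping.keys g)"
 obtain l where l: "inj_on ((\<bullet>) l) ?X" using generic_functional_inj[of "{?X}"] by force
 have top: "EX e:K. ALL e':K. l\<bullet>fst e' < l\<bullet>fst e\<or>(fst e'=fst e & snd e'\<le>snd e)"
  if K: "finite K" "K~={}" "K\<subseteq>Poly_Mapping.keys f\<union>Poly_Mapping.keys g" for K :: "'a exponent set"
 proof -
  let ?m = "Max ((%e. l\<bullet>fst e) ` K)"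
  let ?K = "{e:K. l\<bullet>fst e=?m}"
  have "?m:(%e. l\<bullet>fst e) ` K" using K by (intro Max_in) auto
  then obtain e0 where "?m=l\<bullet>fst e0" "e0:K" by (rule imageE)
  hence ne: "?K~={}" by (metis (mono_tags, lifting) empty_iff mem_Collect_eq)
  have "Max (snd ` ?K):snd ` ?K" using K ne by (intro Max_in) auto
  then obtain e where e: "snd e=Max (snd ` ?K)" "e:?K" by (rule imageE) (rule that, rule sym)
  have "l\<bullet>fst e' < l\<bullet>fst e\<or>(fst e'=fst e & snd e'\<le>snd e)" if e': "e':K" for e'
  proof (cases "l\<bullet>fst e'=?m")
   case True
   hence "e':?K" using e' by blast
   hence "snd e'\<le>snd e" unfolding e(1) using K by (intro Max_ge) auto
   moreover have "fst e'=fst e"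
   proof (rule inj_onD[OF l])
    show "l\<bullet>fst e'=l\<bullet>fst e" using True e(2) by simp
    show "fst e':?X" "fst e:?X" using e' e(2) K(3) by blast+
   qed
   ultimately show ?thesis by blast
  next
   case False
   have "l\<bullet>fst e'\<le>?m" using K e' by (intro Max_ge) auto
   thus ?thesis using False e(2) by simp
  qed
  thus ?thesis using e(2) by blast
 qed
 obtain a where a: "a:Poly_Mapping.keys f" "!!e. e:Poly_Mapping.keys f ==> l\<bullet>fst e < l\<bullet>fst a\<or>(fst e=fst a & snd e\<le>snd a)"
  using top[of "Poly_Mapping.keys f"] assms by auto
 obtain b where b: "b:Poly_Mapping.keys g" "!!e. e:Poly_Mapping.keys g ==> l\<bullet>fst e < l\<bullet>fst b\<or>(fst e=fst b & snd e\<le>snd b)"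
  using top[of "Poly_Mapping.keys g"] assms by auto
 have uniq: "x=a & y=b" if xy: "x:Poly_Mapping.keys f" "y:Poly_Mapping.keys g" "x + y=a + b" for x y
 proof -
  have "l\<bullet>fst x + l\<bullet>fst y=l\<bullet>fst a + l\<bullet>fst b"
   using arg_cong[OF xy(3), of "%e. l\<bullet>fst e"] by (simp add: inner_add_right)
  hence eq: "fst x=fst a" "snd x\<le>snd a" "fst y=fst b" "snd y\<le>snd b"
   using a(2)[OF xy(1)] b(2)[OF xy(2)] by auto
  have s: "snd x + snd y=snd a + snd b" using arg_cong[OF xy(3), of snd] by simp
  have "snd x=snd a"
  proof (rule ccontr)
   assume "snd x~=snd a"
   hence "snd x + snd y < snd a + snd b" using eq by (intro add_less_le_mono) auto
   thus False using s by simp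
  qed
  thus ?thesis using eq s by (auto simp: prod_eq_iff)
 qed
 have fg: "f * g=(\<Sum>x\<in>Poly_Mapping.keys f. Poly_Mapping.single x (Poly_Mapping.lookup f x)) *
   (\<Sum>y\<in>Poly_Mapping.keys g. Poly_Mapping.single y (Poly_Mapping.lookup g y))"
  using project_keys_id[of f UNIV] project_keys_id[of g UNIV] by (simp add: project_keys_def)
 have "Poly_Mapping.lookup (f * g) (a + b)=(\<Sum>x\<in>Poly_Mapping.keys f. \<Sum>y\<in>Poly_Mapping.keys g.
   (Poly_Mapping.lookup f x * Poly_Mapping.lookup g y when x + y=a + b))"
  unfolding fg by (simp add: sum_product mult_single lookup_sum lookup_single)
 also have "...=(\<Sum>x\<in>Poly_Mapping.keys f. if x=a then Poly_Mapping.lookup f a * Poly_Mapping.lookup g b else 0)"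
 proof (rule sum.cong[OF refl])
  fix x assume x: "x:Poly_Mapping.keys f"
  have "(\<Sum>y\<in>Poly_Mapping.keys g. (Poly_Mapping.lookup f x * Poly_Mapping.lookup g y when x + y=a + b))
   = (\<Sum>y\<in>Poly_Mapping.keys g. if y=b then (if x=a then Poly_Mapping.lookup f a * Poly_Mapping.lookup g b else 0) else 0)"
   using uniq[OF x] by (intro sum.cong) (auto simp: when_def)
  thus "(\<Sum>y\<in>Poly_Mapping.keys g. (Poly_Mapping.lookup f x * Poly_Mapping.lookup g y when x + y=a + b))
   = (if x=a then Poly_Mapping.lookup f a * Poly_Mapping.lookup g b else 0)" using b(1) by (simp add: sum.delta)
 qed
 also have "...=Poly_Mapping.lookup f a * Poly_Mapping.lookup g b" using a(1) by (simp add: sum.delta)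
 also have "...~=0" using a(1) b(1) by (simp add: Poly_Mapping.in_keys_iff)
 finally show ?thesis by auto
qed

locale log_scheme = full_lattice_polytope M \<sigma> n
 for M \<sigma> :: "'a::euclidean_space set" and n +
 fixes r :: nat and R :: "('a, 'k::field) fun_ring"
 assumes R_def: "R=coord_ring M \<sigma> r"
begin

abbreviation "Bd \<equiv> boundary_exponents M \<sigma> r"
abbreviation "E \<equiv> stratum_exponents M \<sigma> r"

text \<open>The retraction \<open>O(V) \<rightarrow> O(V\<^sub>\<tau>)\<close>, regarded as an idempotent endomorphism of the ring. Such retractions commute, and this replaces all computations with intersections of strata.\<close>
definition pr :: "'a set=>('a exponent \<Rightarrow>\<^sub>0 'k)=>('a exponent \<Rightarrow>\<^sub>0 'k)" where
 "pr fc=project_keys (E fc)"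

definition is_face :: "'a set=>bool" where
 "is_face fc \<longleftrightarrow> fc face_of \<sigma> & fc~={}"

text \<open>The stratum of the join of two faces is the intersection of their strata.\<close>
definition join :: "'a set=>'a set=>'a set" where
 "join fc fc'=\<Inter>{F. F face_of \<sigma> & fc\<union>fc'\<subseteq>F}"

lemma is_face_subset: "is_face fc ==> fc\<subseteq>\<sigma>"
 by (simp add: is_face_def face_of_imp_subset)

lemma is_face_vertex: "v extreme_point_of \<sigma> ==> is_face {v}"
 by (simp add: is_face_def face_of_singleton)

lemma is_face_edge: "ed edge_of \<sigma> ==> is_face ed"
 by (auto simp: is_face_def edge_of_def)

lemma finite_faces: "finite {fc. is_face fc}"
 using finite_polytope_faces[OF polytope_\<sigma>] by (rule rev_finite_subset) (auto simp: is_face_def)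

lemma join_face:
 assumes "is_face fc" "is_face fc'"
 shows "is_face (join fc fc')" "fc\<subseteq>join fc fc'" "fc'\<subseteq>join fc fc'"
proof -
 have "\<sigma>:{F. F face_of \<sigma> & fc\<union>fc'\<subseteq>F}"
  using assms is_face_subset face_of_refl[OF polytope_imp_convex[OF polytope_\<sigma>]] by auto
 hence "join fc fc' face_of \<sigma>" unfolding join_def by (intro face_of_Inter) auto
 moreover show sub: "fc\<subseteq>join fc fc'" "fc'\<subseteq>join fc fc'" by (auto simp: join_def)
 ultimately show "is_face (join fc fc')" using assms unfolding is_face_def by blast
qed

lemma join_least: "[|F face_of \<sigma>; fc\<subseteq>F; fc'\<subseteq>F|] ==> join fc fc'\<subseteq>F"
 by (auto simp: join_def)

lemma join_subset_minface:
 "[|is_face fc; is_face fc'|] ==> join fc fc'\<subseteq>minface w \<longleftrightarrow> fc\<subseteq>minface w & fc'\<subseteq>minface w"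
 using join_face(2,3)[of fc fc'] join_least[OF minface_face, of fc w fc'] by blast

lemma Bd_iff: "e:Bd \<longleftrightarrow> fst (fst e):N & snd (fst e)=hgt (fst (fst e)) & Poly_Mapping.keys (snd e)\<subseteq>{..<r}"
 unfolding boundary_exponents_def boundary_P_eq by (cases e) auto

lemma E_iff:
 assumes "fc\<subseteq>\<sigma>"
 shows "e:E fc \<longleftrightarrow> e:Bd & fc\<subseteq>minface (fst (fst e))"
proof -
 have "fst (fst e):span M" if "e:Bd" using that N_span[of "fst (fst e)"] by (simp add: Bd_iff)
 thus ?thesis using normal_cone_iff[OF assms, of "fst (fst e)"] by (auto simp: stratum_exponents_def)
qed

lemma E_Bd: "E fc\<subseteq>Bd" by (auto simp: stratum_exponents_def)

lemma Bd_add: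
 assumes "e:Bd" "e':Bd"
 shows "e + e':Bd \<longleftrightarrow> minface (fst (fst e))\<inter>minface (fst (fst e'))~={}"
proof -
 have "Poly_Mapping.keys (snd e + snd e')\<subseteq>{..<r}"
  using Poly_Mapping.keys_add[of "snd e" "snd e'"] assms by (auto simp: Bd_iff)
 hence "e + e':Bd \<longleftrightarrow> hgt (fst (fst e) + fst (fst e'))=hgt (fst (fst e)) + hgt (fst (fst e'))"
  using assms add_N by (auto simp: Bd_iff)
 thus ?thesis by (simp add: hgt_add_iff)
qed

lemma E_face:
 assumes "is_face fc" "e:Bd" "e':Bd" "e + e':E fc"
 shows "e:E fc & e':E fc"
proof -
 have e: "e + e':Bd" "fc\<subseteq>minface (fst (fst e) + fst (fst e'))"
  using assms E_iff[OF is_face_subset[OF assms(1)], of "e + e'"] by auto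
 thus ?thesis using minface_add[of "fst (fst e)" "fst (fst e')"] Bd_add[OF assms(2,3)] assms(2,3)
   E_iff[OF is_face_subset[OF assms(1)]] by auto
qed

lemma E_add:
 assumes "is_face fc" "e:E fc" "e':E fc"
 shows "e + e':E fc"
proof -
 have e: "e:Bd" "e':Bd" "fc\<subseteq>minface (fst (fst e))" "fc\<subseteq>minface (fst (fst e'))"
  using assms E_iff[OF is_face_subset[OF assms(1)]] by auto
 hence "minface (fst (fst e))\<inter>minface (fst (fst e'))~={}" using assms(1) by (auto simp: is_face_def)
 thus ?thesis using e Bd_add[OF e(1,2)] minface_add E_iff[OF is_face_subset[OF assms(1)]] by auto
qed

lemma E_join: "[|is_face fc; is_face fc'|] ==> E fc\<inter>E fc'=E (join fc fc')"
 using E_iff[OF is_face_subset, of fc] E_iff[OF is_face_subset, of fc'] E_iff[OF is_face_subset[OF join_face(1)], of fc fc']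
  join_subset_minface by blast

lemma E_mono: "[|is_face fc; is_face fc'; fc'\<subseteq>fc|] ==> E fc\<subseteq>E fc'"
 using E_iff[OF is_face_subset, of fc] E_iff[OF is_face_subset, of fc'] by blast

lemma zero_E: "is_face fc ==> 0:E fc"
 using E_iff[OF is_face_subset, of fc 0] zero_N hgt_zero is_face_subset[of fc] by (auto simp: Bd_iff minface_hgt)

lemma cring_R: "cring R"
 unfolding R_def by (rule cring_coord_ring[OF \<sigma>_nonempty])

sublocale R: cring R by (rule cring_R)

lemma R_simps:
 "carrier R={f. Poly_Mapping.keys f\<subseteq>Bd}" "f\<otimes>\<^bsub>R\<^esub>g=project_keys Bd (f * g)" "f\<oplus>\<^bsub>R\<^esub>g=f + g"
 "\<zero>\<^bsub>R\<^esub>= 0" "\<one>\<^bsub>R\<^esub>= 1"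
 unfolding R_def coord_ring_def by (simp add: contracted_monoid_ring_def, rule contracted_mult, simp_all add: contracted_monoid_ring_def)

lemma R_uminus: "f:carrier R ==>\<ominus>\<^bsub>R\<^esub>f=- f"
 by (rule R.minus_equality) (auto simp: R_simps Poly_Mapping.in_keys_iff)

lemma R_minus: "[|f:carrier R; g:carrier R|] ==> f\<ominus>\<^bsub>R\<^esub>g=f - g"
 by (simp add: R.minus_eq R_uminus R_simps(3))

lemma pr_closed: "pr fc f:carrier R"
 using keys_project_keys[of "E fc" f] E_Bd[of fc] by (auto simp: pr_def R_simps)

lemma pr_mult:
 assumes "is_face fc" "f:carrier R" "g:carrier R"
 shows "pr fc (f\<otimes>\<^bsub>R\<^esub>g)=pr fc f * pr fc g"
proof -
 have "project_keys (E fc) (f * g)=project_keys (E fc) f * project_keys (E fc) g"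
  by (rule project_keys_mult[of Bd, OF E_face[OF assms(1)] E_add[OF assms(1)]])
   (use assms in \<open>simp_all add: R_simps(1)\<close>)
 thus ?thesis unfolding pr_def R_simps(2) project_keys_subset[OF E_Bd] .
qed

lemma pr_pr: "[|is_face fc; is_face fc'|] ==> pr fc (pr fc' f)=pr (join fc fc') f"
 by (simp add: pr_def project_keys_project_keys E_join)

lemma pr_idem: "pr fc (pr fc f)=pr fc f"
 by (simp add: pr_def project_keys_project_keys)

lemma pr_pr_subset: "[|is_face fc; is_face fc'; fc'\<subseteq>fc|] ==> pr fc (pr fc' f)=pr fc f"
 unfolding pr_def by (rule project_keys_subset[OF E_mono])

lemma pr_mult': "[|is_face fc; f:carrier R; g:carrier R|] ==> pr fc (f\<otimes>\<^bsub>R\<^esub>g)=pr fc f\<otimes>\<^bsub>R\<^esub>pr fc g"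
proof -
 assume "is_face fc" "f:carrier R" "g:carrier R"
 hence "pr fc f * pr fc g=pr fc (f\<otimes>\<^bsub>R\<^esub>g)" by (simp add: pr_mult)
 moreover have "project_keys Bd (pr fc (f\<otimes>\<^bsub>R\<^esub>g))=pr fc (f\<otimes>\<^bsub>R\<^esub>g)"
  using pr_closed[of fc "f\<otimes>\<^bsub>R\<^esub>g"] by (intro project_keys_id) (simp add: R_simps(1))
 ultimately show ?thesis by (simp add: R_simps(2)[of "pr fc f"])
qed

lemma pr_diff: "pr fc (f - g)=pr fc f - pr fc g" by (simp add: pr_def project_keys_diff)
lemma pr_add: "pr fc (f + g)=pr fc f + pr fc g" by (simp add: pr_def project_keys_add)
lemma pr_zero: "pr fc 0=0" by (simp add: pr_def project_keys_0_iff)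
lemma pr_one: "is_face fc ==> pr fc 1=1"
 using zero_E unfolding pr_def by (intro project_keys_id) auto

definition strata_ideal :: "'a set set=>('a exponent \<Rightarrow>\<^sub>0 'k) set" where
 "strata_ideal X={f:carrier R. ALL fc:X. pr fc f=0}"

lemma ideal_strata_ideal:
 assumes "!!fc. fc:X ==> is_face fc"
 shows "ideal (strata_ideal X) R"
proof (rule idealI)
 show "ring R" by (rule R.ring_axioms)
 show "subgroup (strata_ideal X) (add_monoid R)"
 proof (rule R.add.subgroupI)
  show "strata_ideal X~={}" using R.zero_closed pr_zero by (auto simp: strata_ideal_def R_simps(4))
  fix a b assume ab: "a:strata_ideal X"
  thus "\<ominus>\<^bsub>R\<^esub>a:strata_ideal X"
   using R.a_inv_closed pr_diff[of _ 0 a] by (auto simp: strata_ideal_def R_uminus pr_zero)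
  assume "b:strata_ideal X"
  thus "a\<oplus>\<^bsub>R\<^esub>b:strata_ideal X" using ab R.a_closed[of a b]
   by (auto simp: strata_ideal_def R_simps(3) pr_add)
 qed (auto simp: strata_ideal_def)
 fix a x assume ax: "a:strata_ideal X" "x:carrier R"
 hence "pr fc (x\<otimes>\<^bsub>R\<^esub>a)=0" if "fc:X" for fc
  using assms[OF that] that by (simp add: pr_mult strata_ideal_def)
 thus "x\<otimes>\<^bsub>R\<^esub>a:strata_ideal X" using ax by (auto simp: strata_ideal_def)
 thus "a\<otimes>\<^bsub>R\<^esub>x:strata_ideal X" using ax R.m_comm[of a x] by (simp add: strata_ideal_def)
qed

lemma primeideal_stratum:
 assumes "is_face fc"
 shows "primeideal (strata_ideal {fc}) R"
proof (rule primeidealI)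
 show "ideal (strata_ideal {fc}) R" using assms by (intro ideal_strata_ideal) auto
 show "cring R" by (rule cring_R)
 have "1~:strata_ideal {fc}" using pr_one[OF assms] by (simp add: strata_ideal_def)
 thus "carrier R~=strata_ideal {fc}" using R.one_closed by (auto simp: R_simps(5))
 fix a b assume ab: "a:carrier R" "b:carrier R" "a\<otimes>\<^bsub>R\<^esub>b:strata_ideal {fc}"
 hence "pr fc a * pr fc b=0" using pr_mult[OF assms] by (simp add: strata_ideal_def)
 thus "a:strata_ideal {fc}\<or>b:strata_ideal {fc}"
  using exponent_ring_no_zero_divisors[of "pr fc a" "pr fc b"] ab by (auto simp: strata_ideal_def)
qed

lemma stratum_ideal_eq: "stratum_ideal M \<sigma> r fc=strata_ideal {fc}"
 unfolding stratum_ideal_def strata_ideal_def a_kernel_def' R_def[symmetric] pr_def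
 by (simp add: contracted_monoid_ring_def)

definition on_stratum :: "'a set=>('a, 'k) point=>bool" where
 "on_stratum fc x \<longleftrightarrow> strata_ideal {fc}\<subseteq>x"

lemma strata_ideal_antimono: "X\<subseteq>Y ==> strata_ideal Y\<subseteq>strata_ideal X"
 by (auto simp: strata_ideal_def)

lemma zero_locus_strata_ideal:
 assumes x: "x:Spec R" and X: "finite X" "!!fc. fc:X ==> is_face fc"
 shows "x:zero_locus R (strata_ideal X) \<longleftrightarrow> (EX fc:X. on_stratum fc x)"
proof -
 interpret x: primeideal x R using x by (simp add: Spec_def)
 have "EX f:strata_ideal X. f~:x" if "\<not> (EX fc:X. on_stratum fc x)"
  using X that
 proof (induction X rule: finite_induct)
  case empty
  thus ?case using x.I_notcarr x.one_imp_carrier R.one_closed by (auto simp: strata_ideal_def)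
 next
  case (insert fc X)
  obtain f g where f: "f:strata_ideal X" "f~:x" and g: "g:strata_ideal {fc}" "g~:x"
   using insert by (auto simp: on_stratum_def)
  have I: "ideal (strata_ideal X) R" by (rule ideal_strata_ideal, rule insert.prems(1), erule insertI2)
  have J: "ideal (strata_ideal {fc}) R" by (rule ideal_strata_ideal, rule insert.prems(1)) simp
  have c: "f:carrier R" "g:carrier R" using f(1) g(1) by (simp_all add: strata_ideal_def)
  have "f\<otimes>\<^bsub>R\<^esub>g:strata_ideal X" "f\<otimes>\<^bsub>R\<^esub>g:strata_ideal {fc}"
   using ideal.I_r_closed[OF I f(1) c(2)] ideal.I_l_closed[OF J g(1) c(1)] by simp_all
  moreover have "f\<otimes>\<^bsub>R\<^esub>g~:x" using x.I_prime[OF c] f g by blast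
  ultimately show ?case by (intro bexI[of _ "f\<otimes>\<^bsub>R\<^esub>g"]) (auto simp: strata_ideal_def)
 qed
 moreover have "strata_ideal X\<subseteq>x" if "fc:X" "on_stratum fc x" for fc
  using that strata_ideal_antimono[of "{fc}" X] by (auto simp: on_stratum_def)
 ultimately show ?thesis using x by (auto simp: zero_locus_def)
qed

lemma on_stratum_mono:
 assumes "is_face fc" "is_face fc'" "fc'\<subseteq>fc" "on_stratum fc x"
 shows "on_stratum fc' x"
proof -
 have "pr fc f=0" if "pr fc' f=0" for f
  using pr_pr_subset[OF assms(1-3), of f] that pr_zero by simp
 hence "strata_ideal {fc'}\<subseteq>strata_ideal {fc}" by (auto simp: strata_ideal_def)
 thus ?thesis using assms(4) by (simp add: on_stratum_def)
qed

lemma diff_pr_in: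
 assumes "f:carrier R" "on_stratum fc x"
 shows "f - pr fc f:x"
proof -
 have "f - pr fc f:carrier R" using R.minus_closed[OF assms(1) pr_closed] R_minus[OF assms(1) pr_closed] by metis
 hence "f - pr fc f:strata_ideal {fc}" by (simp add: strata_ideal_def pr_diff pr_idem)
 thus ?thesis using assms(2) by (auto simp: on_stratum_def)
qed

lemma pr_in_iff:
 assumes x: "x:Spec R" and f: "f:carrier R" and on: "on_stratum fc x"
 shows "pr fc f:x \<longleftrightarrow> f:x"
proof -
 interpret x: primeideal x R using x by (simp add: Spec_def)
 have d: "f - pr fc f:x" using diff_pr_in[OF f on] .
 have "f=pr fc f\<oplus>\<^bsub>R\<^esub>(f - pr fc f)" by (simp add: R_simps(3))
 moreover have "pr fc f=f\<oplus>\<^bsub>R\<^esub>(\<ominus>\<^bsub>R\<^esub>(f - pr fc f))"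
  using d x.Icarr[OF d] by (simp add: R_simps(3) R_uminus)
 ultimately show ?thesis using d x.a_closed x.a_inv_closed by metis
qed

lemma on_stratum_join:
 assumes x: "x:Spec R" and fc: "is_face fc" "is_face fc'" "on_stratum fc x" "on_stratum fc' x"
 shows "on_stratum (join fc fc') x"
 unfolding on_stratum_def
proof
 fix f assume "f:strata_ideal {join fc fc'}"
 hence f: "f:carrier R" "pr fc' (pr fc f)=0"
  using pr_pr[OF fc(1,2), of f] pr_pr[OF fc(2,1), of f] by (auto simp: strata_ideal_def join_def Un_commute)
 hence "pr fc f:strata_ideal {fc'}" by (simp add: strata_ideal_def pr_closed)
 hence "pr fc f:x" using fc(4) by (auto simp: on_stratum_def)
 thus "f:x" using pr_in_iff[OF x f(1) fc(3)] by simp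
qed

definition vertex_faces :: "'a set set" where
 "vertex_faces=(%v. {v}) ` vertices"

text \<open>The components of \<open>V(p)\<close>; the set is empty if \<open>p\<close> lies off the boundary, where \<open>V(p)\<close> is empty.\<close>
definition faces_p :: "'a\<times>real=>'a set set" where
 "faces_p p=(if p:boundary_P M \<sigma> then {fc:vertex_faces. fc\<subseteq>minface (fst p)} else {})"

lemma vertex_faces: "finite vertex_faces" "fc:vertex_faces ==> is_face fc"
 using finite_vertices is_face_vertex by (auto simp: vertex_faces_def)

lemma faces_p: "finite (faces_p p)" "fc:faces_p p ==> is_face fc"
 using vertex_faces by (auto simp: faces_p_def split: if_splits)

lemma vertex_in_minface: "EX fc:vertex_faces. fc\<subseteq>minface w"
 using face_extreme_point[OF minface_face minface_nonempty, of w] by (auto simp: vertex_faces_def)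

lemma strata_ideal_vertices: "strata_ideal vertex_faces={\<zero>\<^bsub>R\<^esub>}"
proof -
 have "f=0" if f: "f:carrier R" "!!fc. fc:vertex_faces ==> pr fc f=0" for f
 proof (rule ccontr)
  assume "f~=0"
  then obtain e where e: "e:Poly_Mapping.keys f" by (metis all_not_in_conv keys_eq_empty)
  hence eB: "e:Bd" using f by (auto simp: R_simps)
  obtain fc where fc: "fc:vertex_faces" "fc\<subseteq>minface (fst (fst e))" using vertex_in_minface by blast
  hence "e:E fc" using E_iff[OF is_face_subset[OF vertex_faces(2)]] eB by blast
  thus False using f(2)[OF fc(1)] e unfolding pr_def project_keys_0_iff by blast
 qed
 thus ?thesis using R.zero_closed pr_zero by (auto simp: strata_ideal_def R_simps(4))
qed

lemma chart_closed: "chart M \<sigma> p:carrier R"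
proof -
 have "(p, 0):Bd" if "p:boundary_P M \<sigma>" using that by (simp add: boundary_exponents_def)
 thus ?thesis by (auto simp: chart_def R_simps)
qed

text \<open>The monomial \<open>z\<^sup>p\<close> is nonzero exactly on the components of the vertices where \<open>fst p\<close> is minimal, because these are the strata whose retraction keeps it. Density of its nonvanishing locus in each of them follows from primality.\<close>
lemma ideal_p_eq: "ideal_p M \<sigma> r p=strata_ideal (faces_p p)"
proof -
 let ?z = "chart M \<sigma> p :: 'a exponent \<Rightarrow>\<^sub>0 'k"
 let ?D = "{x:Spec R. ?z~:x}"
 have top: "topspace (zariski R)=Spec R"
 proof
  show "topspace (zariski R)\<subseteq>Spec R" using openin_zariski_Spec[OF openin_topspace] .
  have "openin (zariski R) {q:Spec R. \<one>\<^bsub>R\<^esub>~:q}" by (rule openin_basic) simp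
  moreover have "\<one>\<^bsub>R\<^esub>~:q" if "q:Spec R" for q
   using that primeideal.I_notcarr ideal.one_imp_carrier primeideal.axioms(1) unfolding Spec_def by blast
  hence "{q:Spec R. \<one>\<^bsub>R\<^esub>~:q}=Spec R" by blast
  ultimately show "Spec R\<subseteq>topspace (zariski R)" using openin_subset by metis
 qed
 have "ideal_p M \<sigma> r p=vanishing_ideal R (zariski R closure_of ?D)"
  unfolding ideal_p_def V_p_def V_space_def R_def ..
 also have "...={f:carrier R. ALL x:?D. f:x}"
 proof -
  have "f:x" if f: "f:carrier R" "ALL x:?D. f:x" and x: "x:zariski R closure_of ?D" for f x
  proof (rule ccontr)
   assume "f~:x"
   moreover have "x:Spec R" using x top closure_of_subset_topspace[of "zariski R" ?D] by blast
   ultimately have "x:{q:Spec R. f~:q}" by blast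
   then obtain y where "y:?D" "y:{q:Spec R. f~:q}"
   proof -
    assume "x:{q:Spec R. f~:q}"
    hence "EX y. y:?D & y:{q:Spec R. f~:q}"
     using openin_basic[OF f(1)] by (intro conjunct2[OF x[unfolded in_closure_of], rule_format]) (rule conjI)
    thus thesis using that by (elim exE conjE)
   qed
   thus False using f(2) by blast
  qed
  moreover have "?D\<subseteq>zariski R closure_of ?D" using top by (intro closure_of_subset) auto
  ultimately show ?thesis unfolding vanishing_ideal_def by blast
 qed
 also have "...=strata_ideal (faces_p p)"
 proof (intro subset_antisym subsetI)
  fix f assume f: "f:{f:carrier R. ALL x:?D. f:x}"
  have "pr fc f=0" if fc: "fc:faces_p p" for fc
  proof -
   have p: "p:boundary_P M \<sigma>" "fc\<subseteq>minface (fst p)" using fc unfolding faces_p_def by (metis (no_types, lifting) empty_iff mem_Collect_eq)+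
   have "(p, 0):Bd" using p(1) by (simp add: boundary_exponents_def)
   hence "(p, 0):E fc" using E_iff[OF is_face_subset[OF faces_p(2)[OF fc]]] p(2) by simp
   hence "pr fc ?z~=0" using p(1) by (simp add: pr_def project_keys_0_iff chart_def)
   hence "strata_ideal {fc}:?D" using primeideal_stratum[OF faces_p(2)[OF fc]]
    by (simp add: Spec_def strata_ideal_def)
   thus ?thesis using f by (auto simp: strata_ideal_def)
  qed
  thus "f:strata_ideal (faces_p p)" using f by (auto simp: strata_ideal_def)
 next
  fix f assume f: "f:strata_ideal (faces_p p)"
  have "f\<otimes>\<^bsub>R\<^esub>?z=0"
  proof (cases "p:boundary_P M \<sigma>")
   case True
   hence pB: "(p, 0):Bd" by (simp add: boundary_exponents_def)
   have "e + (p, 0)~:Bd" if e: "e:Poly_Mapping.keys f" for e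
   proof
    assume A: "e + (p, 0):Bd"
    have eB: "e:Bd" using f e by (auto simp: strata_ideal_def R_simps)
    hence ne: "minface (fst (fst e))\<inter>minface (fst p)~={}" using A Bd_add[OF eB pB] by simp
    obtain fc where fc: "fc:vertex_faces" "fc\<subseteq>minface (fst (fst e) + fst p)" using vertex_in_minface by blast
    hence "fc:faces_p p" "fc\<subseteq>minface (fst (fst e))"
     using minface_add[OF ne] True by (auto simp: faces_p_def)
    hence "e:E fc" "pr fc f=0" using E_iff[OF is_face_subset[OF faces_p(2)]] eB f
     by (blast, auto simp: strata_ideal_def)
    thus False using e unfolding pr_def project_keys_0_iff by blast
   qed
   moreover have kz: "Poly_Mapping.keys ?z={(p, 0)}" using True by (simp add: chart_def)
   have "k~:Bd" if k: "k:Poly_Mapping.keys (f * ?z)" for k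
   proof -
    obtain a b where "a:Poly_Mapping.keys f" "b:Poly_Mapping.keys ?z" "k=a + b"
     using keys_mult[of f ?z] k by blast
    thus ?thesis using calculation[of a] kz by simp
   qed
   hence "Poly_Mapping.keys (f * ?z)\<inter>Bd={}" by blast
   thus ?thesis by (simp add: R_simps(2) project_keys_0_iff)
  next
   case False
   thus ?thesis by (simp add: chart_def R_simps(2) project_keys_0_iff)
  qed
  moreover have fmem: "f:carrier R" using f by (simp add: strata_ideal_def)
  ultimately have "f:x" if x: "x:?D" for x
  proof -
   interpret x: primeideal x R using x by (simp add: Spec_def)
   have "f\<otimes>\<^bsub>R\<^esub>?z:x" using x.zero_closed \<open>f \<otimes>\<^bsub>R\<^esub> ?z = 0\<close> by (simp add: R_simps(4))
   thus ?thesis using x.I_prime[OF fmem chart_closed] x by blast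
  qed
  thus "f:{f:carrier R. ALL x:?D. f:x}" using fmem by blast
 qed
 finally show ?thesis .
qed

end

section \<open>Gluing germs along strata\<close>

text \<open>Elements that agree wherever two of the idempotents overlap are realised by one element: by induction, the error at a new idempotent is corrected by its image under that idempotent, which is trivial for the others.\<close>
lemma (in comm_group) glue_commuting_idempotents:
 assumes "finite X"
  and hom: "!!i. i:X ==> e i:hom G G" and idem: "!!i g. [|i:X; g:carrier G|] ==> e i (e i g)=e i g"
  and comm: "!!i j g. [|i:X; j:X; g:carrier G|] ==> e i (e j g)=e j (e i g)"
  and c: "!!i. i:X ==> c i:carrier G"
  and compat: "!!i j. [|i:X; j:X|] ==> e i (e j (c j))=e i (e j (c i))"
 shows "EX g:carrier G. ALL i:X. e i g=e i (c i)"
 using assms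
proof (induction X rule: finite_induct)
 case (insert k X)
 have "EX g:carrier G. ALL i:X. e i g=e i (c i)"
  by (rule insert.IH) (use insert.prems in \<open>simp_all\<close>)
 then obtain g where g: "g:carrier G" "ALL i:X. e i g=e i (c i)" by blast
 have cl: "e i h:carrier G" if "i:insert k X" "h:carrier G" for i h
  using hom_in_carrier[OF insert.prems(1)[OF that(1)] that(2)] .
 have mult: "e i (h\<otimes>h')=e i h\<otimes>e i h'" if "i:insert k X" "h:carrier G" "h':carrier G" for i h h'
  using hom_mult[OF insert.prems(1)[OF that(1)] that(2,3)] .
 have einv: "e i (inv h)=inv (e i h)" if "i:insert k X" "h:carrier G" for i h
 proof -
  interpret h: group_hom G G "e i" by (simp add: group_hom_def group_hom_axioms_def insert.prems(1)[OF that(1)])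
  show ?thesis using that(2) by simp
 qed
 have ck: "c k:carrier G" using insert.prems by simp
 define g' where "g'=g\<otimes>e k (c k\<otimes>inv g)"
 have q: "c k\<otimes>inv g:carrier G" using ck g(1) by simp
 have "e k g'=e k g\<otimes>e k (c k\<otimes>inv g)"
  unfolding g'_def using mult[of k] cl[of k] q g(1) insert.prems(2)[of k] by simp
 also have "...=e k (g\<otimes>(c k\<otimes>inv g))" using mult[of k] q g(1) by simp
 also have "g\<otimes>(c k\<otimes>inv g)=c k" using ck g(1) by (simp add: m_comm[of "c k"] m_assoc[symmetric])
 finally have k: "e k g'=e k (c k)" .
 have "e i g'=e i (c i)" if i: "i:X" for i
 proof -
  have i': "i:insert k X" "c i:carrier G" using i insert.prems(4) by auto
  have "e i (e k (c k\<otimes>inv g))=e i (e k (c k))\<otimes>inv (e i (e k g))"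
   using i' mult einv cl ck g(1) by simp
  also have "e i (e k g)=e k (e i (c i))" using insert.prems(3)[of i k g] i' i g by simp
  also have "...=e i (e k (c i))" using insert.prems(3)[of i k "c i"] i' by simp
  also have "e i (e k (c k))=e i (e k (c i))" using insert.prems(5)[of i k] i' by simp
  finally have "e i (e k (c k\<otimes>inv g))=\<one>" using cl i' by simp
  thus ?thesis unfolding g'_def using mult[OF i'(1) g(1)] cl q g i cl[OF i'(1) g(1)] by simp
 qed
 thus ?case using k g(1) cl q by (intro bexI[of _ g']) (auto simp: g'_def)
qed (use one_closed in blast)

context log_scheme begin

abbreviation "fr x a f \<equiv> fraction R {\<zero>\<^bsub>R\<^esub>} x a f"
abbreviation "L x \<equiv> unit_germs R {\<zero>\<^bsub>R\<^esub>} x"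

text \<open>Restriction of a germ to the stratum of a face, followed by the retraction; its value is again a germ on \<open>V\<close>, so that germs on different strata are compared in one group.\<close>
definition pull :: "'a set=>('a, 'k) point=>(('a exponent \<Rightarrow>\<^sub>0 'k)\<times>('a exponent \<Rightarrow>\<^sub>0 'k)) set=>
  (('a exponent \<Rightarrow>\<^sub>0 'k)\<times>('a exponent \<Rightarrow>\<^sub>0 'k)) set" where
 "pull fc x c=(\<Union>(a, f)\<in>c. fr x (pr fc a) (pr fc f))"

lemma zero_ideal: "ideal {\<zero>\<^bsub>R\<^esub>} R" by (rule R.zeroideal)

lemma lf: "[|x:Spec R; ideal I R|] ==> local_fractions R I x" by (rule R.local_fractionsI)

lemma comm_group_L: "x:Spec R ==> comm_group (L x)"
 using local_fractions.comm_group_unit_germs[OF lf[OF _ zero_ideal]] .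

lemma pr_notin: "[|x:Spec R; on_stratum fc x; a:carrier R - x|] ==> pr fc a:carrier R - x"
 using pr_in_iff pr_closed by blast

lemma fr_eq_iff:
 assumes "x:Spec R" "a:carrier R" "f:carrier R - x" "b:carrier R" "g:carrier R - x"
 shows "fr x a f=fr x b g \<longleftrightarrow> (EX u:carrier R - x. u\<otimes>\<^bsub>R\<^esub>(a\<otimes>\<^bsub>R\<^esub>g\<ominus>\<^bsub>R\<^esub>b\<otimes>\<^bsub>R\<^esub>f)=\<zero>\<^bsub>R\<^esub>)"
 using local_fractions.fraction_eq_iff[OF lf[OF assms(1) zero_ideal] assms(2-5)] by simp

lemma pr_cross:
 assumes "is_face fc" "u:carrier R" "a:carrier R" "f:carrier R" "b:carrier R" "g:carrier R"
 shows "pr fc (u\<otimes>\<^bsub>R\<^esub>(a\<otimes>\<^bsub>R\<^esub>g\<ominus>\<^bsub>R\<^esub>b\<otimes>\<^bsub>R\<^esub>f)) =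
  pr fc u\<otimes>\<^bsub>R\<^esub>(pr fc a\<otimes>\<^bsub>R\<^esub>pr fc g\<ominus>\<^bsub>R\<^esub>pr fc b\<otimes>\<^bsub>R\<^esub>pr fc f)"
 using assms R.m_closed[of a g] R.m_closed[of b f] R.minus_closed[of "a\<otimes>\<^bsub>R\<^esub>g" "b\<otimes>\<^bsub>R\<^esub>f"]
  R.m_closed[OF pr_closed pr_closed]
 by (simp add: pr_mult' R_minus pr_diff)

lemma pull_fraction:
 assumes x: "x:Spec R" and fc: "is_face fc" "on_stratum fc x" and I: "ideal I R" "I\<subseteq>strata_ideal {fc}"
  and a: "a:carrier R - x" "f:carrier R - x"
 shows "pull fc x (fraction R I x a f)=fr x (pr fc a) (pr fc f)"
proof -
 interpret l: local_fractions R I x using lf[OF x I(1)] .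
 have "fr x (pr fc b) (pr fc g)=fr x (pr fc a) (pr fc f)" if bg: "(b, g):fraction R I x a f" for b g
 proof -
  obtain u where u: "b:carrier R" "g:carrier R - x" "u:carrier R - x"
   "u\<otimes>\<^bsub>R\<^esub>(a\<otimes>\<^bsub>R\<^esub>g\<ominus>\<^bsub>R\<^esub>b\<otimes>\<^bsub>R\<^esub>f):I"
   using bg unfolding fraction_def by blast
  hence "pr fc (u\<otimes>\<^bsub>R\<^esub>(a\<otimes>\<^bsub>R\<^esub>g\<ominus>\<^bsub>R\<^esub>b\<otimes>\<^bsub>R\<^esub>f))=0" using I(2) by (auto simp: strata_ideal_def)
  hence "pr fc u\<otimes>\<^bsub>R\<^esub>(pr fc a\<otimes>\<^bsub>R\<^esub>pr fc g\<ominus>\<^bsub>R\<^esub>pr fc b\<otimes>\<^bsub>R\<^esub>pr fc f)=\<zero>\<^bsub>R\<^esub>"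
   using pr_cross[OF fc(1), of u a f b g] u a by (simp add: R_simps(4))
  hence "fr x (pr fc a) (pr fc f)=fr x (pr fc b) (pr fc g)"
   using fr_eq_iff[OF x pr_closed[of fc a] pr_notin[OF x fc(2) a(2)] pr_closed[of fc b] pr_notin[OF x fc(2) u(2)]]
    pr_notin[OF x fc(2) u(3)] by blast
  thus ?thesis by simp
 qed
 moreover have "(a, f):fraction R I x a f" using l.fraction_self a by blast
 ultimately show ?thesis unfolding pull_def by blast
qed

lemma unit_germs_cases:
 assumes "c:carrier (unit_germs R I x)"
 obtains a f where "a:carrier R - x" "f:carrier R - x" "c=fraction R I x a f"
 using assms by (auto simp: unit_germs_def)

lemma unit_germsI: "[|a:carrier R - x; f:carrier R - x|] ==> fraction R I x a f:carrier (unit_germs R I x)"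
 by (auto simp: unit_germs_def)

lemma pull_hom:
 assumes x: "x:Spec R" and fc: "is_face fc" "on_stratum fc x" and I: "ideal I R" "I\<subseteq>strata_ideal {fc}"
 shows "pull fc x:hom (unit_germs R I x) (L x)"
proof (rule homI)
 interpret l: local_fractions R I x using lf[OF x I(1)] .
 interpret z: local_fractions R "{\<zero>\<^bsub>R\<^esub>}" x using lf[OF x zero_ideal] .
 fix c c' assume "c:carrier (unit_germs R I x)" "c':carrier (unit_germs R I x)"
 then obtain a f b g where c: "a:carrier R - x" "f:carrier R - x" "c=fraction R I x a f"
  "b:carrier R - x" "g:carrier R - x" "c'=fraction R I x b g" by (metis unit_germs_cases)
 have "c\<otimes>\<^bsub>unit_germs R I x\<^esub>c'=fraction R I x (a\<otimes>\<^bsub>R\<^esub>b) (f\<otimes>\<^bsub>R\<^esub>g)"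
  using c by (simp add: l.unit_germs_simps l.fraction_mult_fraction)
 hence "pull fc x (c\<otimes>\<^bsub>unit_germs R I x\<^esub>c')=fr x (pr fc a\<otimes>\<^bsub>R\<^esub>pr fc b) (pr fc f\<otimes>\<^bsub>R\<^esub>pr fc g)"
  using pull_fraction[OF x fc I l.mult_notin[OF c(1,4)] l.mult_notin[OF c(2,5)]] c fc by (simp add: pr_mult')
 also have "...=pull fc x c\<otimes>\<^bsub>L x\<^esub>pull fc x c'"
  unfolding c(3,6) pull_fraction[OF x fc I c(1,2)] pull_fraction[OF x fc I c(4,5)]
  using pr_notin[OF x fc(2)] c pr_closed by (simp add: z.unit_germs_simps z.fraction_mult_fraction)
 finally show "pull fc x (c\<otimes>\<^bsub>unit_germs R I x\<^esub>c')=pull fc x c\<otimes>\<^bsub>L x\<^esub>pull fc x c'" .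
next
 fix c assume "c:carrier (unit_germs R I x)"
 then obtain a f where c: "a:carrier R - x" "f:carrier R - x" "c=fraction R I x a f" by (metis unit_germs_cases)
 thus "pull fc x c:carrier (L x)"
  using pull_fraction[OF x fc I c(1,2)] pr_notin[OF x fc(2)] by (simp add: unit_germsI)
qed

text \<open>An intersection of the kernels of the retractions is cut out by the retractions: a factor that kills the difference on each component through the point can be taken as a product, and the components off the point are killed by an element that does not vanish there.\<close>
lemma germ_eqI:
 assumes x: "x:Spec R" and X: "finite X" "!!fc. fc:X ==> is_face fc"
  and c: "c:carrier (unit_germs R (strata_ideal X) x)" "c':carrier (unit_germs R (strata_ideal X) x)"
  and eq: "!!fc. [|fc:X; on_stratum fc x|] ==> pull fc x c=pull fc x c'"
 shows "c=c'"
proof -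
 have I: "ideal (strata_ideal X) R" using ideal_strata_ideal X(2) .
 interpret l: local_fractions R "strata_ideal X" x using lf[OF x I] .
 obtain a f b g where a: "a:carrier R - x" "f:carrier R - x" "c=fraction R (strata_ideal X) x a f"
  and b: "b:carrier R - x" "g:carrier R - x" "c'=fraction R (strata_ideal X) x b g"
  using c by (metis unit_germs_cases)
 define D where "D=a\<otimes>\<^bsub>R\<^esub>g\<ominus>\<^bsub>R\<^esub>b\<otimes>\<^bsub>R\<^esub>f"
 have D: "D:carrier R" unfolding D_def using a b by simp
 have one: "EX u:carrier R - x. pr fc (u\<otimes>\<^bsub>R\<^esub>D)=0" if fc: "fc:X" for fc
 proof (cases "on_stratum fc x")
  case True
  have sub: "strata_ideal X\<subseteq>strata_ideal {fc}" using fc strata_ideal_antimono by simp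
  have "fr x (pr fc a) (pr fc f)=fr x (pr fc b) (pr fc g)"
   using eq[OF fc True] unfolding a(3) b(3)
    pull_fraction[OF x X(2)[OF fc] True I sub a(1,2)] pull_fraction[OF x X(2)[OF fc] True I sub b(1,2)] .
  then obtain u where u: "u:carrier R - x" "u\<otimes>\<^bsub>R\<^esub>(pr fc a\<otimes>\<^bsub>R\<^esub>pr fc g\<ominus>\<^bsub>R\<^esub>pr fc b\<otimes>\<^bsub>R\<^esub>pr fc f)=\<zero>\<^bsub>R\<^esub>"
   using fr_eq_iff[OF x pr_closed[of fc a] pr_notin[OF x True a(2)] pr_closed[of fc b] pr_notin[OF x True b(2)]] by blast
  have "pr fc (u\<otimes>\<^bsub>R\<^esub>D)=pr fc (u\<otimes>\<^bsub>R\<^esub>(pr fc a\<otimes>\<^bsub>R\<^esub>pr fc g\<ominus>\<^bsub>R\<^esub>pr fc b\<otimes>\<^bsub>R\<^esub>pr fc f))"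
   unfolding D_def using pr_cross[OF X(2)[OF fc], of u a f b g] a b u(1)
    pr_cross[OF X(2)[OF fc], of u "pr fc a" "pr fc f" "pr fc b" "pr fc g"] pr_closed by (simp add: pr_idem)
  thus ?thesis using u by (intro bexI[of _ u]) (simp_all add: R_simps(4) pr_zero)
 next
  case False
  then obtain u where u: "u:strata_ideal {fc}" "u~:x" by (auto simp: on_stratum_def)
  have uc: "u:carrier R" "pr fc u=0" using u(1) unfolding strata_ideal_def by blast+
  have "pr fc (u\<otimes>\<^bsub>R\<^esub>D)=0" by (simp only: pr_mult[OF X(2)[OF fc] uc(1) D] uc(2) mult_zero_left)
  thus ?thesis using u(2) uc(1) by blast
 qed
 have "EX u:carrier R - x. ALL fc:Y. pr fc (u\<otimes>\<^bsub>R\<^esub>D)=0" if "Y\<subseteq>X" for Y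
  using finite_subset[OF that X(1)] that
 proof (induction Y rule: finite_induct)
  case empty
  thus ?case using l.one_notin by blast
 next
  case (insert fc Y)
  then obtain u where u: "u:carrier R - x" "ALL fc:Y. pr fc (u\<otimes>\<^bsub>R\<^esub>D)=0" by auto
  obtain v where v: "v:carrier R - x" "pr fc (v\<otimes>\<^bsub>R\<^esub>D)=0" using one insert.prems by blast
  have c: "u:carrier R" "v:carrier R" using u v by auto
  have "pr rh ((u\<otimes>\<^bsub>R\<^esub>v)\<otimes>\<^bsub>R\<^esub>D)=0" if rh: "rh:insert fc Y" for rh
  proof -
   have f: "is_face rh" using X(2) rh insert.prems by blast
   have "(u\<otimes>\<^bsub>R\<^esub>v)\<otimes>\<^bsub>R\<^esub>D=u\<otimes>\<^bsub>R\<^esub>(v\<otimes>\<^bsub>R\<^esub>D)" "(u\<otimes>\<^bsub>R\<^esub>v)\<otimes>\<^bsub>R\<^esub>D=v\<otimes>\<^bsub>R\<^esub>(u\<otimes>\<^bsub>R\<^esub>D)"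
    using c D by (simp_all add: R.m_ac)
   thus ?thesis using rh u(2) v(2) pr_mult[OF f c(1), of "v\<otimes>\<^bsub>R\<^esub>D"] pr_mult[OF f c(2), of "u\<otimes>\<^bsub>R\<^esub>D"] c D
    by (metis R.m_closed insert_iff mult_zero_right)
  qed
  thus ?case using l.mult_notin[OF u(1) v(1)] by (intro bexI[of _ "u\<otimes>\<^bsub>R\<^esub>v"]) auto
 qed
 then obtain u where u: "u:carrier R - x" "ALL fc:X. pr fc (u\<otimes>\<^bsub>R\<^esub>D)=0" by blast
 hence "u\<otimes>\<^bsub>R\<^esub>(a\<otimes>\<^bsub>R\<^esub>g\<ominus>\<^bsub>R\<^esub>b\<otimes>\<^bsub>R\<^esub>f):strata_ideal X"
  unfolding strata_ideal_def D_def[symmetric] using D R.m_closed[of u D] by blast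
 thus ?thesis unfolding a(3) b(3) using l.fraction_eq_iff[of a f b g] a b u(1) by blast
qed

lemma pull_restrict:
 assumes x: "x:Spec R" and fc: "is_face fc" "on_stratum fc x" and I: "ideal I R" "ideal J R" "I\<subseteq>J" "J\<subseteq>strata_ideal {fc}"
  and c: "c:carrier (unit_germs R I x)"
 shows "pull fc x (\<Union>(a, f)\<in>c. fraction R J x a f)=pull fc x c"
  "(\<Union>(a, f)\<in>c. fraction R J x a f):carrier (unit_germs R J x)"
proof -
 obtain a f where a: "a:carrier R - x" "f:carrier R - x" "c=fraction R I x a f" using c by (metis unit_germs_cases)
 have e: "(\<Union>(a, f)\<in>c. fraction R J x a f)=fraction R J x a f"
  unfolding a(3) using a prime_point.restrict_fraction[OF R.prime_pointI[OF x] I(1-3), of a f] by blast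
 show "pull fc x (\<Union>(a, f)\<in>c. fraction R J x a f)=pull fc x c"
  unfolding e unfolding a(3) using pull_fraction[OF x fc I(2,4) a(1,2)] pull_fraction[OF x fc I(1) _ a(1,2)] I(3,4) by simp
 show "(\<Union>(a, f)\<in>c. fraction R J x a f):carrier (unit_germs R J x)" unfolding e using a by (simp add: unit_germsI)
qed

lemma zero_sub: "{\<zero>\<^bsub>R\<^esub>}\<subseteq>strata_ideal X"
 using R.zero_closed pr_zero by (auto simp: strata_ideal_def R_simps(4))

lemma pull_fr: "[|x:Spec R; is_face fc; on_stratum fc x; a:carrier R - x; f:carrier R - x|] ==>
  pull fc x (fr x a f)=fr x (pr fc a) (pr fc f)"
 using pull_fraction[OF _ _ _ zero_ideal zero_sub] .

lemma pull_pull: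
 assumes x: "x:Spec R" and fc: "is_face fc" "on_stratum fc x" "is_face fc'" "on_stratum fc' x"
  and I: "ideal I R" "I\<subseteq>strata_ideal {fc'}" and c: "c:carrier (unit_germs R I x)"
 shows "pull fc x (pull fc' x c)=pull (join fc fc') x c"
proof -
 obtain a f where a: "a:carrier R - x" "f:carrier R - x" "c=fraction R I x a f" using c by (metis unit_germs_cases)
 have j: "is_face (join fc fc')" "on_stratum (join fc fc') x"
  using join_face fc on_stratum_join[OF x] by auto
 have "strata_ideal {fc'}\<subseteq>strata_ideal {join fc fc'}"
  using pr_pr_subset[OF j(1) fc(3) join_face(3)[OF fc(1,3)]] pr_zero by (auto simp: strata_ideal_def) metis
 hence "I\<subseteq>strata_ideal {join fc fc'}" using I(2) by blast
 thus ?thesis unfolding a(3)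
  using pull_fraction[OF x j I(1) _ a(1,2)] pull_fraction[OF x fc(3,4) I a(1,2)]
   pull_fr[OF x fc(1,2) pr_notin[OF x fc(4) a(1)] pr_notin[OF x fc(4) a(2)]] pr_pr[OF fc(1,3)] by simp
qed

lemma pull_endo: "[|x:Spec R; is_face fc; on_stratum fc x|] ==> pull fc x:hom (L x) (L x)"
 using pull_hom[OF _ _ _ zero_ideal zero_sub] .

lemma join_commute: "join fc fc'=join fc' fc"
 by (simp add: join_def Un_commute)

lemma join_absorb: "[|is_face fc; is_face fc'; fc'\<subseteq>fc|] ==> join fc fc'=fc"
 using join_face(2) join_least[of fc fc fc'] by (auto simp: is_face_def)

lemma pull_absorb:
 assumes "x:Spec R" "is_face fc" "on_stratum fc x" "is_face fc'" "fc'\<subseteq>fc"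
  "ideal I R" "I\<subseteq>strata_ideal {fc'}" "c:carrier (unit_germs R I x)"
 shows "pull fc x (pull fc' x c)=pull fc x c"
 using pull_pull[OF assms(1-4) _ assms(6-8)] on_stratum_mono[OF assms(2,4,5,3)] join_absorb[OF assms(2,4,5)] by simp

text \<open>Equality of two fractions is witnessed by one multiplier, and the same multiplier works wherever it is a unit.\<close>
lemma spread_equality:
 assumes x: "x:Spec R" and fc: "is_face fc" "on_stratum fc x"
  and a: "a:carrier R - x" "f:carrier R - x" "b:carrier R - x" "g:carrier R - x"
  and eq: "pull fc x (fr x a f)=pull fc x (fr x b g)"
 obtains W where "openin (zariski R) W" "x:W" "!!y. y:W ==> a~:y & f~:y & b~:y & g~:y"
  "!!y. [|y:W; on_stratum fc y|] ==> pull fc y (fr y a f)=pull fc y (fr y b g)"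
proof -
 obtain u where u: "u:carrier R - x" "u\<otimes>\<^bsub>R\<^esub>(pr fc a\<otimes>\<^bsub>R\<^esub>pr fc g\<ominus>\<^bsub>R\<^esub>pr fc b\<otimes>\<^bsub>R\<^esub>pr fc f)=\<zero>\<^bsub>R\<^esub>"
  using eq fr_eq_iff[OF x pr_closed[of fc a] pr_notin[OF x fc(2) a(2)] pr_closed[of fc b] pr_notin[OF x fc(2) a(4)]]
  unfolding pull_fr[OF x fc a(1,2)] pull_fr[OF x fc a(3,4)] by blast
 define W where "W={q:Spec R. a~:q}\<inter>{q:Spec R. f~:q}\<inter>{q:Spec R. b~:q}\<inter>{q:Spec R. g~:q}\<inter>{q:Spec R. u~:q}"
 have op: "openin (zariski R) {q:Spec R. s~:q}" if "s:carrier R - x" for s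
  using that by (intro openin_basic) blast
 have oW: "openin (zariski R) W" unfolding W_def using a u(1) by (intro openin_Int op)
 have eqW: "pull fc y (fr y a f)=pull fc y (fr y b g)" if y: "y:W" "on_stratum fc y" for y
 proof -
  have yS: "y:Spec R" and n: "a:carrier R - y" "f:carrier R - y" "b:carrier R - y" "g:carrier R - y" "u:carrier R - y"
   using y(1) a u(1) unfolding W_def by auto
  show ?thesis unfolding pull_fr[OF yS fc(1) y(2) n(1,2)] pull_fr[OF yS fc(1) y(2) n(3,4)]
   using fr_eq_iff[OF yS pr_closed[of fc a] pr_notin[OF yS y(2) n(2)] pr_closed[of fc b] pr_notin[OF yS y(2) n(4)]] n(5) u(2) by blast
 qed
 have xW: "x:W" using x a u(1) unfolding W_def by simp
 have nW: "a~:y & f~:y & b~:y & g~:y" if "y:W" for y using that unfolding W_def by simp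
 show thesis by (rule that[OF oW xW nW eqW])
qed

lemma open_off_stratum:
 assumes "x:Spec R" "\<not> on_stratum fc x"
 obtains W where "openin (zariski R) W" "x:W" "!!y. y:W ==> \<not> on_stratum fc y"
proof -
 obtain f where f: "f:strata_ideal {fc}" "f~:x" using assms by (auto simp: on_stratum_def)
 have "f:carrier R" using f(1) by (simp add: strata_ideal_def)
 hence "openin (zariski R) {q:Spec R. f~:q}" by (rule openin_basic)
 thus thesis using f assms(1) by (intro that[of "{q:Spec R. f~:q}"]) (auto simp: on_stratum_def)
qed

lemma open_nbhd_finite:
 assumes "finite X" "!!i. i:X ==> EX W. openin (zariski R) W & x:W & (ALL y:W. Q i y)" "openin (zariski R) U" "x:U"
 shows "EX W. openin (zariski R) W & x:W & W\<subseteq>U & (ALL i:X. ALL y:W. Q i y)"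
 using assms(1,2)
proof (induction X rule: finite_induct)
 case empty
 thus ?case using assms(3,4) by auto
next
 case (insert i X)
 then obtain W where W: "openin (zariski R) W" "x:W" "W\<subseteq>U" "ALL i:X. ALL y:W. Q i y" by auto
 obtain W' where W': "openin (zariski R) W'" "x:W'" "ALL y:W'. Q i y" using insert.prems by blast
 have "openin (zariski R) (W\<inter>W')" using W(1) W'(1) by (rule openin_Int)
 thus ?case using W(2-4) W'(2,3) by (intro exI[of _ "W\<inter>W'"]) blast
qed

lemma glue_germs:
 assumes x: "x:Spec R" and X: "finite X" "!!fc. fc:X ==> is_face fc & on_stratum fc x"
  and c: "!!fc. fc:X ==> c fc:carrier (L x)"
  and compat: "!!fc fc'. [|fc:X; fc':X|] ==> pull (join fc fc') x (c fc)=pull (join fc fc') x (c fc')"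
 shows "EX g:carrier (L x). ALL fc:X. pull fc x g=pull fc x (c fc)"
proof -
 interpret L: comm_group "L x" using comm_group_L[OF x] .
 have pp: "pull fc x (pull fc' x g)=pull (join fc fc') x g" if "fc:X" "fc':X" "g:carrier (L x)" for fc fc' g
  using pull_pull[OF x _ _ _ _ zero_ideal zero_sub that(3)] X(2) that(1,2) by blast
 show ?thesis
 proof (rule L.glue_commuting_idempotents[OF X(1)])
  show "pull fc x:hom (L x) (L x)" if "fc:X" for fc using pull_endo[OF x] X(2)[OF that] by blast
  show "pull fc x (pull fc x g)=pull fc x g" if "fc:X" "g:carrier (L x)" for fc g
   using pp[OF that(1) that] join_absorb[of fc fc] X(2)[OF that(1)] by simp
  show "pull fc x (pull fc' x g)=pull fc' x (pull fc x g)" if "fc:X" "fc':X" "g:carrier (L x)" for fc fc' g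
   using pp[OF that] pp[OF that(2,1,3)] join_commute by simp
  show "pull fc x (pull fc' x (c fc'))=pull fc x (pull fc' x (c fc))" if "fc:X" "fc':X" for fc fc'
   using pp[OF that c[OF that(2)]] pp[OF that c[OF that(1)]] compat[OF that] by simp
 qed (rule c)
qed

text \<open>Functions on finitely many strata that agree on the intersections glue to a function on their union: near a point the germs are glued by the commuting retractions, and finitely many equalities of germs persist on a neighbourhood.\<close>
lemma section_from_strata:
 assumes U: "openin (zariski R) U" and X: "finite X" "!!fc. fc:X ==> is_face fc"
  and loc: "!!x. x:U ==> EX W a f. openin (zariski R) W & x:W & W\<subseteq>U &
   (ALL fc:X. ALL y:W. on_stratum fc y --> a fc:carrier R - y & f fc:carrier R - y & val fc y=pull fc y (fr y (a fc) (f fc)))"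
  and compat: "!!x fc fc'. [|x:U; fc:X; fc':X; on_stratum fc x; on_stratum fc' x|] ==>
   pull (join fc fc') x (val fc x)=pull (join fc fc') x (val fc' x)"
 obtains s where "s:carrier (invertible_functions R (strata_ideal X) U)"
  "!!x fc. [|x:U; fc:X; on_stratum fc x|] ==> pull fc x (s x)=val fc x"
proof -
 let ?I = "strata_ideal X"
 have I: "ideal ?I R" using ideal_strata_ideal X(2) .
 have US: "U\<subseteq>Spec R" using openin_zariski_Spec[OF U] .
 have sub: "?I\<subseteq>strata_ideal {fc}" if "fc:X" for fc using that strata_ideal_antimono by simp
 have key: "EX W a f. openin (zariski R) W & x:W & W\<subseteq>U & a:carrier R & f:carrier R &
   (ALL y:W. a~:y & f~:y & (ALL fc:X. on_stratum fc y --> val fc y=pull fc y (fr y a f)))" if xU: "x:U" for x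
 proof -
  have x: "x:Spec R" using US xU by blast
  obtain W0 a0 f0 where W0: "openin (zariski R) W0" "x:W0" "W0\<subseteq>U" and
   v: "!!fc y. [|fc:X; y:W0; on_stratum fc y|] ==>
    a0 fc:carrier R - y & f0 fc:carrier R - y & val fc y=pull fc y (fr y (a0 fc) (f0 fc))"
   using loc[OF xU] by blast
  let ?X = "{fc:X. on_stratum fc x}"
  have "EX g:carrier (L x). ALL fc:?X. pull fc x g=pull fc x (fr x (a0 fc) (f0 fc))"
  proof (rule glue_germs[OF x])
   show "fr x (a0 fc) (f0 fc):carrier (L x)" if "fc:?X" for fc
    using v[of fc x] that W0 by (simp add: unit_germsI)
   fix fc fc' assume t: "fc:?X" "fc':?X"
   have j: "is_face (join fc fc')" "on_stratum (join fc fc') x" "fc\<subseteq>join fc fc'" "fc'\<subseteq>join fc fc'"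
    using t X(2) join_face[of fc fc'] on_stratum_join[OF x] by auto
   have "pull (join fc fc') x (val rh x)=pull (join fc fc') x (fr x (a0 rh) (f0 rh))" if "rh:?X" "rh\<subseteq>join fc fc'" for rh
    using v[of rh x] that W0 pull_absorb[OF x j(1,2) _ that(2) zero_ideal zero_sub] X(2) by (simp add: unit_germsI)
   thus "pull (join fc fc') x (fr x (a0 fc) (f0 fc))=pull (join fc fc') x (fr x (a0 fc') (f0 fc'))"
    using compat[OF xU, of fc fc'] t j by simp
  qed (use X in auto)
  then obtain g where g: "g:carrier (L x)" "ALL fc:?X. pull fc x g=pull fc x (fr x (a0 fc) (f0 fc))" by blast
  obtain a f where af: "a:carrier R - x" "f:carrier R - x" "g=fr x a f" using g(1) by (metis unit_germs_cases)
  have nb: "EX W. openin (zariski R) W & x:W & (ALL y:W. on_stratum fc y --> pull fc y (fr y a f)=pull fc y (fr y (a0 fc) (f0 fc)))"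
   if fc: "fc:X" for fc
  proof (cases "on_stratum fc x")
   case True
   have "a0 fc:carrier R - x" "f0 fc:carrier R - x" using v[OF fc W0(2) True] by auto
   moreover have "pull fc x (fr x a f)=pull fc x (fr x (a0 fc) (f0 fc))" using g(2) fc True af(3) by blast
   ultimately obtain W where "openin (zariski R) W" "x:W"
    "!!y. [|y:W; on_stratum fc y|] ==> pull fc y (fr y a f)=pull fc y (fr y (a0 fc) (f0 fc))"
    using spread_equality[OF x X(2)[OF fc] True af(1,2)] by metis
   thus ?thesis by (intro exI[of _ W]) simp
  next
   case False
   obtain W where "openin (zariski R) W" "x:W" "!!y. y:W ==> \<not> on_stratum fc y"
    using open_off_stratum[OF x False] by metis
   thus ?thesis by (intro exI[of _ W]) simp
  qed
  let ?A = "W0\<inter>{q:Spec R. a~:q}\<inter>{q:Spec R. f~:q}"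
  have A: "openin (zariski R) ?A" using W0(1) openin_basic[of a R] openin_basic[of f R] af by (intro openin_Int) auto
  have xA: "x:?A" using W0(2) x af by blast
  have "EX W. openin (zariski R) W & x:W & W\<subseteq>?A &
    (ALL fc:X. ALL y:W. on_stratum fc y --> pull fc y (fr y a f)=pull fc y (fr y (a0 fc) (f0 fc)))"
   by (rule open_nbhd_finite[OF X(1) _ A xA]) (rule nb)
  then obtain W where W: "openin (zariski R) W" "x:W" "W\<subseteq>?A"
   "ALL fc:X. ALL y:W. on_stratum fc y --> pull fc y (fr y a f)=pull fc y (fr y (a0 fc) (f0 fc))"
   by (elim exE conjE)
  have "a~:y & f~:y & (ALL fc:X. on_stratum fc y --> val fc y=pull fc y (fr y a f))" if "y:W" for y
  proof (intro conjI ballI impI)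
   show "a~:y" "f~:y" using that W(3) by auto
   fix fc assume t: "fc:X" "on_stratum fc y"
   have "y:W0" using that W(3) by blast
   thus "val fc y=pull fc y (fr y a f)" using v[OF t(1) _ t(2)] W(4) t that by simp
  qed
  hence all: "ALL y:W. a~:y & f~:y & (ALL fc:X. on_stratum fc y --> val fc y=pull fc y (fr y a f))"
   by (intro ballI)
  have "W\<subseteq>U" "a:carrier R" "f:carrier R" using W(3) W0(3) af by auto
  thus ?thesis using W(1,2) all by (intro exI conjI)
 qed
 define s where "s=(\<lambda>x\<in>U\<inter>zero_locus R ?I. SOME c. c:carrier (unit_germs R ?I x) &
  (ALL fc:X. on_stratum fc x --> pull fc x c=val fc x))"
 have s_eq: "s x=fraction R ?I x a f" if xU: "x:U\<inter>zero_locus R ?I" and af: "a:carrier R" "f:carrier R" "a~:x" "f~:x"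
  "ALL fc:X. on_stratum fc x --> val fc x=pull fc x (fr x a f)" for x a f
 proof -
  have x: "x:Spec R" using US xU by blast
  let ?Q = "%c. c:carrier (unit_germs R ?I x) & (ALL fc:X. on_stratum fc x --> pull fc x c=val fc x)"
  have af': "a:carrier R - x" "f:carrier R - x" using af by auto
  have "pull fc x (fraction R ?I x a f)=val fc x" if "fc:X" "on_stratum fc x" for fc
   using pull_fraction[OF x X(2)[OF that(1)] that(2) I sub[OF that(1)] af'] pull_fr[OF x X(2)[OF that(1)] that(2) af'] af(5) that by simp
  hence 1: "?Q (fraction R ?I x a f)" using af' by (simp add: unit_germsI)
  have uq: "c=fraction R ?I x a f" if Qc: "?Q c" for c
   by (rule germ_eqI[OF x X conjunct1[OF Qc] conjunct1[OF 1]]) (use Qc 1 in simp_all)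
  have "(SOME c. ?Q c)=fraction R ?I x a f" by (rule some_equality[where P="?Q"]) (rule 1, erule uq)
  thus ?thesis using xU by (simp add: s_def)
 qed
 have "R.locally_fraction ?I U s"
 proof (rule R.locally_fractionI)
  fix x assume xU: "x:U\<inter>zero_locus R ?I"
  then obtain W a f where W: "openin (zariski R) W" "x:W" "W\<subseteq>U" "a:carrier R" "f:carrier R"
   "ALL y:W. a~:y & f~:y & (ALL fc:X. on_stratum fc y --> val fc y=pull fc y (fr y a f))"
   using key[of x] by blast
  have "ALL q:W\<inter>zero_locus R ?I. a~:q & f~:q & s q=fraction R ?I q a f"
  proof
   fix q assume q: "q:W\<inter>zero_locus R ?I"
   hence qU: "q:U\<inter>zero_locus R ?I" using W(3) by blast
   from q have "q:W" by simp
   note vq = bspec[OF W(6) this]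
   have "s q=fraction R ?I q a f"
    by (rule s_eq[OF qU W(4,5) vq[THEN conjunct1] vq[THEN conjunct2, THEN conjunct1] vq[THEN conjunct2, THEN conjunct2]])
   thus "a~:q & f~:q & s q=fraction R ?I q a f" using vq by (elim conjE) (intro conjI)
  qed
  thus "EX W a f. openin (zariski R) W & x:W & W\<subseteq>U & a:carrier R & f:carrier R &
    (ALL q:W\<inter>zero_locus R ?I. a~:q & f~:q & s q=fraction R ?I q a f)"
   using W(1-5) by (intro exI conjI)
 qed
 hence sc: "s:carrier (invertible_functions R ?I U)"
  using R.carrier_invertible_functions[OF I U, of s] by (simp add: s_def)
 have "pull fc x (s x)=val fc x" if t: "x:U" "fc:X" "on_stratum fc x" for x fc
 proof -
  have x: "x:Spec R" using US t by blast
  have xU: "x:U\<inter>zero_locus R ?I" using zero_locus_strata_ideal[OF x X] t by blast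
  obtain W a f where k: "x:W" "a:carrier R" "f:carrier R"
    "ALL y:W. a~:y & f~:y & (ALL fc:X. on_stratum fc y --> val fc y=pull fc y (fr y a f))"
   using key[OF t(1)] by (elim exE conjE)
  note vq = bspec[OF k(4,1)]
  note af = k(2,3) vq[THEN conjunct1] vq[THEN conjunct2, THEN conjunct1] vq[THEN conjunct2, THEN conjunct2]
  have af': "a:carrier R - x" "f:carrier R - x" using af by auto
  show ?thesis unfolding s_eq[OF xU af] using pull_fraction[OF x X(2)[OF t(2)] t(3) I sub[OF t(2)] af']
    pull_fr[OF x X(2)[OF t(2)] t(3) af'] af(5) t by simp
 qed
 thus thesis using that sc by blast
qed

end

section \<open>Piecewise linear functions on the normal fan\<close>

context comm_group begin

lemma div_mult_div:
 "[|a:carrier G; b:carrier G; c:carrier G; e:carrier G|] ==>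
  (a\<otimes>inv b)\<otimes>(c\<otimes>inv e)=(a\<otimes>c)\<otimes>inv (b\<otimes>e)"
 by (simp add: inv_mult m_ac)

lemma div_eq_div_iff:
 assumes "a:carrier G" "b:carrier G" "c:carrier G" "e:carrier G"
 shows "a\<otimes>inv b=c\<otimes>inv e \<longleftrightarrow> a\<otimes>e=c\<otimes>b"
proof -
 have "a\<otimes>inv b=c\<otimes>inv e \<longleftrightarrow> (a\<otimes>inv b)\<otimes>(b\<otimes>e)=(c\<otimes>inv e)\<otimes>(b\<otimes>e)" using assms by simp
 also have "(a\<otimes>inv b)\<otimes>(b\<otimes>e)=a\<otimes>(inv b\<otimes>b)\<otimes>e" using assms by (simp only: m_assoc inv_closed m_closed)
 also have "...=a\<otimes>e" using assms by simp
 also have "(c\<otimes>inv e)\<otimes>(b\<otimes>e)=c\<otimes>(inv e\<otimes>e)\<otimes>b" using assms by (simp only: m_ac inv_closed m_closed)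
 also have "...=c\<otimes>b" using assms by simp
 finally show ?thesis .
qed

lemma finprod_int_pow:
 assumes "finite A" "!!v. v:A ==> F v:carrier G"
 shows "finprod G (%v. F v [^] (i v + j v :: int)) A=finprod G (%v. F v [^] i v) A\<otimes>finprod G (%v. F v [^] j v) A"
proof -
 have "finprod G (%v. F v [^] (i v + j v)) A=finprod G (%v. F v [^] i v\<otimes>F v [^] j v) A"
  using assms by (intro finprod_cong') (auto simp: int_pow_mult)
 also have "...=finprod G (%v. F v [^] i v) A\<otimes>finprod G (%v. F v [^] j v) A"
  using assms by (intro finprod_multf) auto
 finally show ?thesis .
qed

end

context full_lattice_polytope begin

text \<open>A family \<open>\<eta>\<close> indexed by \<open>N\<close> that is additive on each maximal cone of the normal fan belonging to a vertex of \<open>fc\<close>: a multiplicative piecewise linear function.\<close>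
definition pl_on :: "('g, 'x) monoid_scheme=>'a set=>('a=>'g)=>bool" where
 "pl_on G fc \<eta> \<longleftrightarrow> (ALL v. v extreme_point_of \<sigma> --> v:fc --> (ALL w:N. v:minface w --> \<eta> w:carrier G &
   (ALL w':N. v:minface w' --> \<eta> (w + w')=\<eta> w\<otimes>\<^bsub>G\<^esub>\<eta> w')))"

definition shift :: "'a=>'a=>'a" where
 "shift v w=(SOME c. c:N & v:minface c & v:minface (w + c))"

text \<open>The linear function on \<open>N\<close> that extends \<open>\<eta>\<close> from the maximal cone at \<open>v\<close>, computed by shifting the argument into that cone.\<close>
definition ext :: "('g, 'x) monoid_scheme=>('a=>'g)=>'a=>'a=>'g" where
 "ext G \<eta> v w=\<eta> (w + shift v w)\<otimes>\<^bsub>G\<^esub>inv\<^bsub>G\<^esub>\<eta> (shift v w)"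

lemma shift:
 assumes "v extreme_point_of \<sigma>" "w:N"
 shows "shift v w:N" "v:minface (shift v w)" "v:minface (w + shift v w)"
proof -
 obtain c where "c:N & v:minface c & v:minface (w + c)" using vertex_shift[OF assms] by metis
 hence "shift v w:N & v:minface (shift v w) & v:minface (w + shift v w)"
  unfolding shift_def by (rule someI)
 thus "shift v w:N" "v:minface (shift v w)" "v:minface (w + shift v w)" by auto
qed

lemma minface_addI: "[|v:minface w; v:minface w'|] ==> v:minface (w + w')"
 using minface_add[of w w'] by blast

lemma minface_zero: "minface 0=\<sigma>" by (auto simp: minface_def)

context
 fixes G :: "('g, 'x) monoid_scheme" and fc \<eta>
 assumes G: "comm_group G" and pl: "pl_on G fc \<eta>"
begin

interpretation G: comm_group G by (rule G)

lemma pl_closed: "[|v extreme_point_of \<sigma>; v:fc; w:N; v:minface w|] ==> \<eta> w:carrier G"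
 using pl by (simp add: pl_on_def)

lemma pl_add: "[|v extreme_point_of \<sigma>; v:fc; w:N; w':N; v:minface w; v:minface w'|] ==>
  \<eta> (w + w')=\<eta> w\<otimes>\<^bsub>G\<^esub>\<eta> w'"
 using pl by (simp add: pl_on_def)

lemma ext_eq:
 assumes v: "v extreme_point_of \<sigma>" "v:fc" and w: "w:N" and c: "c:N" "v:minface c" "v:minface (w + c)"
 shows "ext G \<eta> v w=\<eta> (w + c)\<otimes>\<^bsub>G\<^esub>inv\<^bsub>G\<^esub>\<eta> c"
proof -
 let ?s = "shift v w"
 note s = shift[OF v(1) w]
 have "\<eta> (w + ?s)\<otimes>\<^bsub>G\<^esub>\<eta> c=\<eta> ((w + ?s) + c)" using pl_add[OF v _ c(1) s(3) c(2)] add_N[OF w s(1)] by simp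
 also have "(w + ?s) + c=(w + c) + ?s" by (simp add: algebra_simps)
 also have "\<eta> ...=\<eta> (w + c)\<otimes>\<^bsub>G\<^esub>\<eta> ?s" using pl_add[OF v add_N[OF w c(1)] s(1) c(3) s(2)] .
 finally show ?thesis unfolding ext_def
  using G.div_eq_div_iff[OF pl_closed[OF v add_N[OF w s(1)] s(3)] pl_closed[OF v s(1,2)]
    pl_closed[OF v add_N[OF w c(1)] c(3)] pl_closed[OF v c(1,2)]] by simp
qed

lemma ext_closed: "[|v extreme_point_of \<sigma>; v:fc; w:N|] ==> ext G \<eta> v w:carrier G"
 unfolding ext_def using shift[of v w] pl_closed[of v] add_N by (intro G.m_closed G.inv_closed) auto

lemma ext_add:
 assumes v: "v extreme_point_of \<sigma>" "v:fc" and w: "w:N" "w':N"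
 shows "ext G \<eta> v (w + w')=ext G \<eta> v w\<otimes>\<^bsub>G\<^esub>ext G \<eta> v w'"
proof -
 let ?s = "shift v w" and ?s' = "shift v w'"
 note s = shift[OF v(1) w(1)] and s' = shift[OF v(1) w(2)]
 have eq: "(w + ?s) + (w' + ?s')=(w + w') + (?s + ?s')" by (simp add: algebra_simps)
 have m: "v:minface (?s + ?s')" "v:minface ((w + w') + (?s + ?s'))"
  using minface_addI[OF s(2) s'(2)] minface_addI[OF s(3) s'(3)] eq by simp_all
 have "ext G \<eta> v (w + w')=\<eta> ((w + w') + (?s + ?s'))\<otimes>\<^bsub>G\<^esub>inv\<^bsub>G\<^esub>\<eta> (?s + ?s')"
  by (rule ext_eq[OF v add_N[OF w] add_N[OF s(1) s'(1)] m])
 also have "\<eta> ((w + w') + (?s + ?s'))=\<eta> (w + ?s)\<otimes>\<^bsub>G\<^esub>\<eta> (w' + ?s')"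
  unfolding eq[symmetric] using pl_add[OF v add_N[OF w(1) s(1)] add_N[OF w(2) s'(1)] s(3) s'(3)] .
 also have "\<eta> (?s + ?s')=\<eta> ?s\<otimes>\<^bsub>G\<^esub>\<eta> ?s'" using pl_add[OF v s(1) s'(1) s(2) s'(2)] .
 finally show ?thesis unfolding ext_def
  using G.div_mult_div pl_closed[OF v add_N[OF w(1) s(1)] s(3)] pl_closed[OF v s(1,2)]
   pl_closed[OF v add_N[OF w(2) s'(1)] s'(3)] pl_closed[OF v s'(1,2)] by simp
qed

lemma ext_id:
 assumes v: "v extreme_point_of \<sigma>" "v:fc" and w: "w:N" "v:minface w"
 shows "ext G \<eta> v w=\<eta> w"
proof -
 have v0: "v:minface 0" using v(1) by (simp add: minface_zero extreme_point_of_def)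
 have z: "\<eta> 0:carrier G" using pl_closed[OF v zero_N v0] .
 have "\<eta> 0=\<eta> 0\<otimes>\<^bsub>G\<^esub>\<eta> 0" using pl_add[OF v zero_N zero_N v0 v0] by simp
 hence "\<eta> 0=\<one>\<^bsub>G\<^esub>" using z by (metis G.l_cancel_one)
 thus ?thesis using ext_eq[OF v w(1) zero_N v0] w(2) pl_closed[OF v w] by simp
qed

end

lemma additive_scale:
 assumes G: "comm_group G" and g: "!!w. w:N ==> g w:carrier G" "!!w w'. [|w:N; w':N|] ==> g (w + w')=g w\<otimes>\<^bsub>G\<^esub>g w'"
  and w: "w:N"
 shows "g (of_int i *\<^sub>R w)=g w [^]\<^bsub>G\<^esub>(i::int)"
proof -
 interpret G: comm_group G by (rule G)
 have g0: "g 0=\<one>\<^bsub>G\<^esub>" using g(2)[OF zero_N zero_N] g(1)[OF zero_N] by (metis G.l_cancel_one add_0)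
 have nat: "g (of_int (int k) *\<^sub>R w)=g w [^]\<^bsub>G\<^esub>(int k)" for k
 proof (induction k)
  case (Suc k)
  have "of_int (int (Suc k)) *\<^sub>R w = of_int (int k) *\<^sub>R w + w" by (simp add: algebra_simps)
  hence "g (of_int (int (Suc k)) *\<^sub>R w)=g w [^]\<^bsub>G\<^esub>(int k)\<otimes>\<^bsub>G\<^esub>g w"
   using g(2)[OF scale_N[OF w] w, of "int k"] Suc by simp
  also have "...=g w [^]\<^bsub>G\<^esub>(int k + 1)" using g(1)[OF w] by (simp add: G.int_pow_mult G.int_pow_1)
  finally show ?case by (simp add: add.commute)
 qed (simp add: g0)
 show ?thesis
 proof (cases "i\<ge>0")
  case True
  thus ?thesis using nat[of "nat i"] by simp
 next
  case False
  have "of_int i *\<^sub>R w + of_int (- i) *\<^sub>R w=0" by simp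
  hence "g (of_int i *\<^sub>R w)\<otimes>\<^bsub>G\<^esub>g (of_int (- i) *\<^sub>R w)=\<one>\<^bsub>G\<^esub>" using g(2)[OF scale_N[OF w] scale_N[OF w], of i "- i"] g0 by simp
  hence "g (of_int i *\<^sub>R w)=inv\<^bsub>G\<^esub>g (of_int (- i) *\<^sub>R w)"
   using g(1)[OF scale_N[OF w]] by (metis G.inv_equality)
  also have "g (of_int (- i) *\<^sub>R w)=g w [^]\<^bsub>G\<^esub>(- i)" using nat[of "nat (- i)"] False by simp
  finally show ?thesis using g(1)[OF w] by (simp add: G.int_pow_neg)
 qed
qed

end

locale oriented_polytope = full_lattice_polytope +
 fixes d :: "'a set=>'a" and \<epsilon> :: "'a set=>'a set=>int"
 assumes prim: "ed edge_of \<sigma> ==> primitive_generator M ed (d ed)"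
  and signs: "two_face_of fc \<sigma> ==> sign_vector \<sigma> d fc (\<epsilon> fc)"
begin

definition ends :: "'a set=>'a\<times>'a" where
 "ends ed=(SOME p. ed=seg (fst p) (snd p) & (EX t>0. snd p - fst p=t *\<^sub>R d ed))"

abbreviation "src ed \<equiv> fst (ends ed)"
abbreviation "tgt ed \<equiv> snd (ends ed)"

lemma ends:
 assumes "ed edge_of \<sigma>"
 shows "ed=seg (src ed) (tgt ed)" "EX t>0. tgt ed - src ed=t *\<^sub>R d ed"
  "src ed extreme_point_of \<sigma>" "tgt ed extreme_point_of \<sigma>" "src ed~=tgt ed" "src ed:ed" "tgt ed:ed"
proof -
 obtain v v' t where "ed=seg v v'" "t > 0" "v' - v=t *\<^sub>R d ed"
  using edge_data[OF assms prim[OF assms]] by metis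
 hence "ed=seg (fst (v, v')) (snd (v, v')) & (EX t>0. snd (v, v') - fst (v, v')=t *\<^sub>R d ed)" by auto
 hence e: "ed=seg (src ed) (tgt ed) & (EX t>0. tgt ed - src ed=t *\<^sub>R d ed)"
  unfolding ends_def by (rule someI)
 thus e1: "ed=seg (src ed) (tgt ed)" and "EX t>0. tgt ed - src ed=t *\<^sub>R d ed" by auto
 have "seg (src ed) (tgt ed) edge_of \<sigma>" using assms e1 by simp
 thus "src ed extreme_point_of \<sigma>" "tgt ed extreme_point_of \<sigma>" "src ed~=tgt ed"
  using edge_of_extreme_points by blast+
 show "src ed:ed" "tgt ed:ed" using e1 by (metis ends_in_segment)+
qed

lemma edge_is_ends:
 assumes "seg a b edge_of \<sigma>"
 shows "(a=src (seg a b) & b=tgt (seg a b))\<or>(b=src (seg a b) & a=tgt (seg a b))"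
 using ends(1)[OF assms] closed_segment_eq[of a b] by (auto simp: doubleton_eq_iff)

definition deg :: "'a=>'a set=>int" where
 "deg w ed=\<lfloor>w\<bullet>d ed\<rfloor>"

lemma d_M: "ed edge_of \<sigma> ==> d ed:M"
 using edge_data[OF _ prim] by metis

lemma deg: "[|ed edge_of \<sigma>; w:N|] ==> of_int (deg w ed)=w\<bullet>d ed"
 using N_M_int[OF _ d_M] by (auto simp: deg_def elim!: Ints_cases)

lemma deg_zero_iff:
 assumes "ed edge_of \<sigma>" "w:N"
 shows "deg w ed=0 \<longleftrightarrow> w\<bullet>src ed=w\<bullet>tgt ed"
proof -
 obtain t where t: "t > 0" "tgt ed - src ed=t *\<^sub>R d ed" using ends(2)[OF assms(1)] by blast
 have "w\<bullet>tgt ed - w\<bullet>src ed=t * (w\<bullet>d ed)" using t(2) by (metis inner_diff_right inner_scaleR_right)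
 hence "w\<bullet>src ed=w\<bullet>tgt ed \<longleftrightarrow> w\<bullet>d ed=0" using t(1) by (metis cancel_comm_monoid_add_class.diff_cancel eq_iff_diff_eq_0 less_numeral_extra(3) mult_eq_0_iff)
 thus ?thesis using deg[OF assms] by (metis of_int_0_eq_iff)
qed

text \<open>A dual vector that measures the primitive direction of the edge.\<close>
definition dirw :: "'a set=>'a" where
 "dirw ed=(SOME w. w:N & w\<bullet>d ed=1)"

text \<open>A point of the wall of the edge, so deep inside that one step to either side stays in the two adjacent maximal cones.\<close>
definition base :: "'a set=>'a" where
 "base ed=(SOME c. c:N & ed\<subseteq>minface c & src ed:minface (c + dirw ed) & tgt ed:minface (c - dirw ed))"

lemma dirw:
 assumes "ed edge_of \<sigma>"
 shows "dirw ed:N" "dirw ed\<bullet>d ed=1"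
proof -
 obtain w where "w:N & w\<bullet>d ed=1" using edge_data[OF assms prim[OF assms]] by metis
 hence "dirw ed:N & dirw ed\<bullet>d ed=1" unfolding dirw_def by (rule someI)
 thus "dirw ed:N" "dirw ed\<bullet>d ed=1" by auto
qed

lemma base:
 assumes "ed edge_of \<sigma>"
 shows "base ed:N" "ed\<subseteq>minface (base ed)" "src ed:minface (base ed + dirw ed)" "tgt ed:minface (base ed - dirw ed)"
proof -
 obtain t where t: "t > 0" "tgt ed - src ed=t *\<^sub>R d ed" using ends(2)[OF assms(1)] by blast
 have "dirw ed\<bullet>tgt ed - dirw ed\<bullet>src ed=t * (dirw ed\<bullet>d ed)" using t(2) by (metis inner_diff_right inner_scaleR_right)
 hence le: "dirw ed\<bullet>src ed\<le>dirw ed\<bullet>tgt ed" using dirw[OF assms] t(1) by simp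
 obtain c where "c:N & ed\<subseteq>minface c & src ed:minface (c + dirw ed) & tgt ed:minface (c - dirw ed)"
  using edge_shift[OF assms prim[OF assms] ends(1)[OF assms] dirw(1)[OF assms] le] by metis
 hence "base ed:N & ed\<subseteq>minface (base ed) & src ed:minface (base ed + dirw ed) & tgt ed:minface (base ed - dirw ed)"
  unfolding base_def by (rule someI)
 thus "base ed:N" "ed\<subseteq>minface (base ed)" "src ed:minface (base ed + dirw ed)" "tgt ed:minface (base ed - dirw ed)" by auto
qed

text \<open>The failure of additivity across the wall of an edge, measured on one chosen triple of points. By \<open>ext_edge\<close> it determines the difference of the two linear extensions.\<close>
definition kink :: "('g, 'x) monoid_scheme=>('a=>'g)=>'a set=>'g" where
 "kink G \<eta> ed=(\<eta> (base ed)\<otimes>\<^bsub>G\<^esub>\<eta> (base ed))\<otimes>\<^bsub>G\<^esub>inv\<^bsub>G\<^esub>(\<eta> (base ed + dirw ed)\<otimes>\<^bsub>G\<^esub>\<eta> (base ed - dirw ed))"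

text \<open>Both extensions agree on functionals that vanish on the direction of the edge, because these move along the wall. Hence their quotient depends on \<open>w \<bullet> d\<close> only and is a power of its value for \<open>dirw\<close>, which the kink computes.\<close>
lemma ext_edge:
 assumes G: "comm_group G" and pl: "pl_on G fc \<eta>" and ed: "ed edge_of \<sigma>" "ed\<subseteq>fc" and w: "w:N"
 shows "kink G \<eta> ed:carrier G"
  "ext G \<eta> (tgt ed) w=ext G \<eta> (src ed) w\<otimes>\<^bsub>G\<^esub>kink G \<eta> ed [^]\<^bsub>G\<^esub>deg w ed"
proof -
 interpret G: comm_group G by (rule G)
 note e = ends[OF ed(1)] and b = base[OF ed(1)] and dw = dirw[OF ed(1)]
 let ?v = "src ed" and ?v' = "tgt ed" and ?c = "base ed" and ?w = "dirw ed"
 have v: "?v extreme_point_of \<sigma>" "?v:fc" and v': "?v' extreme_point_of \<sigma>" "?v':fc" using e ed(2) by auto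
 have c: "?v:minface ?c" "?v':minface ?c" using b e by auto
 have N: "?c + ?w:N" "?c - ?w:N" using b(1) dw(1) add_N minus_N by auto
 note cl = pl_closed[OF G pl v b(1) c(1)] pl_closed[OF G pl v N(1) b(3)] pl_closed[OF G pl v' N(2) b(4)]
 show k: "kink G \<eta> ed:carrier G" unfolding kink_def using cl by simp
 have flat: "ext G \<eta> ?v' w0=ext G \<eta> ?v w0" if w0: "w0:N" "w0\<bullet>d ed=0" for w0
 proof -
  have deg0: "deg w0 ed=0" using deg[OF ed(1) w0(1)] w0(2) by simp
  hence eq: "w0\<bullet>?v=w0\<bullet>?v'" using deg_zero_iff[OF ed(1) w0(1)] by simp
  obtain c where c: "c:N" "ed\<subseteq>minface c" "?v:minface (c + w0)" "?v':minface (c - w0)"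
   using edge_shift[OF ed(1) prim[OF ed(1)] e(1) w0(1)] eq by auto
  have "?v:minface c" "?v':minface c" using c(2) e by auto
  hence "c\<bullet>?v=c\<bullet>?v'" by (simp add: minface_hgt)
  hence "?v':minface (c + w0)" using c(3) eq v'(1) by (simp add: minface_hgt inner_add_left extreme_point_of_def)
  thus ?thesis
   using ext_eq[OF G pl v w0(1) c(1)] ext_eq[OF G pl v' w0(1) c(1)] c(3) \<open>?v \<in> minface c\<close> \<open>?v' \<in> minface c\<close>
   by (simp add: add.commute)
 qed
 have step: "ext G \<eta> ?v' ?w=ext G \<eta> ?v ?w\<otimes>\<^bsub>G\<^esub>kink G \<eta> ed"
 proof -
  have 1: "ext G \<eta> ?v ?w=\<eta> (?c + ?w)\<otimes>\<^bsub>G\<^esub>inv\<^bsub>G\<^esub>\<eta> ?c"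
   using ext_eq[OF G pl v dw(1) b(1) c(1)] b(3) by (simp add: add.commute)
  have 2: "ext G \<eta> ?v' ?w=\<eta> ?c\<otimes>\<^bsub>G\<^esub>inv\<^bsub>G\<^esub>\<eta> (?c - ?w)"
   using ext_eq[OF G pl v' dw(1) N(2) b(4)] c(2) by simp
  show ?thesis unfolding 1 2 kink_def
   using cl by (simp only: G.div_mult_div G.m_closed G.div_eq_div_iff) (simp add: G.m_ac)
 qed
 let ?m = "deg w ed"
 define w0 where "w0=w - of_int ?m *\<^sub>R ?w"
 have w0: "w0:N" "w0\<bullet>d ed=0"
  using minus_N[OF w scale_N[OF dw(1), of ?m]] deg[OF ed(1) w] dw(2) by (auto simp: w0_def inner_diff_left)
 have split: "w=w0 + of_int ?m *\<^sub>R ?w" by (simp add: w0_def)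
 have gen: "ext G \<eta> u w=ext G \<eta> u w0\<otimes>\<^bsub>G\<^esub>ext G \<eta> u ?w [^]\<^bsub>G\<^esub>?m" if u: "u extreme_point_of \<sigma>" "u:fc" for u
 proof -
  have "ext G \<eta> u (of_int ?m *\<^sub>R ?w)=ext G \<eta> u ?w [^]\<^bsub>G\<^esub>?m"
   by (rule additive_scale[OF G _ _ dw(1)]) (use ext_closed[OF G pl u] ext_add[OF G pl u] in auto)
  thus ?thesis using ext_add[OF G pl u w0(1) scale_N[OF dw(1)], of ?m] split by simp
 qed
 have cl2: "ext G \<eta> ?v w0:carrier G" "ext G \<eta> ?v ?w:carrier G" using ext_closed[OF G pl v] w0(1) dw(1) by auto
 have "ext G \<eta> ?v' w=ext G \<eta> ?v w0\<otimes>\<^bsub>G\<^esub>(ext G \<eta> ?v ?w [^]\<^bsub>G\<^esub>?m\<otimes>\<^bsub>G\<^esub>kink G \<eta> ed [^]\<^bsub>G\<^esub>?m)"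
  unfolding gen[OF v'] flat[OF w0] step using cl2 k by (simp add: G.int_pow_distrib)
 thus "ext G \<eta> ?v' w=ext G \<eta> ?v w\<otimes>\<^bsub>G\<^esub>kink G \<eta> ed [^]\<^bsub>G\<^esub>?m"
  unfolding gen[OF v] using cl2 k by (simp add: G.m_assoc)
qed

subsection \<open>The boundary of a polygon\<close>

abbreviation "edges_in fc \<equiv> {ed. ed edge_of \<sigma> & ed\<subseteq>fc}"

lemma finite_edges: "finite {ed. ed edge_of \<sigma>}"
 using finite_polytope_faces[OF polytope_\<sigma>] by (rule rev_finite_subset) (auto simp: edge_of_def)

lemma finite_edges_in: "finite (edges_in fc)"
 using finite_edges by (rule rev_finite_subset) auto

text \<open>At a vertex of a polygon exactly two edges meet, and seen from one of them the other endpoint lies on opposite sides; the area form makes the two contributions cancel.\<close>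
lemma sign_vector_sum_zero:
 assumes fc: "two_face_of fc \<sigma>" and v: "v extreme_point_of \<sigma>"
 shows "(\<Sum>ed\<in>edges_in fc. \<epsilon> fc ed * ((if v=tgt ed then 1 else 0) - (if v=src ed then 1 else 0)))=0"
proof -
 let ?f = "%ed. \<epsilon> fc ed * ((if v=tgt ed then 1 else 0) - (if v=src ed then 1 else 0))"
 have face: "fc face_of \<sigma>" and dim: "aff_dim fc=2" using fc by (auto simp: two_face_of_def)
 have p: "polytope fc" using face polytope_\<sigma> face_of_polytope_polytope by blast
 have off: "?f ed=0" if "ed:edges_in fc" "v~:ed" for ed using that ends(6,7)[of ed] by auto
 show ?thesis
 proof (cases "v:fc")
  case False
  thus ?thesis using off by (intro sum.neutral) blast
 next
  case True
  hence vfc: "v extreme_point_of fc" using extreme_point_of_face[OF face] v by blast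
  obtain u1 u2 where u: "u1~=u2" "{u. seg v u edge_of fc}={u1, u2}"
   using polygon_two_edges[OF p dim vfc] by blast
  let ?ed1 = "seg v u1" and ?ed2 = "seg v u2"
  have efc: "?ed1 edge_of fc" "?ed2 edge_of fc" using u(2) by blast+
  hence e: "?ed1:edges_in fc" "?ed2:edges_in fc" using edge_of_face[OF face] by auto
  have "?ed1~=?ed2" using u(1) by (auto simp: closed_segment_eq doubleton_eq_iff)
  have only: "ed=?ed1\<or>ed=?ed2" if ed: "ed:edges_in fc" "v:ed" for ed
  proof -
   have "ed edge_of fc" using ed edge_of_face[OF face] by auto
   then obtain w where w: "ed=seg v w" using edge_of_at_vertex[OF p _ ed(2) vfc] by blast
   hence "w:{u. seg v u edge_of fc}" using \<open>ed edge_of fc\<close> by simp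
   hence "w=u1\<or>w=u2" unfolding u(2) by simp
   thus ?thesis using w by blast
  qed
  have "(\<Sum>ed\<in>edges_in fc. ?f ed)=(\<Sum>ed\<in>{?ed1, ?ed2}. ?f ed)"
  proof (rule sum.mono_neutral_right[OF finite_edges_in])
   show "{?ed1, ?ed2}\<subseteq>edges_in fc" using e by blast
   show "ALL ed:edges_in fc - {?ed1, ?ed2}. ?f ed=0"
   proof
    fix ed assume ed: "ed:edges_in fc - {?ed1, ?ed2}"
    hence "v~:ed" using only by blast
    thus "?f ed=0" using off[of ed] ed by blast
   qed
  qed
  also have "...=?f ?ed1 + ?f ?ed2" using \<open>?ed1 \<noteq> ?ed2\<close> by simp
  also have "...=0"
  proof -
   obtain \<alpha> where \<alpha>: "area_form fc \<alpha>" and s: "!!ed. ed:edges_in fc ==> \<epsilon> fc ed:{1, -1} &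
    (ALL x:ed. ALL y:fc - ed. of_int (\<epsilon> fc ed)=sgn (\<alpha> (x - y) (d ed)))"
    using signs[OF fc] unfolding sign_vector_def by auto
   have bil: "bilinear \<alpha>" and alt: "!!x. \<alpha> x x=0" using \<alpha> by (auto simp: area_form_def)
   have anti: "\<alpha> x y=- \<alpha> y x" for x y
    using alt[of "x + y"] alt[of x] alt[of y] bil by (simp add: bilinear_ladd bilinear_radd)
   have main: "?f (seg v a)=sgn (\<alpha> (b - v) (a - v)) & \<alpha> (b - v) (a - v)~=0"
    if a: "seg v a edge_of fc" and b: "seg v b edge_of fc" "a~=b" for a b
   proof -
    let ?ed = "seg v a"
    have ed: "?ed:edges_in fc" using a edge_of_face[OF face] by auto
    hence ed\<sigma>: "?ed edge_of \<sigma>" by blast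
    have ba: "b extreme_point_of fc" "b~=v" using edge_of_extreme_points[OF b(1)] by auto
    have "b~:?ed"
    proof
     assume "b:?ed"
     hence "b extreme_point_of ?ed" using ba extreme_point_of_face[of ?ed fc] a by (auto simp: edge_of_def)
     thus False using ba b(2) by (simp add: extreme_point_of_segment)
    qed
    hence bfc: "b:fc - ?ed" using ba(1) by (auto simp: extreme_point_of_def)
    have sg: "of_int (\<epsilon> fc ?ed)=sgn (\<alpha> (v - b) (d ?ed))" "\<epsilon> fc ?ed:{1, -1}" using s[OF ed] bfc by auto
    obtain t where t: "t > 0" "tgt ?ed - src ?ed=t *\<^sub>R d ?ed" using ends(2)[OF ed\<sigma>] by blast
    have av: "a~=v" using edge_of_extreme_points[OF a] by auto
    have vb: "\<alpha> (v - b) z=- \<alpha> (b - v) z" for z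
     using bil by (metis bilinear_lneg minus_diff_eq)
    consider "src ?ed=v" "tgt ?ed=a" | "src ?ed=a" "tgt ?ed=v" using edge_is_ends[OF ed\<sigma>] by metis
    thus ?thesis
    proof cases
     case 1
     have "\<alpha> (b - v) (a - v)=t * \<alpha> (b - v) (d ?ed)" using t(2) bil 1 by (simp add: bilinear_rmul)
     hence "sgn (\<alpha> (b - v) (a - v))=sgn (\<alpha> (b - v) (d ?ed))" using t(1) by (simp add: sgn_mult)
     hence "sgn (\<alpha> (b - v) (a - v))=- of_int (\<epsilon> fc ?ed)" using sg(1) vb by (simp add: sgn_minus)
     thus ?thesis using 1 av sg(2) by auto
    next
     case 2
     have "\<alpha> (b - v) (v - a)=t * \<alpha> (b - v) (d ?ed)" using t(2) bil 2 by (simp add: bilinear_rmul)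
     moreover have "\<alpha> (b - v) (v - a)=- \<alpha> (b - v) (a - v)" using bil by (metis bilinear_rneg minus_diff_eq)
     ultimately have "- sgn (\<alpha> (b - v) (a - v))=sgn (\<alpha> (b - v) (d ?ed))"
      using t(1) by (metis sgn_minus sgn_mult mult_1 sgn_pos)
     hence "sgn (\<alpha> (b - v) (a - v)) = of_int (\<epsilon> fc ?ed)" using sg(1) vb by (simp add: sgn_minus)
     thus ?thesis using 2 av sg(2) by auto
    qed
   qed
   have "real_of_int (?f ?ed1 + ?f ?ed2)=sgn (\<alpha> (u2 - v) (u1 - v)) + sgn (\<alpha> (u1 - v) (u2 - v))"
    using main[OF efc u(1)] main[OF efc(2,1)] u(1) by simp
   also have "...=0" using anti[of "u1 - v" "u2 - v"] by (simp add: sgn_minus)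
   finally show ?thesis by linarith
  qed
  finally show ?thesis .
 qed
qed

text \<open>The boundary of a boundary vanishes: a product of differences over an oriented polygon is trivial.\<close>
lemma finprod_boundary:
 assumes G: "comm_group G" and fc: "two_face_of fc \<sigma>"
  and F: "!!v. [|v extreme_point_of \<sigma>; v:fc|] ==> F v:carrier G"
 shows "finprod G (%ed. (F (tgt ed)\<otimes>\<^bsub>G\<^esub>inv\<^bsub>G\<^esub>F (src ed)) [^]\<^bsub>G\<^esub>\<epsilon> fc ed) (edges_in fc)=\<one>\<^bsub>G\<^esub>"
proof -
 interpret G: comm_group G by (rule G)
 let ?V = "{v. v extreme_point_of \<sigma> & v:fc}"
 let ?k = "%ed v. \<epsilon> fc ed * ((if v=tgt ed then 1 else 0) - (if v=src ed then 1 else 0))"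
 have finV: "finite ?V" using finite_vertices by (rule rev_finite_subset) auto
 have FV: "F v:carrier G" if "v:?V" for v using F that by blast
 have single: "finprod G (%v. F v [^]\<^bsub>G\<^esub>(if v=u then i else 0 :: int)) ?V=F u [^]\<^bsub>G\<^esub>i" if u: "u:?V" for u i
 proof -
  have "finprod G (%v. F v [^]\<^bsub>G\<^esub>(if v=u then i else 0)) ?V=finprod G (%v. if u=v then F v [^]\<^bsub>G\<^esub>i else \<one>\<^bsub>G\<^esub>) ?V"
   using FV by (intro G.finprod_cong') auto
  also have "...=F u [^]\<^bsub>G\<^esub>i" using G.finprod_singleton[OF u finV, of "%v. F v [^]\<^bsub>G\<^esub>i"] FV by auto
  finally show ?thesis .
 qed
 have term_eq: "(F (tgt ed)\<otimes>\<^bsub>G\<^esub>inv\<^bsub>G\<^esub>F (src ed)) [^]\<^bsub>G\<^esub>\<epsilon> fc ed=finprod G (%v. F v [^]\<^bsub>G\<^esub>?k ed v) ?V"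
  if ed: "ed:edges_in fc" for ed
 proof -
  have ed\<sigma>: "ed edge_of \<sigma>" using ed by blast
  have st: "tgt ed:?V" "src ed:?V" using ends[OF ed\<sigma>] ed by blast+
  have "finprod G (%v. F v [^]\<^bsub>G\<^esub>?k ed v) ?V=finprod G (%v. F v [^]\<^bsub>G\<^esub>((if v=tgt ed then \<epsilon> fc ed else 0) + (if v=src ed then - \<epsilon> fc ed else 0))) ?V"
   using FV by (intro G.finprod_cong') auto
  also have "...=F (tgt ed) [^]\<^bsub>G\<^esub>\<epsilon> fc ed\<otimes>\<^bsub>G\<^esub>F (src ed) [^]\<^bsub>G\<^esub>(- \<epsilon> fc ed)"
   by (simp only: G.finprod_int_pow[OF finV FV, of "%v. v"] single[OF st(1)] single[OF st(2)])
  also have "...=(F (tgt ed)\<otimes>\<^bsub>G\<^esub>inv\<^bsub>G\<^esub>F (src ed)) [^]\<^bsub>G\<^esub>\<epsilon> fc ed"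
   using FV[OF st(1)] FV[OF st(2)] by (simp add: G.int_pow_distrib G.int_pow_inv G.int_pow_neg)
  finally show ?thesis by simp
 qed
 have "finprod G (%ed. finprod G (%v. F v [^]\<^bsub>G\<^esub>?k ed v) ?V) S=finprod G (%v. F v [^]\<^bsub>G\<^esub>(\<Sum>ed\<in>S. ?k ed v)) ?V"
  if "finite S" for S
  using that
 proof (induction S rule: finite_induct)
  case (insert ed S)
  have "finprod G (%ed. finprod G (%v. F v [^]\<^bsub>G\<^esub>?k ed v) ?V) (insert ed S) =
    finprod G (%v. F v [^]\<^bsub>G\<^esub>?k ed v) ?V\<otimes>\<^bsub>G\<^esub>finprod G (%v. F v [^]\<^bsub>G\<^esub>(\<Sum>ed\<in>S. ?k ed v)) ?V"
   unfolding insert.IH[symmetric] using insert.hyps FV by (intro G.finprod_insert) (auto intro!: G.finprod_closed)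
  also have "...=finprod G (%v. F v [^]\<^bsub>G\<^esub>(?k ed v + (\<Sum>ed\<in>S. ?k ed v))) ?V"
   using G.finprod_int_pow[OF finV FV] by simp
  finally show ?case using insert.hyps by simp
 qed (simp add: G.finprod_one_eqI)
 note sum_k = this[OF finite_edges_in]
 have "finprod G (%ed. (F (tgt ed)\<otimes>\<^bsub>G\<^esub>inv\<^bsub>G\<^esub>F (src ed)) [^]\<^bsub>G\<^esub>\<epsilon> fc ed) (edges_in fc)
   = finprod G (%ed. finprod G (%v. F v [^]\<^bsub>G\<^esub>?k ed v) ?V) (edges_in fc)"
  using term_eq FV by (intro G.finprod_cong') (auto intro!: G.finprod_closed)
 also have "...=finprod G (%v. F v [^]\<^bsub>G\<^esub>(\<Sum>ed\<in>edges_in fc. ?k ed v)) ?V" by (rule sum_k)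
 also have "...=\<one>\<^bsub>G\<^esub>"
 proof (rule G.finprod_one_eqI)
  fix v assume "v:?V"
  hence "(\<Sum>ed\<in>edges_in fc. ?k ed v)=0" using sign_vector_sum_zero[OF fc] by blast
  thus "F v [^]\<^bsub>G\<^esub>(\<Sum>ed\<in>edges_in fc. ?k ed v)=\<one>\<^bsub>G\<^esub>" by simp
 qed
 finally show ?thesis .
qed

definition oriented :: "('g, 'x) monoid_scheme=>('a set=>'g)=>'a=>'a=>'g" where
 "oriented G k a b=(if a=src (seg a b) then k (seg a b) else inv\<^bsub>G\<^esub>k (seg a b))"

lemma oriented_iff:
 assumes G: "comm_group G" and ab: "seg a b edge_of \<sigma>" and k: "k (seg a b):carrier G"
  and F: "F a:carrier G" "F b:carrier G"
 shows "F b=F a\<otimes>\<^bsub>G\<^esub>oriented G k a b \<longleftrightarrow>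
  F (tgt (seg a b))\<otimes>\<^bsub>G\<^esub>inv\<^bsub>G\<^esub>F (src (seg a b))=k (seg a b)"
proof -
 interpret G: comm_group G by (rule G)
 let ?ed = "seg a b"
 have ne: "a~=b" using edge_of_extreme_points(1)[OF ab] .
 consider "a=src ?ed" "b=tgt ?ed" | "b=src ?ed" "a=tgt ?ed" using edge_is_ends[OF ab] by blast
 thus ?thesis
 proof cases
  case 1
  have "F b=F a\<otimes>\<^bsub>G\<^esub>k ?ed \<longleftrightarrow> F b\<otimes>\<^bsub>G\<^esub>inv\<^bsub>G\<^esub>F a=k ?ed"
   using G.inv_solve_right'[of "k ?ed" "F b" "F a"] k F by (simp add: G.m_comm)
  thus ?thesis using 1 by (simp add: oriented_def)
 next
  case 2
  have "F b=F a\<otimes>\<^bsub>G\<^esub>inv\<^bsub>G\<^esub>k ?ed \<longleftrightarrow> F a\<otimes>\<^bsub>G\<^esub>inv\<^bsub>G\<^esub>F b=k ?ed"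
   using G.div_eq_div_iff[of "F b" "\<one>\<^bsub>G\<^esub>" "F a" "k ?ed"] G.div_eq_div_iff[of "F a" "F b" "k ?ed" "\<one>\<^bsub>G\<^esub>"] k F
   by (auto simp: G.m_comm)
  thus ?thesis using 2 ne by (auto simp: oriented_def)
 qed
qed

text \<open>The cycle condition determines the transport along one edge of the polygon by the transports along the others.\<close>
lemma polygon_closing:
 assumes G: "comm_group G" and ph: "two_face_of ph \<sigma>"
  and k: "!!ed. ed:edges_in ph ==> k ed:carrier G"
  and cyc: "finprod G (%ed. k ed [^]\<^bsub>G\<^esub>\<epsilon> ph ed) (edges_in ph)=\<one>\<^bsub>G\<^esub>"
  and uv: "seg v u edge_of ph"
  and F: "!!x. x extreme_point_of ph ==> F x:carrier G"
  and other: "!!a b. [|seg a b edge_of ph; {a, b}~={v, u}|] ==> F b=F a\<otimes>\<^bsub>G\<^esub>oriented G k a b"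
 shows "F u=F v\<otimes>\<^bsub>G\<^esub>oriented G k v u"
proof -
 interpret G: comm_group G by (rule G)
 have face: "ph face_of \<sigma>" using ph by (simp add: two_face_of_def)
 let ?ed = "seg v u"
 let ?q = "%ed. F (tgt ed)\<otimes>\<^bsub>G\<^esub>inv\<^bsub>G\<^esub>F (src ed)"
 have FV: "F x:carrier G" if "x extreme_point_of \<sigma>" "x:ph" for x using F that extreme_point_of_face[OF face] by blast
 have ec: "F (tgt ed):carrier G" "F (src ed):carrier G" if "ed:edges_in ph" for ed
  using that ends[of ed] FV by blast+
 have ed: "?ed:edges_in ph" using uv edge_of_face[OF face] by auto
 have rest: "?q ed=k ed" if o: "ed:edges_in ph" "ed~=?ed" for ed
 proof -
  have ed\<sigma>: "ed edge_of \<sigma>" using o by blast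
  have seg: "ed=seg (src ed) (tgt ed)" using ends(1)[OF ed\<sigma>] .
  have eph: "seg (src ed) (tgt ed) edge_of ph" using o seg edge_of_face[OF face] by auto
  have "{src ed, tgt ed}~={v, u}" using seg o(2) by (metis closed_segment_eq)
  hence "F (tgt ed)=F (src ed)\<otimes>\<^bsub>G\<^esub>oriented G k (src ed) (tgt ed)" using other[OF eph] by blast
  thus ?thesis
   using oriented_iff[OF G, of "src ed" "tgt ed" k F] seg[symmetric] ed\<sigma> k[OF o(1)] ec[OF o(1)] by simp
 qed
 let ?E = "edges_in ph - {?ed}"
 have E: "edges_in ph=insert ?ed ?E" using ed by blast
 have fin: "finite ?E" using finite_edges_in by blast
 have split: "finprod G (%ed. x ed [^]\<^bsub>G\<^esub>\<epsilon> ph ed) (edges_in ph)=x ?ed [^]\<^bsub>G\<^esub>\<epsilon> ph ?ed\<otimes>\<^bsub>G\<^esub>finprod G (%ed. x ed [^]\<^bsub>G\<^esub>\<epsilon> ph ed) ?E"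
  if "!!ed. ed:edges_in ph ==> x ed:carrier G" for x
  by (subst E) (use fin that ed in \<open>intro G.finprod_insert; auto\<close>)
 have q: "?q ed:carrier G" if "ed:edges_in ph" for ed using ec[OF that] by simp
 have eqE: "finprod G (%ed. ?q ed [^]\<^bsub>G\<^esub>\<epsilon> ph ed) ?E=finprod G (%ed. k ed [^]\<^bsub>G\<^esub>\<epsilon> ph ed) ?E"
  using rest k by (intro G.finprod_cong') auto
 have pE: "finprod G (%ed. k ed [^]\<^bsub>G\<^esub>\<epsilon> ph ed) ?E:carrier G" using k by (intro G.finprod_closed) auto
 have "?q ?ed [^]\<^bsub>G\<^esub>\<epsilon> ph ?ed\<otimes>\<^bsub>G\<^esub>finprod G (%ed. k ed [^]\<^bsub>G\<^esub>\<epsilon> ph ed) ?E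
   = k ?ed [^]\<^bsub>G\<^esub>\<epsilon> ph ?ed\<otimes>\<^bsub>G\<^esub>finprod G (%ed. k ed [^]\<^bsub>G\<^esub>\<epsilon> ph ed) ?E"
  using finprod_boundary[OF G ph, of F, OF FV] cyc split[of ?q] split[of k] q k eqE by simp
 hence pow: "?q ?ed [^]\<^bsub>G\<^esub>\<epsilon> ph ?ed=k ?ed [^]\<^bsub>G\<^esub>\<epsilon> ph ?ed"
  using pE q[OF ed] k[OF ed] by simp
 have "\<epsilon> ph ?ed:{1, -1}" using signs[OF ph] ed unfolding sign_vector_def by blast
 hence "?q ?ed=k ?ed"
 proof (cases "\<epsilon> ph ?ed=1")
  case True
  thus ?thesis using pow q[OF ed] k[OF ed] by (simp add: G.int_pow_1)
 next
  case False
  hence "\<epsilon> ph ?ed=-1" using \<open>\<epsilon> ph ?ed \<in> {1, -1}\<close> by blast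
  hence "inv\<^bsub>G\<^esub>?q ?ed=inv\<^bsub>G\<^esub>k ?ed" using pow q[OF ed] k[OF ed] by (simp add: G.int_pow_neg G.int_pow_1)
  thus ?thesis using G.inv_inj q[OF ed] k[OF ed] by (meson inj_onD)
 qed
 thus ?thesis
  using oriented_iff[OF G, of v u k F] ed k[OF ed] F edge_of_extreme_points[OF uv] by simp
qed

end

section \<open>Lifting cochains at a point\<close>

lemma finprod_hom:
 assumes "comm_group G" "comm_group H" "h:hom G H" "finite A" "!!i. i:A ==> f i:carrier G"
 shows "h (finprod G f A)=finprod H (%i. h (f i)) A"
proof -
 interpret G: comm_group G by fact
 interpret H: comm_group H by fact
 interpret h: group_hom G H h by (simp add: group_hom_def group_hom_axioms_def assms(3) G.is_group H.is_group)
 show ?thesis using assms(4,5)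
 proof (induction A rule: finite_induct)
  case (insert i A)
  have "h (finprod G f (insert i A))=h (f i\<otimes>\<^bsub>G\<^esub>finprod G f A)"
   using insert by (subst G.finprod_insert) auto
  also have "...=h (f i)\<otimes>\<^bsub>H\<^esub>finprod H (%i. h (f i)) A"
   using insert by (subst h.hom_mult) (auto intro!: G.finprod_closed)
  also have "...=finprod H (%i. h (f i)) (insert i A)" using insert by (subst H.finprod_insert) auto
  finally show ?case .
 qed simp
qed

locale oriented_log_scheme = log_scheme M \<sigma> n r R + oriented_polytope M \<sigma> n d \<epsilon>
 for M \<sigma> :: "'a::euclidean_space set" and n r and R :: "('a, 'k::field) fun_ring" and d \<epsilon>
begin

abbreviation "cob x h ed \<equiv> h (tgt ed)\<otimes>\<^bsub>L x\<^esub>inv\<^bsub>L x\<^esub>h (src ed)"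

lemma oriented_swap:
 assumes G: "comm_group G" and ab: "seg a b edge_of \<sigma>" and k: "k (seg a b):carrier G"
 shows "oriented G k b a=inv\<^bsub>G\<^esub>oriented G k a b" "oriented G k a b:carrier G"
proof -
 interpret G: comm_group G by (rule G)
 have ne: "a~=b" using edge_of_extreme_points(1)[OF ab] .
 have c: "seg b a=seg a b" by (rule closed_segment_commute)
 show "oriented G k a b:carrier G" using k by (simp add: oriented_def)
 consider "a=src (seg a b)" "b=tgt (seg a b)" | "b=src (seg a b)" "a=tgt (seg a b)"
  using edge_is_ends[OF ab] by blast
 thus "oriented G k b a=inv\<^bsub>G\<^esub>oriented G k a b"
 proof cases
  case 1
  hence "b~=src (seg a b)" using ne by metis
  thus ?thesis using 1(1) by (simp add: oriented_def c)
 next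
  case 2
  hence "a~=src (seg a b)" using ne by metis
  thus ?thesis using 2(1) k by (simp add: oriented_def c)
 qed
qed

lemma pull_group_hom: "[|x:Spec R; is_face fc; on_stratum fc x|] ==> group_hom (L x) (L x) (pull fc x)"
 using comm_group_L[of x] by (simp add: group_hom_def group_hom_axioms_def pull_endo comm_group.axioms(2))

lemma pull_absorb_L:
 "[|x:Spec R; is_face fc; on_stratum fc x; is_face fc'; fc'\<subseteq>fc; c:carrier (L x)|] ==> pull fc x (pull fc' x c)=pull fc x c"
 using pull_absorb[OF _ _ _ _ _ zero_ideal zero_sub] .

lemma pull_pull_L:
 "[|x:Spec R; is_face fc; on_stratum fc x; is_face fc'; on_stratum fc' x; c:carrier (L x)|] ==> pull fc x (pull fc' x c)=pull (join fc fc') x c"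
 using pull_pull[OF _ _ _ _ _ zero_ideal zero_sub] .

text \<open>The error of a cochain \<open>h\<close> on a stratum satisfies the cycle condition on every two-dimensional face, so the simple connectedness of the face yields a primitive of it.\<close>
lemma extend_cochain_over_face:
 assumes x: "x:Spec R" and fc: "is_face fc" "on_stratum fc x"
  and c: "!!ed. ed edge_of \<sigma> ==> c ed:carrier (L x)"
  and cyc: "!!ph. [|two_face_of ph \<sigma>; on_stratum ph x|] ==>
   finprod (L x) (%ed. pull ph x (c ed) [^]\<^bsub>L x\<^esub>\<epsilon> ph ed) (edges_in ph)=\<one>\<^bsub>L x\<^esub>"
  and h: "!!v. v extreme_point_of \<sigma> ==> h v:carrier (L x)"
 obtains F v0 where "v0 extreme_point_of fc" "F v0=\<one>\<^bsub>L x\<^esub>" "!!v. v extreme_point_of fc ==> F v:carrier (L x)"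
  "!!ed. ed:edges_in fc ==> cob x F ed =
    pull fc x (c ed)\<otimes>\<^bsub>L x\<^esub>inv\<^bsub>L x\<^esub>pull fc x (cob x h ed)"
proof -
 have LG: "comm_group (L x)" using comm_group_L[OF x] .
 interpret G: comm_group "L x" by (rule LG)
 interpret p: group_hom "L x" "L x" "pull fc x" using pull_group_hom[OF x fc] .
 have face: "fc face_of \<sigma>" using fc by (simp add: is_face_def)
 have pfc: "polytope fc" "fc~={}" using face fc polytope_\<sigma> face_of_polytope_polytope by (auto simp: is_face_def)
 define e where "e=(%ed. pull fc x (c ed)\<otimes>\<^bsub>L x\<^esub>inv\<^bsub>L x\<^esub>pull fc x (cob x h ed))"
 have hc: "h (tgt ed):carrier (L x)" "h (src ed):carrier (L x)" if "ed edge_of \<sigma>" for ed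
  using h ends[OF that] by auto
 have e: "e ed:carrier (L x)" if "ed edge_of \<sigma>" for ed
  using c[OF that] hc[OF that] by (simp add: e_def)
 have edgefc: "seg a b edge_of \<sigma>" if "seg a b edge_of fc" for a b
  using that edge_of_face[OF face] by blast
 define T where "T=(%a b g. g\<otimes>\<^bsub>L x\<^esub>oriented (L x) e a b)"
 have swap: "oriented (L x) e b a=inv\<^bsub>L x\<^esub>oriented (L x) e a b" "oriented (L x) e a b:carrier (L x)"
  if "seg a b edge_of fc" for a b
  using oriented_swap[OF LG edgefc[OF that], of e] e[OF edgefc[OF that]] by blast+
 obtain F v0 where F: "v0 extreme_point_of fc" "F v0=\<one>\<^bsub>L x\<^esub>" "!!v. v extreme_point_of fc ==> F v:carrier (L x)"
  "!!a b. seg a b edge_of fc ==> F b=T a b (F a)"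
 proof (rule polytope_simply_connected[OF pfc, of "carrier (L x)" T "\<one>\<^bsub>L x\<^esub>"])
  fix u v g assume uv: "seg u v edge_of fc" "g:carrier (L x)"
  show "T u v g:carrier (L x)" using uv swap(2) by (simp add: T_def)
  show "T v u (T u v g)=g" using uv swap[OF uv(1)] by (simp add: T_def G.m_assoc)
 next
  fix ph F v u
  assume ph: "ph face_of fc" "aff_dim ph=2" and vu: "seg v u edge_of ph"
   and F: "!!x'. x' extreme_point_of ph ==> F x':carrier (L x)"
   and other: "!!a b. [|seg a b edge_of ph; {a, b}~={v, u}|] ==> F b=T a b (F a)"
  have two: "two_face_of ph \<sigma>" using face_of_trans[OF ph(1) face] ph(2) by (simp add: two_face_of_def)
  have fph: "is_face ph" "ph\<subseteq>fc" using two ph face_of_imp_subset by (auto simp: is_face_def two_face_of_def)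
  have on: "on_stratum ph x" using on_stratum_mono[OF fc(1) fph fc(2)] .
  interpret pph: group_hom "L x" "L x" "pull ph x" using pull_group_hom[OF x fph(1) on] .
  have cph: "c ed:carrier (L x)" "h (tgt ed):carrier (L x)" "h (src ed):carrier (L x)" if "ed:edges_in ph" for ed
   using that c hc by auto
  have 1: "finprod (L x) (%ed. pull fc x (c ed) [^]\<^bsub>L x\<^esub>\<epsilon> ph ed) (edges_in ph)=\<one>\<^bsub>L x\<^esub>"
  proof -
   have "pull fc x (pull ph x (c ed) [^]\<^bsub>L x\<^esub>\<epsilon> ph ed)=pull fc x (c ed) [^]\<^bsub>L x\<^esub>\<epsilon> ph ed" if "ed:edges_in ph" for ed
    using cph[OF that] pull_absorb_L[OF x fc fph] by (simp add: p.hom_int_pow)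
   hence "finprod (L x) (%ed. pull fc x (c ed) [^]\<^bsub>L x\<^esub>\<epsilon> ph ed) (edges_in ph)
     = finprod (L x) (%ed. pull fc x (pull ph x (c ed) [^]\<^bsub>L x\<^esub>\<epsilon> ph ed)) (edges_in ph)"
    using cph by (intro G.finprod_cong') auto
   also have "...=pull fc x (finprod (L x) (%ed. pull ph x (c ed) [^]\<^bsub>L x\<^esub>\<epsilon> ph ed) (edges_in ph))"
    using cph by (intro finprod_hom[OF LG LG pull_endo[OF x fc] finite_edges_in, symmetric]) auto
   finally show ?thesis using cyc[OF two on] by simp
  qed
  have H: "pull fc x (h v):carrier (L x)" if "v extreme_point_of \<sigma>" for v using h[OF that] by simp
  have 2: "finprod (L x) (%ed. pull fc x (cob x h ed) [^]\<^bsub>L x\<^esub>\<epsilon> ph ed) (edges_in ph)=\<one>\<^bsub>L x\<^esub>"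
  proof -
   have "finprod (L x) (%ed. pull fc x (cob x h ed) [^]\<^bsub>L x\<^esub>\<epsilon> ph ed) (edges_in ph)
    = finprod (L x) (%ed. (pull fc x (h (tgt ed))\<otimes>\<^bsub>L x\<^esub>inv\<^bsub>L x\<^esub>pull fc x (h (src ed))) [^]\<^bsub>L x\<^esub>\<epsilon> ph ed) (edges_in ph)"
    using cph by (intro G.finprod_cong') auto
   also have "...=\<one>\<^bsub>L x\<^esub>" using finprod_boundary[OF LG two, of "%v. pull fc x (h v)"] H by blast
   finally show ?thesis .
  qed
  have cyc_e: "finprod (L x) (%ed. e ed [^]\<^bsub>L x\<^esub>\<epsilon> ph ed) (edges_in ph)=\<one>\<^bsub>L x\<^esub>"
  proof -
   let ?a = "%ed. pull fc x (c ed) [^]\<^bsub>L x\<^esub>\<epsilon> ph ed"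
   let ?b = "%ed. pull fc x (cob x h ed) [^]\<^bsub>L x\<^esub>\<epsilon> ph ed"
   have "e ed [^]\<^bsub>L x\<^esub>\<epsilon> ph ed\<otimes>\<^bsub>L x\<^esub>?b ed=?a ed" if "ed:edges_in ph" for ed
    using cph[OF that] by (simp add: e_def G.int_pow_distrib[symmetric] G.m_assoc)
   hence "finprod (L x) ?a (edges_in ph)=finprod (L x) (%ed. e ed [^]\<^bsub>L x\<^esub>\<epsilon> ph ed\<otimes>\<^bsub>L x\<^esub>?b ed) (edges_in ph)"
    using cph by (intro G.finprod_cong') (auto simp: Pi_iff)
   also have "...=finprod (L x) (%ed. e ed [^]\<^bsub>L x\<^esub>\<epsilon> ph ed) (edges_in ph)\<otimes>\<^bsub>L x\<^esub>finprod (L x) ?b (edges_in ph)"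
    using cph e by (intro G.finprod_multf) auto
   finally show ?thesis using 1 2 e by simp
  qed
  show "F u=T v u (F v)" unfolding T_def
  proof (rule polygon_closing[OF LG two _ cyc_e vu F])
   show "e ed:carrier (L x)" if "ed:edges_in ph" for ed using e that by blast
   show "F b=F a\<otimes>\<^bsub>L x\<^esub>oriented (L x) e a b" if "seg a b edge_of ph" "{a, b}~={v, u}" for a b
    using other[OF that] by (simp add: T_def)
  qed
 qed auto
 have "cob x F ed=e ed" if ed: "ed:edges_in fc" for ed
 proof -
  have ed\<sigma>: "ed edge_of \<sigma>" using ed by blast
  have seg: "seg (src ed) (tgt ed)=ed" using ends(1)[OF ed\<sigma>] by simp
  have edg: "seg (src ed) (tgt ed) edge_of fc" using ed seg edge_of_face[OF face] by auto
  have Fc: "F (src ed):carrier (L x)" "F (tgt ed):carrier (L x)" using F(3) edge_of_extreme_points[OF edg] by auto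
  have "F (tgt ed)=F (src ed)\<otimes>\<^bsub>L x\<^esub>oriented (L x) e (src ed) (tgt ed)" using F(4)[OF edg] by (simp add: T_def)
  thus ?thesis
   using oriented_iff[OF LG, of "src ed" "tgt ed" e F] e[OF ed\<sigma>] Fc ed\<sigma> unfolding seg by blast
 qed
 note edge = this
 show thesis
 proof (rule that[of v0 F])
  show "v0 extreme_point_of fc" "F v0=\<one>\<^bsub>L x\<^esub>" by (rule F(1), rule F(2))
 next
  fix v assume "v extreme_point_of fc"
  thus "F v:carrier (L x)" by (rule F(3))
 next
  fix ed assume "ed:edges_in fc"
  from edge[OF this] show "cob x F ed =
    pull fc x (c ed)\<otimes>\<^bsub>L x\<^esub>inv\<^bsub>L x\<^esub>pull fc x (cob x h ed)"
   unfolding e_def .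
 qed
qed

text \<open>The relations on different strata have to be solved simultaneously. They are treated in order of decreasing faces, that is, of increasing strata: on a smaller stratum the correction found for a larger one is already trivial, up to a constant that does not change any difference.\<close>
lemma lift_cochain:
 assumes x: "x:Spec R"
  and c: "!!ed. ed edge_of \<sigma> ==> c ed:carrier (L x)"
  and cyc: "!!ph. [|two_face_of ph \<sigma>; on_stratum ph x|] ==>
   finprod (L x) (%ed. pull ph x (c ed) [^]\<^bsub>L x\<^esub>\<epsilon> ph ed) (edges_in ph)=\<one>\<^bsub>L x\<^esub>"
 obtains h where "!!v. v extreme_point_of \<sigma> ==> h v:carrier (L x)"
  "!!ed. [|ed edge_of \<sigma>; on_stratum ed x|] ==> pull ed x (cob x h ed)=pull ed x (c ed)"
proof -
 have LG: "comm_group (L x)" using comm_group_L[OF x] .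
 interpret G: comm_group "L x" by (rule LG)
 let ?\<T> = "{fc. is_face fc & on_stratum fc x}"
 have fin: "finite ?\<T>" using finite_faces by (rule rev_finite_subset) auto
 have "EX h. (ALL v. v extreme_point_of \<sigma> --> h v:carrier (L x)) &
   (ALL fc:\<U>. ALL ed:edges_in fc. pull fc x (cob x h ed)=pull fc x (c ed))"
  if "\<U>\<subseteq>?\<T>" "ALL fc:\<U>. ALL fc':?\<T>. fc\<subseteq>fc' --> fc':\<U>" for \<U>
  using that
 proof (induction "card \<U>" arbitrary: \<U> rule: less_induct)
  case less
  have fU: "finite \<U>" using less.prems(1) fin finite_subset by blast
  show ?case
  proof (cases "\<U>={}")
   case True
   thus ?thesis by (intro exI[of _ "%_. \<one>\<^bsub>L x\<^esub>"]) auto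
  next
   case False
   obtain fc where fcU: "fc:\<U>" and min: "!!fc'. fc':\<U> ==> fc'\<subseteq>fc ==> fc=fc'"
    using finite_has_minimal[OF fU False] by blast
   have fc: "is_face fc" "on_stratum fc x" using fcU less.prems(1) by auto
   let ?U' = "\<U> - {fc}"
   have U': "?U'\<subseteq>?\<T>" "ALL rh:?U'. ALL fc':?\<T>. rh\<subseteq>fc' --> fc':?U'"
    using less.prems min by (blast, blast)
   have "card ?U' < card \<U>" using fU fcU by (meson card_Diff1_less)
   have IH: "EX h. (ALL v. v extreme_point_of \<sigma> --> h v:carrier (L x)) &
   (ALL rh:?U'. ALL ed:edges_in rh. pull rh x (cob x h ed)=pull rh x (c ed))"
    using \<open>card ?U' < card \<U>\<close> U' by (rule less.hyps)
   then obtain h where h: "ALL v. v extreme_point_of \<sigma> --> h v:carrier (L x)"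
    "ALL rh:?U'. ALL ed:edges_in rh. pull rh x (cob x h ed)=pull rh x (c ed)" by (elim exE conjE)
   have hv: "h v:carrier (L x)" if "v extreme_point_of \<sigma>" for v using h(1) that by blast
   obtain F v0 where F: "v0 extreme_point_of fc" "F v0=\<one>\<^bsub>L x\<^esub>" "!!v. v extreme_point_of fc ==> F v:carrier (L x)"
    "!!ed. ed:edges_in fc ==> cob x F ed =
     pull fc x (c ed)\<otimes>\<^bsub>L x\<^esub>inv\<^bsub>L x\<^esub>pull fc x (cob x h ed)"
   proof (rule extend_cochain_over_face[where c = c and h = h, OF x fc c cyc hv])
    fix F v0
    assume F: "v0 extreme_point_of fc" "F v0=\<one>\<^bsub>L x\<^esub>" "!!v. v extreme_point_of fc ==> F v:carrier (L x)"
     "!!ed. ed:edges_in fc ==> cob x F ed =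
      pull fc x (c ed)\<otimes>\<^bsub>L x\<^esub>inv\<^bsub>L x\<^esub>pull fc x (cob x h ed)"
    show thesis by (rule that[of v0 F]) (fact F)+
   qed
   have face: "fc face_of \<sigma>" using fc by (simp add: is_face_def)
   have pfc: "polytope fc" using face polytope_\<sigma> face_of_polytope_polytope by blast
   have extfc: "v extreme_point_of fc \<longleftrightarrow> v extreme_point_of \<sigma> & v:fc" for v using extreme_point_of_face[OF face] .
   define h' where "h'=(%v. if v:fc then h v\<otimes>\<^bsub>L x\<^esub>pull fc x (F v) else h v)"
   interpret pfc: group_hom "L x" "L x" "pull fc x" using pull_group_hom[OF x fc] .
   have h'c: "h' v:carrier (L x)" if "v extreme_point_of \<sigma>" for v
    using hv[OF that] F(3)[of v] that extfc by (auto simp: h'_def)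
   \<comment> \<open>On the smaller strata treated before, the correction is trivial.\<close>
   have triv: "pull rh x (F v)=\<one>\<^bsub>L x\<^esub>" if rh: "rh:?U'" "fc\<subseteq>rh" and v: "v extreme_point_of fc" for rh v
   proof -
    have frh: "is_face rh" "on_stratum rh x" using rh U'(1) by auto
    interpret prh: group_hom "L x" "L x" "pull rh x" using pull_group_hom[OF x frh] .
    have step: "pull rh x (F b)=pull rh x (F a)" if ab: "seg a b edge_of fc" for a b
    proof -
     let ?ed = "seg a b"
     have ed: "?ed:edges_in fc" using ab edge_of_face[OF face] by auto
     hence ed\<sigma>: "?ed edge_of \<sigma>" by blast
     note e = ends[OF ed\<sigma>]
     have Fc: "F (tgt ?ed):carrier (L x)" "F (src ?ed):carrier (L x)" using F(3) extfc e ed by blast+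
     let ?D = "h (tgt ?ed)\<otimes>\<^bsub>L x\<^esub>inv\<^bsub>L x\<^esub>h (src ?ed)"
     have D: "?D:carrier (L x)" using hv e by simp
     have "pull rh x (F (tgt ?ed)\<otimes>\<^bsub>L x\<^esub>inv\<^bsub>L x\<^esub>F (src ?ed))=pull rh x (c ?ed)\<otimes>\<^bsub>L x\<^esub>inv\<^bsub>L x\<^esub>pull rh x ?D"
      unfolding F(4)[OF ed] using D c[OF ed\<sigma>] pull_absorb_L[OF x frh fc(1) rh(2)] by simp
     also have "pull rh x ?D=pull rh x (c ?ed)" using h(2) rh ed by blast
     finally have "pull rh x (F (tgt ?ed))\<otimes>\<^bsub>L x\<^esub>inv\<^bsub>L x\<^esub>pull rh x (F (src ?ed))=\<one>\<^bsub>L x\<^esub>" using Fc c[OF ed\<sigma>] by simp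
     hence "pull rh x (F (tgt ?ed))=pull rh x (F (src ?ed))"
      using Fc G.inv_solve_right'[of "\<one>\<^bsub>L x\<^esub>" "pull rh x (F (tgt ?ed))" "pull rh x (F (src ?ed))"] by simp
     thus ?thesis using edge_is_ends[OF ed\<sigma>] by metis
    qed
    have "(v0, v):(adjacent fc)\<^sup>*" using polytope_graph_connected[OF pfc F(1) v] .
    hence "pull rh x (F v)=pull rh x (F v0)"
    proof (induction rule: rtrancl_induct)
     case (step a b)
     thus ?case using \<open>\<And>b a. seg a b edge_of fc \<Longrightarrow> pull rh x (F b) = pull rh x (F a)\<close>[of a b]
      by (simp add: adjacent_def)
    qed simp
    thus ?thesis using F(2) by simp
   qed
   have "pull rh x (h' (tgt ed)\<otimes>\<^bsub>L x\<^esub>inv\<^bsub>L x\<^esub>h' (src ed))=pull rh x (c ed)"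
    if rh: "rh:\<U>" and ed: "ed:edges_in rh" for rh ed
   proof -
    have frh: "is_face rh" "on_stratum rh x" using rh less.prems(1) by auto
    interpret prh: group_hom "L x" "L x" "pull rh x" using pull_group_hom[OF x frh] .
    have ed\<sigma>: "ed edge_of \<sigma>" using ed by blast
    note e = ends[OF ed\<sigma>]
    show ?thesis
    proof (cases "rh=fc")
     case True
     have st: "src ed:fc" "tgt ed:fc" using e ed True by auto
     have Fc: "F (tgt ed):carrier (L x)" "F (src ed):carrier (L x)" using F(3) extfc e st by blast+
     have hc: "h (tgt ed):carrier (L x)" "h (src ed):carrier (L x)" using hv e by auto
     have edfc: "ed:edges_in fc" using ed True by blast
     have cc: "c ed:carrier (L x)" using c[OF ed\<sigma>] .
     let ?D = "cob x h ed"
     have idem: "pull fc x (pull fc x g)=pull fc x g" if "g:carrier (L x)" for g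
      using pull_absorb_L[OF x fc fc(1) order_refl that] .
     have "pull fc x (h' (tgt ed)\<otimes>\<^bsub>L x\<^esub>inv\<^bsub>L x\<^esub>h' (src ed)) =
       pull fc x ?D\<otimes>\<^bsub>L x\<^esub>pull fc x (cob x F ed)"
      using st hc Fc idem by (simp add: h'_def G.inv_mult G.m_ac)
     also have "...=pull fc x ?D\<otimes>\<^bsub>L x\<^esub>(pull fc x (c ed)\<otimes>\<^bsub>L x\<^esub>inv\<^bsub>L x\<^esub>pull fc x ?D)"
      unfolding F(4)[OF edfc] using hc cc idem by simp
     also have "...=pull fc x (c ed)"
     proof -
      have "pull fc x ?D:carrier (L x)" "pull fc x (c ed):carrier (L x)" using hc cc by auto
      thus ?thesis by (simp add: G.m_lcomm)
     qed
     finally show ?thesis using True by simp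
    next
     case False
     hence rh': "rh:?U'" using rh by blast
     let ?j = "join rh fc"
     note j = join_face[OF frh(1) fc(1)]
     have jon: "on_stratum ?j x" using on_stratum_join[OF x frh(1) fc(1) frh(2) fc(2)] .
     have "?j:\<U>" using less.prems(2) rh j jon by blast
     moreover have "?j~=fc" using min[OF rh] j(2) False by auto
     ultimately have jU: "?j:?U'" by blast
     have same: "pull rh x (h' v)=pull rh x (h v)" if v: "v extreme_point_of \<sigma>" for v
     proof (cases "v:fc")
      case True
      hence vfc: "v extreme_point_of fc" using v extfc by blast
      have "pull rh x (pull fc x (F v))=\<one>\<^bsub>L x\<^esub>"
       using pull_pull_L[OF x frh fc F(3)[OF vfc]] triv[OF jU j(3) vfc] by simp
      thus ?thesis using True hv[OF v] F(3)[OF vfc] by (simp add: h'_def)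
     qed (simp add: h'_def)
     have "pull rh x (h' (tgt ed)\<otimes>\<^bsub>L x\<^esub>inv\<^bsub>L x\<^esub>h' (src ed))=pull rh x (cob x h ed)"
      using same e h'c hv by simp
     thus ?thesis using h(2) rh' ed by blast
    qed
   qed
   thus ?thesis using h'c by blast
  qed
 qed
 from this[of ?\<T>] obtain h where h: "ALL v. v extreme_point_of \<sigma> --> h v:carrier (L x)"
  "ALL fc:?\<T>. ALL ed:edges_in fc. pull fc x (cob x h ed)=pull fc x (c ed)" by blast
 show thesis
 proof (rule that)
  fix ed assume "ed edge_of \<sigma>" "on_stratum ed x"
  thus "pull ed x (cob x h ed)=pull ed x (c ed)" using h(2) is_face_edge by blast
 qed (use h(1) in blast)
qed

end

section \<open>Restriction of functions\<close>

lemma zero_locus_antimono: "I\<subseteq>J ==> zero_locus R J\<subseteq>zero_locus R I"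
 by (auto simp: zero_locus_def)

context cring begin

lemma unit_germ_cases:
 assumes "c:carrier (unit_germs R I x)"
 obtains a f where "a:carrier R - x" "f:carrier R - x" "c=fraction R I x a f"
 using assms by (auto simp: unit_germs_def)

lemma restrict_germ:
 assumes "x:Spec R" "ideal I R" "ideal J R" "I\<subseteq>J" "a:carrier R" "f:carrier R - x"
 shows "(\<Union>(b, g)\<in>fraction R I x a f. fraction R J x b g)=fraction R J x a f"
 using prime_point.restrict_fraction[OF prime_pointI[OF assms(1)] assms(2-6)] .

lemma section_germ:
 assumes "ideal I R" "openin (zariski R) U" "s:carrier (invertible_functions R I U)" "x:U\<inter>zero_locus R I"
 shows "s x:carrier (unit_germs R I x)"
 using hom_in_carrier[OF germ_hom[OF assms(1,2,4)] assms(3)] .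

lemma restrict_function_closed:
 assumes I: "ideal I R" "ideal J R" "I\<subseteq>J" and U: "openin (zariski R) U" "openin (zariski R) W" "W\<subseteq>U"
  and s: "s:carrier (invertible_functions R I U)"
 shows "restrict_function R J W s:carrier (invertible_functions R J W)"
 unfolding carrier_invertible_functions[OF I(2) U(2)]
proof
 show "restrict_function R J W s:extensional (W\<inter>zero_locus R J)" by (simp add: restrict_function_def)
 show "locally_fraction J W (restrict_function R J W s)"
 proof (rule locally_fractionI)
  fix p assume p: "p:W\<inter>zero_locus R J"
  have lf: "locally_fraction I U s" using s unfolding carrier_invertible_functions[OF I(1) U(1)] by (rule conjunct2)
  have p': "p:U\<inter>zero_locus R I" using p U(3) zero_locus_antimono[OF I(3), of R] by auto
  obtain W' a f where W': "openin (zariski R) W'" "p:W'" "W'\<subseteq>U" and af: "a:carrier R" "f:carrier R"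
   and q: "ALL q:W'\<inter>zero_locus R I. a~:q & f~:q & s q=fraction R I q a f"
   by (rule locally_fractionE[OF lf p'])
  have "a~:q & f~:q & restrict_function R J W s q=fraction R J q a f" if qW: "q:(W\<inter>W')\<inter>zero_locus R J" for q
  proof -
   have "q:W'\<inter>zero_locus R I" using qW zero_locus_antimono[OF I(3), of R] by auto
   hence q': "a~:q" "f~:q" "s q=fraction R I q a f" using bspec[OF q] by auto
   have "q:Spec R" using qW by (auto simp: zero_locus_def)
   from restrict_germ[OF this I af(1)] have "(\<Union>(b, g)\<in>fraction R I q a f. fraction R J q b g)=fraction R J q a f"
    using af q' by blast
   thus ?thesis using q' qW by (simp add: restrict_function_def)
  qed
  thus "EX W' a f. openin (zariski R) W' & p:W' & W'\<subseteq>W & a:carrier R & f:carrier R &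
    (ALL q:W'\<inter>zero_locus R J. a~:q & f~:q & restrict_function R J W s q=fraction R J q a f)"
   using p W' af U(2) openin_Int[OF U(2) W'(1)] by (intro exI[of _ "W\<inter>W'"] exI[of _ a] exI[of _ f]) simp
 qed
qed

lemma restrict_function_mult:
 assumes I: "ideal I R" "ideal J R" "I\<subseteq>J" and U: "openin (zariski R) U" "openin (zariski R) W" "W\<subseteq>U"
  and s: "s:carrier (invertible_functions R I U)" "t:carrier (invertible_functions R I U)"
 shows "restrict_function R J W (s\<otimes>\<^bsub>invertible_functions R I U\<^esub>t) =
  restrict_function R J W s\<otimes>\<^bsub>invertible_functions R J W\<^esub>restrict_function R J W t"
proof
 fix q
 show "restrict_function R J W (s\<otimes>\<^bsub>invertible_functions R I U\<^esub>t) q =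
  (restrict_function R J W s\<otimes>\<^bsub>invertible_functions R J W\<^esub>restrict_function R J W t) q"
 proof (cases "q:W\<inter>zero_locus R J")
  case False
  have e: "restrict_function R J W s\<otimes>\<^bsub>invertible_functions R J W\<^esub>restrict_function R J W t:extensional (W\<inter>zero_locus R J)"
   by (simp add: invertible_functions_simps)
  show ?thesis unfolding extensional_arb[OF e False] using False by (simp only: restrict_function_def restrict_apply if_False)
 next
  case True
  hence q: "q:U\<inter>zero_locus R I" "q:Spec R" using U(3) I(3) by (auto simp: zero_locus_def)
  interpret I: local_fractions R I q using local_fractionsI[OF q(2) I(1)] .
  interpret J: local_fractions R J q using local_fractionsI[OF q(2) I(2)] .
  obtain a f where a: "a:carrier R - q" "f:carrier R - q" "s q=fraction R I q a f"
   by (rule unit_germ_cases[OF section_germ[OF I(1) U(1) s(1) q(1)]])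
  obtain b g where b: "b:carrier R - q" "g:carrier R - q" "t q=fraction R I q b g"
   by (rule unit_germ_cases[OF section_germ[OF I(1) U(1) s(2) q(1)]])
  have ab: "a\<otimes>b:carrier R" "f\<otimes>g:carrier R - q" using a b I.mult_notin[OF a(2) b(2)] by auto
  have "(\<Union>(b, g)\<in>(s\<otimes>\<^bsub>invertible_functions R I U\<^esub>t) q. fraction R J q b g)=fraction R J q (a\<otimes>b) (f\<otimes>g)"
   using restrict_germ[OF q(2) I ab] a b q
   by (simp add: invertible_functions_simps I.unit_germs_simps I.fraction_mult_fraction)
  moreover have "(\<Union>(b, g)\<in>s q. fraction R J q b g)=fraction R J q a f" "(\<Union>(b, g)\<in>t q. fraction R J q b g)=fraction R J q b g"
   using restrict_germ[OF q(2) I] a b by simp_all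
  ultimately show ?thesis using True a b
   by (simp add: restrict_function_def invertible_functions_simps J.unit_germs_simps J.fraction_mult_fraction)
 qed
qed

lemma restrict_function_hom:
 assumes I: "ideal I R" "ideal J R" "I\<subseteq>J" and U: "openin (zariski R) U" "openin (zariski R) W" "W\<subseteq>U"
 shows "restrict_function R J W:hom (invertible_functions R I U) (invertible_functions R J W)"
 by (rule homI) (rule restrict_function_closed[OF assms], assumption, rule restrict_function_mult[OF assms])

lemma restrict_function_trans:
 assumes I: "ideal I R" "ideal J R" "ideal K R" "I\<subseteq>J" "J\<subseteq>K" and U: "openin (zariski R) U" "W\<subseteq>U" "W'\<subseteq>W"
  and s: "s:carrier (invertible_functions R I U)"
 shows "restrict_function R K W' (restrict_function R J W s)=restrict_function R K W' s"
proof
 fix q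
 show "restrict_function R K W' (restrict_function R J W s) q=restrict_function R K W' s q"
 proof (cases "q:W'\<inter>zero_locus R K")
  case True
  have q: "q:Spec R" "K\<subseteq>q" using True by (auto simp: zero_locus_def)
  have "J\<subseteq>q" "I\<subseteq>q" using q(2) I(4,5) by blast+
  hence q: "q:U\<inter>zero_locus R I" "q:W\<inter>zero_locus R J" "q:Spec R"
   using True U(2,3) q(1) by (auto simp: zero_locus_def)
  obtain a f where a: "a:carrier R - q" "f:carrier R - q" "s q=fraction R I q a f"
   by (rule unit_germ_cases[OF section_germ[OF I(1) U(1) s q(1)]])
  have aR: "a:carrier R" using a by blast
  have IK: "I\<subseteq>K" using I by blast
  show ?thesis using True q a restrict_germ[OF q(3) I(1,2,4) aR a(2)] restrict_germ[OF q(3) I(2,3,5) aR a(2)]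
    restrict_germ[OF q(3) I(1,3) IK aR a(2)] by (simp add: restrict_function_def)
 next
  case False
  thus ?thesis by (simp only: restrict_function_def restrict_apply if_False)
 qed
qed

end

context log_scheme begin

abbreviation "Inv I U \<equiv> invertible_functions R I U"
abbreviation "opn U \<equiv> openin (zariski R) U"
abbreviation "rs \<equiv> restrict_function R"

lemma ideal_face: "is_face fc ==> ideal (strata_ideal {fc}) R"
 using ideal_strata_ideal[of "{fc}"] by simp

lemma on_stratum_zero_locus: "[|x:Spec R; J\<subseteq>strata_ideal {fc}; on_stratum fc x|] ==> x:zero_locus R J"
 by (auto simp: on_stratum_def zero_locus_def)

lemma opn_Spec: "[|opn U; x:U|] ==> x:Spec R" using openin_zariski_Spec by blast

lemma pull_closed:
 assumes "is_face fc" "opn U" "x:U" "on_stratum fc x" "ideal I R" "I\<subseteq>strata_ideal {fc}" "s:carrier (Inv I U)"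
 shows "pull fc x (s x):carrier (L x)"
proof -
 have x: "x:Spec R" using opn_Spec[OF assms(2,3)] .
 have z: "x:U\<inter>zero_locus R I" using on_stratum_zero_locus[OF x assms(6,4)] assms(3) by blast
 show ?thesis using hom_in_carrier[OF pull_hom[OF x assms(1,4,5,6)] R.section_germ[OF assms(5,2,7) z]] .
qed

lemma pull_section_hom:
 assumes "is_face fc" "opn U" "x:U" "on_stratum fc x" "ideal I R" "I\<subseteq>strata_ideal {fc}"
 shows "(%s. pull fc x (s x)):hom (Inv I U) (L x)"
proof -
 have x: "x:Spec R" using opn_Spec[OF assms(2,3)] .
 have z: "x:U\<inter>zero_locus R I" using on_stratum_zero_locus[OF x assms(6,4)] assms(3) by blast
 show ?thesis using hom_compose[OF R.germ_hom[OF assms(5,2) z] pull_hom[OF x assms(1,4,5,6)]] by (simp add: comp_def)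
qed

lemma pull_restrict_function:
 assumes fc: "is_face fc" "on_stratum fc x" and U: "opn U" "W\<subseteq>U" "x:W"
  and I: "ideal I R" "ideal J R" "I\<subseteq>J" "J\<subseteq>strata_ideal {fc}" and s: "s:carrier (Inv I U)"
 shows "pull fc x (rs J W s x)=pull fc x (s x)"
proof -
 have xU: "x:U" using U by blast
 have x: "x:Spec R" using opn_Spec[OF U(1) xU] .
 have IJ: "I\<subseteq>strata_ideal {fc}" using I by blast
 have z: "x:U\<inter>zero_locus R I" "x:W\<inter>zero_locus R J"
  using on_stratum_zero_locus[OF x IJ fc(2)] on_stratum_zero_locus[OF x I(4) fc(2)] xU U(3) by blast+
 show ?thesis using pull_restrict(1)[OF x fc I R.section_germ[OF I(1) U(1) s z(1)]] z(2) by (simp add: restrict_function_def)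
qed

lemma section_eqI:
 assumes U: "opn U" and X: "finite X" "!!fc. fc:X ==> is_face fc"
  and s: "s:carrier (Inv (strata_ideal X) U)" "t:carrier (Inv (strata_ideal X) U)"
  and eq: "!!x fc. [|x:U; fc:X; on_stratum fc x|] ==> pull fc x (s x)=pull fc x (t x)"
 shows "s=t"
proof (rule R.invertible_functions_eqI[OF ideal_strata_ideal[OF X(2)] U s])
 fix x assume x: "x:U\<inter>zero_locus R (strata_ideal X)"
 hence xU: "x:U" by blast
 have xS: "x:Spec R" using opn_Spec[OF U xU] .
 note id = ideal_strata_ideal[OF X(2)]
 show "s x=t x"
  by (rule germ_eqI[OF xS X R.section_germ[OF id U s(1) x] R.section_germ[OF id U s(2) x]]) (assumption | rule eq[OF xU])+
qed assumption

abbreviation "rep fc y c a f \<equiv> on_stratum fc y --> a:carrier R - y & f:carrier R - y & c=pull fc y (fr y a f)"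

text \<open>A function with values in the germs on \<open>V\<^sub>\<tau>\<close> that is locally one fraction, so that it comes from a regular invertible function; values off the stratum are irrelevant.\<close>
definition fractional_on :: "'a set=>('a, 'k) point set=>('a, 'k) local_fun=>bool" where
 "fractional_on fc U g \<longleftrightarrow> (ALL x:U. EX W a f. opn W & x:W & W\<subseteq>U &
   (ALL y:W. rep fc y (g y) a f))"

lemma fractional_onE:
 assumes "fractional_on fc U g" "x:U"
 obtains W a f where "opn W" "x:W" "W\<subseteq>U"
  "ALL y:W. rep fc y (g y) a f"
 using bspec[OF assms(1)[unfolded fractional_on_def] assms(2)] by (elim exE conjE)

lemma fractional_on_one:
 assumes fc: "is_face fc" and U: "opn U"
 shows "fractional_on fc U (%y. \<one>\<^bsub>L y\<^esub>)"
 unfolding fractional_on_def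
proof
 fix x assume x: "x:U"
 have "\<one>\<^bsub>R\<^esub>:carrier R - y & \<one>\<^bsub>R\<^esub>:carrier R - y & \<one>\<^bsub>L y\<^esub>= pull fc y (fr y \<one>\<^bsub>R\<^esub>\<one>\<^bsub>R\<^esub>)"
  if y: "y:U" "on_stratum fc y" for y
 proof -
  have yS: "y:Spec R" using opn_Spec[OF U y(1)] .
  interpret z: local_fractions R "{\<zero>\<^bsub>R\<^esub>}" y using lf[OF yS zero_ideal] .
  have "pull fc y \<one>\<^bsub>L y\<^esub>= \<one>\<^bsub>L y\<^esub>"
   using hom_one[OF pull_endo[OF yS fc y(2)]] comm_group_L[OF yS] comm_group.axioms(2) by blast
  thus ?thesis using z.one_notin by (simp add: z.unit_germs_simps)
 qed
 thus "EX W a f. opn W & x:W & W\<subseteq>U &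
   (ALL y:W. rep fc y (\<one>\<^bsub>L y\<^esub>) a f)"
  using x U by (intro exI[of _ U] exI[of _ "\<one>\<^bsub>R\<^esub>"]) simp
qed

lemma fractional_on_mult:
 assumes fc: "is_face fc" and U: "opn U" and g: "fractional_on fc U g" "fractional_on fc U g'"
 shows "fractional_on fc U (%y. g y\<otimes>\<^bsub>L y\<^esub>g' y)"
 unfolding fractional_on_def
proof
 fix x assume x: "x:U"
 obtain W a f where W: "opn W" "x:W" "W\<subseteq>U"
  "ALL y:W. rep fc y (g y) a f"
  by (rule fractional_onE[OF g(1) x])
 obtain W' a' f' where W': "opn W'" "x:W'" "W'\<subseteq>U"
  "ALL y:W'. rep fc y (g' y) a' f'"
  by (rule fractional_onE[OF g(2) x])
 have "a\<otimes>\<^bsub>R\<^esub>a':carrier R - y & f\<otimes>\<^bsub>R\<^esub>f':carrier R - y & g y\<otimes>\<^bsub>L y\<^esub>g' y=pull fc y (fr y (a\<otimes>\<^bsub>R\<^esub>a') (f\<otimes>\<^bsub>R\<^esub>f'))"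
  if y: "y:W\<inter>W'" "on_stratum fc y" for y
 proof -
  have yS: "y:Spec R" using opn_Spec[OF W(1)] y(1) by blast
  interpret z: local_fractions R "{\<zero>\<^bsub>R\<^esub>}" y using lf[OF yS zero_ideal] .
  have 1: "a:carrier R - y" "f:carrier R - y" "g y=pull fc y (fr y a f)" using bspec[OF W(4), of y] y by auto
  have 2: "a':carrier R - y" "f':carrier R - y" "g' y=pull fc y (fr y a' f')" using bspec[OF W'(4), of y] y by auto
  have "fr y (a\<otimes>\<^bsub>R\<^esub>a') (f\<otimes>\<^bsub>R\<^esub>f')=fr y a f\<otimes>\<^bsub>L y\<^esub>fr y a' f'"
   using 1 2 by (simp add: z.unit_germs_simps z.fraction_mult_fraction)
  hence "pull fc y (fr y (a\<otimes>\<^bsub>R\<^esub>a') (f\<otimes>\<^bsub>R\<^esub>f'))=pull fc y (fr y a f)\<otimes>\<^bsub>L y\<^esub>pull fc y (fr y a' f')"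
   using hom_mult[OF pull_endo[OF yS fc y(2)] unit_germsI[OF 1(1,2)] unit_germsI[OF 2(1,2)]] by simp
  thus ?thesis using 1(3) 2(3) z.mult_notin[OF 1(1) 2(1)] z.mult_notin[OF 1(2) 2(2)] by simp
 qed
 thus "EX W a f. opn W & x:W & W\<subseteq>U &
   (ALL y:W. rep fc y (g y\<otimes>\<^bsub>L y\<^esub>g' y) a f)"
  by (intro exI[of _ "W\<inter>W'"] exI[of _ "a\<otimes>\<^bsub>R\<^esub>a'"] exI[of _ "f\<otimes>\<^bsub>R\<^esub>f'"] conjI ballI impI
    openin_Int[OF W(1) W'(1)] IntI W(2) W'(2) le_infI1[OF W(3)]) blast+
qed

lemma fractional_on_inv:
 assumes fc: "is_face fc" and U: "opn U" and g: "fractional_on fc U g"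
 shows "fractional_on fc U (%y. inv\<^bsub>L y\<^esub>g y)"
 unfolding fractional_on_def
proof
 fix x assume x: "x:U"
 obtain W a f where W: "opn W" "x:W" "W\<subseteq>U"
  "ALL y:W. rep fc y (g y) a f"
  by (rule fractional_onE[OF g x])
 have "f:carrier R - y & a:carrier R - y & inv\<^bsub>L y\<^esub>g y=pull fc y (fr y f a)"
  if y: "y:W" "on_stratum fc y" for y
 proof -
  have yS: "y:Spec R" using opn_Spec[OF W(1) y(1)] .
  interpret z: local_fractions R "{\<zero>\<^bsub>R\<^esub>}" y using lf[OF yS zero_ideal] .
  interpret L: comm_group "L y" using comm_group_L[OF yS] .
  have 1: "a:carrier R - y" "f:carrier R - y" "g y=pull fc y (fr y a f)" using bspec[OF W(4), of y] y by auto
  have "fr y f a\<otimes>\<^bsub>L y\<^esub>fr y a f=\<one>\<^bsub>L y\<^esub>"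
   using 1 z.fraction_cancel[OF 1(2,1)] by (simp add: z.unit_germs_simps z.fraction_mult_fraction)
  hence "pull fc y (fr y f a)\<otimes>\<^bsub>L y\<^esub>pull fc y (fr y a f)=\<one>\<^bsub>L y\<^esub>"
   using hom_mult[OF pull_endo[OF yS fc y(2)] unit_germsI[OF 1(2,1)] unit_germsI[OF 1(1,2)]]
    hom_one[OF pull_endo[OF yS fc y(2)] L.is_group L.is_group] by simp
  hence "inv\<^bsub>L y\<^esub>g y=pull fc y (fr y f a)"
   using L.inv_equality hom_in_carrier[OF pull_endo[OF yS fc y(2)] unit_germsI[OF 1(2,1)]]
    hom_in_carrier[OF pull_endo[OF yS fc y(2)] unit_germsI[OF 1(1,2)]] 1(3) by simp
  thus ?thesis using 1 by simp
 qed
 thus "EX W a f. opn W & x:W & W\<subseteq>U &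
   (ALL y:W. rep fc y (inv\<^bsub>L y\<^esub>g y) a f)"
  by (intro exI[of _ W] exI[of _ f] exI[of _ a] conjI ballI impI W(1-3)) blast+
qed

lemma fractional_on_cong:
 assumes "opn U" "!!y. [|y:U; on_stratum fc y|] ==> g y=g' y" "fractional_on fc U g"
 shows "fractional_on fc U g'"
 unfolding fractional_on_def
proof
 fix x assume x: "x:U"
 obtain W a f where W: "opn W" "x:W" "W\<subseteq>U"
  "ALL y:W. rep fc y (g y) a f"
  by (rule fractional_onE[OF assms(3) x])
 have "ALL y:W. rep fc y (g' y) a f"
 proof (intro ballI impI)
  fix y assume y: "y:W" "on_stratum fc y"
  have "y:U" using y W(3) by blast
  from assms(2)[OF this y(2)] show "a:carrier R - y & f:carrier R - y & g' y=pull fc y (fr y a f)"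
   using bspec[OF W(4) y(1)] y(2) by simp
 qed
 thus "EX W a f. opn W & x:W & W\<subseteq>U &
   (ALL y:W. rep fc y (g' y) a f)"
  using W(1-3) by (intro exI[of _ W] exI[of _ a] exI[of _ f] conjI)
qed

lemma fractional_on_carrier:
 assumes fc: "is_face fc" and U: "opn U" and g: "fractional_on fc U g" and y: "y:U" "on_stratum fc y"
 shows "g y:carrier (L y)"
proof -
 obtain W a f where W: "opn W" "y:W" "W\<subseteq>U"
  "ALL y:W. rep fc y (g y) a f"
  by (rule fractional_onE[OF g y(1)])
 have 1: "a:carrier R - y" "f:carrier R - y" "g y=pull fc y (fr y a f)" using bspec[OF W(4,2)] y(2) by auto
 show ?thesis unfolding 1(3) using hom_in_carrier[OF pull_endo[OF opn_Spec[OF U y(1)] fc y(2)] unit_germsI[OF 1(1,2)]] .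
qed

lemma fractional_on_pow:
 assumes fc: "is_face fc" and U: "opn U" and g: "fractional_on fc U g"
 shows "fractional_on fc U (%y. g y [^]\<^bsub>L y\<^esub>(i :: int))"
proof -
 have nat: "fractional_on fc U (%y. g y [^]\<^bsub>L y\<^esub>(k :: nat))" for k
 proof (induction k)
  case 0 thus ?case using fractional_on_one[OF fc U] by simp
 next
  case (Suc k) thus ?case using fractional_on_mult[OF fc U Suc g] by simp
 qed
 show ?thesis
 proof (cases "i < 0")
  case True
  hence "(%y. g y [^]\<^bsub>L y\<^esub>i)=(%y. inv\<^bsub>L y\<^esub>(g y [^]\<^bsub>L y\<^esub>nat (- i)))" by (simp only: int_pow_def2 if_True)
  thus ?thesis using fractional_on_inv[OF fc U nat[of "nat (- i)"]] by (simp only:)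
 next
  case False
  hence "(%y. g y [^]\<^bsub>L y\<^esub>i)=(%y. g y [^]\<^bsub>L y\<^esub>nat i)" by (simp only: int_pow_def2 if_False)
  thus ?thesis using nat[of "nat i"] by (simp only:)
 qed
qed

lemma fractional_on_finprod:
 assumes fc: "is_face fc" and U: "opn U" and S: "finite S" "!!i. i:S ==> fractional_on fc U (g i)"
 shows "fractional_on fc U (%y. finprod (L y) (%i. g i y) S)"
 using S
proof (induction S rule: finite_induct)
 case empty
 show ?case
  by (rule fractional_on_cong[OF U _ fractional_on_one[OF fc U]])
   (use comm_group_L[OF opn_Spec[OF U]] comm_group.axioms(1) comm_monoid.finprod_empty in metis)
next
 case (insert j S)
 have gj: "fractional_on fc U (g j)" and gS: "fractional_on fc U (%y. finprod (L y) (%i. g i y) S)" using insert by auto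
 show ?case
 proof (rule fractional_on_cong[OF U _ fractional_on_mult[OF fc U gj gS]])
  fix y assume y: "y:U" "on_stratum fc y"
  interpret L: comm_group "L y" using comm_group_L[OF opn_Spec[OF U y(1)]] .
  have "(%i. g i y):S \<rightarrow> carrier (L y)" using fractional_on_carrier[OF fc U _ y] insert.prems by blast
  moreover have "g j y:carrier (L y)" using fractional_on_carrier[OF fc U gj y] .
  ultimately show "g j y\<otimes>\<^bsub>L y\<^esub>finprod (L y) (%i. g i y) S=finprod (L y) (%i. g i y) (insert j S)"
   using L.finprod_insert[OF insert.hyps, of "%i. g i y"] by simp
 qed
qed

lemma fractional_on_section:
 assumes fc: "is_face fc" and U: "opn U" and I: "ideal I R" "I\<subseteq>strata_ideal {fc}" and s: "s:carrier (Inv I U)"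
 shows "fractional_on fc U (%y. pull fc y (s y))"
 unfolding fractional_on_def
proof
 fix x assume x: "x:U"
 have xS: "x:Spec R" using opn_Spec[OF U x] .
 show "EX W a f. opn W & x:W & W\<subseteq>U &
   (ALL y:W. rep fc y (pull fc y (s y)) a f)"
 proof (cases "on_stratum fc x")
  case False
  have "EX W. opn W & x:W & (ALL y:W. \<not> on_stratum fc y)"
   by (rule open_off_stratum[OF xS False]) (intro exI conjI ballI)
  then obtain W where W: "opn W" "x:W" "ALL y:W. \<not> on_stratum fc y" by (elim exE conjE)
  thus ?thesis using x openin_Int[OF W(1) U] by (intro exI[of _ "W\<inter>U"]) simp
 next
  case True
  have z: "x:U\<inter>zero_locus R I" using on_stratum_zero_locus[OF xS I(2) True] x by blast
  have lfs: "R.locally_fraction I U s" using s unfolding R.carrier_invertible_functions[OF I(1) U] by (rule conjunct2)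
  obtain W a f where W: "opn W" "x:W" "W\<subseteq>U" and af: "a:carrier R" "f:carrier R"
   and q: "ALL q:W\<inter>zero_locus R I. a~:q & f~:q & s q=fraction R I q a f"
   by (rule R.locally_fractionE[OF lfs z])
  have "a:carrier R - y & f:carrier R - y & pull fc y (s y)=pull fc y (fr y a f)" if y: "y:W" "on_stratum fc y" for y
  proof -
   have yS: "y:Spec R" using opn_Spec[OF W(1) y(1)] .
   have yz: "y:W\<inter>zero_locus R I" using on_stratum_zero_locus[OF yS I(2) y(2)] y(1) by blast
   have n: "a:carrier R - y" "f:carrier R - y" "s y=fraction R I y a f" using bspec[OF q yz] af by auto
   show ?thesis using n pull_fraction[OF yS fc y(2) I n(1,2)] pull_fr[OF yS fc y(2) n(1,2)] by simp
  qed
  thus ?thesis by (intro exI[of _ W] exI[of _ a] exI[of _ f] conjI ballI impI W) blast+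
 qed
qed

lemma section_from_fractions:
 assumes U: "opn U" and X: "finite X" "!!fc. fc:X ==> is_face fc"
  and frac: "!!fc. fc:X ==> fractional_on fc U (val fc)"
  and compat: "!!x fc fc'. [|x:U; fc:X; fc':X; on_stratum fc x; on_stratum fc' x|] ==>
   pull (join fc fc') x (val fc x)=pull (join fc fc') x (val fc' x)"
 obtains s where "s:carrier (Inv (strata_ideal X) U)"
  "!!x fc. [|x:U; fc:X; on_stratum fc x|] ==> pull fc x (s x)=val fc x"
proof (rule section_from_strata[where U = U and X = X and val = val, OF U X _ compat])
 fix x assume x: "x:U"
 define Q where "Q=(%fc p y. on_stratum fc y --> fst p:carrier R - y & snd p:carrier R - y & val fc y=pull fc y (fr y (fst p) (snd p)))"
 have "ALL fc:X. EX p. EX W. opn W & x:W & (ALL y:W. Q fc p y)"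
 proof
  fix fc assume fc: "fc:X"
  obtain W a f where W: "opn W" "x:W" "W\<subseteq>U"
   "ALL y:W. rep fc y (val fc y) a f"
   by (rule fractional_onE[OF frac[OF fc] x])
  thus "EX p. EX W. opn W & x:W & (ALL y:W. Q fc p y)"
   unfolding Q_def by (intro exI[of _ "(a, f)"] exI[of _ W]) simp
 qed
 from bchoice[OF this] obtain p where p: "ALL fc:X. EX W. opn W & x:W & (ALL y:W. Q fc (p fc) y)" by (elim exE)
 have "EX W. opn W & x:W & W\<subseteq>U & (ALL fc:X. ALL y:W. Q fc (p fc) y)"
  by (rule open_nbhd_finite[OF X(1) _ U x]) (rule bspec[OF p])
 then obtain W where W: "opn W" "x:W" "W\<subseteq>U" "ALL fc:X. ALL y:W. Q fc (p fc) y" by (elim exE conjE)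
 show "EX W a f. opn W & x:W & W\<subseteq>U &
   (ALL fc:X. ALL y:W. on_stratum fc y --> a fc:carrier R - y & f fc:carrier R - y & val fc y=pull fc y (fr y (a fc) (f fc)))"
  by (intro exI[of _ W] exI[of _ "%fc. fst (p fc)"] exI[of _ "%fc. snd (p fc)"] conjI W(1-3) W(4)[unfolded Q_def])
next
 fix s assume s: "s:carrier (Inv (strata_ideal X) U)"
  "!!x fc. [|x:U; fc:X; on_stratum fc x|] ==> pull fc x (s x)=val fc x"
 show thesis by (rule that[of s]) (fact s)+
qed

end

section \<open>The tensor product\<close>

locale tensor_pair = A: comm_group A + G: comm_group G for A :: "('a, 'x) monoid_scheme" and G :: "('b, 'y) monoid_scheme"
begin

abbreviation "Fr \<equiv> free_Abelian_group (carrier A\<times>carrier G)"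
abbreviation "K \<equiv> tensor_kernel A G"
abbreviation "T \<equiv> tensor_group A G"
abbreviation "pt \<equiv> pure_tensor A G"

sublocale Fr: comm_group Fr by (rule abelian_free_Abelian_group)

lemma frag_closed: "[|a:carrier A; g:carrier G|] ==> frag_of (a, g):carrier Fr"
 by (simp add: free_Abelian_group_def)

lemma Fr_simps: "x\<otimes>\<^bsub>Fr\<^esub>y=x + y" "\<one>\<^bsub>Fr\<^esub>= 0" by (simp_all add: free_Abelian_group_def)

lemma relations_closed: "tensor_relations A G\<subseteq>carrier Fr"
proof -
 have "frag_of p - frag_of q - frag_of s:carrier Fr"
  if "p:carrier A\<times>carrier G" "q:carrier A\<times>carrier G" "s:carrier A\<times>carrier G" for p q s :: "'a\<times>'b"
 proof -
  have "Poly_Mapping.keys (frag_of p - frag_of q - frag_of s)\<subseteq>{p, q, s}"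
   using keys_diff[of "frag_of p - frag_of q" "frag_of s"] keys_diff[of "frag_of p" "frag_of q"] by (auto simp: keys_frag_of)
  thus ?thesis using that by (simp add: free_Abelian_group_def) blast
 qed
 thus ?thesis unfolding tensor_relations_def by auto
qed

lemma subgroup_K: "subgroup K Fr"
 unfolding tensor_kernel_def using relations_closed by (rule Fr.generate_is_subgroup)

lemma comm_group_T: "comm_group T"
 unfolding tensor_group_def using Fr.abelian_FactGroup[OF subgroup_K] .

sublocale T: comm_group T by (rule comm_group_T)

lemma proj_hom: "(%x. K #>\<^bsub>Fr\<^esub>x):hom Fr T"
 unfolding tensor_group_def using normal.r_coset_hom_Mod[OF Fr.subgroup_imp_normal[OF subgroup_K]] .

lemma one_T: "\<one>\<^bsub>T\<^esub>= K" by (simp add: tensor_group_def FactGroup_def)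

lemma proj_eq_one_iff: "x:carrier Fr ==> K #>\<^bsub>Fr\<^esub>x=\<one>\<^bsub>T\<^esub>\<longleftrightarrow> x:K"
 unfolding one_T using Fr.coset_join1[OF _ _ subgroup_K, of x] Fr.coset_join2[OF _ subgroup_K, of x] subgroup.subset[OF subgroup_K] by blast

lemma pt_closed: "[|a:carrier A; g:carrier G|] ==> pt a g:carrier T"
 unfolding pure_tensor_def using hom_in_carrier[OF proj_hom frag_closed] .

lemma proj_eqI:
 assumes xy: "x:carrier Fr" "y:carrier Fr" "z:carrier Fr" and r: "x - y - z:tensor_relations A G"
 shows "K #>\<^bsub>Fr\<^esub>x=(K #>\<^bsub>Fr\<^esub>y)\<otimes>\<^bsub>T\<^esub>(K #>\<^bsub>Fr\<^esub>z)"
proof -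
 have k: "x - y - z:K" unfolding tensor_kernel_def using r by (rule generate.incl)
 have kc: "x - y - z:carrier Fr" using k subgroup.subset[OF subgroup_K] by blast
 have "x=(x - y - z)\<otimes>\<^bsub>Fr\<^esub>(y\<otimes>\<^bsub>Fr\<^esub>z)" by (simp add: Fr_simps)
 hence "K #>\<^bsub>Fr\<^esub>x=(K #>\<^bsub>Fr\<^esub>(x - y - z))\<otimes>\<^bsub>T\<^esub>(K #>\<^bsub>Fr\<^esub>(y\<otimes>\<^bsub>Fr\<^esub>z))"
  using hom_mult[OF proj_hom kc, of "y\<otimes>\<^bsub>Fr\<^esub>z"] xy by (metis Fr.m_closed)
 also have "K #>\<^bsub>Fr\<^esub>(x - y - z)=\<one>\<^bsub>T\<^esub>" using proj_eq_one_iff[OF kc] k by simp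
 finally show ?thesis using hom_mult[OF proj_hom xy(2,3)] hom_in_carrier[OF proj_hom] xy by simp
qed

lemma pt_add_left: "[|a:carrier A; a':carrier A; g:carrier G|] ==> pt (a\<otimes>\<^bsub>A\<^esub>a') g=pt a g\<otimes>\<^bsub>T\<^esub>pt a' g"
 unfolding pure_tensor_def by (rule proj_eqI) (auto simp: frag_closed tensor_relations_def)

lemma pt_add_right: "[|a:carrier A; g:carrier G; g':carrier G|] ==> pt a (g\<otimes>\<^bsub>G\<^esub>g')=pt a g\<otimes>\<^bsub>T\<^esub>pt a g'"
 unfolding pure_tensor_def by (rule proj_eqI) (auto simp: frag_closed tensor_relations_def)

lemma pt_left_hom: "g:carrier G ==> (%a. pt a g):hom A T"
 by (rule homI) (auto simp: pt_closed pt_add_left)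

lemma pt_right_hom: "a:carrier A ==> pt a:hom G T"
 by (rule homI) (auto simp: pt_closed pt_add_right)

lemma pt_one_right: "a:carrier A ==> pt a \<one>\<^bsub>G\<^esub>= \<one>\<^bsub>T\<^esub>"
 using hom_one[OF pt_right_hom] G.is_group T.is_group by blast

lemma pt_one_left: "g:carrier G ==> pt \<one>\<^bsub>A\<^esub>g=\<one>\<^bsub>T\<^esub>"
 using hom_one[OF pt_left_hom] A.is_group T.is_group by blast

text \<open>The universal property of the tensor product, applied to one relation between pure tensors.\<close>
lemma bilinear_kills:
 assumes H: "comm_group H" and l: "!!a g. [|a:carrier A; g:carrier G|] ==> l a g:carrier H"
  and l1: "!!a a' g. [|a:carrier A; a':carrier A; g:carrier G|] ==> l (a\<otimes>\<^bsub>A\<^esub>a') g=l a g\<otimes>\<^bsub>H\<^esub>l a' g"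
  and l2: "!!a g g'. [|a:carrier A; g:carrier G; g':carrier G|] ==> l a (g\<otimes>\<^bsub>G\<^esub>g')=l a g\<otimes>\<^bsub>H\<^esub>l a g'"
  and S: "finite S" "!!i. i:S ==> a i:carrier A & g i:carrier G"
  and one: "finprod T (%i. pt (a i) (g i)) S=\<one>\<^bsub>T\<^esub>"
 shows "finprod H (%i. l (a i) (g i)) S=\<one>\<^bsub>H\<^esub>"
proof -
 interpret H: comm_group H by (rule H)
 have im: "(%(a, g). l a g) ` (carrier A\<times>carrier G)\<subseteq>carrier H" using l by (simp add: image_subset_iff)
 have "EX h. h:hom Fr H & (ALL p:carrier A\<times>carrier G. h (frag_of p)=(%(a, g). l a g) p)"
  by (rule H.free_Abelian_group_universal[OF im]) (intro exI conjI ballI)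
 then obtain h where h: "h:hom Fr H" and h2: "ALL p:carrier A\<times>carrier G. h (frag_of p)=(%(a, g). l a g) p"
  by (elim exE conjE)
 have hfr: "h (frag_of (a, g))=l a g" if "a:carrier A" "g:carrier G" for a g
  using bspec[OF h2, of "(a, g)"] that by simp
 interpret h: group_hom Fr H h by (simp add: group_hom_def group_hom_axioms_def h)
 have kills3: "h (x - y - z)=\<one>\<^bsub>H\<^esub>"
  if "x:carrier Fr" "y:carrier Fr" "z:carrier Fr" "x - y - z:carrier Fr" "h x=h y\<otimes>\<^bsub>H\<^esub>h z" for x y z
 proof -
  have "x=(x - y - z)\<otimes>\<^bsub>Fr\<^esub>(y\<otimes>\<^bsub>Fr\<^esub>z)" by (simp add: Fr_simps)
  hence "h x=h (x - y - z)\<otimes>\<^bsub>H\<^esub>(h y\<otimes>\<^bsub>H\<^esub>h z)" using that(2-4) by (metis h.hom_mult Fr.m_closed)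
  thus ?thesis using that by (metis H.l_cancel_one' H.r_cancel_one' h.hom_closed)
 qed
 have "h x=\<one>\<^bsub>H\<^esub>" if "x:tensor_relations A G" for x
  using that unfolding tensor_relations_def
 proof (elim UnE CollectE exE conjE)
  fix a a' g assume x: "x=frag_of (a\<otimes>\<^bsub>A\<^esub>a', g) - frag_of (a, g) - frag_of (a', g)" and c: "a:carrier A" "a':carrier A" "g:carrier G"
  have "x:carrier Fr" using that relations_closed by blast
  thus "h x=\<one>\<^bsub>H\<^esub>" unfolding x using c frag_closed hfr l1 by (intro kills3) auto
 next
  fix a g g' assume x: "x=frag_of (a, g\<otimes>\<^bsub>G\<^esub>g') - frag_of (a, g) - frag_of (a, g')" and c: "a:carrier A" "g:carrier G" "g':carrier G"
  have "x:carrier Fr" using that relations_closed by blast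
  thus "h x=\<one>\<^bsub>H\<^esub>" unfolding x using c frag_closed hfr l2 by (intro kills3) auto
 qed
 hence "tensor_relations A G\<subseteq>kernel Fr H h" using relations_closed unfolding kernel_def by blast
 hence Kh: "K\<subseteq>kernel Fr H h" unfolding tensor_kernel_def
  by (rule Fr.generate_subgroup_incl[OF _ h.subgroup_kernel])
 have "EX z:carrier Fr. K #>\<^bsub>Fr\<^esub>z=finprod T (%i. pt (a i) (g i)) S & h z=finprod H (%i. l (a i) (g i)) S"
  using S
 proof (induction S rule: finite_induct)
  case empty
  show ?case using Fr.coset_mult_one[OF subgroup.subset[OF subgroup_K]] h.hom_one
   by (intro bexI[of _ "\<one>\<^bsub>Fr\<^esub>"]) (auto simp: one_T)
 next
  case (insert i S)
  then obtain z where z: "z:carrier Fr" "K #>\<^bsub>Fr\<^esub>z=finprod T (%i. pt (a i) (g i)) S" "h z=finprod H (%i. l (a i) (g i)) S"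
   by auto
  have c: "a i:carrier A" "g i:carrier G" using insert.prems by auto
  let ?f = "frag_of (a i, g i)"
  have f: "?f:carrier Fr" using frag_closed[OF c] .
  have "K #>\<^bsub>Fr\<^esub>(?f\<otimes>\<^bsub>Fr\<^esub>z)=pt (a i) (g i)\<otimes>\<^bsub>T\<^esub>finprod T (%i. pt (a i) (g i)) S"
   using hom_mult[OF proj_hom f z(1)] z(2) by (simp add: pure_tensor_def)
  also have "...=finprod T (%i. pt (a i) (g i)) (insert i S)"
   using insert pt_closed by (intro T.finprod_insert[symmetric]) auto
  finally have 1: "K #>\<^bsub>Fr\<^esub>(?f\<otimes>\<^bsub>Fr\<^esub>z)=finprod T (%i. pt (a i) (g i)) (insert i S)" .
  have "h (?f\<otimes>\<^bsub>Fr\<^esub>z)=l (a i) (g i)\<otimes>\<^bsub>H\<^esub>finprod H (%i. l (a i) (g i)) S"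
   using h.hom_mult[OF f z(1)] z(3) hfr[OF c] by simp
  also have "...=finprod H (%i. l (a i) (g i)) (insert i S)"
   using insert l by (intro H.finprod_insert[symmetric]) auto
  finally have 2: "h (?f\<otimes>\<^bsub>Fr\<^esub>z)=finprod H (%i. l (a i) (g i)) (insert i S)" .
  show ?case by (intro bexI[of _ "?f\<otimes>\<^bsub>Fr\<^esub>z"] conjI 1 2 Fr.m_closed f z(1))
 qed
 then obtain z where z: "z:carrier Fr" "K #>\<^bsub>Fr\<^esub>z=\<one>\<^bsub>T\<^esub>" "h z=finprod H (%i. l (a i) (g i)) S" using one by auto
 hence "z:K" using proj_eq_one_iff by blast
 thus ?thesis using Kh z(3) by (auto simp: kernel_def)
qed

end

context full_lattice_polytope begin

lemma comm_group_M: "comm_group (additive_group M)"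
proof (rule comm_groupI)
 fix x assume "x:carrier (additive_group M)"
 thus "EX y:carrier (additive_group M). y\<otimes>\<^bsub>additive_group M\<^esub>x=\<one>\<^bsub>additive_group M\<^esub>"
  using minus_M[OF zero_M, of x] by (intro bexI[of _ "- x"]) (auto simp: additive_group_def)
qed (auto simp: additive_group_def zero_M add_M algebra_simps)

text \<open>As \<open>M\<close> is free, an element of \<open>M \<otimes> G\<close> is trivial if all elements of the dual lattice, applied to the first factor, send it to the identity of \<open>G\<close>.\<close>
lemma tensor_finprod_one_iff:
 assumes G: "comm_group G" and S: "finite S" and dg: "!!i. i:S ==> m i:M & g i:carrier G"
 shows "finprod (tensor_group (additive_group M) G) (%i. pure_tensor (additive_group M) G (m i) (g i)) S
   = \<one>\<^bsub>tensor_group (additive_group M) G\<^esub>\<longleftrightarrow>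
  (ALL w:N. finprod G (%i. g i [^]\<^bsub>G\<^esub>\<lfloor>w\<bullet>m i\<rfloor>) S=\<one>\<^bsub>G\<^esub>)"
proof -
 let ?A = "additive_group M"
 have A: "comm_group ?A" by (rule comm_group_M)
 interpret tp: tensor_pair ?A G by (simp add: tensor_pair_def A G)
 have cA: "carrier ?A=M" "!!x y. x\<otimes>\<^bsub>?A\<^esub>y=x + y" "\<one>\<^bsub>?A\<^esub>= 0" by (simp_all add: additive_group_def)
 have fl: "\<lfloor>w\<bullet>(a + a')\<rfloor>=\<lfloor>w\<bullet>a\<rfloor> + \<lfloor>w\<bullet>a'\<rfloor>" if wN: "w:N" "a:M" for w a a'
  using N_M_int[OF wN] by (auto simp: inner_add_right elim!: Ints_cases)
 show ?thesis
 proof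
  assume one: "finprod tp.T (%i. tp.pt (m i) (g i)) S=\<one>\<^bsub>tp.T\<^esub>"
  show "ALL w:N. finprod G (%i. g i [^]\<^bsub>G\<^esub>\<lfloor>w\<bullet>m i\<rfloor>) S=\<one>\<^bsub>G\<^esub>"
  proof
   fix w assume w: "w:N"
   show "finprod G (%i. g i [^]\<^bsub>G\<^esub>\<lfloor>w\<bullet>m i\<rfloor>) S=\<one>\<^bsub>G\<^esub>"
    by (rule tp.bilinear_kills[OF G, where l = "%a g. g [^]\<^bsub>G\<^esub>\<lfloor>w\<bullet>a\<rfloor>", OF _ _ _ S _ one])
     (use fl[OF w] dg in \<open>auto simp: cA tp.G.int_pow_mult tp.G.int_pow_distrib\<close>)
  qed
 next
  assume all: "ALL w:N. finprod G (%i. g i [^]\<^bsub>G\<^esub>\<lfloor>w\<bullet>m i\<rfloor>) S=\<one>\<^bsub>G\<^esub>"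
  obtain B D where BD: "dual_bases B D" using dual_bases_exist by blast
  hence fB: "finite B" and BM: "B\<subseteq>M" and DN: "!!b. b:B ==> D b:N"
   and exp: "!!x. x:span M ==> x=(\<Sum>b\<in>B. (D b\<bullet>x) *\<^sub>R b)" unfolding dual_bases_def by blast+
  have scale: "tp.pt (of_int i *\<^sub>R b) x=tp.pt b (x [^]\<^bsub>G\<^esub>i)" if b: "b:M" and x: "x:carrier G" for i b x
  proof -
   have sum: "b [^]\<^bsub>?A\<^esub>i = of_int i *\<^sub>R b" for i :: int
   proof -
    have nat: "b [^]\<^bsub>?A\<^esub>int k = of_int (int k) *\<^sub>R b" for k
    proof (induction k)
     case (Suc k)
     have "b [^]\<^bsub>?A\<^esub>int (Suc k)=b [^]\<^bsub>?A\<^esub>int k\<otimes>\<^bsub>?A\<^esub>b"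
      by (simp only: int_pow_int nat_pow_Suc)
     thus ?case using Suc by (simp add: cA algebra_simps)
    qed (simp add: int_pow_int cA)
    show ?thesis
    proof (cases "i\<ge>0")
     case True thus ?thesis using nat[of "nat i"] by simp
    next
     case False
     have "b [^]\<^bsub>?A\<^esub>i\<otimes>\<^bsub>?A\<^esub>b [^]\<^bsub>?A\<^esub>(- i)=\<one>\<^bsub>?A\<^esub>"
      using tp.A.int_pow_mult[of b i "- i"] b by (simp add: cA)
     hence "b [^]\<^bsub>?A\<^esub>i + of_int (- i) *\<^sub>R b=0" using nat[of "nat (- i)"] False by (simp add: cA)
     thus ?thesis by (metis add.commute add_eq_0_iff minus_minus of_int_minus scaleR_minus_left)
    qed
   qed
   have "tp.pt (b [^]\<^bsub>?A\<^esub>i) x=tp.pt b x [^]\<^bsub>tp.T\<^esub>i"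
    using hom_int_pow[OF tp.pt_left_hom[OF x], of b i] b tp.A.is_group tp.T.is_group by (simp add: cA)
   also have "...=tp.pt b (x [^]\<^bsub>G\<^esub>i)"
    using hom_int_pow[OF tp.pt_right_hom, of b x i] b x tp.G.is_group tp.T.is_group by (simp add: cA)
   finally show ?thesis unfolding sum .
  qed
  have coord: "of_int \<lfloor>D b\<bullet>x\<rfloor>=D b\<bullet>x" if "b:B" "x:M" for b x
   using N_M_int[OF DN[OF that(1)] that(2)] by (auto elim!: Ints_cases)
  have decomp: "tp.pt x y=finprod tp.T (%b. tp.pt b (y [^]\<^bsub>G\<^esub>\<lfloor>D b\<bullet>x\<rfloor>)) B" if x: "x:M" and y: "y:carrier G" for x y
  proof -
   have "(\<Sum>b\<in>C. of_int \<lfloor>D b\<bullet>x\<rfloor> *\<^sub>R b):M &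
     tp.pt (\<Sum>b\<in>C. of_int \<lfloor>D b\<bullet>x\<rfloor> *\<^sub>R b) y=finprod tp.T (%b. tp.pt b (y [^]\<^bsub>G\<^esub>\<lfloor>D b\<bullet>x\<rfloor>)) C" if "C\<subseteq>B" for C
    using finite_subset[OF that fB] that
   proof (induction C rule: finite_induct)
    case empty
    thus ?case using tp.pt_one_left[OF y] zero_M by (simp add: cA)
   next
    case (insert b C)
    let ?s = "\<Sum>b\<in>C. of_int \<lfloor>D b\<bullet>x\<rfloor> *\<^sub>R b" and ?t = "of_int \<lfloor>D b\<bullet>x\<rfloor> *\<^sub>R b"
    have b: "b:M" "?t:M" using insert.prems BM scale_M by auto
    have IH: "?s:M" "tp.pt ?s y=finprod tp.T (%b. tp.pt b (y [^]\<^bsub>G\<^esub>\<lfloor>D b\<bullet>x\<rfloor>)) C" using insert by auto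
    have "tp.pt (?t + ?s) y=tp.pt b (y [^]\<^bsub>G\<^esub>\<lfloor>D b\<bullet>x\<rfloor>)\<otimes>\<^bsub>tp.T\<^esub>finprod tp.T (%b. tp.pt b (y [^]\<^bsub>G\<^esub>\<lfloor>D b\<bullet>x\<rfloor>)) C"
     using tp.pt_add_left[of ?t ?s y] b IH y scale[OF b(1) y] by (simp add: cA)
    also have "...=finprod tp.T (%b. tp.pt b (y [^]\<^bsub>G\<^esub>\<lfloor>D b\<bullet>x\<rfloor>)) (insert b C)"
     using insert b y tp.pt_closed BM by (intro tp.T.finprod_insert[symmetric]) (auto simp: cA)
    finally show ?case using insert.hyps add_M[OF b(2) IH(1)] by simp
   qed
   from this[OF order_refl] have "tp.pt (\<Sum>b\<in>B. of_int \<lfloor>D b\<bullet>x\<rfloor> *\<^sub>R b) y=finprod tp.T (%b. tp.pt b (y [^]\<^bsub>G\<^esub>\<lfloor>D b\<bullet>x\<rfloor>)) B" by blast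
   moreover have "(\<Sum>b\<in>B. of_int \<lfloor>D b\<bullet>x\<rfloor> *\<^sub>R b)=(\<Sum>b\<in>B. (D b\<bullet>x) *\<^sub>R b)"
    using coord[OF _ x] by (intro sum.cong) auto
   ultimately show ?thesis using exp[OF span_base[OF x]] by simp
  qed
  have "finprod tp.T (%i. tp.pt (m i) (g i)) S'=finprod tp.T (%b. tp.pt b (finprod G (%i. g i [^]\<^bsub>G\<^esub>\<lfloor>D b\<bullet>m i\<rfloor>) S')) B"
   if "S'\<subseteq>S" for S'
   using finite_subset[OF that S] that
  proof (induction S' rule: finite_induct)
   case empty
   have "finprod tp.T (%b. tp.pt b \<one>\<^bsub>G\<^esub>) B=\<one>\<^bsub>tp.T\<^esub>"
    using BM tp.pt_one_right by (intro tp.T.finprod_one_eqI) (auto simp: cA)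
   thus ?case by simp
  next
   case (insert i S')
   have i: "m i:M" "g i:carrier G" and S': "!!j. j:S' ==> g j:carrier G" using dg insert.prems by auto
   let ?P = "%b. finprod G (%i. g i [^]\<^bsub>G\<^esub>\<lfloor>D b\<bullet>m i\<rfloor>) S'"
   have P: "?P b:carrier G" for b using S' by (intro tp.G.finprod_closed) auto
   have "finprod tp.T (%i. tp.pt (m i) (g i)) (insert i S')=tp.pt (m i) (g i)\<otimes>\<^bsub>tp.T\<^esub>finprod tp.T (%i. tp.pt (m i) (g i)) S'"
    using insert dg tp.pt_closed by (intro tp.T.finprod_insert) (auto simp: cA)
   also have "...=finprod tp.T (%b. tp.pt b (g i [^]\<^bsub>G\<^esub>\<lfloor>D b\<bullet>m i\<rfloor>)) B\<otimes>\<^bsub>tp.T\<^esub>finprod tp.T (%b. tp.pt b (?P b)) B"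
    using decomp[OF i] insert by simp
   also have "...=finprod tp.T (%b. tp.pt b (g i [^]\<^bsub>G\<^esub>\<lfloor>D b\<bullet>m i\<rfloor>)\<otimes>\<^bsub>tp.T\<^esub>tp.pt b (?P b)) B"
    using i P BM tp.pt_closed by (intro tp.T.finprod_multf[symmetric]) (auto simp: cA)
   also have "...=finprod tp.T (%b. tp.pt b (finprod G (%i. g i [^]\<^bsub>G\<^esub>\<lfloor>D b\<bullet>m i\<rfloor>) (insert i S'))) B"
   proof (rule tp.T.finprod_cong')
    show "(%b. tp.pt b (finprod G (%i. g i [^]\<^bsub>G\<^esub>\<lfloor>D b\<bullet>m i\<rfloor>) (insert i S'))):B \<rightarrow> carrier tp.T"
     using i S' BM tp.pt_closed by (auto simp: cA intro!: tp.G.finprod_closed)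
    fix b assume b: "b:B"
    have "finprod G (%i. g i [^]\<^bsub>G\<^esub>\<lfloor>D b\<bullet>m i\<rfloor>) (insert i S')=g i [^]\<^bsub>G\<^esub>\<lfloor>D b\<bullet>m i\<rfloor>\<otimes>\<^bsub>G\<^esub>?P b"
     using insert i S' by (intro tp.G.finprod_insert) auto
    thus "tp.pt b (g i [^]\<^bsub>G\<^esub>\<lfloor>D b\<bullet>m i\<rfloor>)\<otimes>\<^bsub>tp.T\<^esub>tp.pt b (?P b)=tp.pt b (finprod G (%i. g i [^]\<^bsub>G\<^esub>\<lfloor>D b\<bullet>m i\<rfloor>) (insert i S'))"
     using tp.pt_add_right[of b "g i [^]\<^bsub>G\<^esub>\<lfloor>D b\<bullet>m i\<rfloor>" "?P b"] b BM i P by (simp add: cA subset_iff)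
   qed simp
   finally show ?case .
  qed
  from this[OF order_refl] have "finprod tp.T (%i. tp.pt (m i) (g i)) S=finprod tp.T (%b. tp.pt b (finprod G (%i. g i [^]\<^bsub>G\<^esub>\<lfloor>D b\<bullet>m i\<rfloor>) S)) B" .
  also have "...=\<one>\<^bsub>tp.T\<^esub>"
   using all DN BM tp.pt_one_right by (intro tp.T.finprod_one_eqI) (auto simp: cA subset_iff)
  finally show "finprod tp.T (%i. tp.pt (m i) (g i)) S=\<one>\<^bsub>tp.T\<^esub>" .
 qed
qed

end

section \<open>Families of group elements\<close>

text \<open>The sections of both presheaves are subgroups of a product of groups, with extensional functions as tuples.\<close>
lemma comm_group_families:
 assumes G: "!!i. i:A ==> comm_group (G i)"
  and C: "C\<subseteq>(\<Pi>\<^sub>E i\<in>A. carrier (G i))"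
  and mult: "!!h h'. [|h:C; h':C|] ==> (\<lambda>i\<in>A. h i\<otimes>\<^bsub>G i\<^esub>h' i):C"
  and one: "(\<lambda>i\<in>A. \<one>\<^bsub>G i\<^esub>):C"
  and inv: "!!h. h:C ==> (\<lambda>i\<in>A. inv\<^bsub>G i\<^esub>h i):C"
 shows "comm_group \<lparr>carrier=C, mult=(%h h'. \<lambda>i\<in>A. h i\<otimes>\<^bsub>G i\<^esub>h' i), one=(\<lambda>i\<in>A. \<one>\<^bsub>G i\<^esub>)\<rparr>" (is "comm_group ?F")
proof -
 have cl: "h i:carrier (G i)" if "h:C" "i:A" for h i using subsetD[OF C that(1)] that(2) by (auto simp: PiE_iff)
 have ex: "h:extensional A" if "h:C" for h using subsetD[OF C that] by (auto simp: PiE_iff)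
 show ?thesis
 proof (rule comm_groupI)
  fix h h' h'' assume hs: "h:carrier ?F" "h':carrier ?F" "h'':carrier ?F"
  show "h\<otimes>\<^bsub>?F\<^esub>h'\<otimes>\<^bsub>?F\<^esub>h''=h\<otimes>\<^bsub>?F\<^esub>(h'\<otimes>\<^bsub>?F\<^esub>h'')"
  proof (rule extensionalityI[of _ A])
   fix i assume i: "i:A"
   interpret Gi: comm_group "G i" using G[OF i] .
   show "(h\<otimes>\<^bsub>?F\<^esub>h'\<otimes>\<^bsub>?F\<^esub>h'') i=(h\<otimes>\<^bsub>?F\<^esub>(h'\<otimes>\<^bsub>?F\<^esub>h'')) i"
    using hs i cl by (simp add: Gi.m_assoc)
  qed simp_all
 next
  fix h h' assume hs: "h:carrier ?F" "h':carrier ?F"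
  show "h\<otimes>\<^bsub>?F\<^esub>h'=h'\<otimes>\<^bsub>?F\<^esub>h"
  proof (rule extensionalityI[of _ A])
   fix i assume i: "i:A"
   interpret Gi: comm_group "G i" using G[OF i] .
   show "(h\<otimes>\<^bsub>?F\<^esub>h') i=(h'\<otimes>\<^bsub>?F\<^esub>h) i"
    using hs i cl by (simp add: Gi.m_comm)
  qed simp_all
 next
  fix h assume h: "h:carrier ?F"
  show "\<one>\<^bsub>?F\<^esub>\<otimes>\<^bsub>?F\<^esub>h=h"
  proof (rule extensionalityI[of _ A])
   fix i assume i: "i:A"
   interpret Gi: comm_group "G i" using G[OF i] .
   show "(\<one>\<^bsub>?F\<^esub>\<otimes>\<^bsub>?F\<^esub>h) i=h i" using h i cl by simp
  qed (use ex h in simp_all)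
  show "EX y:carrier ?F. y\<otimes>\<^bsub>?F\<^esub>h=\<one>\<^bsub>?F\<^esub>"
  proof (rule bexI)
   show "(\<lambda>i\<in>A. inv\<^bsub>G i\<^esub>h i)\<otimes>\<^bsub>?F\<^esub>h=\<one>\<^bsub>?F\<^esub>"
   proof (rule extensionalityI[of _ A])
    fix i assume i: "i:A"
    interpret Gi: comm_group "G i" using G[OF i] .
    show "((\<lambda>i\<in>A. inv\<^bsub>G i\<^esub>h i)\<otimes>\<^bsub>?F\<^esub>h) i=\<one>\<^bsub>?F\<^esub>i" using h i cl by simp
   qed simp_all
  qed (use inv h in simp)
 qed (use mult one in simp_all)
qed

lemma comm_group_inv_hom: "comm_group G ==> (%a. inv\<^bsub>G\<^esub>a):hom G G"
proof (rule homI)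
 assume "comm_group G"
 then interpret comm_group G .
 show "inv\<^bsub>G\<^esub>x:carrier G" if "x:carrier G" for x using that by simp
 show "inv\<^bsub>G\<^esub>(x\<otimes>\<^bsub>G\<^esub>y)=inv\<^bsub>G\<^esub>x\<otimes>\<^bsub>G\<^esub>inv\<^bsub>G\<^esub>y" if "x:carrier G" "y:carrier G" for x y
  using that by (rule inv_mult)
qed

section \<open>Kinks\<close>

context oriented_polytope begin

lemma pl_on_hom:
 assumes "\<psi>:hom G G'" "pl_on G fc \<eta>"
 shows "pl_on G' fc (%w. \<psi> (\<eta> w))"
 using assms(2) hom_in_carrier[OF assms(1)] hom_mult[OF assms(1)] unfolding pl_on_def by simp

lemma pl_on_cong:
 assumes "pl_on G fc \<eta>" "!!v w. [|v extreme_point_of \<sigma>; v:fc; w:N; v:minface w|] ==> \<eta> w=\<eta>' w"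
 shows "pl_on G fc \<eta>'"
 unfolding pl_on_def
proof (intro allI impI ballI conjI)
 fix v w assume v: "v extreme_point_of \<sigma>" "v:fc" and w: "w:N" "v:minface w"
 have pl: "\<eta> w:carrier G" "!!w'. [|w':N; v:minface w'|] ==> \<eta> (w + w')=\<eta> w\<otimes>\<^bsub>G\<^esub>\<eta> w'"
  using assms(1) v w unfolding pl_on_def by blast+
 show "\<eta>' w:carrier G" using pl(1) assms(2)[OF v w] by simp
 fix w' assume w': "w':N" "v:minface w'"
 show "\<eta>' (w + w')=\<eta>' w\<otimes>\<^bsub>G\<^esub>\<eta>' w'"
  using pl(2)[OF w'] assms(2)[OF v w] assms(2)[OF v w'] assms(2)[OF v add_N[OF w(1) w'(1)] minface_addI[OF w(2) w'(2)]] by simp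
qed

context
 fixes ed assumes ed: "ed edge_of \<sigma>"
begin

lemma kink_points:
 "base ed:N" "src ed:minface (base ed)"
 "base ed + dirw ed:N" "src ed:minface (base ed + dirw ed)"
 "base ed - dirw ed:N" "tgt ed:minface (base ed - dirw ed)"
 using base[OF ed] dirw[OF ed] ends(6)[OF ed] add_N minus_N by blast+

lemma kink_values:
 assumes Q: "!!v w. [|v extreme_point_of \<sigma>; v:ed; w:N; v:minface w|] ==> Q w"
 shows "Q (base ed)" "Q (base ed + dirw ed)" "Q (base ed - dirw ed)"
 using Q[OF ends(3,6)[OF ed] kink_points(1,2)] Q[OF ends(3,6)[OF ed] kink_points(3,4)] Q[OF ends(4,7)[OF ed] kink_points(5,6)] .

lemma kink_cong:
 assumes "!!v w. [|v extreme_point_of \<sigma>; v:ed; w:N; v:minface w|] ==> \<eta> w=\<eta>' w"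
 shows "kink G \<eta> ed=kink G \<eta>' ed"
 using kink_values[of "%w. \<eta> w=\<eta>' w", OF assms] by (simp add: kink_def)

lemma pl_on_closed: "[|pl_on G ed \<eta>; v extreme_point_of \<sigma>; v:ed; w:N; v:minface w|] ==> \<eta> w:carrier G"
 unfolding pl_on_def by blast

lemma kink_hom:
 assumes G: "comm_group G" "comm_group G'" and \<psi>: "\<psi>:hom G G'" and pl: "pl_on G ed \<eta>"
 shows "\<psi> (kink G \<eta> ed)=kink G' (%w. \<psi> (\<eta> w)) ed"
proof -
 interpret G: comm_group G by fact
 interpret G': comm_group G' by fact
 interpret \<psi>: group_hom G G' \<psi> by (simp add: group_hom_def group_hom_axioms_def \<psi> G.is_group G'.is_group)
 note c = kink_values[of "%w. \<eta> w:carrier G", OF pl_on_closed[OF pl]]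
 show ?thesis using c by (simp add: kink_def)
qed

lemma kink_mult:
 assumes G: "comm_group G" and pl: "pl_on G ed \<eta>" "pl_on G ed \<eta>'"
 shows "kink G (%w. \<eta> w\<otimes>\<^bsub>G\<^esub>\<eta>' w) ed=kink G \<eta> ed\<otimes>\<^bsub>G\<^esub>kink G \<eta>' ed"
proof -
 interpret G: comm_group G by fact
 note c = kink_values[of "%w. \<eta> w:carrier G", OF pl_on_closed[OF pl(1)]]
 note c' = kink_values[of "%w. \<eta>' w:carrier G", OF pl_on_closed[OF pl(2)]]
 show ?thesis using c c' by (simp add: kink_def G.inv_mult G.m_ac)
qed

lemma kink_additive:
 assumes G: "comm_group G" and \<eta>: "!!w. w:N ==> \<eta> w:carrier G"
  "!!w w'. [|w:N; w':N|] ==> \<eta> (w + w')=\<eta> w\<otimes>\<^bsub>G\<^esub>\<eta> w'"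
 shows "kink G \<eta> ed=\<one>\<^bsub>G\<^esub>"
proof -
 interpret G: comm_group G by fact
 note c = \<eta>(1)[OF kink_points(1)] \<eta>(1)[OF kink_points(3)] \<eta>(1)[OF kink_points(5)]
 have "\<eta> (base ed)\<otimes>\<^bsub>G\<^esub>\<eta> (base ed)=\<eta> ((base ed + dirw ed) + (base ed - dirw ed))"
  using \<eta>(2)[OF kink_points(1) kink_points(1)] by simp
 also have "...=\<eta> (base ed + dirw ed)\<otimes>\<^bsub>G\<^esub>\<eta> (base ed - dirw ed)" by (rule \<eta>(2)[OF kink_points(3) kink_points(5)])
 finally show ?thesis using c by (simp add: kink_def)
qed

end

end

section \<open>The two sheaves\<close>

context oriented_log_scheme begin

abbreviation "P \<equiv> P_monoid M \<sigma>"
abbreviation "Ip p \<equiv> strata_ideal (faces_p p)"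
abbreviation "Ie fc \<equiv> strata_ideal {fc}"
abbreviation "bd w \<equiv> (w, hgt w)"
abbreviation "edges \<equiv> {ed. ed edge_of \<sigma>}"
abbreviation LF :: "(('a, 'k) point, 'a\<times>real=>('a, 'k) local_fun) presheaf" where "LF \<equiv> log_families M \<sigma> r"
abbreviation ES :: "(('a, 'k) point, 'a set=>('a, 'k) local_fun) presheaf" where "ES \<equiv> edge_sheaf M \<sigma> r d \<epsilon>"

lemma P_add: "[|p:P; q:P|] ==> p + q:P"
 using hgt_add_le[of "fst p" "fst q"] add_N by (auto simp: P_monoid_eq)

lemma bd_P: "w:N ==> bd w:P" by (simp add: P_monoid_eq hgt_int)

lemma faces_p_bd: "w:N ==> faces_p (bd w)={fc:vertex_faces. fc\<subseteq>minface w}"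
 by (simp add: faces_p_def boundary_P_eq)

text \<open>Heights are subadditive, so a sum lies on the boundary only if both summands do and the two functionals are minimal at a common vertex.\<close>
lemma faces_p_add:
 assumes "p:P" "q:P"
 shows "faces_p (p + q)\<subseteq>faces_p p\<inter>faces_p q"
proof
 fix fc assume t: "fc:faces_p (p + q)"
 hence b: "p + q:boundary_P M \<sigma>" and fc: "fc:vertex_faces" "fc\<subseteq>minface (fst p + fst q)"
  by (auto simp: faces_p_def split: if_splits)
 obtain w where w: "p + q=(w, hgt w)" using b by (auto simp: boundary_P_eq)
 have e: "snd p + snd q=hgt (fst p + fst q)" using arg_cong[OF w, of fst] arg_cong[OF w, of snd] by simp
 have g: "hgt (fst p)\<le>snd p" "hgt (fst q)\<le>snd q" "fst p:N" "fst q:N" using assms by (auto simp: P_monoid_eq)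
 have "snd p=hgt (fst p)" "snd q=hgt (fst q)" "hgt (fst p + fst q)=hgt (fst p) + hgt (fst q)"
  using e g hgt_add_le[of "fst p" "fst q"] by linarith+
 hence "p:boundary_P M \<sigma>" "q:boundary_P M \<sigma>" "minface (fst p + fst q)=minface (fst p)\<inter>minface (fst q)"
  using g minface_add hgt_add_iff by (auto simp: boundary_P_eq prod_eq_iff)
 thus "fc:faces_p p\<inter>faces_p q" using fc by (auto simp: faces_p_def)
qed

lemma Ip_ideal: "ideal (Ip p) R" using ideal_strata_ideal[of "faces_p p"] faces_p(2) by blast

lemma Ip_add: "[|p:P; q:P|] ==> Ip p\<subseteq>Ip (p + q)" "[|p:P; q:P|] ==> Ip q\<subseteq>Ip (p + q)"
 using strata_ideal_antimono faces_p_add by blast+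

lemma strata_ideal_mono_face:
 assumes "is_face fc" "is_face fc'" "fc'\<subseteq>fc"
 shows "Ie fc'\<subseteq>Ie fc"
proof
 fix f assume f: "f:Ie fc'"
 hence "f:carrier R" "pr fc' f=0" by (auto simp: strata_ideal_def)
 moreover have "pr fc f=0" using pr_pr_subset[OF assms, of f] calculation(2) pr_zero by simp
 ultimately show "f:Ie fc" by (auto simp: strata_ideal_def)
qed

lemma Ip_vertex:
 assumes v: "v extreme_point_of \<sigma>" "v:minface w" and w: "w:N"
 shows "Ip (bd w)\<subseteq>Ie {v}"
proof (rule strata_ideal_antimono)
 show "{{v}}\<subseteq>faces_p (bd w)" unfolding faces_p_bd[OF w] using v by (auto simp: vertex_faces_def)
qed

lemma Ip_face:
 assumes v: "v extreme_point_of \<sigma>" "v:minface w" "v:fc" and w: "w:N" and fc: "is_face fc"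
 shows "Ip (bd w)\<subseteq>Ie fc"
 using Ip_vertex[OF v(1,2) w] strata_ideal_mono_face[OF fc is_face_vertex[OF v(1)]] v(3) by blast

lemma LF_sect: "sect LF U=\<lparr>
    carrier={h:(\<Pi>\<^sub>E p\<in>P. carrier (Inv (Ip p) U)).
     ALL p:P. ALL q:P. rs (Ip (p + q)) U (h p)\<otimes>\<^bsub>Inv (Ip (p + q)) U\<^esub>rs (Ip (p + q)) U (h q)=h (p + q)},
    mult=(%h h'. \<lambda>p\<in>P. h p\<otimes>\<^bsub>Inv (Ip p) U\<^esub>h' p),
    one=(\<lambda>p\<in>P. \<one>\<^bsub>Inv (Ip p) U\<^esub>)\<rparr>"
 by (simp add: log_families_def Let_def ideal_p_eq R_def[symmetric])

lemma LF_restr: "restr LF U W h=(\<lambda>p\<in>P. rs (Ip p) W (h p))"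
 by (simp add: log_families_def Let_def ideal_p_eq R_def[symmetric])

lemma LF_carrier: "h:carrier (sect LF U) \<longleftrightarrow> h:(\<Pi>\<^sub>E p\<in>P. carrier (Inv (Ip p) U)) &
  (ALL p:P. ALL q:P. rs (Ip (p + q)) U (h p)\<otimes>\<^bsub>Inv (Ip (p + q)) U\<^esub>rs (Ip (p + q)) U (h q)=h (p + q))"
 by (simp add: LF_sect)

lemma LF_mult: "h\<otimes>\<^bsub>sect LF U\<^esub>h'=(\<lambda>p\<in>P. h p\<otimes>\<^bsub>Inv (Ip p) U\<^esub>h' p)" by (simp add: LF_sect)

lemma LF_closed: "[|h:carrier (sect LF U); p:P|] ==> h p:carrier (Inv (Ip p) U)"
 by (simp add: LF_carrier PiE_iff)

lemma LF_ext: "h:carrier (sect LF U) ==> h:extensional P"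
 by (simp add: LF_carrier PiE_iff)

lemma LF_law: "[|h:carrier (sect LF U); p:P; q:P|] ==>
  h (p + q)=rs (Ip (p + q)) U (h p)\<otimes>\<^bsub>Inv (Ip (p + q)) U\<^esub>rs (Ip (p + q)) U (h q)"
 by (simp add: LF_carrier)

lemma Inv_group: "[|ideal I R; opn U|] ==> comm_group (Inv I U)" by (rule R.comm_group_invertible_functions)

lemma LF_restrict_hom:
 assumes "opn U" "p:P" "q:P"
 shows "group_hom (Inv (Ip p) U) (Inv (Ip (p + q)) U) (rs (Ip (p + q)) U)"
  "group_hom (Inv (Ip q) U) (Inv (Ip (p + q)) U) (rs (Ip (p + q)) U)"
 using R.restrict_function_hom[OF Ip_ideal Ip_ideal Ip_add(1)[OF assms(2,3)] assms(1) assms(1) subset_refl]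
  R.restrict_function_hom[OF Ip_ideal Ip_ideal Ip_add(2)[OF assms(2,3)] assms(1) assms(1) subset_refl]
  Inv_group[OF Ip_ideal assms(1)] comm_group.axioms(2)
 unfolding group_hom_def group_hom_axioms_def by blast+

lemma LF_group:
 assumes U: "opn U"
 shows "comm_group (sect LF U)"
 unfolding LF_sect
proof (rule comm_group_families)
 show "comm_group (Inv (Ip p) U)" for p using Inv_group[OF Ip_ideal U] .
 let ?C = "{h:(\<Pi>\<^sub>E p\<in>P. carrier (Inv (Ip p) U)).
     ALL p:P. ALL q:P. rs (Ip (p + q)) U (h p)\<otimes>\<^bsub>Inv (Ip (p + q)) U\<^esub>rs (Ip (p + q)) U (h q)=h (p + q)}"
 show "?C\<subseteq>(\<Pi>\<^sub>E p\<in>P. carrier (Inv (Ip p) U))" by blast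
 have C: "h p:carrier (Inv (Ip p) U)" "h (p + q)=rs (Ip (p + q)) U (h p)\<otimes>\<^bsub>Inv (Ip (p + q)) U\<^esub>rs (Ip (p + q)) U (h q)"
  if "h:?C" "p:P" "q:P" for h p q using that by (simp_all add: PiE_iff)
 fix h assume h: "h:?C"
 show "(\<lambda>p\<in>P. inv\<^bsub>Inv (Ip p) U\<^esub>h p):?C"
 proof (intro CollectI conjI ballI)
  show "(\<lambda>p\<in>P. inv\<^bsub>Inv (Ip p) U\<^esub>h p):(\<Pi>\<^sub>E p\<in>P. carrier (Inv (Ip p) U))"
  proof
   fix p assume p: "p:P"
   interpret G: comm_group "Inv (Ip p) U" using Inv_group[OF Ip_ideal U] .
   show "(\<lambda>p\<in>P. inv\<^bsub>Inv (Ip p) U\<^esub>h p) p:carrier (Inv (Ip p) U)" using p C(1)[OF h p p] by simp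
  qed simp
  fix p q assume pq: "p:P" "q:P"
  interpret p: group_hom "Inv (Ip p) U" "Inv (Ip (p + q)) U" "rs (Ip (p + q)) U" by (rule LF_restrict_hom(1)[OF U pq])
  interpret q: group_hom "Inv (Ip q) U" "Inv (Ip (p + q)) U" "rs (Ip (p + q)) U" by (rule LF_restrict_hom(2)[OF U pq])
  interpret G: comm_group "Inv (Ip (p + q)) U" using Inv_group[OF Ip_ideal U] .
  show "rs (Ip (p + q)) U ((\<lambda>p\<in>P. inv\<^bsub>Inv (Ip p) U\<^esub>h p) p)\<otimes>\<^bsub>Inv (Ip (p + q)) U\<^esub>
    rs (Ip (p + q)) U ((\<lambda>p\<in>P. inv\<^bsub>Inv (Ip p) U\<^esub>h p) q)=(\<lambda>p\<in>P. inv\<^bsub>Inv (Ip p) U\<^esub>h p) (p + q)"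
   using pq P_add[OF pq] C(1)[OF h pq] C(1)[OF h pq(2,1)] C(2)[OF h pq] by (simp add: G.inv_mult)
 qed
 fix h' assume h': "h':?C"
 show "(\<lambda>p\<in>P. h p\<otimes>\<^bsub>Inv (Ip p) U\<^esub>h' p):?C"
 proof (intro CollectI conjI ballI)
  show "(\<lambda>p\<in>P. h p\<otimes>\<^bsub>Inv (Ip p) U\<^esub>h' p):(\<Pi>\<^sub>E p\<in>P. carrier (Inv (Ip p) U))"
  proof
   fix p assume p: "p:P"
   interpret G: comm_group "Inv (Ip p) U" using Inv_group[OF Ip_ideal U] .
   show "(\<lambda>p\<in>P. h p\<otimes>\<^bsub>Inv (Ip p) U\<^esub>h' p) p:carrier (Inv (Ip p) U)"
    using p G.m_closed[OF C(1)[OF h p p] C(1)[OF h' p p]] by simp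
  qed simp
  fix p q assume pq: "p:P" "q:P"
  interpret p: group_hom "Inv (Ip p) U" "Inv (Ip (p + q)) U" "rs (Ip (p + q)) U" by (rule LF_restrict_hom(1)[OF U pq])
  interpret q: group_hom "Inv (Ip q) U" "Inv (Ip (p + q)) U" "rs (Ip (p + q)) U" by (rule LF_restrict_hom(2)[OF U pq])
  interpret G: comm_group "Inv (Ip (p + q)) U" using Inv_group[OF Ip_ideal U] .
  note c = C(1)[OF h pq] C(1)[OF h pq(2,1)] C(1)[OF h' pq] C(1)[OF h' pq(2,1)]
  have m: "rs (Ip (p + q)) U (h p\<otimes>\<^bsub>Inv (Ip p) U\<^esub>h' p)=rs (Ip (p + q)) U (h p)\<otimes>\<^bsub>Inv (Ip (p + q)) U\<^esub>rs (Ip (p + q)) U (h' p)"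
   "rs (Ip (p + q)) U (h q\<otimes>\<^bsub>Inv (Ip q) U\<^esub>h' q)=rs (Ip (p + q)) U (h q)\<otimes>\<^bsub>Inv (Ip (p + q)) U\<^esub>rs (Ip (p + q)) U (h' q)"
   by (rule p.hom_mult[OF c(1,3)], rule q.hom_mult[OF c(2,4)])
  note cc = p.hom_closed[OF c(1)] q.hom_closed[OF c(2)] p.hom_closed[OF c(3)] q.hom_closed[OF c(4)]
  have s: "(a\<otimes>\<^bsub>Inv (Ip (p + q)) U\<^esub>b)\<otimes>\<^bsub>Inv (Ip (p + q)) U\<^esub>(c\<otimes>\<^bsub>Inv (Ip (p + q)) U\<^esub>e) =
    (a\<otimes>\<^bsub>Inv (Ip (p + q)) U\<^esub>c)\<otimes>\<^bsub>Inv (Ip (p + q)) U\<^esub>(b\<otimes>\<^bsub>Inv (Ip (p + q)) U\<^esub>e)"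
   if "a:carrier (Inv (Ip (p + q)) U)" "b:carrier (Inv (Ip (p + q)) U)" "c:carrier (Inv (Ip (p + q)) U)" "e:carrier (Inv (Ip (p + q)) U)"
   for a b c e using that by (simp only: G.m_ac p.H.m_closed)
  show "rs (Ip (p + q)) U ((\<lambda>p\<in>P. h p\<otimes>\<^bsub>Inv (Ip p) U\<^esub>h' p) p)\<otimes>\<^bsub>Inv (Ip (p + q)) U\<^esub>
    rs (Ip (p + q)) U ((\<lambda>p\<in>P. h p\<otimes>\<^bsub>Inv (Ip p) U\<^esub>h' p) q)=(\<lambda>p\<in>P. h p\<otimes>\<^bsub>Inv (Ip p) U\<^esub>h' p) (p + q)"
   unfolding restrict_apply'[OF pq(1)] restrict_apply'[OF pq(2)] restrict_apply'[OF P_add[OF pq]] m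
    C(2)[OF h pq] C(2)[OF h' pq] by (rule s[OF cc(1,3,2,4)])
 qed
next
 show "(\<lambda>p\<in>P. \<one>\<^bsub>Inv (Ip p) U\<^esub>):{h:(\<Pi>\<^sub>E p\<in>P. carrier (Inv (Ip p) U)).
     ALL p:P. ALL q:P. rs (Ip (p + q)) U (h p)\<otimes>\<^bsub>Inv (Ip (p + q)) U\<^esub>rs (Ip (p + q)) U (h q)=h (p + q)}"
 proof (intro CollectI conjI ballI)
  show "(\<lambda>p\<in>P. \<one>\<^bsub>Inv (Ip p) U\<^esub>):(\<Pi>\<^sub>E p\<in>P. carrier (Inv (Ip p) U))"
  proof
   fix p assume p: "p:P"
   interpret G: comm_group "Inv (Ip p) U" using Inv_group[OF Ip_ideal U] .
   show "(\<lambda>p\<in>P. \<one>\<^bsub>Inv (Ip p) U\<^esub>) p:carrier (Inv (Ip p) U)" using p G.one_closed by simp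
  qed simp
  fix p q assume pq: "p:P" "q:P"
  interpret p: group_hom "Inv (Ip p) U" "Inv (Ip (p + q)) U" "rs (Ip (p + q)) U" by (rule LF_restrict_hom(1)[OF U pq])
  interpret q: group_hom "Inv (Ip q) U" "Inv (Ip (p + q)) U" "rs (Ip (p + q)) U" by (rule LF_restrict_hom(2)[OF U pq])
  show "rs (Ip (p + q)) U ((\<lambda>p\<in>P. \<one>\<^bsub>Inv (Ip p) U\<^esub>) p)\<otimes>\<^bsub>Inv (Ip (p + q)) U\<^esub>
    rs (Ip (p + q)) U ((\<lambda>p\<in>P. \<one>\<^bsub>Inv (Ip p) U\<^esub>) q)=(\<lambda>p\<in>P. \<one>\<^bsub>Inv (Ip p) U\<^esub>) (p + q)"
   unfolding restrict_apply'[OF pq(1)] restrict_apply'[OF pq(2)] restrict_apply'[OF P_add[OF pq]] p.hom_one q.hom_one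
   by (rule p.H.l_one[OF p.H.one_closed])
 qed
qed

lemma LF_restr_closed:
 assumes U: "opn U" "opn W" "W\<subseteq>U" and h: "h:carrier (sect LF U)"
 shows "restr LF U W h:carrier (sect LF W)"
 unfolding LF_carrier LF_restr
proof (intro conjI ballI)
 have c: "rs (Ip p) W (h p):carrier (Inv (Ip p) W)" if "p:P" for p
  using R.restrict_function_closed[OF Ip_ideal Ip_ideal subset_refl U LF_closed[OF h that]] .
 thus "(\<lambda>p\<in>P. rs (Ip p) W (h p)):(\<Pi>\<^sub>E p\<in>P. carrier (Inv (Ip p) W))" by simp
 fix p q assume pq: "p:P" "q:P"
 let ?J = "Ip (p + q)"
 note I = Ip_add(1)[OF pq] Ip_add(2)[OF pq]
 have e: "rs ?J W (rs (Ip p) W (h p))=rs ?J W (rs ?J U (h p))" if "p:P" "Ip p\<subseteq>?J" for p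
  using R.restrict_function_trans[OF Ip_ideal Ip_ideal Ip_ideal subset_refl that(2) U(1,3) subset_refl LF_closed[OF h that(1)]]
   R.restrict_function_trans[OF Ip_ideal Ip_ideal Ip_ideal that(2) subset_refl U(1) subset_refl U(3) LF_closed[OF h that(1)]] by (rule trans[OF _ sym])
 have cl: "rs ?J U (h p):carrier (Inv ?J U)" if "p:P" "Ip p\<subseteq>?J" for p
  using R.restrict_function_closed[OF Ip_ideal Ip_ideal that(2) U(1) U(1) subset_refl LF_closed[OF h that(1)]] .
 show "rs ?J W ((\<lambda>p\<in>P. rs (Ip p) W (h p)) p)\<otimes>\<^bsub>Inv ?J W\<^esub>rs ?J W ((\<lambda>p\<in>P. rs (Ip p) W (h p)) q)=(\<lambda>p\<in>P. rs (Ip p) W (h p)) (p + q)"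
  unfolding restrict_apply'[OF pq(1)] restrict_apply'[OF pq(2)] restrict_apply'[OF P_add[OF pq]] e[OF pq(1) I(1)] e[OF pq(2) I(2)] LF_law[OF h pq]
  by (rule R.restrict_function_mult[OF Ip_ideal Ip_ideal subset_refl U cl[OF pq(1) I(1)] cl[OF pq(2) I(2)], symmetric])
qed

lemma LF_restr_hom:
 assumes U: "opn U" "opn W" "W\<subseteq>U"
 shows "restr LF U W:hom (sect LF U) (sect LF W)"
proof (rule homI)
 fix h h' assume h: "h:carrier (sect LF U)" "h':carrier (sect LF U)"
 show "restr LF U W h:carrier (sect LF W)" using LF_restr_closed[OF U h(1)] .
 show "restr LF U W (h\<otimes>\<^bsub>sect LF U\<^esub>h')=restr LF U W h\<otimes>\<^bsub>sect LF W\<^esub>restr LF U W h'"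
  unfolding LF_restr LF_mult
  by (rule restrict_ext)
   (simp add: R.restrict_function_mult[OF Ip_ideal Ip_ideal subset_refl U LF_closed[OF h(1)] LF_closed[OF h(2)]])
qed

end

section \<open>The cycle condition at points\<close>

context oriented_log_scheme begin

abbreviation "cycle_value fc x f w \<equiv>
 finprod (L x) (%ed. (pull fc x (f ed x) [^]\<^bsub>L x\<^esub>deg w ed) [^]\<^bsub>L x\<^esub>\<epsilon> fc ed) (edges_in fc)"

text \<open>The cycle condition of a two-dimensional face at one point of its stratum, tested against the dual lattice.\<close>
definition cyc :: "'a set=>('a, 'k) point=>('a set=>('a, 'k) local_fun)=>bool" where
 "cyc fc x f \<longleftrightarrow> (ALL w:N. cycle_value fc x f w=\<one>\<^bsub>L x\<^esub>)"

lemma is_face_two: "two_face_of fc \<sigma> ==> is_face fc"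
 by (auto simp: two_face_of_def is_face_def)

lemma Ie_edge:
 assumes "is_face fc" "ed edge_of \<sigma>" "ed\<subseteq>fc"
 shows "Ie ed\<subseteq>Ie fc"
 using strata_ideal_mono_face[OF assms(1) is_face_edge[OF assms(2)] assms(3)] .

lemma pull_edge_closed:
 assumes U: "opn U" "x:U" and fc: "is_face fc" "on_stratum fc x" and ed: "ed:edges_in fc" and f: "f ed:carrier (Inv (Ie ed) U)"
 shows "pull fc x (f ed x):carrier (L x)"
 using pull_closed[OF fc(1) U fc(2) ideal_face[OF is_face_edge] Ie_edge[OF fc(1)] f] ed by blast

lemma eps_zero: "[|two_face_of fc \<sigma>; ed edge_of \<sigma>; \<not> ed\<subseteq>fc|] ==> \<epsilon> fc ed=0"
 using signs unfolding sign_vector_def by blast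

text \<open>The tensor condition is tested against dual vectors, and an equality of invertible functions on a reduced stratum is tested on germs.\<close>
lemma cycle_condition_iff:
 assumes U: "opn U" and fc: "two_face_of fc \<sigma>" and f: "!!ed. ed:edges ==> f ed:carrier (Inv (Ie ed) U)"
 shows "cycle_condition M \<sigma> r d (\<epsilon> fc) fc U f \<longleftrightarrow> (ALL x:U. on_stratum fc x --> cyc fc x f)"
proof -
 have F: "is_face fc" using is_face_two[OF fc] .
 have id: "ideal (Ie fc) R" using ideal_face[OF F] .
 let ?G = "Inv (Ie fc) U"
 have CG: "comm_group ?G" using Inv_group[OF id U] .
 interpret G: comm_group ?G by (rule CG)
 define g where "g=(%ed. (if ed\<subseteq>fc then rs (Ie fc) U (f ed) else \<one>\<^bsub>?G\<^esub>) [^]\<^bsub>?G\<^esub>\<epsilon> fc ed)"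
 have rsc: "rs (Ie fc) U (f ed):carrier ?G" if "ed:edges_in fc" for ed
  using R.restrict_function_closed[OF ideal_face[OF is_face_edge] id Ie_edge[OF F] U U subset_refl f] that by blast
 have gc: "g ed:carrier ?G" if "ed:edges" for ed
  using rsc[of ed] that by (simp add: g_def)
 have "cycle_condition M \<sigma> r d (\<epsilon> fc) fc U f \<longleftrightarrow>
   finprod (tensor_group (additive_group M) ?G) (%ed. pure_tensor (additive_group M) ?G (d ed) (g ed)) edges
    = \<one>\<^bsub>tensor_group (additive_group M) ?G\<^esub>"
  unfolding cycle_condition_def Let_def g_def stratum_ideal_eq R_def[symmetric] ..
 also have "... \<longleftrightarrow> (ALL w:N. finprod ?G (%ed. g ed [^]\<^bsub>?G\<^esub>deg w ed) edges=\<one>\<^bsub>?G\<^esub>)"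
  unfolding deg_def by (rule tensor_finprod_one_iff[OF CG finite_edges]) (use d_M gc in blast)
 also have "... \<longleftrightarrow> (ALL x:U. on_stratum fc x --> cyc fc x f)"
 proof -
  have val: "pull fc x ((finprod ?G (%ed. g ed [^]\<^bsub>?G\<^esub>deg w ed) edges) x) =
    cycle_value fc x f w"
   if x: "x:U" "on_stratum fc x" for x w
  proof -
   have xS: "x:Spec R" using opn_Spec[OF U x(1)] .
   have CL: "comm_group (L x)" using comm_group_L[OF xS] .
   interpret L: comm_group "L x" by (rule CL)
   have eh: "(%s. pull fc x (s x)):hom ?G (L x)" using pull_section_hom[OF F U x id subset_refl] .
   interpret e: group_hom ?G "L x" "%s. pull fc x (s x)"
    by (simp add: group_hom_def group_hom_axioms_def eh G.is_group L.is_group)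
   have one: "pull fc x ((g ed [^]\<^bsub>?G\<^esub>deg w ed) x)=\<one>\<^bsub>L x\<^esub>" if "ed:edges - edges_in fc" for ed
   proof -
    have "g ed=\<one>\<^bsub>?G\<^esub>" using that eps_zero[OF fc] by (simp add: g_def)
    thus ?thesis using e.hom_one by simp
   qed
   have val: "pull fc x ((g ed [^]\<^bsub>?G\<^esub>deg w ed) x)=(pull fc x (f ed x) [^]\<^bsub>L x\<^esub>deg w ed) [^]\<^bsub>L x\<^esub>\<epsilon> fc ed"
    if ed: "ed:edges_in fc" for ed
   proof -
    have "g ed=rs (Ie fc) U (f ed) [^]\<^bsub>?G\<^esub>\<epsilon> fc ed" using ed by (simp add: g_def)
    hence 1: "pull fc x ((g ed [^]\<^bsub>?G\<^esub>deg w ed) x)=(pull fc x (rs (Ie fc) U (f ed) x) [^]\<^bsub>L x\<^esub>\<epsilon> fc ed) [^]\<^bsub>L x\<^esub>deg w ed"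
     using e.hom_int_pow[OF gc[of ed], of "deg w ed"] e.hom_int_pow[OF rsc[OF ed], of "\<epsilon> fc ed"] ed by simp
    have 2: "pull fc x (rs (Ie fc) U (f ed) x)=pull fc x (f ed x)"
     using pull_restrict_function[OF F x(2) U subset_refl x(1) ideal_face[OF is_face_edge] id Ie_edge[OF F] subset_refl f] ed by blast
    have 3: "pull fc x (f ed x):carrier (L x)" using pull_edge_closed[where f = f, OF U x(1) F x(2) ed f] ed by blast
    show ?thesis unfolding 1 2 using 3 by (simp add: L.int_pow_pow mult.commute)
   qed
   have c: "(pull fc x (f ed x) [^]\<^bsub>L x\<^esub>deg w ed) [^]\<^bsub>L x\<^esub>\<epsilon> fc ed:carrier (L x)" if "ed:edges_in fc" for ed
    using pull_edge_closed[where f = f, OF U x(1) F x(2) that f] that by simp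
   have "pull fc x ((finprod ?G (%ed. g ed [^]\<^bsub>?G\<^esub>deg w ed) edges) x)=finprod (L x) (%ed. pull fc x ((g ed [^]\<^bsub>?G\<^esub>deg w ed) x)) edges"
    by (rule finprod_hom[OF CG CL eh finite_edges]) (use gc in simp)
   also have "...=cycle_value fc x f w"
   proof (rule L.finprod_mono_neutral_cong_left[symmetric, OF finite_edges])
    show "(%ed. pull fc x ((g ed [^]\<^bsub>?G\<^esub>deg w ed) x)):edges \<rightarrow> carrier (L x)"
     using e.hom_closed[OF G.int_pow_closed[OF gc]] by (intro Pi_I)
   qed (use val one in auto)
   finally show ?thesis .
  qed
  have oneval: "pull fc x (\<one>\<^bsub>?G\<^esub>x)=\<one>\<^bsub>L x\<^esub>" if x: "x:U" "on_stratum fc x" for x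
   using hom_one[OF pull_section_hom[OF F U x id subset_refl]] G.is_group comm_group.axioms(2)[OF comm_group_L[OF opn_Spec[OF U x(1)]]] by blast
  have fmem: "finprod ?G (%ed. g ed [^]\<^bsub>?G\<^esub>deg w ed) edges:carrier ?G" for w using gc by (intro G.finprod_closed) simp
  show ?thesis
  proof
   assume a: "ALL w:N. finprod ?G (%ed. g ed [^]\<^bsub>?G\<^esub>deg w ed) edges=\<one>\<^bsub>?G\<^esub>"
   show "ALL x:U. on_stratum fc x --> cyc fc x f"
    unfolding cyc_def
   proof (intro ballI impI)
    fix x w assume x: "x:U" "on_stratum fc x" and w: "w:N"
    show "cycle_value fc x f w=\<one>\<^bsub>L x\<^esub>"
     unfolding val[OF x, symmetric] bspec[OF a w] by (rule oneval[OF x])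
   qed
  next
   assume a: "ALL x:U. on_stratum fc x --> cyc fc x f"
   show "ALL w:N. finprod ?G (%ed. g ed [^]\<^bsub>?G\<^esub>deg w ed) edges=\<one>\<^bsub>?G\<^esub>"
   proof
    fix w assume w: "w:N"
    show "finprod ?G (%ed. g ed [^]\<^bsub>?G\<^esub>deg w ed) edges=\<one>\<^bsub>?G\<^esub>"
    proof (rule section_eqI[OF U, of "{fc}"])
     fix x fc' assume x: "x:U" "fc':{fc}" "on_stratum fc' x"
     hence e: "fc'=fc" "on_stratum fc x" by auto
     have "cyc fc x f" using a x(1) e(2) by blast
     thus "pull fc' x ((finprod ?G (%ed. g ed [^]\<^bsub>?G\<^esub>deg w ed) edges) x)=pull fc' x (\<one>\<^bsub>?G\<^esub>x)"
      unfolding e(1) val[OF x(1) e(2)] oneval[OF x(1) e(2)] using w unfolding cyc_def by blast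
    qed (use F fmem in auto)
   qed
  qed
 qed
 finally show ?thesis .
qed

section \<open>The sheaf of edge functions\<close>

abbreviation "edge_functions U \<equiv> (\<Pi>\<^sub>E ed\<in>edges. carrier (Inv (Ie ed) U))"

lemma ES_mult: "f\<otimes>\<^bsub>sect ES U\<^esub>g=(\<lambda>ed\<in>edges. f ed\<otimes>\<^bsub>Inv (Ie ed) U\<^esub>g ed)"
 by (simp add: edge_sheaf_def Let_def stratum_ideal_eq R_def[symmetric])

lemma ES_one: "\<one>\<^bsub>sect ES U\<^esub>= (\<lambda>ed\<in>edges. \<one>\<^bsub>Inv (Ie ed) U\<^esub>)"
 by (simp add: edge_sheaf_def Let_def stratum_ideal_eq R_def[symmetric])

lemma ES_restr: "restr ES U W f=(\<lambda>ed\<in>edges. rs (Ie ed) W (f ed))"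
 by (simp add: edge_sheaf_def Let_def stratum_ideal_eq R_def[symmetric])

lemma ES_carrier:
 assumes U: "opn U"
 shows "carrier (sect ES U)={f:edge_functions U. ALL fc. two_face_of fc \<sigma> --> (ALL x:U. on_stratum fc x --> cyc fc x f)}"
proof -
 have "carrier (sect ES U)={f:edge_functions U. ALL fc. two_face_of fc \<sigma> --> cycle_condition M \<sigma> r d (\<epsilon> fc) fc U f}"
  by (simp add: edge_sheaf_def Let_def stratum_ideal_eq R_def[symmetric])
 also have "...={f:edge_functions U. ALL fc. two_face_of fc \<sigma> --> (ALL x:U. on_stratum fc x --> cyc fc x f)}"
 proof (rule Collect_cong, rule conj_cong[OF refl])
  fix f assume f: "f:edge_functions U"
  hence "!!ed. ed:edges ==> f ed:carrier (Inv (Ie ed) U)" by (auto simp: PiE_iff)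
  from cycle_condition_iff[OF U _ this]
  show "(ALL fc. two_face_of fc \<sigma> --> cycle_condition M \<sigma> r d (\<epsilon> fc) fc U f) \<longleftrightarrow>
   (ALL fc. two_face_of fc \<sigma> --> (ALL x:U. on_stratum fc x --> cyc fc x f))" by simp
 qed
 finally show ?thesis .
qed

lemma ES_sect:
 assumes "opn U"
 shows "sect ES U=\<lparr>carrier={f:edge_functions U. ALL fc. two_face_of fc \<sigma> --> (ALL x:U. on_stratum fc x --> cyc fc x f)},
    mult=(%f g. \<lambda>ed\<in>edges. f ed\<otimes>\<^bsub>Inv (Ie ed) U\<^esub>g ed), one=(\<lambda>ed\<in>edges. \<one>\<^bsub>Inv (Ie ed) U\<^esub>)\<rparr>"
 unfolding ES_carrier[OF assms, symmetric]
 by (simp add: edge_sheaf_def Let_def stratum_ideal_eq R_def[symmetric])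

lemma ES_closed: "[|opn U; f:carrier (sect ES U); ed:edges|] ==> f ed:carrier (Inv (Ie ed) U)"
 by (simp add: ES_carrier PiE_iff)

lemma ES_ext: "[|opn U; f:carrier (sect ES U)|] ==> f:extensional edges"
 by (simp add: ES_carrier PiE_iff)

lemma cyc_cong:
 assumes "!!ed. ed:edges_in fc ==> pull fc x (f ed x)=pull fc x (g ed x)" "x:Spec R"
  "!!ed. ed:edges_in fc ==> pull fc x (g ed x):carrier (L x)" "cyc fc x g"
 shows "cyc fc x f"
 unfolding cyc_def
proof
 fix w assume w: "w:N"
 interpret L: comm_group "L x" using comm_group_L[OF assms(2)] .
 have "cycle_value fc x f w =
   cycle_value fc x g w"
  using assms(1,3) by (intro L.finprod_cong') auto
 thus "cycle_value fc x f w=\<one>\<^bsub>L x\<^esub>"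
  using bspec[OF assms(4)[unfolded cyc_def] w] by simp
qed

lemma ES_group:
 assumes U: "opn U"
 shows "comm_group (sect ES U)"
 unfolding ES_sect[OF U]
proof (rule comm_group_families)
 fix ed assume "ed:edges"
 thus "comm_group (Inv (Ie ed) U)" using Inv_group[OF ideal_face[OF is_face_edge] U] by blast
next
 let ?C = "{f:edge_functions U. ALL fc. two_face_of fc \<sigma> --> (ALL x:U. on_stratum fc x --> cyc fc x f)}"
 show "?C\<subseteq>edge_functions U" by blast
 have Gr: "comm_group (Inv (Ie ed) U)" if "ed:edges" for ed using Inv_group[OF ideal_face[OF is_face_edge] U] that by blast
 have hm: "group_hom (Inv (Ie ed) U) (L x) (%s. pull fc x (s x))" if "ed:edges_in fc" "is_face fc" "x:U" "on_stratum fc x" for ed fc x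
  using pull_section_hom[OF that(2) U that(3,4) ideal_face[OF is_face_edge] Ie_edge[OF that(2)], of ed] that(1)
   comm_group.axioms(2)[OF Gr[of ed]] comm_group.axioms(2)[OF comm_group_L[OF opn_Spec[OF U that(3)]]]
  by (simp add: group_hom_def group_hom_axioms_def)
 have fmem: "f ed:carrier (Inv (Ie ed) U)" if "f:?C" "ed:edges" for f ed using that by (auto simp: PiE_iff)
 have C: "cyc fc x f" if "f:?C" "two_face_of fc \<sigma>" "x:U" "on_stratum fc x" for f fc x using that by blast
 fix f assume f: "f:?C"
 show "(\<lambda>ed\<in>edges. inv\<^bsub>Inv (Ie ed) U\<^esub>f ed):?C"
 proof (intro CollectI conjI allI impI ballI)
  show "(\<lambda>ed\<in>edges. inv\<^bsub>Inv (Ie ed) U\<^esub>f ed):edge_functions U"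
   using group.inv_closed[OF comm_group.axioms(2)[OF Gr] fmem[OF f]] by simp
  fix fc x assume fc: "two_face_of fc \<sigma>" and x: "x:U" "on_stratum fc x"
  have F: "is_face fc" using is_face_two[OF fc] .
  have CL: "comm_group (L x)" using comm_group_L[OF opn_Spec[OF U x(1)]] .
  interpret L: comm_group "L x" by (rule CL)
  have p: "pull fc x ((\<lambda>ed\<in>edges. inv\<^bsub>Inv (Ie ed) U\<^esub>f ed) ed x)=inv\<^bsub>L x\<^esub>pull fc x (f ed x)"
    "pull fc x (f ed x):carrier (L x)" if ed: "ed:edges_in fc" for ed
   using group_hom.hom_inv[OF hm[OF ed F x] fmem[OF f]] group_hom.hom_closed[OF hm[OF ed F x] fmem[OF f]] ed by simp_all
  show "cyc fc x (\<lambda>ed\<in>edges. inv\<^bsub>Inv (Ie ed) U\<^esub>f ed)"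
   unfolding cyc_def
  proof
   fix w assume w: "w:N"
   let ?t = "%ed. (pull fc x (f ed x) [^]\<^bsub>L x\<^esub>deg w ed) [^]\<^bsub>L x\<^esub>\<epsilon> fc ed"
   have "finprod (L x) (%ed. (pull fc x ((\<lambda>ed\<in>edges. inv\<^bsub>Inv (Ie ed) U\<^esub>f ed) ed x) [^]\<^bsub>L x\<^esub>deg w ed) [^]\<^bsub>L x\<^esub>\<epsilon> fc ed) (edges_in fc)
    = finprod (L x) (%ed. inv\<^bsub>L x\<^esub>?t ed) (edges_in fc)"
    using p by (intro L.finprod_cong') (auto simp: L.int_pow_inv)
   also have "...=inv\<^bsub>L x\<^esub>finprod (L x) ?t (edges_in fc)"
    by (rule finprod_hom[OF CL CL comm_group_inv_hom[OF CL] finite_edges_in, symmetric]) (use p(2) in simp)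
   also have "...=\<one>\<^bsub>L x\<^esub>" using bspec[OF C[OF f fc x, unfolded cyc_def] w] by simp
   finally show "finprod (L x) (%ed. (pull fc x ((\<lambda>ed\<in>edges. inv\<^bsub>Inv (Ie ed) U\<^esub>f ed) ed x) [^]\<^bsub>L x\<^esub>deg w ed) [^]\<^bsub>L x\<^esub>\<epsilon> fc ed) (edges_in fc)=\<one>\<^bsub>L x\<^esub>" .
  qed
 qed
 fix g assume g: "g:?C"
 show "(\<lambda>ed\<in>edges. f ed\<otimes>\<^bsub>Inv (Ie ed) U\<^esub>g ed):?C"
 proof (intro CollectI conjI allI impI ballI)
  show "(\<lambda>ed\<in>edges. f ed\<otimes>\<^bsub>Inv (Ie ed) U\<^esub>g ed):edge_functions U"
  proof
   fix ed assume ed: "ed:edges"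
   interpret Gr: comm_group "Inv (Ie ed) U" using Gr[OF ed] .
   show "(\<lambda>ed\<in>edges. f ed\<otimes>\<^bsub>Inv (Ie ed) U\<^esub>g ed) ed:carrier (Inv (Ie ed) U)"
    using Gr.m_closed[OF fmem[OF f ed] fmem[OF g ed]] ed by simp
  qed simp
  fix fc x assume fc: "two_face_of fc \<sigma>" and x: "x:U" "on_stratum fc x"
  have F: "is_face fc" using is_face_two[OF fc] .
  have CL: "comm_group (L x)" using comm_group_L[OF opn_Spec[OF U x(1)]] .
  interpret L: comm_group "L x" by (rule CL)
  have p: "pull fc x ((\<lambda>ed\<in>edges. f ed\<otimes>\<^bsub>Inv (Ie ed) U\<^esub>g ed) ed x)=pull fc x (f ed x)\<otimes>\<^bsub>L x\<^esub>pull fc x (g ed x)"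
    "pull fc x (f ed x):carrier (L x)" "pull fc x (g ed x):carrier (L x)" if ed: "ed:edges_in fc" for ed
   using group_hom.hom_mult[OF hm[OF ed F x] fmem[OF f] fmem[OF g]] group_hom.hom_closed[OF hm[OF ed F x] fmem[OF f]]
    group_hom.hom_closed[OF hm[OF ed F x] fmem[OF g]] ed by simp_all
  show "cyc fc x (\<lambda>ed\<in>edges. f ed\<otimes>\<^bsub>Inv (Ie ed) U\<^esub>g ed)"
   unfolding cyc_def
  proof
   fix w assume w: "w:N"
   let ?t = "%f ed. (pull fc x (f ed x) [^]\<^bsub>L x\<^esub>deg w ed) [^]\<^bsub>L x\<^esub>\<epsilon> fc ed"
   have "finprod (L x) (?t (\<lambda>ed\<in>edges. f ed\<otimes>\<^bsub>Inv (Ie ed) U\<^esub>g ed)) (edges_in fc)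
    = finprod (L x) (%ed. ?t f ed\<otimes>\<^bsub>L x\<^esub>?t g ed) (edges_in fc)"
   proof (rule L.finprod_cong')
    show "(%ed. ?t f ed\<otimes>\<^bsub>L x\<^esub>?t g ed):edges_in fc \<rightarrow> carrier (L x)" using p(2,3) by simp
    fix ed assume ed: "ed:edges_in fc"
    show "?t (\<lambda>ed\<in>edges. f ed\<otimes>\<^bsub>Inv (Ie ed) U\<^esub>g ed) ed=?t f ed\<otimes>\<^bsub>L x\<^esub>?t g ed"
     unfolding p(1)[OF ed] using p(2,3)[OF ed] by (simp add: L.int_pow_distrib)
   qed simp
   also have "...=finprod (L x) (?t f) (edges_in fc)\<otimes>\<^bsub>L x\<^esub>finprod (L x) (?t g) (edges_in fc)"
    using p(2,3) by (intro L.finprod_multf) auto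
   also have "...=\<one>\<^bsub>L x\<^esub>" using bspec[OF C[OF f fc x, unfolded cyc_def] w] bspec[OF C[OF g fc x, unfolded cyc_def] w] by simp
   finally show "finprod (L x) (?t (\<lambda>ed\<in>edges. f ed\<otimes>\<^bsub>Inv (Ie ed) U\<^esub>g ed)) (edges_in fc)=\<one>\<^bsub>L x\<^esub>" .
  qed
 qed
next
 have Gr: "comm_group (Inv (Ie ed) U)" if "ed:edges" for ed using Inv_group[OF ideal_face[OF is_face_edge] U] that by blast
 show "(\<lambda>ed\<in>edges. \<one>\<^bsub>Inv (Ie ed) U\<^esub>):{f:edge_functions U. ALL fc. two_face_of fc \<sigma> --> (ALL x:U. on_stratum fc x --> cyc fc x f)}"
 proof (intro CollectI conjI allI impI ballI)
  show "(\<lambda>ed\<in>edges. \<one>\<^bsub>Inv (Ie ed) U\<^esub>):edge_functions U"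
  proof
   fix ed assume ed: "ed:edges"
   interpret Gr: comm_group "Inv (Ie ed) U" using Gr[OF ed] .
   show "(\<lambda>ed\<in>edges. \<one>\<^bsub>Inv (Ie ed) U\<^esub>) ed:carrier (Inv (Ie ed) U)" using Gr.one_closed ed by simp
  qed simp
  fix fc x assume fc: "two_face_of fc \<sigma>" and x: "x:U" "on_stratum fc x"
  have F: "is_face fc" using is_face_two[OF fc] .
  interpret L: comm_group "L x" using comm_group_L[OF opn_Spec[OF U x(1)]] .
  have p: "pull fc x ((\<lambda>ed\<in>edges. \<one>\<^bsub>Inv (Ie ed) U\<^esub>) ed x)=\<one>\<^bsub>L x\<^esub>" if ed: "ed:edges_in fc" for ed
   using hom_one[OF pull_section_hom[OF F U x ideal_face[OF is_face_edge] Ie_edge[OF F], of ed]] ed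
    comm_group.axioms(2)[OF Gr[of ed]] L.is_group by simp
  show "cyc fc x (\<lambda>ed\<in>edges. \<one>\<^bsub>Inv (Ie ed) U\<^esub>)"
   unfolding cyc_def
  proof
   fix w
   show "finprod (L x) (%ed. (pull fc x ((\<lambda>ed\<in>edges. \<one>\<^bsub>Inv (Ie ed) U\<^esub>) ed x) [^]\<^bsub>L x\<^esub>deg w ed) [^]\<^bsub>L x\<^esub>\<epsilon> fc ed) (edges_in fc)=\<one>\<^bsub>L x\<^esub>"
    by (rule L.finprod_one_eqI) (use p in simp)
  qed
 qed
qed

end

context oriented_log_scheme begin

lemma ES_restr_closed:
 assumes U: "opn U" "opn W" "W\<subseteq>U" and f: "f:carrier (sect ES U)"
 shows "restr ES U W f:carrier (sect ES W)"
 unfolding ES_carrier[OF U(2)] ES_restr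
proof (intro CollectI conjI allI impI ballI)
 have fmem: "f ed:carrier (Inv (Ie ed) U)" if "ed:edges" for ed using ES_closed[OF U(1) f that] .
 show "(\<lambda>ed\<in>edges. rs (Ie ed) W (f ed)):edge_functions W"
  using R.restrict_function_closed[OF ideal_face[OF is_face_edge] ideal_face[OF is_face_edge] subset_refl U fmem] by simp
 fix fc x assume fc: "two_face_of fc \<sigma>" and x: "x:W" "on_stratum fc x"
 have F: "is_face fc" using is_face_two[OF fc] .
 have xU: "x:U" using x U(3) by blast
 show "cyc fc x (\<lambda>ed\<in>edges. rs (Ie ed) W (f ed))"
 proof (rule cyc_cong[where g = f])
  fix ed assume ed: "ed:edges_in fc"
  hence w: "ed edge_of \<sigma>" "ed\<subseteq>fc" "ed:edges" by auto
  note id = ideal_face[OF is_face_edge[OF w(1)]]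
  show "pull fc x ((\<lambda>ed\<in>edges. rs (Ie ed) W (f ed)) ed x)=pull fc x (f ed x)"
   using pull_restrict_function[OF F x(2) U(1,3) x(1) id id subset_refl Ie_edge[OF F w(1,2)] fmem[OF w(3)]] w(3) by simp
  show "pull fc x (f ed x):carrier (L x)" by (rule pull_edge_closed[where f = f, OF U(1) xU F x(2) ed fmem[OF w(3)]])
 next
  show "cyc fc x f" using f fc xU x(2) unfolding ES_carrier[OF U(1)] by blast
 qed (rule opn_Spec[OF U(2) x(1)])
qed

lemma ES_restr_hom:
 assumes U: "opn U" "opn W" "W\<subseteq>U"
 shows "restr ES U W:hom (sect ES U) (sect ES W)"
proof (rule homI)
 fix h h' assume h: "h:carrier (sect ES U)" "h':carrier (sect ES U)"
 show "restr ES U W h:carrier (sect ES W)" using ES_restr_closed[OF U h(1)] .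
 show "restr ES U W (h\<otimes>\<^bsub>sect ES U\<^esub>h')=restr ES U W h\<otimes>\<^bsub>sect ES W\<^esub>restr ES U W h'"
  unfolding ES_restr ES_mult
 proof (rule restrict_ext)
  fix ed assume ed: "ed:edges"
  hence id: "ideal (Ie ed) R" using ideal_face[OF is_face_edge] by blast
  show "rs (Ie ed) W ((\<lambda>ed\<in>edges. h ed\<otimes>\<^bsub>Inv (Ie ed) U\<^esub>h' ed) ed) =
    (\<lambda>ed\<in>edges. rs (Ie ed) W (h ed)) ed\<otimes>\<^bsub>Inv (Ie ed) W\<^esub>(\<lambda>ed\<in>edges. rs (Ie ed) W (h' ed)) ed"
   using R.restrict_function_mult[OF id id subset_refl U ES_closed[OF U(1) h(1) ed] ES_closed[OF U(1) h(2) ed]] ed by simp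
 qed
qed

lemma ES_trans:
 assumes U: "opn U" "W\<subseteq>U" "V\<subseteq>W" and f: "f:carrier (sect ES U)"
 shows "restr ES W V (restr ES U W f)=restr ES U V f"
 unfolding ES_restr
proof (rule restrict_ext)
 fix ed assume ed: "ed:edges"
 hence id: "ideal (Ie ed) R" using ideal_face[OF is_face_edge] by blast
 show "rs (Ie ed) V ((\<lambda>ed\<in>edges. rs (Ie ed) W (f ed)) ed)=rs (Ie ed) V (f ed)"
  using R.restrict_function_trans[OF id id id subset_refl subset_refl U ES_closed[OF U(1) f ed]] ed by simp
qed

lemma ES_pull_restr:
 assumes U: "opn U" "W\<subseteq>U" "x:W" and f: "f:carrier (sect ES U)" and ed: "ed:edges" "on_stratum ed x"
 shows "pull ed x (restr ES U W f ed x)=pull ed x (f ed x)"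
proof -
 have F: "is_face ed" using is_face_edge ed by blast
 show ?thesis
  using pull_restrict_function[OF F ed(2) U ideal_face[OF F] ideal_face[OF F] subset_refl subset_refl ES_closed[OF U(1) f ed(1)]] ed(1)
  by (simp add: ES_restr)
qed

lemma ES_eqI:
 assumes U: "opn U" and f: "f:carrier (sect ES U)" "g:carrier (sect ES U)"
  and eq: "!!x ed. [|x:U; ed:edges; on_stratum ed x|] ==> pull ed x (f ed x)=pull ed x (g ed x)"
 shows "f=g"
proof (rule extensionalityI[OF ES_ext[OF U f(1)] ES_ext[OF U f(2)]])
 fix ed assume ed: "ed:edges"
 show "f ed=g ed"
 proof (rule section_eqI[OF U, of "{ed}"])
  fix x fc assume "x:U" "fc:{ed}" "on_stratum fc x"
  thus "pull fc x (f ed x)=pull fc x (g ed x)" using eq[of x ed] ed by simp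
 qed (use ES_closed[OF U f(1) ed] ES_closed[OF U f(2) ed] is_face_edge ed in auto)
qed

lemma fractional_on_local:
 assumes "!!x. x:U ==> opn (W x) & x:W x & W x\<subseteq>U & fractional_on fc (W x) g"
 shows "fractional_on fc U g"
 unfolding fractional_on_def
proof
 fix x assume x: "x:U"
 note W = assms[OF x]
 obtain W' a f where W': "opn W'" "x:W'" "W'\<subseteq>W x"
  "ALL y:W'. rep fc y (g y) a f"
  by (rule fractional_onE[of fc "W x" g x]) (use W in blast)+
 show "EX W a f. opn W & x:W & W\<subseteq>U &
   (ALL y:W. rep fc y (g y) a f)"
  using W'(3) W by (intro exI[of _ W'] exI[of _ a] exI[of _ f] conjI W'(1,2,4)) blast
qed

text \<open>The cycle condition is pointwise by \<open>cycle_condition_iff\<close>, so only the functions on the single strata have to be glued.\<close>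
lemma ES_glue:
 assumes U: "opn U" and W: "!!x. x:U ==> opn (W x) & x:W x & W x\<subseteq>U & t x:carrier (sect ES (W x))"
  and compat: "!!x y. [|x:U; y:U|] ==> restr ES (W x) (W x\<inter>W y) (t x)=restr ES (W y) (W x\<inter>W y) (t y)"
 shows "EX s:carrier (sect ES U). ALL x:U. restr ES U (W x) s=t x"
proof -
 have Wx: "opn (W x)" "x:W x" "W x\<subseteq>U" "t x:carrier (sect ES (W x))" if "x:U" for x using W[OF that] by blast+
 have agree: "pull ed y (t x ed y)=pull ed y (t y ed y)" if x: "x:U" and y: "y:W x" and ed: "ed:edges" "on_stratum ed y" for x y ed
 proof -
  have yU: "y:U" using Wx(3)[OF x] y by blast
  have i: "y:W x\<inter>W y" using y Wx(2)[OF yU] by blast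
  show ?thesis
   using ES_pull_restr[OF Wx(1)[OF x] _ i Wx(4)[OF x] ed] ES_pull_restr[OF Wx(1)[OF yU] _ i Wx(4)[OF yU] ed] compat[OF x yU]
   by (metis Int_lower1 Int_lower2)
 qed
 have "ALL ed:edges. EX s. s:carrier (Inv (Ie ed) U) & (ALL x:U. on_stratum ed x --> pull ed x (s x)=pull ed x (t x ed x))"
 proof
  fix ed assume ed: "ed:edges"
  hence F: "is_face ed" using is_face_edge by blast
  have "fractional_on ed U (%y. pull ed y (t y ed y))"
  proof (rule fractional_on_local[of U W])
   fix x assume x: "x:U"
   have "fractional_on ed (W x) (%y. pull ed y (t y ed y))"
    by (rule fractional_on_cong[OF Wx(1)[OF x] agree[OF x _ ed]
       fractional_on_section[OF F Wx(1)[OF x] ideal_face[OF F] subset_refl ES_closed[OF Wx(1)[OF x] Wx(4)[OF x] ed]]])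
   thus "opn (W x) & x:W x & W x\<subseteq>U & fractional_on ed (W x) (%y. pull ed y (t y ed y))" using Wx[OF x] by blast
  qed
  hence fr: "!!fc. fc:{ed} ==> fractional_on fc U (%y. pull ed y (t y ed y))" by simp
  show "EX s. s:carrier (Inv (Ie ed) U) & (ALL x:U. on_stratum ed x --> pull ed x (s x)=pull ed x (t x ed x))"
   by (rule section_from_fractions[OF U, of "{ed}" "%fc y. pull ed y (t y ed y)"]) (use F fr in auto)
 qed
 from bchoice[OF this] obtain s where s: "ALL ed:edges. s ed:carrier (Inv (Ie ed) U) &
  (ALL x:U. on_stratum ed x --> pull ed x (s ed x)=pull ed x (t x ed x))" by (elim exE)
 have sc: "s ed:carrier (Inv (Ie ed) U)" if "ed:edges" for ed using conjunct1[OF bspec[OF s that]] .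
 have sp: "pull ed x (s ed x)=pull ed x (t x ed x)" if "ed:edges" "x:U" "on_stratum ed x" for ed x
  using bspec[OF conjunct2[OF bspec[OF s that(1)]] that(2)] that(3) by simp
 define s' where "s'=(\<lambda>ed\<in>edges. s ed)"
 have s'ed: "s' ed=s ed" if "ed:edges" for ed using that by (simp add: s'_def)
 have s'c: "s':carrier (sect ES U)"
  unfolding ES_carrier[OF U]
 proof (intro CollectI conjI allI impI ballI)
  show "s':edge_functions U" using sc by (simp add: s'_def)
  fix fc x assume fc: "two_face_of fc \<sigma>" and x: "x:U" "on_stratum fc x"
  have F: "is_face fc" using is_face_two[OF fc] .
  have xS: "x:Spec R" using opn_Spec[OF U x(1)] .
  show "cyc fc x s'"
  proof (rule cyc_cong[where g = "t x"])
   fix ed assume ed: "ed:edges_in fc"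
   hence w: "ed edge_of \<sigma>" "ed\<subseteq>fc" "ed:edges" by auto
   note Fed = is_face_edge[OF w(1)]
   note id = ideal_face[OF Fed]
   have on: "on_stratum ed x" using on_stratum_mono[OF F Fed w(2) x(2)] .
   have tc: "t x ed:carrier (Inv (Ie ed) (W x))" using ES_closed[OF Wx(1)[OF x(1)] Wx(4)[OF x(1)] w(3)] .
   have z: "x:zero_locus R (Ie ed)" using on_stratum_zero_locus[OF xS subset_refl on] .
   have "pull fc x (s ed x)=pull fc x (pull ed x (s ed x))"
    by (rule pull_absorb[OF xS F x(2) Fed w(2) id subset_refl R.section_germ[OF id U sc[OF w(3)]], symmetric]) (use z x(1) in blast)
   also have "...=pull fc x (pull ed x (t x ed x))" unfolding sp[OF w(3) x(1) on] ..
   also have "...=pull fc x (t x ed x)"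
    by (rule pull_absorb[OF xS F x(2) Fed w(2) id subset_refl R.section_germ[OF id Wx(1)[OF x(1)] tc]]) (use z Wx(2)[OF x(1)] in blast)
   finally show "pull fc x (s' ed x)=pull fc x (t x ed x)" unfolding s'ed[OF w(3)] .
   show "pull fc x (t x ed x):carrier (L x)" by (rule pull_edge_closed[where f = "t x", OF Wx(1,2)[OF x(1)] F x(2) ed tc])
  next
   show "cyc fc x (t x)" using Wx(4)[OF x(1)] fc Wx(2)[OF x(1)] x(2) unfolding ES_carrier[OF Wx(1)[OF x(1)]] by blast
  qed (rule xS)
 qed
 have "restr ES U (W x) s'=t x" if x: "x:U" for x
 proof (rule ES_eqI[OF Wx(1)[OF x] ES_restr_closed[OF U Wx(1)[OF x] Wx(3)[OF x] s'c] Wx(4)[OF x]])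
  fix y ed assume y: "y:W x" "ed:edges" "on_stratum ed y"
  have yU: "y:U" using Wx(3)[OF x] y(1) by blast
  show "pull ed y (restr ES U (W x) s' ed y)=pull ed y (t x ed y)"
   unfolding ES_pull_restr[OF U Wx(3)[OF x] y(1) s'c y(2,3)] s'ed[OF y(2)] sp[OF y(2) yU y(3)] by (rule agree[OF x y, symmetric])
 qed
 thus ?thesis using s'c by blast
qed

lemma ES_separated:
 assumes U: "opn U" and t: "t:carrier (sect ES U)" "t':carrier (sect ES U)"
  and loc: "!!x. x:U ==> EX W. opn W & x:W & W\<subseteq>U & restr ES U W t=restr ES U W t'"
 shows "t=t'"
proof (rule ES_eqI[OF U t])
 fix x ed assume x: "x:U" and ed: "ed:edges" "on_stratum ed x"
 obtain W where W: "opn W" "x:W" "W\<subseteq>U" "restr ES U W t=restr ES U W t'" using loc[OF x] by (elim exE conjE)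
 show "pull ed x (t ed x)=pull ed x (t' ed x)"
  using ES_pull_restr[OF U W(3,2) t(1) ed] ES_pull_restr[OF U W(3,2) t(2) ed] W(4) by simp
qed

section \<open>The kinks of a family\<close>

text \<open>The isomorphism of the theorem. The values of a family at the boundary points of \<open>P\<close> form a multiplicative piecewise linear function, and its kink at an edge is a function on the stratum of that edge.\<close>
definition kinks :: "('a, 'k) point set=>('a\<times>real=>('a, 'k) local_fun)=>'a set=>('a, 'k) local_fun" where
 "kinks U h=(\<lambda>ed\<in>edges. kink (Inv (Ie ed) U) (%w. rs (Ie ed) U (h (bd w))) ed)"

lemma pl_on_sections:
 assumes U: "opn U" and h: "h:carrier (sect LF U)" and fc: "is_face fc"
 shows "pl_on (Inv (Ie fc) U) fc (%w. rs (Ie fc) U (h (bd w)))"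
 unfolding pl_on_def
proof (intro allI impI ballI conjI)
 fix v w assume v: "v extreme_point_of \<sigma>" "v:fc" and w: "w:N" "v:minface w"
 note I = Ip_face[OF v(1) _ v(2) _ fc]
 show "rs (Ie fc) U (h (bd w)):carrier (Inv (Ie fc) U)"
  using R.restrict_function_closed[OF Ip_ideal ideal_face[OF fc] I[OF w(2,1)] U U subset_refl LF_closed[OF h bd_P[OF w(1)]]] .
 fix w' assume w': "w':N" "v:minface w'"
 note ww = add_N[OF w(1) w'(1)] minface_addI[OF w(2) w'(2)]
 have "hgt (w + w')=hgt w + hgt w'" using w(2) w'(2) hgt_add_iff by blast
 hence e: "bd (w + w')=bd w + bd w'" by simp
 note pq = bd_P[OF w(1)] bd_P[OF w'(1)]
 have J: "Ip (bd w + bd w')\<subseteq>Ie fc" using I[OF ww(2,1)] unfolding e .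
 have c: "rs (Ip (bd w + bd w')) U (h (bd w)):carrier (Inv (Ip (bd w + bd w')) U)"
  "rs (Ip (bd w + bd w')) U (h (bd w')):carrier (Inv (Ip (bd w + bd w')) U)"
  using R.restrict_function_closed[OF Ip_ideal Ip_ideal Ip_add(1)[OF pq] U U subset_refl LF_closed[OF h pq(1)]]
   R.restrict_function_closed[OF Ip_ideal Ip_ideal Ip_add(2)[OF pq] U U subset_refl LF_closed[OF h pq(2)]] .
 have "rs (Ie fc) U (h (bd (w + w'))) =
   rs (Ie fc) U (rs (Ip (bd w + bd w')) U (h (bd w)))\<otimes>\<^bsub>Inv (Ie fc) U\<^esub>rs (Ie fc) U (rs (Ip (bd w + bd w')) U (h (bd w')))"
  unfolding e LF_law[OF h pq] by (rule R.restrict_function_mult[OF Ip_ideal ideal_face[OF fc] J U U subset_refl c])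
 thus "rs (Ie fc) U (h (bd (w + w')))=rs (Ie fc) U (h (bd w))\<otimes>\<^bsub>Inv (Ie fc) U\<^esub>rs (Ie fc) U (h (bd w'))"
  unfolding R.restrict_function_trans[OF Ip_ideal Ip_ideal ideal_face[OF fc] Ip_add(1)[OF pq] J U subset_refl subset_refl LF_closed[OF h pq(1)]]
   R.restrict_function_trans[OF Ip_ideal Ip_ideal ideal_face[OF fc] Ip_add(2)[OF pq] J U subset_refl subset_refl LF_closed[OF h pq(2)]] .
qed

abbreviation "pl_germ h fc x w \<equiv> pull fc x (h (bd w) x)"

lemma pl_germ_restrict:
 assumes U: "opn U" "W\<subseteq>U" "x:W" and h: "h:carrier (sect LF U)" and fc: "is_face fc" "on_stratum fc x"
  and fc': "is_face fc'" "fc'\<subseteq>fc" and v: "v extreme_point_of \<sigma>" "v:fc'" "w:N" "v:minface w"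
 shows "pull fc x (rs (Ie fc') W (h (bd w)) x)=pl_germ h fc x w"
 using pull_restrict_function[OF fc U Ip_ideal ideal_face[OF fc'(1)] Ip_face[OF v(1,4,2,3) fc'(1)]
   strata_ideal_mono_face[OF fc(1) fc'] LF_closed[OF h bd_P[OF v(3)]]] .

lemma pl_on_germ:
 assumes U: "opn U" "x:U" and h: "h:carrier (sect LF U)" and fc: "is_face fc" "on_stratum fc x"
 shows "pl_on (L x) fc (pl_germ h fc x)"
proof (rule pl_on_cong[OF pl_on_hom[OF pull_section_hom[OF fc(1) U fc(2) ideal_face[OF fc(1)] subset_refl] pl_on_sections[OF U(1) h fc(1)]]])
 fix v w assume "v extreme_point_of \<sigma>" "v:fc" "w:N" "v:minface w"
 thus "pull fc x (rs (Ie fc) U (h (bd w)) x)=pl_germ h fc x w"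
  by (rule pl_germ_restrict[OF U(1) subset_refl U(2) h fc fc(1) subset_refl])
qed

lemma pull_kinks:
 assumes U: "opn U" "x:U" and h: "h:carrier (sect LF U)" and fc: "is_face fc" "on_stratum fc x" and ed: "ed:edges_in fc"
 shows "pull fc x (kinks U h ed x)=kink (L x) (pl_germ h fc x) ed"
proof -
 have w: "ed edge_of \<sigma>" "ed\<subseteq>fc" "ed:edges" using ed by auto
 note F = is_face_edge[OF w(1)]
 have "pull fc x (kinks U h ed x)=kink (L x) (%w. pull fc x (rs (Ie ed) U (h (bd w)) x)) ed"
  unfolding kinks_def restrict_apply'[OF w(3)]
  by (rule kink_hom[OF w(1) Inv_group[OF ideal_face[OF F] U(1)] comm_group_L[OF opn_Spec[OF U]]
    pull_section_hom[OF fc(1) U fc(2) ideal_face[OF F] Ie_edge[OF fc(1) w(1,2)]] pl_on_sections[OF U(1) h F]])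
 also have "...=kink (L x) (pl_germ h fc x) ed"
  by (rule kink_cong[OF w(1)]) (rule pl_germ_restrict[OF U(1) subset_refl U(2) h fc F w(2)])
 finally show ?thesis .
qed

text \<open>Around a two-dimensional face the kinks are the successive differences of the linear extensions at its vertices, and their oriented product telescopes.\<close>
lemma kinks_closed:
 assumes U: "opn U" and h: "h:carrier (sect LF U)"
 shows "kinks U h:carrier (sect ES U)"
 unfolding ES_carrier[OF U]
proof (intro CollectI conjI allI impI ballI)
 show "kinks U h:edge_functions U"
 proof
  fix ed assume ed: "ed:edges"
  hence F: "is_face ed" "ed edge_of \<sigma>" using is_face_edge by auto
  show "kinks U h ed:carrier (Inv (Ie ed) U)" unfolding kinks_def restrict_apply'[OF ed]
   by (rule ext_edge(1)[OF Inv_group[OF ideal_face[OF F(1)] U] pl_on_sections[OF U h F(1)] F(2) subset_refl zero_N])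
 qed (simp add: kinks_def)
 fix fc x assume fc: "two_face_of fc \<sigma>" and x: "x:U" "on_stratum fc x"
 have F: "is_face fc" using is_face_two[OF fc] .
 have CL: "comm_group (L x)" using comm_group_L[OF opn_Spec[OF U x(1)]] .
 interpret L: comm_group "L x" by (rule CL)
 have pl: "pl_on (L x) fc (pl_germ h fc x)" by (rule pl_on_germ[OF U x(1) h F x(2)])
 let ?e = "%w v. ext (L x) (pl_germ h fc x) v w"
 show "cyc fc x (kinks U h)"
  unfolding cyc_def
 proof
  fix w assume w: "w:N"
  have ec: "?e w v:carrier (L x)" if "v extreme_point_of \<sigma>" "v:fc" for v using ext_closed[OF CL pl that w] .
  have "finprod (L x) (%ed. (pull fc x (kinks U h ed x) [^]\<^bsub>L x\<^esub>deg w ed) [^]\<^bsub>L x\<^esub>\<epsilon> fc ed) (edges_in fc) =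
    finprod (L x) (%ed. (?e w (tgt ed)\<otimes>\<^bsub>L x\<^esub>inv\<^bsub>L x\<^esub>?e w (src ed)) [^]\<^bsub>L x\<^esub>\<epsilon> fc ed) (edges_in fc)"
  proof (rule L.finprod_cong')
   have c: "?e w (tgt ed):carrier (L x)" "?e w (src ed):carrier (L x)" if "ed:edges_in fc" for ed
    using ends[of ed] that ec by auto
   thus "(%ed. (?e w (tgt ed)\<otimes>\<^bsub>L x\<^esub>inv\<^bsub>L x\<^esub>?e w (src ed)) [^]\<^bsub>L x\<^esub>\<epsilon> fc ed):edges_in fc \<rightarrow> carrier (L x)" by simp
   fix ed assume ed: "ed:edges_in fc"
   hence o: "ed edge_of \<sigma>" "ed\<subseteq>fc" by auto
   have k: "kink (L x) (pl_germ h fc x) ed:carrier (L x)" using ext_edge(1)[OF CL pl o w] .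
   have "?e w (tgt ed)\<otimes>\<^bsub>L x\<^esub>inv\<^bsub>L x\<^esub>?e w (src ed)=kink (L x) (pl_germ h fc x) ed [^]\<^bsub>L x\<^esub>deg w ed"
    unfolding ext_edge(2)[OF CL pl o w] using k c(2)[OF ed] by (simp add: L.m_comm[of "?e w (src ed)"] L.m_assoc)
   thus "(pull fc x (kinks U h ed x) [^]\<^bsub>L x\<^esub>deg w ed) [^]\<^bsub>L x\<^esub>\<epsilon> fc ed =
     (?e w (tgt ed)\<otimes>\<^bsub>L x\<^esub>inv\<^bsub>L x\<^esub>?e w (src ed)) [^]\<^bsub>L x\<^esub>\<epsilon> fc ed"
    unfolding pull_kinks[OF U x(1) h F x(2) ed] by simp
  qed simp
  also have "...=\<one>\<^bsub>L x\<^esub>" by (rule finprod_boundary[OF CL fc]) (rule ec)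
  finally show "finprod (L x) (%ed. (pull fc x (kinks U h ed x) [^]\<^bsub>L x\<^esub>deg w ed) [^]\<^bsub>L x\<^esub>\<epsilon> fc ed) (edges_in fc)=\<one>\<^bsub>L x\<^esub>" .
 qed
qed

lemma kinks_hom:
 assumes U: "opn U"
 shows "kinks U:hom (sect LF U) (sect ES U)"
proof (rule homI)
 fix h h' assume h: "h:carrier (sect LF U)" "h':carrier (sect LF U)"
 show "kinks U h:carrier (sect ES U)" using kinks_closed[OF U h(1)] .
 show "kinks U (h\<otimes>\<^bsub>sect LF U\<^esub>h')=kinks U h\<otimes>\<^bsub>sect ES U\<^esub>kinks U h'"
  unfolding ES_mult kinks_def
 proof (rule restrict_ext)
  fix ed assume ed: "ed:edges"
  hence o: "ed edge_of \<sigma>" by blast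
  note F = is_face_edge[OF o]
  let ?G = "Inv (Ie ed) U"
  have "kink ?G (%w. rs (Ie ed) U ((h\<otimes>\<^bsub>sect LF U\<^esub>h') (bd w))) ed =
    kink ?G (%w. rs (Ie ed) U (h (bd w))\<otimes>\<^bsub>?G\<^esub>rs (Ie ed) U (h' (bd w))) ed"
  proof (rule kink_cong[OF o])
   fix v w assume v: "v extreme_point_of \<sigma>" "v:ed" "w:N" "v:minface w"
   show "rs (Ie ed) U ((h\<otimes>\<^bsub>sect LF U\<^esub>h') (bd w))=rs (Ie ed) U (h (bd w))\<otimes>\<^bsub>?G\<^esub>rs (Ie ed) U (h' (bd w))"
    unfolding LF_mult restrict_apply'[OF bd_P[OF v(3)]]
    by (rule R.restrict_function_mult[OF Ip_ideal ideal_face[OF F] Ip_face[OF v(1,4,2,3) F] U U subset_refl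
       LF_closed[OF h(1) bd_P[OF v(3)]] LF_closed[OF h(2) bd_P[OF v(3)]]])
  qed
  also have "...=kink ?G (%w. rs (Ie ed) U (h (bd w))) ed\<otimes>\<^bsub>?G\<^esub>kink ?G (%w. rs (Ie ed) U (h' (bd w))) ed"
   by (rule kink_mult[OF o Inv_group[OF ideal_face[OF F] U] pl_on_sections[OF U h(1) F] pl_on_sections[OF U h(2) F]])
  finally show "kink ?G (%w. rs (Ie ed) U ((h\<otimes>\<^bsub>sect LF U\<^esub>h') (bd w))) ed =
   (\<lambda>ed\<in>edges. kink (Inv (Ie ed) U) (%w. rs (Ie ed) U (h (bd w))) ed) ed\<otimes>\<^bsub>?G\<^esub>
   (\<lambda>ed\<in>edges. kink (Inv (Ie ed) U) (%w. rs (Ie ed) U (h' (bd w))) ed) ed"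
   unfolding restrict_apply'[OF ed] .
 qed
qed

lemma kinks_natural:
 assumes U: "opn U" "opn W" "W\<subseteq>U" and h: "h:carrier (sect LF U)"
 shows "kinks W (restr LF U W h)=restr ES U W (kinks U h)"
 unfolding ES_restr kinks_def LF_restr
proof (rule restrict_ext)
 fix ed assume ed: "ed:edges"
 hence o: "ed edge_of \<sigma>" by blast
 note F = is_face_edge[OF o]
 note id = ideal_face[OF F]
 have "rs (Ie ed) W (kink (Inv (Ie ed) U) (%w. rs (Ie ed) U (h (bd w))) ed) =
   kink (Inv (Ie ed) W) (%w. rs (Ie ed) W (rs (Ie ed) U (h (bd w)))) ed"
  by (rule kink_hom[OF o Inv_group[OF id U(1)] Inv_group[OF id U(2)] R.restrict_function_hom[OF id id subset_refl U] pl_on_sections[OF U(1) h F]])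
 also have "...=kink (Inv (Ie ed) W) (%w. rs (Ie ed) W ((\<lambda>p\<in>P. rs (Ip p) W (h p)) (bd w))) ed"
 proof (rule kink_cong[OF o])
  fix v w assume v: "v extreme_point_of \<sigma>" "v:ed" "w:N" "v:minface w"
  note I = Ip_face[OF v(1,4,2,3) F] and c = LF_closed[OF h bd_P[OF v(3)]]
  show "rs (Ie ed) W (rs (Ie ed) U (h (bd w)))=rs (Ie ed) W ((\<lambda>p\<in>P. rs (Ip p) W (h p)) (bd w))"
   unfolding restrict_apply'[OF bd_P[OF v(3)]]
    R.restrict_function_trans[OF Ip_ideal id id I subset_refl U(1) subset_refl U(3) c]
    R.restrict_function_trans[OF Ip_ideal Ip_ideal id subset_refl I U(1,3) subset_refl c] ..
 qed
 finally show "kink (Inv (Ie ed) W) (%w. rs (Ie ed) W ((\<lambda>p\<in>P. rs (Ip p) W (h p)) (bd w))) ed =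
  rs (Ie ed) W ((\<lambda>ed\<in>edges. kink (Inv (Ie ed) U) (%w. rs (Ie ed) U (h (bd w))) ed) ed)"
  unfolding restrict_apply'[OF ed] by (rule sym)
qed

end

context oriented_log_scheme begin

section \<open>The kernel\<close>

lemma constant_on_face:
 assumes fc: "is_face fc" and F: "!!ed. ed:edges_in fc ==> F (tgt ed)=F (src ed)"
  and v: "v extreme_point_of \<sigma>" "v:fc" "v' extreme_point_of \<sigma>" "v':fc"
 shows "F v=F v'"
proof -
 have face: "fc face_of \<sigma>" using fc by (simp add: is_face_def)
 have p: "polytope fc" using face_of_polytope_polytope[OF polytope_\<sigma> face] .
 have ev: "v extreme_point_of fc" "v' extreme_point_of fc" using extreme_point_of_face[OF face] v by blast+
 have step: "F a=F b" if "(a, b):adjacent fc" for a b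
 proof -
  have e: "seg a b edge_of \<sigma>" "seg a b\<subseteq>fc" using that edge_of_face[OF face] by (auto simp: adjacent_def)
  hence "F (tgt (seg a b))=F (src (seg a b))" by (intro F) simp
  thus ?thesis using edge_is_ends[OF e(1)] by metis
 qed
 from polytope_graph_connected[OF p ev] show ?thesis
  by (induction rule: rtrancl_induct) (use step in \<open>simp_all\<close>)
qed

lemma vertex_facesE:
 assumes "fc:vertex_faces"
 obtains v where "fc={v}" "v extreme_point_of \<sigma>"
 using assms by (auto simp: vertex_faces_def)

lemma pl_germ_absorb:
 assumes U: "opn U" "x:U" and h: "h:carrier (sect LF U)" and fc: "is_face fc" "on_stratum fc x"
  and v: "v extreme_point_of \<sigma>" "v:fc" "w:N" "v:minface w"
 shows "pull fc x (pl_germ h {v} x w)=pl_germ h fc x w"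
proof -
 have xS: "x:Spec R" using opn_Spec[OF U] .
 have sub: "{v}\<subseteq>fc" using v by blast
 have I: "Ip (bd w)\<subseteq>Ie {v}" by (rule Ip_vertex[OF v(1,4,3)])
 have on: "on_stratum {v} x" by (rule on_stratum_mono[OF fc(1) is_face_vertex[OF v(1)] sub fc(2)])
 have z: "x:U\<inter>zero_locus R (Ip (bd w))" using on_stratum_zero_locus[OF xS I on] U(2) by blast
 show ?thesis
  by (rule pull_absorb[OF xS fc is_face_vertex[OF v(1)] sub Ip_ideal I R.section_germ[OF Ip_ideal U(1) LF_closed[OF h bd_P[OF v(3)]] z]])
qed

lemma pull_ext:
 assumes U: "opn U" "x:U" and h: "h:carrier (sect LF U)" and fc: "is_face fc" "on_stratum fc x"
  and v: "v extreme_point_of \<sigma>" "v:fc" "w:N"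
 shows "pull fc x (ext (L x) (pl_germ h {v} x) v w)=ext (L x) (pl_germ h fc x) v w"
proof -
 have xS: "x:Spec R" using opn_Spec[OF U] .
 interpret p: group_hom "L x" "L x" "pull fc x" using pull_group_hom[OF xS fc] .
 have sub: "{v}\<subseteq>fc" using v by blast
 note Fv = is_face_vertex[OF v(1)]
 have on: "on_stratum {v} x" by (rule on_stratum_mono[OF fc(1) Fv sub fc(2)])
 have pl: "pl_on (L x) {v} (pl_germ h {v} x)" by (rule pl_on_germ[OF U h Fv on])
 note s = shift[OF v(1,3)]
 note ws = add_N[OF v(3) s(1)]
 have c: "pl_germ h {v} x (w + shift v w):carrier (L x)" "pl_germ h {v} x (shift v w):carrier (L x)"
  using pl_closed[OF comm_group_L[OF xS] pl v(1) singletonI ws s(3)] pl_closed[OF comm_group_L[OF xS] pl v(1) singletonI s(1,2)] .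
 show ?thesis unfolding ext_def
  using c pl_germ_absorb[OF U h fc v(1,2) ws s(3)] pl_germ_absorb[OF U h fc v(1,2) s(1,2)] by simp
qed

lemma fractional_on_pl_germ:
 assumes U: "opn U" and h: "h:carrier (sect LF U)" and v: "v extreme_point_of \<sigma>" "w:N" "v:minface w"
 shows "fractional_on {v} U (%y. pl_germ h {v} y w)"
 by (rule fractional_on_section[OF is_face_vertex[OF v(1)] U Ip_ideal Ip_vertex[OF v(1,3,2)] LF_closed[OF h bd_P[OF v(2)]]])

lemma kinks_one_ext:
 assumes U: "opn U" "x:U" and h: "h:carrier (sect LF U)" and k: "kinks U h=\<one>\<^bsub>sect ES U\<^esub>"
  and fc: "is_face fc" "on_stratum fc x" and v: "v extreme_point_of \<sigma>" "v:fc" "v' extreme_point_of \<sigma>" "v':fc" and w: "w:N"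
 shows "ext (L x) (pl_germ h fc x) v w=ext (L x) (pl_germ h fc x) v' w"
proof (rule constant_on_face[OF fc(1) _ v])
 fix ed assume ed: "ed:edges_in fc"
 hence o: "ed edge_of \<sigma>" "ed\<subseteq>fc" "ed:edges" by auto
 note F = is_face_edge[OF o(1)]
 have CL: "comm_group (L x)" using comm_group_L[OF opn_Spec[OF U]] .
 interpret L: comm_group "L x" by (rule CL)
 interpret I: comm_group "Inv (Ie ed) U" using Inv_group[OF ideal_face[OF F] U(1)] .
 have pl: "pl_on (L x) fc (pl_germ h fc x)" by (rule pl_on_germ[OF U h fc])
 have "kink (L x) (pl_germ h fc x) ed=pull fc x (kinks U h ed x)" by (rule pull_kinks[OF U h fc ed, symmetric])
 also have "...=pull fc x (\<one>\<^bsub>Inv (Ie ed) U\<^esub>x)" unfolding k ES_one restrict_apply'[OF o(3)] ..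
 also have "...=\<one>\<^bsub>L x\<^esub>"
  by (rule hom_one[OF pull_section_hom[OF fc(1) U fc(2) ideal_face[OF F] Ie_edge[OF fc(1) o(1,2)]] I.is_group L.is_group])
 finally have k1: "kink (L x) (pl_germ h fc x) ed=\<one>\<^bsub>L x\<^esub>" .
 have c: "ext (L x) (pl_germ h fc x) (src ed) w:carrier (L x)"
  using ext_closed[OF CL pl ends(3)[OF o(1)] _ w] ends(6)[OF o(1)] o(2) by blast
 show "ext (L x) (pl_germ h fc x) (tgt ed) w=ext (L x) (pl_germ h fc x) (src ed) w"
  unfolding ext_edge(2)[OF CL pl o(1,2) w] k1 using c by simp
qed

text \<open>Without kinks the linear extensions at the vertices of a face agree on its stratum, because the vertices of the face are joined by edges. The extensions for the vertices therefore glue to a function on \<open>V\<close>.\<close>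
lemma trivial_kinks_extend:
 assumes U: "opn U" and h: "h:carrier (sect LF U)" and k: "kinks U h=\<one>\<^bsub>sect ES U\<^esub>" and w: "w:N"
 shows "EX s. s:carrier (Inv {\<zero>\<^bsub>R\<^esub>} U) &
  (ALL x:U. ALL v. v extreme_point_of \<sigma> --> on_stratum {v} x --> pull {v} x (s x)=ext (L x) (pl_germ h {v} x) v w)"
proof -
 define val where "val=(%fc x. ext (L x) (pl_germ h fc x) (the_elem fc) w)"
 have val: "val {v} x=ext (L x) (pl_germ h {v} x) v w" for v x by (simp add: val_def)
 have sect: "EX s. s:carrier (Inv (strata_ideal vertex_faces) U) &
   (ALL x:U. ALL fc:vertex_faces. on_stratum fc x --> pull fc x (s x)=val fc x)"
 proof (rule section_from_fractions[OF U, of vertex_faces val])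
  show "finite vertex_faces" by (rule vertex_faces(1))
  show "is_face fc" if "fc:vertex_faces" for fc by (rule vertex_faces(2)[OF that])
 next
  fix fc assume "fc:vertex_faces"
  then obtain v where v: "fc={v}" "v extreme_point_of \<sigma>" by (rule vertex_facesE)
  note F = is_face_vertex[OF v(2)] and s = shift[OF v(2) w]
  show "fractional_on fc U (val fc)"
   unfolding v(1) val_def the_elem_eq ext_def
   by (rule fractional_on_mult[OF F U fractional_on_pl_germ[OF U h v(2) add_N[OF w s(1)] s(3)]
      fractional_on_inv[OF F U fractional_on_pl_germ[OF U h v(2) s(1,2)]]])
 next
  fix x fc fc' assume x: "x:U" and t: "fc:vertex_faces" "fc':vertex_faces" and on: "on_stratum fc x" "on_stratum fc' x"
  obtain v where v: "fc={v}" "v extreme_point_of \<sigma>" using t(1) by (rule vertex_facesE)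
  obtain v' where v': "fc'={v'}" "v' extreme_point_of \<sigma>" using t(2) by (rule vertex_facesE)
  note Ft = vertex_faces(2)[OF t(1)] vertex_faces(2)[OF t(2)]
  note J = join_face[OF Ft] and onJ = on_stratum_join[OF opn_Spec[OF U x] Ft on]
  have vJ: "v:join fc fc'" "v':join fc fc'" using J(2,3) v(1) v'(1) by auto
  have "pull (join fc fc') x (val fc x)=ext (L x) (pl_germ h (join fc fc') x) v w"
   unfolding v(1) val using pull_ext[OF U x h J(1) onJ v(2) vJ(1) w] unfolding v(1) .
  also have "...=ext (L x) (pl_germ h (join fc fc') x) v' w"
   by (rule kinks_one_ext[OF U x h k J(1) onJ v(2) vJ(1) v'(2) vJ(2) w])
  also have "...=pull (join fc fc') x (val fc' x)"
   unfolding v'(1) val using pull_ext[OF U x h J(1) onJ v'(2) vJ(2) w, symmetric] unfolding v'(1) .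
  finally show "pull (join fc fc') x (val fc x)=pull (join fc fc') x (val fc' x)" .
 next
  fix s assume s: "s:carrier (Inv (strata_ideal vertex_faces) U)"
   "!!x fc. [|x:U; fc:vertex_faces; on_stratum fc x|] ==> pull fc x (s x)=val fc x"
  show "EX s. s:carrier (Inv (strata_ideal vertex_faces) U) &
   (ALL x:U. ALL fc:vertex_faces. on_stratum fc x --> pull fc x (s x)=val fc x)"
   by (intro exI[of _ s] conjI ballI impI s)
 qed
 then obtain s where s: "s:carrier (Inv {\<zero>\<^bsub>R\<^esub>} U)"
  "ALL x:U. ALL fc:vertex_faces. on_stratum fc x --> pull fc x (s x)=val fc x" unfolding strata_ideal_vertices by (elim exE conjE)
 have "pull {v} x (s x)=ext (L x) (pl_germ h {v} x) v w" if "x:U" "v extreme_point_of \<sigma>" "on_stratum {v} x" for x v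
 proof -
  have "{v}:vertex_faces" using that(2) by (simp add: vertex_faces_def)
  from bspec[OF bspec[OF s(2) that(1)] this] that(3) show ?thesis unfolding val by simp
 qed
 thus ?thesis by (intro exI[of _ s] conjI s(1) ballI allI impI)
qed

lemma hom_families_eq: "hom_families M \<sigma> r U =
  (%ph. \<lambda>p\<in>P. rs (Ip p) U (ph (fst p))) ` hom (additive_group N) (Inv {\<zero>\<^bsub>R\<^esub>} U)"
 by (simp add: hom_families_def Let_def ideal_p_eq R_def[symmetric])

lemma homomorphism_family:
 assumes U: "opn U" and ph: "ph:hom (additive_group N) (Inv {\<zero>\<^bsub>R\<^esub>} U)"
 defines "h \<equiv> \<lambda>p\<in>P. rs (Ip p) U (ph (fst p))"
 shows "h:carrier (sect LF U)" "kinks U h=\<one>\<^bsub>sect ES U\<^esub>"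
proof -
 have c: "ph w:carrier (Inv {\<zero>\<^bsub>R\<^esub>} U)" if "w:N" for w
  using hom_in_carrier[OF ph] that by (simp add: additive_group_def)
 have add: "ph (w + w')=ph w\<otimes>\<^bsub>Inv {\<zero>\<^bsub>R\<^esub>} U\<^esub>ph w'" if "w:N" "w':N" for w w'
  using hom_mult[OF ph, of w w'] that by (simp add: additive_group_def)
 have PN: "fst p:N" if "p:P" for p using that by (auto simp: P_monoid_eq)
 have hp: "h p=rs (Ip p) U (ph (fst p))" if "p:P" for p using that by (simp add: h_def)
 show h: "h:carrier (sect LF U)"
  unfolding LF_carrier
 proof (intro conjI ballI)
  show "h:(\<Pi>\<^sub>E p\<in>P. carrier (Inv (Ip p) U))"
  proof
   fix p assume p: "p:P"
   show "h p:carrier (Inv (Ip p) U)" unfolding hp[OF p]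
    by (rule R.restrict_function_closed[OF zero_ideal Ip_ideal zero_sub U U subset_refl c[OF PN[OF p]]])
  qed (simp add: h_def)
  fix p q assume pq: "p:P" "q:P"
  have e: "rs (Ip (p + q)) U (rs (Ip p') U (ph w))=rs (Ip (p + q)) U (ph w)" if "Ip p'\<subseteq>Ip (p + q)" "w:N" for p' w
   by (rule R.restrict_function_trans[OF zero_ideal Ip_ideal Ip_ideal zero_sub that(1) U subset_refl subset_refl c[OF that(2)]])
  show "rs (Ip (p + q)) U (h p)\<otimes>\<^bsub>Inv (Ip (p + q)) U\<^esub>rs (Ip (p + q)) U (h q)=h (p + q)"
   unfolding hp[OF pq(1)] hp[OF pq(2)] hp[OF P_add[OF pq]] e[OF Ip_add(1)[OF pq] PN[OF pq(1)]] e[OF Ip_add(2)[OF pq] PN[OF pq(2)]]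
    fst_add add[OF PN[OF pq(1)] PN[OF pq(2)]]
   by (rule R.restrict_function_mult[OF zero_ideal Ip_ideal zero_sub U U subset_refl c[OF PN[OF pq(1)]] c[OF PN[OF pq(2)]], symmetric])
 qed
 show "kinks U h=\<one>\<^bsub>sect ES U\<^esub>"
  unfolding kinks_def ES_one
 proof (rule restrict_ext)
  fix ed assume "ed:edges"
  hence o: "ed edge_of \<sigma>" by blast
  note F = is_face_edge[OF o]
  note id = ideal_face[OF F]
  have "kink (Inv (Ie ed) U) (%w. rs (Ie ed) U (h (bd w))) ed=kink (Inv (Ie ed) U) (%w. rs (Ie ed) U (ph w)) ed"
  proof (rule kink_cong[OF o])
   fix v w assume v: "v extreme_point_of \<sigma>" "v:ed" "w:N" "v:minface w"
   show "rs (Ie ed) U (h (bd w))=rs (Ie ed) U (ph w)"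
    unfolding hp[OF bd_P[OF v(3)]] fst_conv
    by (rule R.restrict_function_trans[OF zero_ideal Ip_ideal id zero_sub Ip_face[OF v(1,4,2,3) F] U subset_refl subset_refl c[OF v(3)]])
  qed
  also have "...=\<one>\<^bsub>Inv (Ie ed) U\<^esub>"
  proof (rule kink_additive[OF o Inv_group[OF id U]])
   show "rs (Ie ed) U (ph w):carrier (Inv (Ie ed) U)" if "w:N" for w
    by (rule R.restrict_function_closed[OF zero_ideal id zero_sub U U subset_refl c[OF that]])
   show "rs (Ie ed) U (ph (w + w'))=rs (Ie ed) U (ph w)\<otimes>\<^bsub>Inv (Ie ed) U\<^esub>rs (Ie ed) U (ph w')" if "w:N" "w':N" for w w'
    unfolding add[OF that] by (rule R.restrict_function_mult[OF zero_ideal id zero_sub U U subset_refl c[OF that(1)] c[OF that(2)]])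
  qed
  finally show "kink (Inv (Ie ed) U) (%w. rs (Ie ed) U (h (bd w))) ed=\<one>\<^bsub>Inv (Ie ed) U\<^esub>" .
 qed
qed

text \<open>The glued extensions depend additively on \<open>w\<close>, and they restrict to the given family since an extension agrees with the function on its own cone.\<close>
lemma trivial_kinks_family:
 assumes U: "opn U" and h: "h:carrier (sect LF U)" and k: "kinks U h=\<one>\<^bsub>sect ES U\<^esub>"
 shows "h:hom_families M \<sigma> r U"
proof -
 have "ALL w:N. EX s. s:carrier (Inv {\<zero>\<^bsub>R\<^esub>} U) &
  (ALL x:U. ALL v. v extreme_point_of \<sigma> --> on_stratum {v} x --> pull {v} x (s x)=ext (L x) (pl_germ h {v} x) v w)"
  using trivial_kinks_extend[OF U h k] by (rule ballI)
 from bchoice[OF this] obtain ph where ph: "ALL w:N. ph w:carrier (Inv {\<zero>\<^bsub>R\<^esub>} U) &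
  (ALL x:U. ALL v. v extreme_point_of \<sigma> --> on_stratum {v} x --> pull {v} x (ph w x)=ext (L x) (pl_germ h {v} x) v w)" by (elim exE)
 have c: "ph w:carrier (Inv {\<zero>\<^bsub>R\<^esub>} U)" if "w:N" for w using conjunct1[OF bspec[OF ph that]] .
 have val: "pull {v} x (ph w x)=ext (L x) (pl_germ h {v} x) v w" if "w:N" "x:U" "v extreme_point_of \<sigma>" "on_stratum {v} x" for w x v
  using spec[OF bspec[OF conjunct2[OF bspec[OF ph that(1)]] that(2)], of v] that(3,4) by simp
 interpret I: comm_group "Inv {\<zero>\<^bsub>R\<^esub>} U" using Inv_group[OF zero_ideal U] .
 have "ph:hom (additive_group N) (Inv {\<zero>\<^bsub>R\<^esub>} U)"
 proof (rule homI)
  fix w w' assume ww: "w:carrier (additive_group N)" "w':carrier (additive_group N)"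
  hence w: "w:N" "w':N" by (simp_all add: additive_group_def)
  have "ph (w + w')=ph w\<otimes>\<^bsub>Inv {\<zero>\<^bsub>R\<^esub>} U\<^esub>ph w'"
  proof (rule section_eqI[OF U vertex_faces])
   show "ph (w + w'):carrier (Inv (strata_ideal vertex_faces) U)" unfolding strata_ideal_vertices by (rule c[OF add_N[OF w]])
   show "ph w\<otimes>\<^bsub>Inv {\<zero>\<^bsub>R\<^esub>} U\<^esub>ph w':carrier (Inv (strata_ideal vertex_faces) U)"
    unfolding strata_ideal_vertices by (rule I.m_closed[OF c[OF w(1)] c[OF w(2)]])
   fix x fc assume x: "x:U" and t: "fc:vertex_faces" "on_stratum fc x"
   obtain v where v: "fc={v}" "v extreme_point_of \<sigma>" using t(1) by (rule vertex_facesE)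
   have on: "on_stratum {v} x" using t(2) v(1) by simp
   note F = is_face_vertex[OF v(2)]
   have CL: "comm_group (L x)" using comm_group_L[OF opn_Spec[OF U x]] .
   have "pull {v} x ((ph w\<otimes>\<^bsub>Inv {\<zero>\<^bsub>R\<^esub>} U\<^esub>ph w') x)=pull {v} x (ph w x)\<otimes>\<^bsub>L x\<^esub>pull {v} x (ph w' x)"
    by (rule hom_mult[OF pull_section_hom[OF F U x on zero_ideal zero_sub] c[OF w(1)] c[OF w(2)]])
   also have "...=ext (L x) (pl_germ h {v} x) v (w + w')"
    unfolding val[OF w(1) x v(2) on] val[OF w(2) x v(2) on]
    by (rule ext_add[OF CL pl_on_germ[OF U x h F on] v(2) singletonI w, symmetric])
   finally show "pull fc x (ph (w + w') x)=pull fc x ((ph w\<otimes>\<^bsub>Inv {\<zero>\<^bsub>R\<^esub>} U\<^esub>ph w') x)"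
    unfolding v(1) val[OF add_N[OF w] x v(2) on] by (rule sym)
  qed assumption
  thus "ph (w\<otimes>\<^bsub>additive_group N\<^esub>w')=ph w\<otimes>\<^bsub>Inv {\<zero>\<^bsub>R\<^esub>} U\<^esub>ph w'" by (simp add: additive_group_def)
 qed (use c in \<open>simp add: additive_group_def\<close>)
 moreover have "h=(\<lambda>p\<in>P. rs (Ip p) U (ph (fst p)))"
 proof (rule extensionalityI[OF LF_ext[OF h]])
  fix p assume p: "p:P"
  have w: "fst p:N" using p by (auto simp: P_monoid_eq)
  have "h p=rs (Ip p) U (ph (fst p))"
  proof (rule section_eqI[OF U faces_p LF_closed[OF h p]])
   show "rs (Ip p) U (ph (fst p)):carrier (Inv (Ip p) U)"
    by (rule R.restrict_function_closed[OF zero_ideal Ip_ideal zero_sub U U subset_refl c[OF w]])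
   fix x fc assume x: "x:U" and t: "fc:faces_p p" "on_stratum fc x"
   have b: "p:boundary_P M \<sigma>" and tv: "fc:vertex_faces" "fc\<subseteq>minface (fst p)" using t(1) by (auto simp: faces_p_def split: if_splits)
   obtain v where v: "fc={v}" "v extreme_point_of \<sigma>" using tv(1) by (rule vertex_facesE)
   have on: "on_stratum {v} x" and vm: "v:minface (fst p)" using t(2) tv(2) v(1) by auto
   have bp: "bd (fst p)=p" using b by (auto simp: boundary_P_eq)
   note F = is_face_vertex[OF v(2)]
   have CL: "comm_group (L x)" using comm_group_L[OF opn_Spec[OF U x]] .
   have I: "Ip p\<subseteq>Ie {v}" using Ip_vertex[OF v(2) vm w] unfolding bp .
   have "pull {v} x (rs (Ip p) U (ph (fst p)) x)=pull {v} x (ph (fst p) x)"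
    by (rule pull_restrict_function[OF F on U subset_refl x zero_ideal Ip_ideal zero_sub I c[OF w]])
   also have "...=pl_germ h {v} x (fst p)" unfolding val[OF w x v(2) on]
    by (rule ext_id[OF CL pl_on_germ[OF U x h F on] v(2) singletonI w vm])
   finally show "pull fc x (h p x)=pull fc x (rs (Ip p) U (ph (fst p)) x)" unfolding v(1) bp by (rule sym)
  qed assumption
  thus "h p=(\<lambda>p\<in>P. rs (Ip p) U (ph (fst p))) p" unfolding restrict_apply'[OF p] .
 qed simp
 ultimately show ?thesis unfolding hom_families_eq image_iff by (intro bexI[of _ ph])
qed

lemma kinks_kernel:
 assumes U: "opn U"
 shows "hom_families M \<sigma> r U={h:carrier (sect LF U). kinks U h=\<one>\<^bsub>sect ES U\<^esub>}"
proof (intro subset_antisym subsetI)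
 fix h assume "h:hom_families M \<sigma> r U"
 then obtain ph where "ph:hom (additive_group N) (Inv {\<zero>\<^bsub>R\<^esub>} U)" "h=(\<lambda>p\<in>P. rs (Ip p) U (ph (fst p)))"
  unfolding hom_families_eq by (rule imageE)
 thus "h:{h:carrier (sect LF U). kinks U h=\<one>\<^bsub>sect ES U\<^esub>}" using homomorphism_family[OF U] by blast
next
 fix h assume "h:{h:carrier (sect LF U). kinks U h=\<one>\<^bsub>sect ES U\<^esub>}"
 thus "h:hom_families M \<sigma> r U" using trivial_kinks_family[OF U] by blast
qed

end

context oriented_log_scheme begin

section \<open>Local surjectivity\<close>

lemma fractional_on_mono:
 assumes "fractional_on fc U g" "opn W" "W\<subseteq>U"
 shows "fractional_on fc W g"
 unfolding fractional_on_def
proof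
 fix x assume x: "x:W"
 obtain W' a f where W': "opn W'" "x:W'" "W'\<subseteq>U"
  "ALL y:W'. rep fc y (g y) a f"
  by (rule fractional_onE[OF assms(1) subsetD[OF assms(3) x]])
 show "EX W' a f. opn W' & x:W' & W'\<subseteq>W &
   (ALL y:W'. rep fc y (g y) a f)"
  by (rule exI[of _ "W'\<inter>W"], rule exI[of _ a], rule exI[of _ f],
    intro conjI openin_Int[OF W'(1) assms(2)] IntI W'(2) x Int_lower2 ballI) (rule bspec[OF W'(4)], blast)
qed

lemma fractional_on_eq_open:
 assumes fc: "is_face fc" "on_stratum fc x" and U: "opn U" "x:U"
  and g: "fractional_on fc U g" "fractional_on fc U g'" "g x=g' x"
 shows "EX W. opn W & x:W & (ALL y:W. on_stratum fc y --> g y=g' y)"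
proof -
 obtain W a f where W: "opn W" "x:W" "W\<subseteq>U"
  "ALL y:W. rep fc y (g y) a f"
  by (rule fractional_onE[OF g(1) U(2)])
 obtain W' b e where W': "opn W'" "x:W'" "W'\<subseteq>U"
  "ALL y:W'. rep fc y (g' y) b e"
  by (rule fractional_onE[OF g(2) U(2)])
 have 1: "a:carrier R - x" "f:carrier R - x" "g x=pull fc x (fr x a f)" using bspec[OF W(4,2)] fc(2) by auto
 have 2: "b:carrier R - x" "e:carrier R - x" "g' x=pull fc x (fr x b e)" using bspec[OF W'(4,2)] fc(2) by auto
 have eq: "pull fc x (fr x a f)=pull fc x (fr x b e)" using 1(3) 2(3) g(3) by simp
 have "EX V. opn V & x:V & (ALL y:V. on_stratum fc y --> pull fc y (fr y a f)=pull fc y (fr y b e))"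
  by (rule spread_equality[OF opn_Spec[OF U] fc 1(1,2) 2(1,2) eq]) (intro exI conjI ballI impI)
 then obtain V where V: "opn V" "x:V" "ALL y:V. on_stratum fc y --> pull fc y (fr y a f)=pull fc y (fr y b e)" by (elim exE conjE)
 have "g y=g' y" if y: "y:W\<inter>W'\<inter>V" "on_stratum fc y" for y
 proof -
  have "g y=pull fc y (fr y a f)" using bspec[OF W(4), of y] y by blast
  moreover have "g' y=pull fc y (fr y b e)" using bspec[OF W'(4), of y] y by blast
  moreover have "pull fc y (fr y a f)=pull fc y (fr y b e)" using bspec[OF V(3), of y] y by blast
  ultimately show ?thesis by simp
 qed
 thus ?thesis
  by (intro exI[of _ "W\<inter>W'\<inter>V"] conjI ballI impI openin_Int[OF openin_Int[OF W(1) W'(1)] V(1)] IntI W(2) W'(2) V(2))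
qed

lemma fractional_on_fraction:
 assumes U: "opn U" and a: "!!y. y:U ==> a:carrier R - y & f:carrier R - y"
 shows "fractional_on fc U (%y. pull fc y (fr y a f))"
 unfolding fractional_on_def using U a by (intro ballI exI[of _ U] exI[of _ a] exI[of _ f] conjI) simp_all

lemma deg_sum:
 assumes BD: "dual_bases B D" and ed: "ed edge_of \<sigma>" and w: "w:N"
 shows "deg w ed=(\<Sum>b\<in>B. \<lfloor>w\<bullet>b\<rfloor> * deg (D b) ed)"
proof -
 have B: "B\<subseteq>M" "D ` B\<subseteq>N" and exp: "w=(\<Sum>b\<in>B. (w\<bullet>b) *\<^sub>R D b)"
  using BD N_span[OF w] unfolding dual_bases_def by blast+
 have i: "of_int \<lfloor>w\<bullet>b\<rfloor>=w\<bullet>b" if "b:B" for b using N_M_int[OF w] B(1) that by (auto elim!: Ints_cases)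
 have "of_int (deg w ed)=(\<Sum>b\<in>B. (w\<bullet>b) *\<^sub>R D b)\<bullet>d ed" unfolding deg[OF ed w] using exp by simp
 also have "...=(\<Sum>b\<in>B. (w\<bullet>b) * (D b\<bullet>d ed))" by (simp add: inner_sum_left)
 also have "...=(\<Sum>b\<in>B. of_int \<lfloor>w\<bullet>b\<rfloor> * of_int (deg (D b) ed))"
 proof (rule sum.cong[OF refl])
  fix b assume b: "b:B"
  have "D b:N" using B(2) b by blast
  note D = deg[OF ed this]
  show "(w\<bullet>b) * (D b\<bullet>d ed) = of_int \<lfloor>w\<bullet>b\<rfloor> * of_int (deg (D b) ed)" unfolding i[OF b] D ..
 qed
 also have "... = of_int (\<Sum>b\<in>B. \<lfloor>w\<bullet>b\<rfloor> * deg (D b) ed)" by simp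
 finally show ?thesis by (simp only: of_int_eq_iff)
qed

lemma (in comm_group) finprod_pow_sum:
 assumes "finite A" "x:carrier G"
 shows "finprod G (%a. x [^] (i a :: int)) A=x [^] (\<Sum>a\<in>A. i a)"
 using assms by (induction A rule: finite_induct) (simp_all add: int_pow_mult)

text \<open>One dual vector turns the edge functions into a cochain at the point, and the cycle condition is what \<open>lift_cochain\<close> needs.\<close>
lemma fractional_solution_at_point:
 assumes U: "opn U" "x:U" and f: "f:carrier (sect ES U)" and b: "b:N"
 obtains A A' where "!!v. v extreme_point_of \<sigma> ==> A v:carrier R - x & A' v:carrier R - x"
  "!!ed. [|ed edge_of \<sigma>; on_stratum ed x|] ==>
   pull ed x (fr x (A (tgt ed)) (A' (tgt ed))\<otimes>\<^bsub>L x\<^esub>inv\<^bsub>L x\<^esub>fr x (A (src ed)) (A' (src ed)))=pull ed x (f ed x) [^]\<^bsub>L x\<^esub>deg b ed"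
proof -
 have xS: "x:Spec R" using opn_Spec[OF U] .
 have CL: "comm_group (L x)" using comm_group_L[OF xS] .
 interpret L: comm_group "L x" by (rule CL)
 define c where "c=(%ed. if on_stratum ed x then pull ed x (f ed x) [^]\<^bsub>L x\<^esub>deg b ed else \<one>\<^bsub>L x\<^esub>)"
 have fmem: "pull ed x (f ed x):carrier (L x)" if "ed edge_of \<sigma>" "on_stratum ed x" for ed
  using pull_closed[OF is_face_edge[OF that(1)] U that(2) ideal_face[OF is_face_edge[OF that(1)]] subset_refl ES_closed[OF U(1) f]] that(1) by blast
 have c: "c ed:carrier (L x)" if "ed edge_of \<sigma>" for ed using fmem[OF that] by (simp add: c_def)
 have cycle: "finprod (L x) (%ed. pull ph x (c ed) [^]\<^bsub>L x\<^esub>\<epsilon> ph ed) (edges_in ph)=\<one>\<^bsub>L x\<^esub>"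
  if ph: "two_face_of ph \<sigma>" "on_stratum ph x" for ph
 proof -
  have F: "is_face ph" using is_face_two[OF ph(1)] .
  interpret p: group_hom "L x" "L x" "pull ph x" using pull_group_hom[OF xS F ph(2)] .
  have "pull ph x (c ed)=pull ph x (f ed x) [^]\<^bsub>L x\<^esub>deg b ed & pull ph x (f ed x):carrier (L x)" if ed: "ed:edges_in ph" for ed
  proof -
   have o: "ed edge_of \<sigma>" "ed\<subseteq>ph" "ed:edges" using ed by auto
   note Fo = is_face_edge[OF o(1)]
   have on: "on_stratum ed x" by (rule on_stratum_mono[OF F Fo o(2) ph(2)])
   have z: "x:U\<inter>zero_locus R (Ie ed)" using on_stratum_zero_locus[OF xS subset_refl on] U(2) by blast
   have ab: "pull ph x (pull ed x (f ed x))=pull ph x (f ed x)"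
    by (rule pull_absorb[OF xS F ph(2) Fo o(2) ideal_face[OF Fo] subset_refl R.section_germ[OF ideal_face[OF Fo] U(1) ES_closed[OF U(1) f o(3)] z]])
   have "pull ph x (c ed)=pull ph x (pull ed x (f ed x)) [^]\<^bsub>L x\<^esub>deg b ed"
    using p.hom_int_pow[OF fmem[OF o(1) on]] on by (simp add: c_def)
   thus ?thesis using p.hom_closed[OF fmem[OF o(1) on]] unfolding ab by simp
  qed
  hence "finprod (L x) (%ed. pull ph x (c ed) [^]\<^bsub>L x\<^esub>\<epsilon> ph ed) (edges_in ph) =
   cycle_value ph x f b"
   by (intro L.finprod_cong') auto
  also have "...=\<one>\<^bsub>L x\<^esub>" using f ph U(2) b unfolding ES_carrier[OF U(1)] cyc_def by blast
  finally show ?thesis .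
 qed
 have "EX h. (ALL v. v extreme_point_of \<sigma> --> h v:carrier (L x)) &
  (ALL ed. ed edge_of \<sigma> --> on_stratum ed x --> pull ed x (cob x h ed)=pull ed x (c ed))"
  by (rule lift_cochain[where c = c, OF xS c cycle]) (assumption | assumption | intro exI conjI allI impI)+
 then obtain h where h: "ALL v. v extreme_point_of \<sigma> --> h v:carrier (L x)"
  "ALL ed. ed edge_of \<sigma> --> on_stratum ed x --> pull ed x (cob x h ed)=pull ed x (c ed)" by (elim exE conjE)
 have "ALL v:vertices. EX p. fst p:carrier R - x & snd p:carrier R - x & h v=fr x (fst p) (snd p)"
 proof
  fix v assume "v:vertices"
  hence "h v:carrier (L x)" using h(1) by blast
  then obtain a f where "a:carrier R - x" "f:carrier R - x" "h v=fr x a f" by (rule unit_germs_cases)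
  thus "EX p. fst p:carrier R - x & snd p:carrier R - x & h v=fr x (fst p) (snd p)"
   by (intro exI[of _ "(a, f)"]) simp
 qed
 from bchoice[OF this] obtain p where p: "ALL v:vertices. fst (p v):carrier R - x & snd (p v):carrier R - x & h v=fr x (fst (p v)) (snd (p v))"
  by (elim exE)
 show thesis
 proof (rule that[of "%v. fst (p v)" "%v. snd (p v)"])
  show "fst (p v):carrier R - x & snd (p v):carrier R - x" if "v extreme_point_of \<sigma>" for v using bspec[OF p, of v] that by blast
  fix ed assume ed: "ed edge_of \<sigma>" "on_stratum ed x"
  have hv: "h v=fr x (fst (p v)) (snd (p v))" if "v extreme_point_of \<sigma>" for v using bspec[OF p, of v] that by blast
  have "pull ed x (cob x h ed)=pull ed x (c ed)" using h(2) ed by blast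
  also have "...=pull ed x (pull ed x (f ed x) [^]\<^bsub>L x\<^esub>deg b ed)" using ed by (simp add: c_def)
  also have "...=pull ed x (f ed x) [^]\<^bsub>L x\<^esub>deg b ed"
  proof -
   note Fo = is_face_edge[OF ed(1)]
   interpret p: group_hom "L x" "L x" "pull ed x" using pull_group_hom[OF xS Fo ed(2)] .
   have z: "x:U\<inter>zero_locus R (Ie ed)" using on_stratum_zero_locus[OF xS subset_refl ed(2)] U(2) by blast
   have m: "ed:edges" using ed(1) by blast
   have "pull ed x (pull ed x (f ed x))=pull ed x (f ed x)"
    by (rule pull_absorb[OF xS Fo ed(2) Fo subset_refl ideal_face[OF Fo] subset_refl R.section_germ[OF ideal_face[OF Fo] U(1) ES_closed[OF U(1) f m] z]])
   thus ?thesis using p.hom_int_pow[OF fmem[OF ed]] by simp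
  qed
  finally show "pull ed x (fr x (fst (p (tgt ed))) (snd (p (tgt ed)))\<otimes>\<^bsub>L x\<^esub>inv\<^bsub>L x\<^esub>fr x (fst (p (src ed))) (snd (p (src ed)))) =
    pull ed x (f ed x) [^]\<^bsub>L x\<^esub>deg b ed"
   unfolding hv[OF ends(3)[OF ed(1)]] hv[OF ends(4)[OF ed(1)]] .
 qed
qed

text \<open>One linear function of \<open>w\<close> for each vertex, such that the functions at the ends of an edge differ on its stratum by the prescribed power: the linear extensions of a family with prescribed kinks.\<close>
definition solves :: "('a=>'a=>('a, 'k) local_fun)=>('a, 'k) point set=>('a set=>('a, 'k) local_fun)=>bool" where
 "solves g W f \<longleftrightarrow>
  (ALL v w. v extreme_point_of \<sigma> --> w:N --> (ALL y:W. g v w y:carrier (L y)) & fractional_on {v} W (%y. pull {v} y (g v w y))) &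
  (ALL v w w' y. v extreme_point_of \<sigma> --> w:N --> w':N --> y:W --> g v (w + w') y=g v w y\<otimes>\<^bsub>L y\<^esub>g v w' y) &
  (ALL ed w y. ed edge_of \<sigma> --> w:N --> y:W --> on_stratum ed y -->
   pull ed y (g (tgt ed) w y)=pull ed y (g (src ed) w y)\<otimes>\<^bsub>L y\<^esub>pull ed y (f ed y) [^]\<^bsub>L y\<^esub>deg w ed)"

text \<open>On the component of a vertex the family is the linear function of that vertex. Two such functions agree at \<open>w\<close> on the intersection of their components if \<open>w\<close> is minimal on both vertices, because the edges of the join then have degree zero.\<close>
lemma family_from_solution:
 assumes W: "opn W" and f: "f:carrier (sect ES W)" and g: "solves g W f"
 shows "EX h:carrier (sect LF W). kinks W h=f"
proof -
 have gc: "g v w y:carrier (L y)" if "v extreme_point_of \<sigma>" "w:N" "y:W" for v w y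
  using g[unfolded solves_def, THEN conjunct1, rule_format, OF that(1,2), THEN conjunct1, rule_format, OF that(3)] .
 have gf: "fractional_on {v} W (%y. pull {v} y (g v w y))" if "v extreme_point_of \<sigma>" "w:N" for v w
  using g[unfolded solves_def, THEN conjunct1, rule_format, OF that(1,2), THEN conjunct2] .
 have ga: "g v (w + w') y=g v w y\<otimes>\<^bsub>L y\<^esub>g v w' y" if "v extreme_point_of \<sigma>" "w:N" "w':N" "y:W" for v w w' y
  using g[unfolded solves_def, THEN conjunct2, THEN conjunct1, rule_format, OF that] .
 have ge: "pull ed y (g (tgt ed) w y)=pull ed y (g (src ed) w y)\<otimes>\<^bsub>L y\<^esub>pull ed y (f ed y) [^]\<^bsub>L y\<^esub>deg w ed"
  if "ed edge_of \<sigma>" "w:N" "y:W" "on_stratum ed y" for ed w y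
  using g[unfolded solves_def, THEN conjunct2, THEN conjunct2, rule_format, OF that] .
 have const: "pull fc y (g v w y)=pull fc y (g v' w y)"
  if w: "w:N" and y: "y:W" and fc: "is_face fc" "on_stratum fc y" "fc\<subseteq>minface w"
   and v: "v extreme_point_of \<sigma>" "v:fc" "v' extreme_point_of \<sigma>" "v':fc" for w y fc v v'
 proof (rule constant_on_face[OF fc(1) _ v])
  fix ed assume "ed:edges_in fc"
  hence o: "ed edge_of \<sigma>" "ed\<subseteq>fc" "ed:edges" by auto
  have yS: "y:Spec R" using opn_Spec[OF W y] .
  note F = is_face_edge[OF o(1)]
  have on: "on_stratum ed y" by (rule on_stratum_mono[OF fc(1) F o(2) fc(2)])
  interpret L: comm_group "L y" using comm_group_L[OF yS] .
  have m: "src ed:minface w" "tgt ed:minface w" using ends(6,7)[OF o(1)] o(2) fc(3) by auto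
  have "deg w ed=0" unfolding deg_zero_iff[OF o(1) w] using hgt_eq[OF m(1)] hgt_eq[OF m(2)] by simp
  moreover have "pull ed y (g (src ed) w y):carrier (L y)"
   by (rule hom_in_carrier[OF pull_endo[OF yS F on] gc[OF ends(3)[OF o(1)] w y]])
  ultimately have "pull ed y (g (tgt ed) w y)=pull ed y (g (src ed) w y)" using ge[OF o(1) w y on] by simp
  hence "pull fc y (pull ed y (g (tgt ed) w y))=pull fc y (pull ed y (g (src ed) w y))" by simp
  thus "pull fc y (g (tgt ed) w y)=pull fc y (g (src ed) w y)"
   unfolding pull_absorb_L[OF yS fc(1,2) F o(2) gc[OF ends(4)[OF o(1)] w y]]
    pull_absorb_L[OF yS fc(1,2) F o(2) gc[OF ends(3)[OF o(1)] w y]] .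
 qed
 have "ALL p:P. EX s. s:carrier (Inv (Ip p) W) &
  (ALL y:W. ALL v. {v}:faces_p p --> on_stratum {v} y --> pull {v} y (s y)=pull {v} y (g v (fst p) y))"
 proof
  fix p assume p: "p:P"
  have w: "fst p:N" using p by (auto simp: P_monoid_eq)
  define val where "val=(%fc y. pull fc y (g (the_elem fc) (fst p) y))"
  have fp: "fc:vertex_faces & fc\<subseteq>minface (fst p)" if "fc:faces_p p" for fc using that by (auto simp: faces_p_def split: if_splits)
  show "EX s. s:carrier (Inv (Ip p) W) &
   (ALL y:W. ALL v. {v}:faces_p p --> on_stratum {v} y --> pull {v} y (s y)=pull {v} y (g v (fst p) y))"
  proof (rule section_from_fractions[OF W, of "faces_p p" val])
   show "finite (faces_p p)" by (rule faces_p(1))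
   show "is_face fc" if "fc:faces_p p" for fc by (rule faces_p(2)[OF that])
  next
   fix fc assume t: "fc:faces_p p"
   obtain v where v: "fc={v}" "v extreme_point_of \<sigma>" using conjunct1[OF fp[OF t]] by (rule vertex_facesE)
   show "fractional_on fc W (val fc)" unfolding v(1) val_def the_elem_eq by (rule gf[OF v(2) w])
  next
   fix y fc fc' assume y: "y:W" and t: "fc:faces_p p" "fc':faces_p p" and on: "on_stratum fc y" "on_stratum fc' y"
   obtain v where v: "fc={v}" "v extreme_point_of \<sigma>" using conjunct1[OF fp[OF t(1)]] by (rule vertex_facesE)
   obtain v' where v': "fc'={v'}" "v' extreme_point_of \<sigma>" using conjunct1[OF fp[OF t(2)]] by (rule vertex_facesE)
   note Ft = faces_p(2)[OF t(1)] faces_p(2)[OF t(2)]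
   have yS: "y:Spec R" using opn_Spec[OF W y] .
   note J = join_face[OF Ft] and onJ = on_stratum_join[OF yS Ft on]
   have Jm: "join fc fc'\<subseteq>minface (fst p)" unfolding join_subset_minface[OF Ft] using fp[OF t(1)] fp[OF t(2)] by blast
   have vJ: "v:join fc fc'" "v':join fc fc'" using J(2,3) v(1) v'(1) by auto
   have "pull (join fc fc') y (val fc y)=pull (join fc fc') y (g v (fst p) y)"
    unfolding val_def using pull_absorb_L[OF yS J(1) onJ Ft(1) J(2) gc[OF v(2) w y]] v(1) by simp
   also have "...=pull (join fc fc') y (g v' (fst p) y)" by (rule const[OF w y J(1) onJ Jm v(2) vJ(1) v'(2) vJ(2)])
   also have "...=pull (join fc fc') y (val fc' y)"
    unfolding val_def using pull_absorb_L[OF yS J(1) onJ Ft(2) J(3) gc[OF v'(2) w y]] v'(1) by simp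
   finally show "pull (join fc fc') y (val fc y)=pull (join fc fc') y (val fc' y)" .
  next
   fix s assume s: "s:carrier (Inv (Ip p) W)" "!!x fc. [|x:W; fc:faces_p p; on_stratum fc x|] ==> pull fc x (s x)=val fc x"
   show "EX s. s:carrier (Inv (Ip p) W) &
    (ALL y:W. ALL v. {v}:faces_p p --> on_stratum {v} y --> pull {v} y (s y)=pull {v} y (g v (fst p) y))"
    by (intro exI[of _ s] conjI ballI allI impI s(1)) (use s(2) in \<open>simp add: val_def\<close>)
  qed
 qed
 from bchoice[OF this] obtain h0 where h0: "ALL p:P. h0 p:carrier (Inv (Ip p) W) &
  (ALL y:W. ALL v. {v}:faces_p p --> on_stratum {v} y --> pull {v} y (h0 p y)=pull {v} y (g v (fst p) y))" by (elim exE)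
 define h where "h=(\<lambda>p\<in>P. h0 p)"
 have hp: "h p=h0 p" if "p:P" for p using that by (simp add: h_def)
 have hc: "h p:carrier (Inv (Ip p) W)" if "p:P" for p using conjunct1[OF bspec[OF h0 that]] unfolding hp[OF that] .
 have val: "pull {v} y (h p y)=pull {v} y (g v (fst p) y)" if "p:P" "y:W" "{v}:faces_p p" "on_stratum {v} y" for p y v
  using spec[OF bspec[OF conjunct2[OF bspec[OF h0 that(1)]] that(2)], of v] that(3,4) unfolding hp[OF that(1)] by simp
 have hLF: "h:carrier (sect LF W)"
  unfolding LF_carrier
 proof (intro conjI ballI)
  show "h:(\<Pi>\<^sub>E p\<in>P. carrier (Inv (Ip p) W))"
  proof
   show "h p:carrier (Inv (Ip p) W)" if "p:P" for p by (rule hc[OF that])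
  qed (simp add: h_def)
  fix p q assume pq: "p:P" "q:P"
  have N: "fst p:N" "fst q:N" using pq by (auto simp: P_monoid_eq)
  let ?J = "Ip (p + q)"
  interpret I: comm_group "Inv ?J W" using Inv_group[OF Ip_ideal W] .
  have c: "rs ?J W (h p):carrier (Inv ?J W)" "rs ?J W (h q):carrier (Inv ?J W)"
   using R.restrict_function_closed[OF Ip_ideal Ip_ideal Ip_add(1)[OF pq] W W subset_refl hc[OF pq(1)]]
    R.restrict_function_closed[OF Ip_ideal Ip_ideal Ip_add(2)[OF pq] W W subset_refl hc[OF pq(2)]] .
  show "rs ?J W (h p)\<otimes>\<^bsub>Inv ?J W\<^esub>rs ?J W (h q)=h (p + q)"
  proof (rule section_eqI[OF W faces_p I.m_closed[OF c] hc[OF P_add[OF pq]]])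
   fix y fc assume y: "y:W" and t: "fc:faces_p (p + q)" "on_stratum fc y"
   have "fc:vertex_faces" using t(1) by (auto simp: faces_p_def split: if_splits)
   then obtain v where v: "fc={v}" "v extreme_point_of \<sigma>" by (rule vertex_facesE)
   have on: "on_stratum {v} y" and vf: "{v}:faces_p (p + q)" "{v}:faces_p p" "{v}:faces_p q"
    using t v(1) subsetD[OF faces_p_add[OF pq] t(1)] by auto
   note F = is_face_vertex[OF v(2)]
   have yS: "y:Spec R" using opn_Spec[OF W y] .
   have J: "?J\<subseteq>Ie {v}" using vf(1) by (intro strata_ideal_antimono) simp
   have r: "pull {v} y (rs ?J W (h p') y)=pull {v} y (g v (fst p') y)" if "p':P" "Ip p'\<subseteq>?J" "{v}:faces_p p'" for p'
    using pull_restrict_function[OF F on W subset_refl y Ip_ideal Ip_ideal that(2) J hc[OF that(1)]] val[OF that(1) y that(3) on] by simp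
   have "pull {v} y ((rs ?J W (h p)\<otimes>\<^bsub>Inv ?J W\<^esub>rs ?J W (h q)) y)=pull {v} y (rs ?J W (h p) y)\<otimes>\<^bsub>L y\<^esub>pull {v} y (rs ?J W (h q) y)"
    by (rule hom_mult[OF pull_section_hom[OF F W y on Ip_ideal J] c])
   also have "...=pull {v} y (g v (fst p) y\<otimes>\<^bsub>L y\<^esub>g v (fst q) y)"
    unfolding r[OF pq(1) Ip_add(1)[OF pq] vf(2)] r[OF pq(2) Ip_add(2)[OF pq] vf(3)]
    by (rule hom_mult[OF pull_endo[OF yS F on] gc[OF v(2) N(1) y] gc[OF v(2) N(2) y], symmetric])
   also have "...=pull {v} y (h (p + q) y)"
    unfolding val[OF P_add[OF pq] y vf(1) on] fst_add ga[OF v(2) N y] ..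
   finally show "pull fc y ((rs ?J W (h p)\<otimes>\<^bsub>Inv ?J W\<^esub>rs ?J W (h q)) y)=pull fc y (h (p + q) y)" unfolding v(1) .
  qed assumption
 qed
 have "kinks W h=f"
 proof (rule ES_eqI[OF W kinks_closed[OF W hLF] f])
  fix y ed assume y: "y:W" and ed: "ed:edges" "on_stratum ed y"
  have o: "ed edge_of \<sigma>" "ed:edges_in ed" using ed(1) by auto
  note F = is_face_edge[OF o(1)]
  have yS: "y:Spec R" using opn_Spec[OF W y] .
  have CL: "comm_group (L y)" using comm_group_L[OF yS] .
  interpret L: comm_group "L y" by (rule CL)
  interpret p: group_hom "L y" "L y" "pull ed y" using pull_group_hom[OF yS F ed(2)] .
  have pl: "pl_on (L y) ed (pl_germ h ed y)" by (rule pl_on_germ[OF W y hLF F ed(2)])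
  have germ: "pl_germ h ed y w=pull ed y (g v w y)"
   if v: "v extreme_point_of \<sigma>" "v:ed" and w: "w:N" "v:minface w" for v w
  proof -
   have sub: "{v}\<subseteq>ed" using v by blast
   have on: "on_stratum {v} y" by (rule on_stratum_mono[OF F is_face_vertex[OF v(1)] sub ed(2)])
   have vf: "{v}:faces_p (bd w)" unfolding faces_p_bd[OF w(1)] using v(1) w(2) by (simp add: vertex_faces_def)
   have "pl_germ h ed y w=pull ed y (pl_germ h {v} y w)" by (rule pl_germ_absorb[OF W y hLF F ed(2) v w, symmetric])
   also have "...=pull ed y (pull {v} y (g v w y))" unfolding val[OF bd_P[OF w(1)] y vf on] fst_conv ..
   also have "...=pull ed y (g v w y)" by (rule pull_absorb_L[OF yS F ed(2) is_face_vertex[OF v(1)] sub gc[OF v(1) w(1) y]])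
   finally show ?thesis .
  qed
  have ext: "ext (L y) (pl_germ h ed y) v w=pull ed y (g v w y)" if v: "v extreme_point_of \<sigma>" "v:ed" and w: "w:N" for v w
  proof -
   note s = shift[OF v(1) w]
   show ?thesis
    unfolding ext_def germ[OF v add_N[OF w s(1)] s(3)] germ[OF v s(1,2)] ga[OF v(1) w s(1) y]
    using gc[OF v(1) w y] gc[OF v(1) s(1) y] by (simp add: L.m_assoc)
  qed
  have deg1: "deg (dirw ed) ed=1" unfolding deg_def dirw(2)[OF o(1)] by simp
  note wN = dirw(1)[OF o(1)]
  have k: "kink (L y) (pl_germ h ed y) ed:carrier (L y)" by (rule ext_edge(1)[OF CL pl o(1) subset_refl wN])
  have fmem: "pull ed y (f ed y):carrier (L y)"
   by (rule pull_closed[OF F W y ed(2) ideal_face[OF F] subset_refl ES_closed[OF W f ed(1)]])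
  have sc: "pull ed y (g (src ed) (dirw ed) y):carrier (L y)" by (rule p.hom_closed[OF gc[OF ends(3)[OF o(1)] wN y]])
  have "pull ed y (g (src ed) (dirw ed) y)\<otimes>\<^bsub>L y\<^esub>kink (L y) (pl_germ h ed y) ed =
    pull ed y (g (src ed) (dirw ed) y)\<otimes>\<^bsub>L y\<^esub>pull ed y (f ed y)"
   using ext_edge(2)[OF CL pl o(1) subset_refl wN] ge[OF o(1) wN y ed(2)] k fmem
   unfolding ext[OF ends(3,6)[OF o(1)] wN] ext[OF ends(4,7)[OF o(1)] wN] deg1 by (simp add: L.int_pow_1)
  hence "kink (L y) (pl_germ h ed y) ed=pull ed y (f ed y)"
   using L.Units_l_cancel[of "pull ed y (g (src ed) (dirw ed) y)"] sc k fmem by (simp add: L.Units_eq)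
  thus "pull ed y (kinks W h ed y)=pull ed y (f ed y)" unfolding pull_kinks[OF W y hLF F ed(2) o(2)] .
 qed
 thus ?thesis using hLF by blast
qed

end

section \<open>Sheaves presented as quotients\<close>

text \<open>A natural homomorphism \<open>\<Phi>\<close> from a presheaf to a sheaf \<open>G\<close> with kernel \<open>H\<close> that is locally surjective. It identifies the sheafified quotient with \<open>G\<close>.\<close>
locale sheaf_presentation =
 fixes X :: "'p topology" and F :: "('p, 's) presheaf" and H :: "'p set=>'s set"
  and G :: "('p, 't) presheaf" and \<Phi> :: "'p set=>'s=>'t"
 assumes F_group: "!!U. openin X U ==> comm_group (sect F U)"
  and F_hom: "!!U W. [|openin X U; openin X W; W\<subseteq>U|] ==> restr F U W:hom (sect F U) (sect F W)"
  and G_group: "!!U. openin X U ==> comm_group (sect G U)"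
  and G_hom: "!!U W. [|openin X U; openin X W; W\<subseteq>U|] ==> restr G U W:hom (sect G U) (sect G W)"
  and G_trans: "!!U W V t. [|openin X U; openin X W; openin X V; W\<subseteq>U; V\<subseteq>W; t:carrier (sect G U)|] ==>
   restr G W V (restr G U W t)=restr G U V t"
  and G_separated: "!!U t t'. [|openin X U; t:carrier (sect G U); t':carrier (sect G U);
   !!x. x:U ==> EX W. openin X W & x:W & W\<subseteq>U & restr G U W t=restr G U W t'|] ==> t=t'"
  and G_glue: "!!U W t. [|openin X U; !!x. x:U ==> openin X (W x) & x:W x & W x\<subseteq>U & t x:carrier (sect G (W x));
   !!x y. [|x:U; y:U|] ==> restr G (W x) (W x\<inter>W y) (t x)=restr G (W y) (W x\<inter>W y) (t y)|] ==>
   EX s:carrier (sect G U). ALL x:U. restr G U (W x) s=t x"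
  and \<Phi>_hom: "!!U. openin X U ==> \<Phi> U:hom (sect F U) (sect G U)"
  and \<Phi>_nat: "!!U W s. [|openin X U; openin X W; W\<subseteq>U; s:carrier (sect F U)|] ==>
   \<Phi> W (restr F U W s)=restr G U W (\<Phi> U s)"
  and \<Phi>_kernel: "!!U. openin X U ==> H U={s:carrier (sect F U). \<Phi> U s=\<one>\<^bsub>sect G U\<^esub>}"
  and \<Phi>_surj: "!!U t x. [|openin X U; t:carrier (sect G U); x:U|] ==>
   EX W s. openin X W & x:W & W\<subseteq>U & s:carrier (sect F W) & \<Phi> W s=restr G U W t"
begin

lemma \<Phi>_group_hom: "openin X U ==> group_hom (sect F U) (sect G U) (\<Phi> U)"
 by (simp add: group_hom_def group_hom_axioms_def \<Phi>_hom F_group G_group comm_group.axioms(2))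

lemma \<Phi>_closed: "[|openin X U; s:carrier (sect F U)|] ==> \<Phi> U s:carrier (sect G U)"
 using hom_in_carrier[OF \<Phi>_hom] .

lemma F_closed: "[|openin X U; openin X W; W\<subseteq>U; s:carrier (sect F U)|] ==> restr F U W s:carrier (sect F W)"
 using hom_in_carrier[OF F_hom] .

lemma G_closed: "[|openin X U; openin X W; W\<subseteq>U; s:carrier (sect G U)|] ==> restr G U W s:carrier (sect G W)"
 using hom_in_carrier[OF G_hom] .

definition cls :: "'p set=>'s=>'s set" where
 "cls U s=H U #>\<^bsub>sect F U\<^esub>s"

abbreviation "Q \<equiv> quotient_presheaf F H"

lemma H_kernel: "openin X U ==> H U=kernel (sect F U) (sect G U) (\<Phi> U)"
 by (simp add: \<Phi>_kernel kernel_def)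

lemma H_normal: "openin X U ==> H U \<lhd> sect F U"
 using group_hom.normal_kernel[OF \<Phi>_group_hom] H_kernel by metis

lemma cls_eq_iff:
 assumes U: "openin X U" and s: "s:carrier (sect F U)" "t:carrier (sect F U)"
 shows "cls U s=cls U t \<longleftrightarrow> \<Phi> U s=\<Phi> U t"
proof -
 interpret h: group_hom "sect F U" "sect G U" "\<Phi> U" using \<Phi>_group_hom[OF U] .
 have sg: "subgroup (H U) (sect F U)" using normal_imp_subgroup[OF H_normal[OF U]] .
 have "cls U s=cls U t \<longleftrightarrow> s\<otimes>\<^bsub>sect F U\<^esub>inv\<^bsub>sect F U\<^esub>t:H U"
  unfolding cls_def
 proof
  assume e: "H U #>\<^bsub>sect F U\<^esub>s=H U #>\<^bsub>sect F U\<^esub>t"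
  have "s:H U #>\<^bsub>sect F U\<^esub>t" using h.G.rcos_self[OF s(1) sg] e by simp
  then obtain a where a: "a:H U" "s=a\<otimes>\<^bsub>sect F U\<^esub>t" by (auto simp: r_coset_def)
  thus "s\<otimes>\<^bsub>sect F U\<^esub>inv\<^bsub>sect F U\<^esub>t:H U"
   using s(2) subgroup.mem_carrier[OF sg a(1)] by (simp add: h.G.m_assoc)
 next
  assume e: "s\<otimes>\<^bsub>sect F U\<^esub>inv\<^bsub>sect F U\<^esub>t:H U"
  have "s=(s\<otimes>\<^bsub>sect F U\<^esub>inv\<^bsub>sect F U\<^esub>t)\<otimes>\<^bsub>sect F U\<^esub>t" using s by (simp add: h.G.m_assoc)
  hence "s:H U #>\<^bsub>sect F U\<^esub>t" using e unfolding r_coset_def by blast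
  thus "H U #>\<^bsub>sect F U\<^esub>s=H U #>\<^bsub>sect F U\<^esub>t" using h.G.repr_independence[OF _ s(2) sg] by metis
 qed
 also have "... \<longleftrightarrow> \<Phi> U s\<otimes>\<^bsub>sect G U\<^esub>inv\<^bsub>sect G U\<^esub>(\<Phi> U t)=\<one>\<^bsub>sect G U\<^esub>"
  using s by (simp add: \<Phi>_kernel[OF U])
 also have "... \<longleftrightarrow> \<Phi> U s=\<Phi> U t" using s h.H.inv_solve_right'[of "\<one>\<^bsub>sect G U\<^esub>" "\<Phi> U s" "\<Phi> U t"] by simp
 finally show ?thesis .
qed

lemma carrier_Q: "carrier (sect Q U)=cls U ` carrier (sect F U)"
 by (auto simp: quotient_presheaf_def FactGroup_def RCOSETS_def cls_def)

lemma mult_Q: "[|openin X U; s:carrier (sect F U); t:carrier (sect F U)|] ==>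
  cls U s\<otimes>\<^bsub>sect Q U\<^esub>cls U t=cls U (s\<otimes>\<^bsub>sect F U\<^esub>t)"
 using normal.rcos_sum[OF H_normal] by (simp add: quotient_presheaf_def FactGroup_def cls_def)

lemma restr_Q:
 assumes U: "openin X U" "openin X W" "W\<subseteq>U" and s: "s:carrier (sect F U)"
 shows "restr Q U W (cls U s)=cls W (restr F U W s)"
proof -
 interpret g: group "sect F U" using F_group[OF U(1)] comm_group.axioms(2) by blast
 have sg: "subgroup (H U) (sect F U)" using normal_imp_subgroup[OF H_normal[OF U(1)]] .
 have "cls W (restr F U W t)=cls W (restr F U W s)" if t: "t:cls U s" for t
 proof -
  have tc: "t:carrier (sect F U)" using t g.r_coset_subset_G[OF subgroup.subset[OF sg] s] by (auto simp: cls_def)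
  have "cls U t=cls U s" unfolding cls_def using g.repr_independence[OF _ s sg, of t] t by (simp add: cls_def)
  hence "\<Phi> U t=\<Phi> U s" using cls_eq_iff[OF U(1) tc s] by blast
  thus ?thesis using cls_eq_iff[OF U(2)] F_closed[OF U] \<Phi>_nat[OF U] s tc by simp
 qed
 hence "(\<Union>t\<in>cls U s. cls W (restr F U W t))=(\<Union>t\<in>cls U s. cls W (restr F U W s))" by (rule SUP_cong[OF refl])
 also have "...=cls W (restr F U W s)" using g.rcos_self[OF s sg] by (auto simp: cls_def)
 finally show ?thesis by (simp add: quotient_presheaf_def cls_def)
qed

text \<open>The germ of a section \<open>t\<close> of \<open>G\<close>, written in classes modulo \<open>H\<close>: it consists of all classes whose image agrees with \<open>t\<close> near the point.\<close>
definition gm :: "'p set=>'t=>'p=>('p set\<times>'s set) set" where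
 "gm U t y={(W, C). openin X W & y:W & (EX s:carrier (sect F W). C=cls W s &
   (EX W'. openin X W' & y:W' & W'\<subseteq>U\<inter>W & restr G U W' t=restr G W W' (\<Phi> W s)))}"

lemma gm_eqI:
 assumes U: "openin X U" "openin X U'" and t: "t:carrier (sect G U)" "t':carrier (sect G U')"
  and V: "openin X V" "y:V" "V\<subseteq>U\<inter>U'" "restr G U V t=restr G U' V t'"
 shows "gm U t y=gm U' t' y"
proof -
 have sub: "gm U t y\<subseteq>gm U' t' y"
  if A: "openin X U" "openin X U'" "t:carrier (sect G U)" "t':carrier (sect G U')" "V\<subseteq>U" "V\<subseteq>U'"
   "restr G U V t=restr G U' V t'" for U U' t t'
 proof
  fix p assume "p:gm U t y"
  then obtain W s W' where W: "p=(W, cls W s)" "openin X W" "y:W" "s:carrier (sect F W)" "openin X W'"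
   "y:W'" "W'\<subseteq>U\<inter>W" "restr G U W' t=restr G W W' (\<Phi> W s)" unfolding gm_def by blast
  let ?W = "W'\<inter>V"
  have o: "openin X ?W" using W(5) V(1) by (rule openin_Int)
  have "restr G U' ?W t'=restr G V ?W (restr G U' V t')"
   using G_trans[OF A(2) V(1) o A(6) _ A(4)] by simp
  also have "...=restr G U ?W t" unfolding A(7)[symmetric] using G_trans[OF A(1) V(1) o A(5) _ A(3)] by simp
  also have "...=restr G W' ?W (restr G U W' t)" using G_trans[OF A(1) W(5) o _ _ A(3)] W(7) by simp
  also have "...=restr G W ?W (\<Phi> W s)"
   unfolding W(8) using G_trans[OF W(2) W(5) o _ _ \<Phi>_closed[OF W(2,4)]] W(7) by simp
  finally have "restr G U' ?W t'=restr G W ?W (\<Phi> W s)" .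
  moreover have "y:?W" "?W\<subseteq>U'\<inter>W" using V(2) W(6,7) A(6) by auto
  ultimately have "EX W'. openin X W' & y:W' & W'\<subseteq>U'\<inter>W & restr G U' W' t'=restr G W W' (\<Phi> W s)"
   using o by (intro exI conjI)
  thus "p:gm U' t' y" unfolding gm_def W(1) using W(2-4) by blast
 qed
 show ?thesis using sub[OF U t _ _ V(4)] sub[OF U(2,1) t(2,1) _ _ V(4)[symmetric]] V(3) by blast
qed

lemma gm_eqD:
 assumes U: "openin X U" "openin X U'" and t: "t:carrier (sect G U)" "t':carrier (sect G U')"
  and y: "y:U" and eq: "gm U t y=gm U' t' y"
 obtains V where "openin X V" "y:V" "V\<subseteq>U\<inter>U'" "restr G U V t=restr G U' V t'"
proof -
 obtain W s where W: "openin X W" "y:W" "W\<subseteq>U" "s:carrier (sect F W)" "\<Phi> W s=restr G U W t"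
  using \<Phi>_surj[OF U(1) t(1) y] by blast
 have "restr G U W t=restr G W W (\<Phi> W s)" unfolding W(5) using G_trans[OF U(1) W(1,1) W(3) order_refl t(1)] by simp
 hence "(W, cls W s):gm U t y" unfolding gm_def using W by blast
 hence "(W, cls W s):gm U' t' y" using eq by simp
 then obtain s' W' where s': "s':carrier (sect F W)" "cls W s=cls W s'" "openin X W'" "y:W'" "W'\<subseteq>U'\<inter>W"
   "restr G U' W' t'=restr G W W' (\<Phi> W s')" unfolding gm_def by blast
 have "\<Phi> W s'=\<Phi> W s" using cls_eq_iff[OF W(1,4) s'(1)] s'(2) by simp
 hence "restr G U' W' t'=restr G U W' t"
  unfolding s'(6) W(5) using G_trans[OF U(1) W(1) s'(3) W(3) _ t(1)] s'(5) W(5) by simp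
 thus thesis using that[OF s'(3,4)] s'(5) W(3) by auto
qed

lemma germ_eq:
 assumes U: "openin X U" and s: "s:carrier (sect F U)"
 shows "germ X Q y U (cls U s)=gm U (\<Phi> U s) y"
proof -
 have "restr Q U W' (cls U s)=restr Q W W' (cls W t) \<longleftrightarrow> restr G U W' (\<Phi> U s)=restr G W W' (\<Phi> W t)"
  if A: "openin X W" "openin X W'" "W'\<subseteq>U\<inter>W" "t:carrier (sect F W)" for W W' t
 proof -
  have W: "W'\<subseteq>U" "W'\<subseteq>W" using A by auto
  show ?thesis
   using restr_Q[OF U A(2) W(1) s] restr_Q[OF A(1,2) W(2) A(4)] \<Phi>_nat[OF U A(2) W(1) s] \<Phi>_nat[OF A(1,2) W(2) A(4)]
    cls_eq_iff[OF A(2) F_closed[OF U A(2) W(1) s] F_closed[OF A(1,2) W(2) A(4)]] by simp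
 qed
 note k = this
 show ?thesis
 proof (intro subset_antisym subsetI)
  fix p assume "p:germ X Q y U (cls U s)"
  then obtain W t W' where p: "p=(W, cls W t)" "openin X W" "y:W" "t:carrier (sect F W)" "openin X W'" "y:W'"
   "W'\<subseteq>U\<inter>W" "restr Q U W' (cls U s)=restr Q W W' (cls W t)" unfolding germ_def carrier_Q by blast
  thus "p:gm U (\<Phi> U s) y" using k[OF p(2,5,7,4)] unfolding gm_def by blast
 next
  fix p assume "p:gm U (\<Phi> U s) y"
  then obtain W t W' where p: "p=(W, cls W t)" "openin X W" "y:W" "t:carrier (sect F W)" "openin X W'" "y:W'"
   "W'\<subseteq>U\<inter>W" "restr G U W' (\<Phi> U s)=restr G W W' (\<Phi> W t)" unfolding gm_def by blast
  thus "p:germ X Q y U (cls U s)" using k[OF p(2,5,7,4)] unfolding germ_def carrier_Q by blast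
 qed
qed

definition \<psi> :: "'p set=>'t=>'p=>('p set\<times>'s set) set" where
 "\<psi> U t=(\<lambda>y\<in>U. gm U t y)"

abbreviation "S \<equiv> quotient_sheaf X F H"

lemma S_simps:
 "g:carrier (sect S U) \<longleftrightarrow> g:extensional U & (ALL x:U. EX W s. openin X W & x:W & W\<subseteq>U &
   s:carrier (sect Q W) & (ALL y:W. g y=germ X Q y W s))"
 "g\<otimes>\<^bsub>sect S U\<^esub>h=(\<lambda>x\<in>U. germ_mult X Q x (g x) (h x))"
 "restr S U W g=restrict g W"
 by (simp_all add: quotient_sheaf_def sheafify_def)

lemma \<psi>_restr:
 assumes U: "openin X U" "openin X W" "W\<subseteq>U" and t: "t:carrier (sect G U)"
 shows "restrict (\<psi> U t) W=\<psi> W (restr G U W t)"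
proof -
 have "gm U t y=gm W (restr G U W t) y" if "y:W" for y
 proof (rule gm_eqI[OF U(1,2) t G_closed[OF U t] U(2) that])
  show "restr G U W t=restr G W W (restr G U W t)" using G_trans[OF U(1,2,2,3) order_refl t] by simp
 qed (use U(3) in blast)
 note gm_eq = this
 show ?thesis
 proof
  fix y show "restrict (\<psi> U t) W y=\<psi> W (restr G U W t) y"
   using gm_eq[of y] subsetD[OF U(3), of y] by (simp add: \<psi>_def restrict_def)
 qed
qed

lemma \<psi>_closed:
 assumes U: "openin X U" and t: "t:carrier (sect G U)"
 shows "\<psi> U t:carrier (sect S U)"
 unfolding S_simps(1)
proof (intro conjI ballI)
 show "\<psi> U t:extensional U" by (simp add: \<psi>_def)
 fix x assume x: "x:U"
 obtain W s where W: "openin X W" "x:W" "W\<subseteq>U" "s:carrier (sect F W)" "\<Phi> W s=restr G U W t"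
  using \<Phi>_surj[OF U t x] by blast
 have "\<psi> U t y=germ X Q y W (cls W s)" if y: "y:W" for y
 proof -
  have "\<psi> U t y=restrict (\<psi> U t) W y" using y by simp
  also have "...=gm W (\<Phi> W s) y" unfolding \<psi>_restr[OF U W(1,3) t] W(5) using y by (simp add: \<psi>_def)
  finally show ?thesis by (simp add: germ_eq[OF W(1,4)])
 qed
 moreover have "cls W s:carrier (sect Q W)" unfolding carrier_Q using W(4) by blast
 ultimately have "cls W s:carrier (sect Q W) & (ALL y:W. \<psi> U t y=germ X Q y W (cls W s))" by blast
 thus "EX W s. openin X W & x:W & W\<subseteq>U & s:carrier (sect Q W) & (ALL y:W. \<psi> U t y=germ X Q y W s)"
  using W(1-3) by (intro exI conjI) (assumption | blast)+
qed

lemma germ_mult_gm: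
 assumes U: "openin X U" and t: "t:carrier (sect G U)" "t':carrier (sect G U)" and y: "y:U"
 shows "germ_mult X Q y (gm U t y) (gm U t' y)=gm U (t\<otimes>\<^bsub>sect G U\<^esub>t') y"
proof -
 have term_eq: "germ X Q y (A\<inter>B) (restr Q A (A\<inter>B) C\<otimes>\<^bsub>sect Q (A\<inter>B)\<^esub>restr Q B (A\<inter>B) D)=gm U (t\<otimes>\<^bsub>sect G U\<^esub>t') y"
  if AC: "(A, C):gm U t y" and BD: "(B, D):gm U t' y" for A B C D
 proof -
  obtain s A' where s: "openin X A" "y:A" "s:carrier (sect F A)" "C=cls A s" "openin X A'" "y:A'" "A'\<subseteq>U\<inter>A"
   "restr G U A' t=restr G A A' (\<Phi> A s)" using AC unfolding gm_def by blast
  obtain s' B' where s': "openin X B" "y:B" "s':carrier (sect F B)" "D=cls B s'" "openin X B'" "y:B'" "B'\<subseteq>U\<inter>B"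
   "restr G U B' t'=restr G B B' (\<Phi> B s')" using BD unfolding gm_def by blast
  let ?AB = "A\<inter>B" and ?V = "A'\<inter>B'"
  have o: "openin X ?AB" "openin X ?V" using s s' by auto
  let ?s = "restr F A ?AB s" and ?s' = "restr F B ?AB s'"
  have c: "?s:carrier (sect F ?AB)" "?s':carrier (sect F ?AB)"
   using F_closed[OF s(1) o(1) _ s(3)] F_closed[OF s'(1) o(1) _ s'(3)] by auto
  interpret FAB: comm_group "sect F ?AB" using F_group[OF o(1)] .
  interpret GU: comm_group "sect G U" using G_group[OF U] .
  have p: "?s\<otimes>\<^bsub>sect F ?AB\<^esub>?s':carrier (sect F ?AB)" using c by simp
  have "restr Q A ?AB C\<otimes>\<^bsub>sect Q ?AB\<^esub>restr Q B ?AB D=cls ?AB (?s\<otimes>\<^bsub>sect F ?AB\<^esub>?s')"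
   unfolding s(4) s'(4) using restr_Q[OF s(1) o(1) _ s(3)] restr_Q[OF s'(1) o(1) _ s'(3)] mult_Q[OF o(1) c] by simp
  hence "germ X Q y ?AB (restr Q A ?AB C\<otimes>\<^bsub>sect Q ?AB\<^esub>restr Q B ?AB D)=gm ?AB (\<Phi> ?AB (?s\<otimes>\<^bsub>sect F ?AB\<^esub>?s')) y"
   using germ_eq[OF o(1) p] by simp
  also have "...=gm U (t\<otimes>\<^bsub>sect G U\<^esub>t') y"
  proof (rule gm_eqI[OF o(1) U \<Phi>_closed[OF o(1) p] _ o(2)])
   show "t\<otimes>\<^bsub>sect G U\<^esub>t':carrier (sect G U)" using t by simp
   show "y:?V" "?V\<subseteq>?AB\<inter>U" using s s' by auto
   have V: "?V\<subseteq>?AB" "?V\<subseteq>U" "?V\<subseteq>A" "?V\<subseteq>B" "?V\<subseteq>A'" "?V\<subseteq>B'" using s s' by auto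
   have 1: "restr G ?AB ?V (\<Phi> ?AB ?s)=restr G U ?V t"
   proof -
    have "restr G ?AB ?V (\<Phi> ?AB ?s)=restr G A ?V (\<Phi> A s)"
     using \<Phi>_nat[OF s(1) o(1) _ s(3)] G_trans[OF s(1) o(1,2) _ V(1) \<Phi>_closed[OF s(1,3)]] by simp
    also have "...=restr G A' ?V (restr G A A' (\<Phi> A s))" using G_trans[OF s(1,5) o(2) _ V(5) \<Phi>_closed[OF s(1,3)]] s(7) by simp
    also have "...=restr G U ?V t" unfolding s(8)[symmetric] using G_trans[OF U s(5) o(2) _ V(5) t(1)] s(7) by simp
    finally show ?thesis .
   qed
   have 2: "restr G ?AB ?V (\<Phi> ?AB ?s')=restr G U ?V t'"
   proof -
    have "restr G ?AB ?V (\<Phi> ?AB ?s')=restr G B ?V (\<Phi> B s')"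
     using \<Phi>_nat[OF s'(1) o(1) _ s'(3)] G_trans[OF s'(1) o(1,2) _ V(1) \<Phi>_closed[OF s'(1,3)]] by simp
    also have "...=restr G B' ?V (restr G B B' (\<Phi> B s'))" using G_trans[OF s'(1,5) o(2) _ V(6) \<Phi>_closed[OF s'(1,3)]] s'(7) by simp
    also have "...=restr G U ?V t'" unfolding s'(8)[symmetric] using G_trans[OF U s'(5) o(2) _ V(6) t(2)] s'(7) by simp
    finally show ?thesis .
   qed
   show "restr G ?AB ?V (\<Phi> ?AB (?s\<otimes>\<^bsub>sect F ?AB\<^esub>?s'))=restr G U ?V (t\<otimes>\<^bsub>sect G U\<^esub>t')"
    using hom_mult[OF \<Phi>_hom[OF o(1)] c] hom_mult[OF G_hom[OF o V(1)] \<Phi>_closed[OF o(1) c(1)] \<Phi>_closed[OF o(1) c(2)]]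
     hom_mult[OF G_hom[OF U o(2) V(2)] t] 1 2 by simp
  qed
  finally show ?thesis .
 qed
 have ne: "EX A C. (A, C):gm U t y" if t: "t:carrier (sect G U)" for t
 proof -
  obtain W s where W: "openin X W" "y:W" "W\<subseteq>U" "s:carrier (sect F W)" "\<Phi> W s=restr G U W t"
   using \<Phi>_surj[OF U t y] by blast
  have "restr G U W t=restr G W W (\<Phi> W s)" unfolding W(5) using G_trans[OF U W(1,1,3) order_refl t] by simp
  hence "(W, cls W s):gm U t y" unfolding gm_def using W by blast
  thus ?thesis by blast
 qed
 obtain A C B D where AB: "(A, C):gm U t y" "(B, D):gm U t' y" using ne t by blast
 show ?thesis unfolding germ_mult_def
 proof (intro subset_antisym subsetI)
  fix p assume "p:(\<Union>(Ua, s)\<in>gm U t y. \<Union>(W, ta)\<in>gm U t' y.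
    germ X Q y (Ua\<inter>W) (restr Q Ua (Ua\<inter>W) s\<otimes>\<^bsub>sect Q (Ua\<inter>W)\<^esub>restr Q W (Ua\<inter>W) ta))"
  then obtain A C B D where "(A, C):gm U t y" "(B, D):gm U t' y"
   "p:germ X Q y (A\<inter>B) (restr Q A (A\<inter>B) C\<otimes>\<^bsub>sect Q (A\<inter>B)\<^esub>restr Q B (A\<inter>B) D)" by blast
  thus "p:gm U (t\<otimes>\<^bsub>sect G U\<^esub>t') y" using term_eq by blast
 next
  fix p assume "p:gm U (t\<otimes>\<^bsub>sect G U\<^esub>t') y"
  hence "p:germ X Q y (A\<inter>B) (restr Q A (A\<inter>B) C\<otimes>\<^bsub>sect Q (A\<inter>B)\<^esub>restr Q B (A\<inter>B) D)"
   using term_eq[OF AB] by simp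
  thus "p:(\<Union>(Ua, s)\<in>gm U t y. \<Union>(W, ta)\<in>gm U t' y.
    germ X Q y (Ua\<inter>W) (restr Q Ua (Ua\<inter>W) s\<otimes>\<^bsub>sect Q (Ua\<inter>W)\<^esub>restr Q W (Ua\<inter>W) ta))"
   using AB by blast
 qed
qed

lemma \<psi>_iso:
 assumes U: "openin X U"
 shows "\<psi> U:iso (sect G U) (sect S U)"
proof -
 have hom: "\<psi> U:hom (sect G U) (sect S U)"
 proof (rule homI)
  fix t t' assume t: "t:carrier (sect G U)" "t':carrier (sect G U)"
  show "\<psi> U (t\<otimes>\<^bsub>sect G U\<^esub>t')=\<psi> U t\<otimes>\<^bsub>sect S U\<^esub>\<psi> U t'"
   unfolding S_simps(2) by (auto simp: \<psi>_def germ_mult_gm[OF U t] intro!: ext)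
 qed (rule \<psi>_closed[OF U])
 have inj: "inj_on (\<psi> U) (carrier (sect G U))"
 proof (rule inj_onI)
  fix t t' assume t: "t:carrier (sect G U)" "t':carrier (sect G U)" "\<psi> U t=\<psi> U t'"
  show "t=t'"
  proof (rule G_separated[OF U t(1,2)])
   fix x assume x: "x:U"
   have "gm U t x=gm U t' x" using fun_cong[OF t(3), of x] x by (simp add: \<psi>_def)
   then obtain V where "openin X V" "x:V" "V\<subseteq>U\<inter>U" "restr G U V t=restr G U V t'"
    using gm_eqD[OF U U t(1,2) x] by blast
   thus "EX W. openin X W & x:W & W\<subseteq>U & restr G U W t=restr G U W t'" by auto
  qed
 qed
 have "g:\<psi> U ` carrier (sect G U)" if g: "g:carrier (sect S U)" for g
 proof -
  have ext: "g:extensional U" and loc: "ALL x:U. EX W s. openin X W & x:W & W\<subseteq>U &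
   s:carrier (sect Q W) & (ALL y:W. g y=germ X Q y W s)" using g unfolding S_simps(1) by auto
  have "EX W. EX s. openin X W & x:W & W\<subseteq>U & s:carrier (sect F W) & (ALL y:W. g y=gm W (\<Phi> W s) y)" if x: "x:U" for x
  proof -
   obtain W C where W: "openin X W" "x:W" "W\<subseteq>U" "C:carrier (sect Q W)" "ALL y:W. g y=germ X Q y W C"
    using bspec[OF loc x] by (elim exE conjE)
   then obtain s where "s:carrier (sect F W)" "C=cls W s" unfolding carrier_Q by blast
   thus ?thesis using W germ_eq[OF W(1)] by auto
  qed
  then obtain W s where W: "!!x. x:U ==> openin X (W x) & x:W x & W x\<subseteq>U & s x:carrier (sect F (W x)) &
    (ALL y:W x. g y=gm (W x) (\<Phi> (W x) (s x)) y)" by metis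
  let ?t = "%x. \<Phi> (W x) (s x)"
  have "EX t:carrier (sect G U). ALL x:U. restr G U (W x) t=?t x"
  proof (rule G_glue[OF U])
   fix x assume x: "x:U"
   thus "openin X (W x) & x:W x & W x\<subseteq>U & ?t x:carrier (sect G (W x))" using W[OF x] \<Phi>_closed by blast
  next
   fix x y assume xy: "x:U" "y:U"
   let ?V = "W x\<inter>W y"
   have o: "openin X (W x)" "openin X (W y)" "openin X ?V" using W xy by auto
   have c: "?t x:carrier (sect G (W x))" "?t y:carrier (sect G (W y))" using W xy \<Phi>_closed by blast+
   show "restr G (W x) ?V (?t x)=restr G (W y) ?V (?t y)"
   proof (rule G_separated[OF o(3)])
    show "restr G (W x) ?V (?t x):carrier (sect G ?V)" "restr G (W y) ?V (?t y):carrier (sect G ?V)"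
     using G_closed[OF o(1,3) _ c(1)] G_closed[OF o(2,3) _ c(2)] by auto
    fix z assume z: "z:?V"
    have "gm (W x) (?t x) z=gm (W y) (?t y) z" using W[OF xy(1)] W[OF xy(2)] z by (metis Int_iff)
    then obtain V where V: "openin X V" "z:V" "V\<subseteq>W x\<inter>W y" "restr G (W x) V (?t x)=restr G (W y) V (?t y)"
     using gm_eqD[OF o(1,2) c, of z] z by blast
    have "restr G ?V V (restr G (W x) ?V (?t x))=restr G ?V V (restr G (W y) ?V (?t y))"
     using G_trans[OF o(1,3) V(1) _ V(3) c(1)] G_trans[OF o(2,3) V(1) _ V(3) c(2)] V(4) by simp
    thus "EX V. openin X V & z:V & V\<subseteq>?V & restr G ?V V (restr G (W x) ?V (?t x))=restr G ?V V (restr G (W y) ?V (?t y))"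
     using V(1-3) by (intro exI conjI)
   qed
  qed
  then obtain t where t: "t:carrier (sect G U)" "ALL x:U. restr G U (W x) t=?t x" by blast
  have "\<psi> U t=g"
  proof
   fix z show "\<psi> U t z=g z"
   proof (cases "z:U")
    case True
    have w: "openin X (W z)" "z:W z" "W z\<subseteq>U" "ALL y:W z. g y=gm (W z) (?t z) y" using W[OF True] by auto
    have "\<psi> U t z=restrict (\<psi> U t) (W z) z" using w(2) by simp
    also have "...=gm (W z) (?t z) z" unfolding \<psi>_restr[OF U w(1,3) t(1)] using t(2) True w(2) by (simp add: \<psi>_def)
    finally show ?thesis using w(2,4) by simp
   next
    case False
    thus ?thesis using ext by (simp add: \<psi>_def extensional_def)
   qed
  qed
  thus ?thesis using t(1) by blast
 qed
 hence "\<psi> U ` carrier (sect G U)=carrier (sect S U)" using \<psi>_closed[OF U] by blast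
 thus ?thesis using hom inj by (simp add: iso_def bij_betw_def)
qed

theorem quotient_sheaf_isomorphic: "sheaf_isomorphic X (quotient_sheaf X F H) G"
proof -
 let ?ph = "%U. inv_into (carrier (sect G U)) (\<psi> U)"
 have bij: "bij_betw (\<psi> U) (carrier (sect G U)) (carrier (sect S U))" if "openin X U" for U
  using \<psi>_iso[OF that] by (simp add: iso_def)
 have "?ph U:iso (sect S U) (sect G U)" if U: "openin X U" for U
  using group.iso_set_sym[OF comm_group.axioms(2)[OF G_group[OF U]] \<psi>_iso[OF U]] .
 moreover have "?ph W (restr S U W g)=restr G U W (?ph U g)"
  if U: "openin X U" "openin X W" "W\<subseteq>U" and g: "g:carrier (sect S U)" for U W g
 proof -
  obtain t where t: "t:carrier (sect G U)" "g=\<psi> U t" using g bij[OF U(1)] by (auto simp: bij_betw_def)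
  have "?ph U g=t" unfolding t(2) using bij_betw_inv_into_left[OF bij[OF U(1)] t(1)] .
  moreover have "?ph W (restr S U W g)=restr G U W t"
   unfolding S_simps(3) t(2) \<psi>_restr[OF U t(1)] using bij_betw_inv_into_left[OF bij[OF U(2)] G_closed[OF U t(1)]] .
  ultimately show ?thesis by simp
 qed
 ultimately show ?thesis unfolding sheaf_isomorphic_def by (intro exI[of _ ?ph]) blast
qed

end

context oriented_log_scheme begin

section \<open>Existence of local solutions\<close>

text \<open>A basis of the dual lattice reduces the problem to finitely many cochains. Their solutions at the point are fractions, and the finitely many equations between them hold on a neighbourhood; strata that avoid the point are removed from it.\<close>
lemma solution_near_point:
 assumes U: "opn U" "x:U" and f: "f:carrier (sect ES U)"
 shows "EX W g. opn W & x:W & W\<subseteq>U & solves g W f"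
proof -
 have xS: "x:Spec R" using opn_Spec[OF U] .
 obtain B D where BD: "dual_bases B D" using dual_bases_exist by (elim exE)
 have fB: "finite B" and BM: "B\<subseteq>M" and DN: "!!b. b:B ==> D b:N" using BD unfolding dual_bases_def by blast+
 have "ALL b:B. EX A. (ALL v. v extreme_point_of \<sigma> --> fst (A v):carrier R - x & snd (A v):carrier R - x) &
  (ALL ed. ed edge_of \<sigma> --> on_stratum ed x -->
   pull ed x (fr x (fst (A (tgt ed))) (snd (A (tgt ed)))\<otimes>\<^bsub>L x\<^esub>inv\<^bsub>L x\<^esub>fr x (fst (A (src ed))) (snd (A (src ed))))
    = pull ed x (f ed x) [^]\<^bsub>L x\<^esub>deg (D b) ed)"
 proof
  fix b assume b: "b:B"
  show "EX A. (ALL v. v extreme_point_of \<sigma> --> fst (A v):carrier R - x & snd (A v):carrier R - x) &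
   (ALL ed. ed edge_of \<sigma> --> on_stratum ed x -->
    pull ed x (fr x (fst (A (tgt ed))) (snd (A (tgt ed)))\<otimes>\<^bsub>L x\<^esub>inv\<^bsub>L x\<^esub>fr x (fst (A (src ed))) (snd (A (src ed))))
     = pull ed x (f ed x) [^]\<^bsub>L x\<^esub>deg (D b) ed)"
  proof (rule fractional_solution_at_point[OF U f DN[OF b]])
   fix A A'
   assume A: "!!v. v extreme_point_of \<sigma> ==> A v:carrier R - x & A' v:carrier R - x"
    "!!ed. [|ed edge_of \<sigma>; on_stratum ed x|] ==>
     pull ed x (fr x (A (tgt ed)) (A' (tgt ed))\<otimes>\<^bsub>L x\<^esub>inv\<^bsub>L x\<^esub>fr x (A (src ed)) (A' (src ed)))=pull ed x (f ed x) [^]\<^bsub>L x\<^esub>deg (D b) ed"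
   show ?thesis by (intro exI[of _ "%v. (A v, A' v)"] conjI allI impI) (simp_all only: fst_conv snd_conv A)
  qed
 qed
 from bchoice[OF this] obtain A where A: "ALL b:B. (ALL v. v extreme_point_of \<sigma> --> fst (A b v):carrier R - x & snd (A b v):carrier R - x) &
  (ALL ed. ed edge_of \<sigma> --> on_stratum ed x -->
   pull ed x (fr x (fst (A b (tgt ed))) (snd (A b (tgt ed)))\<otimes>\<^bsub>L x\<^esub>inv\<^bsub>L x\<^esub>fr x (fst (A b (src ed))) (snd (A b (src ed))))
    = pull ed x (f ed x) [^]\<^bsub>L x\<^esub>deg (D b) ed)" by (elim exE)
 have Ac: "fst (A b v):carrier R - x" "snd (A b v):carrier R - x" if "b:B" "v extreme_point_of \<sigma>" for b v
  using bspec[OF A that(1), THEN conjunct1, rule_format, OF that(2)] by blast+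
 define a where "a=(%b v y. fr y (fst (A b v)) (snd (A b v)))"
 have Ae: "pull ed x (a b (tgt ed) x\<otimes>\<^bsub>L x\<^esub>inv\<^bsub>L x\<^esub>a b (src ed) x)=pull ed x (f ed x) [^]\<^bsub>L x\<^esub>deg (D b) ed"
  if "b:B" "ed edge_of \<sigma>" "on_stratum ed x" for b ed
  unfolding a_def using bspec[OF A that(1), THEN conjunct2, rule_format, OF that(2,3)] .
 have "EX W. opn W & x:W & W\<subseteq>U & (ALL i:B\<times>vertices. ALL y:W. fst (A (fst i) (snd i))~:y & snd (A (fst i) (snd i))~:y)"
 proof (rule open_nbhd_finite[OF _ _ U])
  show "finite (B\<times>vertices)" using fB finite_vertices by blast
  fix i assume "i:B\<times>vertices"
  hence c: "fst (A (fst i) (snd i)):carrier R - x" "snd (A (fst i) (snd i)):carrier R - x" using Ac by auto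
  hence op: "opn {q:Spec R. fst (A (fst i) (snd i))~:q}" "opn {q:Spec R. snd (A (fst i) (snd i))~:q}"
   using openin_basic[of "fst (A (fst i) (snd i))" R] openin_basic[of "snd (A (fst i) (snd i))" R] by simp_all
  show "EX W. opn W & x:W & (ALL y:W. fst (A (fst i) (snd i))~:y & snd (A (fst i) (snd i))~:y)"
   using c xS by (intro exI[of _ "{q:Spec R. fst (A (fst i) (snd i))~:q}\<inter>{q:Spec R. snd (A (fst i) (snd i))~:q}"]
     conjI ballI openin_Int[OF op]) simp_all
 qed
 then obtain W1 where W1: "opn W1" "x:W1" "W1\<subseteq>U"
  "ALL i:B\<times>vertices. ALL y:W1. fst (A (fst i) (snd i))~:y & snd (A (fst i) (snd i))~:y" by (elim exE conjE)
 have AW: "fst (A b v):carrier R - y & snd (A b v):carrier R - y" if "b:B" "v extreme_point_of \<sigma>" "y:W1" for b v y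
  using bspec[OF bspec[OF W1(4), of "(b, v)"] that(3)] Ac[OF that(1,2)] that(1,2) by simp
 have ac: "a b v y:carrier (L y)" if "b:B" "v extreme_point_of \<sigma>" "y:W1" for b v y
  unfolding a_def using AW[OF that] by (intro unit_germsI) blast+
 have afrac: "fractional_on fc W1 (%y. pull fc y (a b v y))" if "b:B" "v extreme_point_of \<sigma>" for fc b v
  unfolding a_def by (rule fractional_on_fraction[OF W1(1) AW[OF that]])
 define Q where "Q=(%i y. on_stratum (snd i) y -->
   pull (snd i) y (a (fst i) (tgt (snd i)) y)\<otimes>\<^bsub>L y\<^esub>inv\<^bsub>L y\<^esub>pull (snd i) y (a (fst i) (src (snd i)) y)
    = pull (snd i) y (f (snd i) y) [^]\<^bsub>L y\<^esub>deg (D (fst i)) (snd i))"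
 have "EX W. opn W & x:W & W\<subseteq>W1 & (ALL i:B\<times>edges. ALL y:W. Q i y)"
 proof (rule open_nbhd_finite[OF _ _ W1(1,2)])
  show "finite (B\<times>edges)" using fB finite_edges by blast
  fix i assume "i:B\<times>edges"
  hence b: "fst i:B" and o: "snd i edge_of \<sigma>" "snd i:edges" by auto
  note F = is_face_edge[OF o(1)]
  note e = ends(3,4)[OF o(1)]
  show "EX W. opn W & x:W & (ALL y:W. Q i y)"
  proof (cases "on_stratum (snd i) x")
   case False
   have "EX W. opn W & x:W & (ALL y:W. \<not> on_stratum (snd i) y)"
    by (rule open_off_stratum[OF xS False]) (intro exI conjI ballI)
   then obtain W where W: "opn W" "x:W" "ALL y:W. \<not> on_stratum (snd i) y" by (elim exE conjE)
   thus ?thesis unfolding Q_def by (intro exI[of _ W]) simp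
  next
   case True
   interpret p: group_hom "L x" "L x" "pull (snd i) x" using pull_group_hom[OF xS F True] .
   have g1: "fractional_on (snd i) W1 (%y. pull (snd i) y (a (fst i) (tgt (snd i)) y)\<otimes>\<^bsub>L y\<^esub>inv\<^bsub>L y\<^esub>pull (snd i) y (a (fst i) (src (snd i)) y))"
    by (rule fractional_on_mult[OF F W1(1) afrac[OF b e(2)] fractional_on_inv[OF F W1(1) afrac[OF b e(1)]]])
   have g2: "fractional_on (snd i) W1 (%y. pull (snd i) y (f (snd i) y) [^]\<^bsub>L y\<^esub>deg (D (fst i)) (snd i))"
    by (rule fractional_on_mono[OF fractional_on_pow[OF F U(1) fractional_on_section[OF F U(1) ideal_face[OF F] subset_refl ES_closed[OF U(1) f o(2)]]] W1(1,3)])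
   have eq: "pull (snd i) x (a (fst i) (tgt (snd i)) x)\<otimes>\<^bsub>L x\<^esub>inv\<^bsub>L x\<^esub>pull (snd i) x (a (fst i) (src (snd i)) x)
     = pull (snd i) x (f (snd i) x) [^]\<^bsub>L x\<^esub>deg (D (fst i)) (snd i)"
    using Ae[OF b o(1) True] ac[OF b e(1) W1(2)] ac[OF b e(2) W1(2)] by simp
   show ?thesis unfolding Q_def by (rule fractional_on_eq_open[OF F True W1(1,2) g1 g2 eq])
  qed
 qed
 then obtain W where W: "opn W" "x:W" "W\<subseteq>W1" "ALL i:B\<times>edges. ALL y:W. Q i y" by (elim exE conjE)
 have WU: "W\<subseteq>U" using W(3) W1(3) by blast
 have QW: "pull ed y (a b (tgt ed) y)\<otimes>\<^bsub>L y\<^esub>inv\<^bsub>L y\<^esub>pull ed y (a b (src ed) y)=pull ed y (f ed y) [^]\<^bsub>L y\<^esub>deg (D b) ed"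
  if "b:B" "ed edge_of \<sigma>" "y:W" "on_stratum ed y" for b ed y
  using bspec[OF bspec[OF W(4), of "(b, ed)"] that(3)] that(1,2,4) unfolding Q_def by simp
 define g where "g=(%v w y. finprod (L y) (%b. a b v y [^]\<^bsub>L y\<^esub>\<lfloor>w\<bullet>b\<rfloor>) B)"
 have CL: "comm_group (L y)" if "y:W" for y using comm_group_L[OF opn_Spec[OF W(1) that]] .
 have aW: "a b v y:carrier (L y)" if "b:B" "v extreme_point_of \<sigma>" "y:W" for b v y using ac[OF that(1,2)] W(3) that(3) by blast
 have pulled: "pull fc y (g v w y)=finprod (L y) (%b. pull fc y (a b v y) [^]\<^bsub>L y\<^esub>\<lfloor>w\<bullet>b\<rfloor>) B"
  if v: "v extreme_point_of \<sigma>" and y: "y:W" and fc: "is_face fc" "on_stratum fc y" for v w y fc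
 proof -
  have yS: "y:Spec R" using opn_Spec[OF W(1) y] .
  interpret p: group_hom "L y" "L y" "pull fc y" using pull_group_hom[OF yS fc] .
  interpret L: comm_group "L y" using CL[OF y] .
  have "pull fc y (g v w y)=finprod (L y) (%b. pull fc y (a b v y [^]\<^bsub>L y\<^esub>\<lfloor>w\<bullet>b\<rfloor>)) B"
   unfolding g_def by (rule finprod_hom[OF CL[OF y] CL[OF y] pull_endo[OF yS fc] fB]) (use aW[OF _ v y] in simp)
  also have "...=finprod (L y) (%b. pull fc y (a b v y) [^]\<^bsub>L y\<^esub>\<lfloor>w\<bullet>b\<rfloor>) B"
   using aW[OF _ v y] by (intro L.finprod_cong') (auto simp: p.hom_int_pow)
  finally show ?thesis .
 qed
 have "solves g W f"
  unfolding solves_def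
 proof (intro conjI allI impI ballI)
  fix v w y assume v: "v extreme_point_of \<sigma>" and w: "w:N" and y: "y:W"
  interpret L: comm_group "L y" using CL[OF y] .
  show "g v w y:carrier (L y)" unfolding g_def using aW[OF _ v y] by (intro L.finprod_closed) simp
 next
  fix v w assume v: "v extreme_point_of \<sigma>" and w: "w:N"
  note F = is_face_vertex[OF v]
  have "fractional_on {v} W (%y. finprod (L y) (%b. pull {v} y (a b v y) [^]\<^bsub>L y\<^esub>\<lfloor>w\<bullet>b\<rfloor>) B)"
   by (rule fractional_on_finprod[OF F W(1) fB fractional_on_pow[OF F W(1) fractional_on_mono[OF afrac[OF _ v] W(1,3)]]])
  thus "fractional_on {v} W (%y. pull {v} y (g v w y))"
   by (rule fractional_on_cong[OF W(1), rotated]) (rule pulled[OF v _ F, symmetric])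
 next
  fix v w w' y assume v: "v extreme_point_of \<sigma>" and w: "w:N" "w':N" and y: "y:W"
  interpret L: comm_group "L y" using CL[OF y] .
  have fl: "\<lfloor>(w + w')\<bullet>b\<rfloor>=\<lfloor>w\<bullet>b\<rfloor> + \<lfloor>w'\<bullet>b\<rfloor>" if b: "b:B" for b
   using N_M_int[OF w(1) subsetD[OF BM b]] N_M_int[OF w(2) subsetD[OF BM b]] by (auto simp: inner_add_left elim!: Ints_cases)
  have "g v (w + w') y=finprod (L y) (%b. a b v y [^]\<^bsub>L y\<^esub>(\<lfloor>w\<bullet>b\<rfloor> + \<lfloor>w'\<bullet>b\<rfloor>)) B"
   unfolding g_def using aW[OF _ v y] fl by (intro L.finprod_cong') auto
  thus "g v (w + w') y=g v w y\<otimes>\<^bsub>L y\<^esub>g v w' y"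
   unfolding g_def using L.finprod_int_pow[OF fB aW[OF _ v y]] by simp
 next
  fix ed w y assume ed: "ed edge_of \<sigma>" and w: "w:N" and y: "y:W" and on: "on_stratum ed y"
  note F = is_face_edge[OF ed]
  note e = ends(3,4)[OF ed]
  have yS: "y:Spec R" using opn_Spec[OF W(1) y] .
  interpret L: comm_group "L y" using CL[OF y] .
  interpret p: group_hom "L y" "L y" "pull ed y" using pull_group_hom[OF yS F on] .
  let ?f = "pull ed y (f ed y)"
  have m: "ed:edges" using ed by blast
  have fmem: "?f:carrier (L y)"
   by (rule pull_closed[OF F U(1) subsetD[OF WU y] on ideal_face[OF F] subset_refl ES_closed[OF U(1) f m]])
  have tgt: "pull ed y (a b (tgt ed) y)=pull ed y (a b (src ed) y)\<otimes>\<^bsub>L y\<^esub>?f [^]\<^bsub>L y\<^esub>deg (D b) ed" if b: "b:B" for b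
   unfolding QW[OF b ed y on, symmetric] using p.hom_closed[OF aW[OF b e(1) y]] p.hom_closed[OF aW[OF b e(2) y]]
   by (simp add: L.m_lcomm[of _ "pull ed y (a b (tgt ed) y)"] L.m_assoc)
  have sc: "pull ed y (a b (src ed) y):carrier (L y)" if b: "b:B" for b using p.hom_closed[OF aW[OF b e(1) y]] .
  have "pull ed y (g (tgt ed) w y)=finprod (L y) (%b. pull ed y (a b (tgt ed) y) [^]\<^bsub>L y\<^esub>\<lfloor>w\<bullet>b\<rfloor>) B"
   by (rule pulled[OF e(2) y F on])
  also have "...=finprod (L y) (%b. pull ed y (a b (src ed) y) [^]\<^bsub>L y\<^esub>\<lfloor>w\<bullet>b\<rfloor>\<otimes>\<^bsub>L y\<^esub>?f [^]\<^bsub>L y\<^esub>(\<lfloor>w\<bullet>b\<rfloor> * deg (D b) ed)) B"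
  proof (rule L.finprod_cong')
   show "(%b. pull ed y (a b (src ed) y) [^]\<^bsub>L y\<^esub>\<lfloor>w\<bullet>b\<rfloor>\<otimes>\<^bsub>L y\<^esub>?f [^]\<^bsub>L y\<^esub>(\<lfloor>w\<bullet>b\<rfloor> * deg (D b) ed)):B \<rightarrow> carrier (L y)"
    using sc fmem by simp
   fix b assume b: "b:B"
   show "pull ed y (a b (tgt ed) y) [^]\<^bsub>L y\<^esub>\<lfloor>w\<bullet>b\<rfloor> =
     pull ed y (a b (src ed) y) [^]\<^bsub>L y\<^esub>\<lfloor>w\<bullet>b\<rfloor>\<otimes>\<^bsub>L y\<^esub>?f [^]\<^bsub>L y\<^esub>(\<lfloor>w\<bullet>b\<rfloor> * deg (D b) ed)"
    unfolding tgt[OF b] using sc[OF b] fmem by (simp add: L.int_pow_distrib L.int_pow_pow mult.commute)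
  qed simp
  also have "...=finprod (L y) (%b. pull ed y (a b (src ed) y) [^]\<^bsub>L y\<^esub>\<lfloor>w\<bullet>b\<rfloor>) B\<otimes>\<^bsub>L y\<^esub>
    finprod (L y) (%b. ?f [^]\<^bsub>L y\<^esub>(\<lfloor>w\<bullet>b\<rfloor> * deg (D b) ed)) B"
   using sc fmem by (intro L.finprod_multf) auto
  also have "finprod (L y) (%b. ?f [^]\<^bsub>L y\<^esub>(\<lfloor>w\<bullet>b\<rfloor> * deg (D b) ed)) B=?f [^]\<^bsub>L y\<^esub>deg w ed"
   unfolding deg_sum[OF BD ed w] by (rule L.finprod_pow_sum[OF fB fmem])
  also have "finprod (L y) (%b. pull ed y (a b (src ed) y) [^]\<^bsub>L y\<^esub>\<lfloor>w\<bullet>b\<rfloor>) B=pull ed y (g (src ed) w y)"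
   by (rule pulled[OF e(1) y F on, symmetric])
  finally show "pull ed y (g (tgt ed) w y)=pull ed y (g (src ed) w y)\<otimes>\<^bsub>L y\<^esub>?f [^]\<^bsub>L y\<^esub>deg w ed" .
 qed
 thus ?thesis using W(1,2) WU by (intro exI[of _ W] exI[of _ g] conjI)
qed

lemma solves_restr:
 assumes U: "opn U" "W\<subseteq>U" and f: "f:carrier (sect ES U)" and g: "solves g W f"
 shows "solves g W (restr ES U W f)"
 unfolding solves_def
proof (intro conjI[OF g[unfolded solves_def, THEN conjunct1]] conjI[OF g[unfolded solves_def, THEN conjunct2, THEN conjunct1]] allI impI)
 fix ed w y assume a: "ed edge_of \<sigma>" "w:N" "y:W" "on_stratum ed y"
 have m: "ed:edges" using a(1) by blast
 show "pull ed y (g (tgt ed) w y)=pull ed y (g (src ed) w y)\<otimes>\<^bsub>L y\<^esub>pull ed y (restr ES U W f ed y) [^]\<^bsub>L y\<^esub>deg w ed"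
  unfolding ES_pull_restr[OF U a(3) f m a(4)] using g[unfolded solves_def, THEN conjunct2, THEN conjunct2, rule_format, OF a] .
qed

lemma kinks_locally_surjective:
 assumes U: "opn U" and f: "f:carrier (sect ES U)" and x: "x:U"
 shows "EX W h. opn W & x:W & W\<subseteq>U & h:carrier (sect LF W) & kinks W h=restr ES U W f"
proof -
 obtain W g where W: "opn W" "x:W" "W\<subseteq>U" "solves g W f" using solution_near_point[OF U x f] by (elim exE conjE)
 obtain h where "h:carrier (sect LF W)" "kinks W h=restr ES U W f"
  using family_from_solution[OF W(1) ES_restr_closed[OF U W(1,3) f] solves_restr[OF U W(3) f W(4)]] by (rule bexE)
 thus ?thesis using W(1-3) by (intro exI[of _ W] exI[of _ h] conjI)
qed

sublocale presentation: sheaf_presentation "zariski R" LF "hom_families M \<sigma> r" ES kinks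
proof (rule sheaf_presentation.intro)
 show "comm_group (sect LF U)" if "opn U" for U by (rule LF_group[OF that])
 show "restr LF U W:hom (sect LF U) (sect LF W)" if "opn U" "opn W" "W\<subseteq>U" for U W by (rule LF_restr_hom[OF that])
 show "comm_group (sect ES U)" if "opn U" for U by (rule ES_group[OF that])
 show "restr ES U W:hom (sect ES U) (sect ES W)" if "opn U" "opn W" "W\<subseteq>U" for U W by (rule ES_restr_hom[OF that])
 show "restr ES W V (restr ES U W t)=restr ES U V t"
  if "opn U" "opn W" "opn V" "W\<subseteq>U" "V\<subseteq>W" "t:carrier (sect ES U)" for U W V t by (rule ES_trans[OF that(1,4,5,6)])
 show "t=t'" if "opn U" "t:carrier (sect ES U)" "t':carrier (sect ES U)"
  "!!x. x:U ==> EX W. opn W & x:W & W\<subseteq>U & restr ES U W t=restr ES U W t'" for U t t' by (rule ES_separated[OF that])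
 show "EX s:carrier (sect ES U). ALL x:U. restr ES U (W x) s=t x"
  if "opn U" "!!x. x:U ==> opn (W x) & x:W x & W x\<subseteq>U & t x:carrier (sect ES (W x))"
   "!!x y. [|x:U; y:U|] ==> restr ES (W x) (W x\<inter>W y) (t x)=restr ES (W y) (W x\<inter>W y) (t y)" for U W t
  by (rule ES_glue[OF that])
 show "kinks U:hom (sect LF U) (sect ES U)" if "opn U" for U by (rule kinks_hom[OF that])
 show "kinks W (restr LF U W s)=restr ES U W (kinks U s)"
  if "opn U" "opn W" "W\<subseteq>U" "s:carrier (sect LF U)" for U W s by (rule kinks_natural[OF that])
 show "hom_families M \<sigma> r U={s:carrier (sect LF U). kinks U s=\<one>\<^bsub>sect ES U\<^esub>}" if "opn U" for U by (rule kinks_kernel[OF that])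
 show "EX W s. opn W & x:W & W\<subseteq>U & s:carrier (sect LF W) & kinks W s=restr ES U W t"
  if "opn U" "t:carrier (sect ES U)" "x:U" for U t x by (rule kinks_locally_surjective[OF that])
qed

end

theorem theorem3p22:
  fixes M \<sigma> :: "'a::euclidean_space set" and n r :: nat
    and d :: "'a set \<Rightarrow> 'a" and \<epsilon> :: "'a set \<Rightarrow> 'a set \<Rightarrow> int"
  assumes "lattice_of_rank n M"
    and "lattice_polytope M \<sigma>" and "aff_dim \<sigma> = int n"
    and "\<And>\<omega>. \<omega> edge_of \<sigma> \<Longrightarrow> primitive_generator M \<omega> (d \<omega>)"
    and "\<And>\<tau>. two_face_of \<tau> \<sigma> \<Longrightarrow> sign_vector \<sigma> d \<tau> (\<epsilon> \<tau>)"
  shows "sheaf_isomorphic (V_space M \<sigma> r :: ('a, 'k::alg_closed_field) point topology)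
           (LS_sheaf M \<sigma> r) (edge_sheaf M \<sigma> r d \<epsilon>)"
proof -
  interpret oriented_log_scheme M \<sigma> n r "coord_ring M \<sigma> r :: ('a, 'k) fun_ring" d \<epsilon>
  proof
    show "lattice_of_rank n M" "lattice_polytope M \<sigma>" "aff_dim \<sigma> = int n" by (fact assms(1-3))+
    show "primitive_generator M \<omega> (d \<omega>)" if "\<omega> edge_of \<sigma>" for \<omega> using that by (rule assms(4))
    show "sign_vector \<sigma> d \<tau> (\<epsilon> \<tau>)" if "two_face_of \<tau> \<sigma>" for \<tau> using that by (rule assms(5))
  qed (rule refl)
  show ?thesis
    unfolding V_space_def LS_sheaf_def by (rule presentation.quotient_sheaf_isomorphic)
qed

end
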